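(* Let $n\ge 1$ and let $\Sigma=\hat\Sigma+\Sigma_\Pi$ be the gauge-fixed classical action of the $BF$ theory in flat space-time of dimension $n+2$ (both terms, all fields and all operators are defined in the context), with the gauge parameters fixed to $$x_{k,g,n}=(-1)^{n+g+(k+1)/2}\qquad (k\text{ odd}).$$ Then, for every constant (odd) vector $\xi^\mu$, the supersymmetry Ward operator $\mathcal W^{\rm S}_{(\xi)}$ satisfies the Ward identity $$\mathcal W^{\rm S}_{(\xi)}\Sigma=\Delta^{\rm S}_{(\xi)\,{\rm class}},$$ where the breaking is linear in the quantum fields: $$\Delta^{\rm S}_{(\xi)\,{\rm class}}=\int_{\mathbb R^{n+2}}{\rm Tr}\Big\{-\sum_{g=0}^{n}b^{-g-1}_{g+2}\,\mathcal L_\xi B^g_{n-g}+(-1)^n\gamma\,\mathcal L_\xi A+(-1)^n\tau\,\mathcal L_\xi c+d{*}i_\xi\big(b^{-1}_2\pi+\gamma\,\Pi^0_{n-1}\big)\Big\}.$$ Moreover $\mathcal W^{\rm S}_{(\xi)}$ and the linearized Slavnov operator $\mathcal S_\Sigma$ form an algebra closing off-shell on the space-time translations: $$[\mathcal S_\Sigma,\mathcal W^{\rm S}_{(\xi)}]=\mathcal W^{\rm T}_{(\xi)},\qquad (\mathcal S_\Sigma)^2=0,\qquad [\mathcal W^{\rm S}_{(\xi)},\mathcal W^{\rm S}_{(\xi')}]=0 .$$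
   Context: All fields are differential forms on flat $\mathbb R^{n+2}$ with values in the Lie algebra of a simple Lie group. An upper index denotes ghost number, a lower index form degree; a form's grading is the parity of ghost number plus form degree. $[\cdot,\cdot]$ is the graded commutator, wedge products are understood, $*$ is the Hodge dual of the flat metric $g_{\mu\nu}$, $i_\xi$ is the inner derivative, $\mathcal L_\xi=[i_\xi,d]$ is the Lie derivative. Forms with a negative lower index are zero. Fields: the Yang-Mills connection $A=A^0_1$, ghost $c=c^1_0$, antighost $\bar c$ (ghost number $-1$, degree 0), multiplier $\pi$ (ghost number $0$, degree 0); $B^g_{n-g}$ for $0\le g\le n$ ($B^0_n=B$ is the gauge field, the others are ghosts); antighosts $\bar C^{\gamma(k)}_{n-g-k}$ and multipliers $\Pi^{\gamma(k)+1}_{n-g-k}$ for $1\le k\le n$, $0\le g\le n-k$, where $\gamma(k)=g$ for $k$ even and $\gamma(k)=-g-1$ for $k$ odd. External sources (non-quantum fields): $\gamma=\gamma^{-1}_{n+1}$, $\tau=\tau^{-2}_{n+2}$, $b^{-g-1}_{g+2}$ ($0\le g\le n$). Shifted sources: $\hat\gamma=\gamma-{*}d\bar c$; $\hat b^{-g-1}_{g+2}=b^{-g-1}_{g+2}+(-1)^{g+1}{*}d\bar C^{-g-1}_{n-g-1}$ for $0\le g\le n-1$ (with the $k=1$ antighosts); $\hat b^{-n-1}_{n+2}=b^{-n-1}_{n+2}$. Ladders: $\hat\phi^{(1)}_0=c$, $\hat\phi^{(1)}_1=A$, $\hat\phi^{(1)}_{g+2}=\hat b^{-g-1}_{g+2}$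 ($0\le g\le n$); $\hat\phi^{(2)}_{n-g}=B^g_{n-g}$ ($0\le g\le n$), $\hat\phi^{(2)}_{n+1}=\hat\gamma$, $\hat\phi^{(2)}_{n+2}=\tau$. Action: $$\hat\Sigma=\int_{\mathbb R^{n+2}}{\rm Tr}\Big(\sum_{p=0}^{n+1}\hat\phi^{(1)}_p d\hat\phi^{(2)}_{n+1-p}+\tfrac12\sum_{p=0}^{n+2}\sum_{q=0}^{n+2-p}[\hat\phi^{(1)}_p,\hat\phi^{(1)}_q]\hat\phi^{(2)}_{n+2-p-q}\Big),$$ $$\Sigma_\Pi=\int_{\mathbb R^{n+2}}{\rm Tr}\Big\{-d\pi{*}A-\sum_{g=0}^{n-1}d\Pi^{-g}_{n-g-1}{*}B^g_{n-g}+\sum_{k=2}^{n}\sum_{g=0}^{n-k}\Big[-d\Pi^{\gamma(k)+1}_{n-g-k}{*}\bar C^{\gamma(k-1)}_{n-g-k+1}+(-1)^{n+1}d\bar C^{\gamma(k)}_{n-g-k}{*}\Pi^{\gamma(k-1)+1}_{n-g-k+1}\Big]+\sum_{k=1,3,5,\dots}^{n}\ \sum_{g=1}^{n-k}x_{k,g,n}\,\Pi^{-g}_{n-g-k}{*}\Pi^{g}_{n-g-k}\Big\}.$$ Supersymmetry transformations $\delta^{\rm S}_{(\xi)}$ ($\xi^\mu$ constant, of odd grading and ghost number 1; $g(\xi)=g_{\mu\nu}\xi^\mu dx^\nu$): on the ladders, $\delta^{\rm S}_{(\xi)}\hat\phi^{(A)}_p=-i_\xi\hat\phi^{(A)}_{p+1}$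 for $0\le p\le n+1$ and $\delta^{\rm S}_{(\xi)}\hat\phi^{(A)}_{n+2}=0$ ($A=1,2$); $\delta^{\rm S}_{(\xi)}\bar c=0$, $\delta^{\rm S}_{(\xi)}\pi=\mathcal L_\xi\bar c$; for $1\le k\le n$, $0\le g\le n-k$: for $k$ odd, $\delta^{\rm S}_{(\xi)}\bar C^{-g-1}_{n-g-k}=(-1)^{n+(k+1)/2}g(\xi)\bar C^{-g-2}_{n-g-k-1}$ and $\delta^{\rm S}_{(\xi)}\Pi^{-g}_{n-g-k}=(-1)^{n+(k+1)/2}g(\xi)\Pi^{-g-1}_{n-g-k-1}+\mathcal L_\xi\bar C^{-g-1}_{n-g-k}$; for $k$ even, $\delta^{\rm S}_{(\xi)}\bar C^{g}_{n-g-k}=(-1)^{k/2+1}i_\xi\bar C^{g-1}_{n-g-k+1}$ and $\delta^{\rm S}_{(\xi)}\Pi^{g+1}_{n-g-k}=(-1)^{k/2+1}i_\xi\Pi^{g}_{n-g-k+1}+\mathcal L_\xi\bar C^{g}_{n-g-k}$. The transformations of the sources $\gamma,\tau,b$ are determined by the transformations of the ladder fields $\hat\gamma,\tau,\hat b$ and of the antighosts $\bar c,\bar C$ through the definitions of the shifted sources, i.e. $\delta^{\rm S}_{(\xi)}\gamma=-i_\xi\tau$, $\delta^{\rm S}_{(\xi)}\tau=0$, $\delta^{\rm S}_{(\xi)}b^{-n-1}_{n+2}=0$, and $\delta^{\rm S}_{(\xi)}b^{-g-1}_{g+2}=-i_\xi\hat b^{-g-2}_{g+3}-(-1)^{g+1}\delta^{\rm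 S}_{(\xi)}\big({*}d\bar C^{-g-1}_{n-g-1}\big)$ for $0\le g\le n-1$ (with the $k=1$ antighosts). Ward operators: $\mathcal W^{\rm S}_{(\xi)}=\int{\rm Tr}\sum_\varphi\delta^{\rm S}_{(\xi)}\varphi\,\frac{\delta}{\delta\varphi}$, and for translations $\mathcal W^{\rm T}_{(\varepsilon)}=\int{\rm Tr}\sum_\varphi\mathcal L_\varepsilon\varphi\,\frac{\delta}{\delta\varphi}$, sums over all fields $\varphi$ (including sources). Linearized Slavnov operator: $$\mathcal S_\Sigma=\int{\rm Tr}\Big\{\sum_{g=0}^n\Big(\frac{\delta\Sigma}{\delta b^{-g-1}_{g+2}}\frac{\delta}{\delta B^g_{n-g}}+\frac{\delta\Sigma}{\delta B^g_{n-g}}\frac{\delta}{\delta b^{-g-1}_{g+2}}\Big)+\frac{\delta\Sigma}{\delta\gamma}\frac{\delta}{\delta A}+\frac{\delta\Sigma}{\delta A}\frac{\delta}{\delta\gamma}+\frac{\delta\Sigma}{\delta\tau}\frac{\delta}{\delta c}+\frac{\delta\Sigma}{\delta c}\frac{\delta}{\delta\tau}+\pi\frac{\delta}{\delta\bar c}+\sum_{k=1}^n\sum_{g=0}^{n-k}\Pi^{\gamma(k)+1}_{n-g-k}\frac{\delta}{\delta\bar C^{\gamma(k)}_{n-g-k}}\Big\}.$$ On the ladder fields it acts as $\hat\phi^{(1)}_p\mapsto d\hat\phi^{(1)}_{p-1}+\frac12\sum_q[\hat\phi^{(1)}_q,\hat\phi^{(1)}_{p-q}]$, $\hat\phi^{(2)}_p\mapsto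 d\hat\phi^{(2)}_{p-1}+\sum_q[\hat\phi^{(1)}_q,\hat\phi^{(2)}_{p-q}]$; it sends $\bar c\mapsto\pi$, $\bar C\mapsto\Pi$, and annihilates $\pi$ and $\Pi$.
   Formalization: The last breaking terms are read as (d*i_ξ b)π+(d*i_ξ γ)Π; i_ξ is odd with commuting ξ^μ, since odd ξ^μ give wrong signs; the Hodge dual is normalized by *(g(ξ)ω)=(-1)^{n+3} i_ξ*ω; for k even, g=0 the C̄^{g-1} and Π^g terms in δ^S are zero. *)

theory Defs
  imports "HOL-Analysis.Analysis" "HOL-Library.Multiset" "HOL-Library.Countable"
begin

section \<open>Fields\<close>

datatype field =
    Conn                 \<comment> \<open>connection \<open>A\<close>\<close>
  | Ghost                \<comment> \<open>\<open>c\<close>\<close>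
  | AGhost               \<comment> \<open>\<open>c-bar\<close>\<close>
  | Mult                 \<comment> \<open>\<open>pi\<close>\<close>
  | BF nat               \<comment> \<open>\<open>BF g\<close> is \<open>B^g_{n-g}\<close>\<close>
  | CBar nat nat         \<comment> \<open>\<open>CBar k g\<close> is \<open>C-bar^{gamma(k)}_{n-g-k}\<close>\<close>
  | PiF nat nat          \<comment> \<open>\<open>PiF k g\<close> is \<open>Pi^{gamma(k)+1}_{n-g-k}\<close>\<close>
  | SrcGamma             \<comment> \<open>\<open>gamma\<close>\<close>
  | SrcTau               \<comment> \<open>\<open>tau\<close>\<close>
  | SrcB nat             \<comment> \<open>\<open>SrcB g\<close> is \<open>b^{-g-1}_{g+2}\<close>\<close>

instance field :: countable
proof
  show "\<exists>f :: field \<Rightarrow> nat. inj f"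
  proof
    show "inj (\<lambda>\<phi>. to_nat (case \<phi> of Conn \<Rightarrow> (0 :: nat, 0 :: nat, 0 :: nat)
      | Ghost \<Rightarrow> (1, 0, 0) | AGhost \<Rightarrow> (2, 0, 0) | Mult \<Rightarrow> (3, 0, 0)
      | BF g \<Rightarrow> (4, g, 0) | CBar k g \<Rightarrow> (5, k, g) | PiF k g \<Rightarrow> (6, k, g)
      | SrcGamma \<Rightarrow> (7, 0, 0) | SrcTau \<Rightarrow> (8, 0, 0) | SrcB g \<Rightarrow> (9, g, 0)))"
      by (rule injI, case_tac x; case_tac y; simp)
  qed
qed

instance multiset :: (countable) countable
proof
  obtain h :: "'a multiset \<Rightarrow> 'a list" where h: "\<And>M. mset (h M) = M"
    using ex_mset by metis
  have "inj (to_nat \<circ> h)"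
    by (rule inj_compose[OF inj_to_nat], rule inj_on_inverseI[where g = mset], rule h)
  then show "\<exists>f :: 'a multiset \<Rightarrow> nat. inj f"
    by (rule exI[of inj "to_nat \<circ> h"])
qed

definition gam :: "nat \<Rightarrow> nat \<Rightarrow> int" where
  "gam k g = (if even k then int g else - int g - 1)"

fun ghost_number :: "field \<Rightarrow> int" where
  "ghost_number Conn = 0"
| "ghost_number Ghost = 1"
| "ghost_number AGhost = -1"
| "ghost_number Mult = 0"
| "ghost_number (BF g) = int g"
| "ghost_number (CBar k g) = gam k g"
| "ghost_number (PiF k g) = gam k g + 1"
| "ghost_number SrcGamma = -1"
| "ghost_number SrcTau = -2"
| "ghost_number (SrcB g) = - int g - 1"

fun form_degree :: "nat \<Rightarrow> field \<Rightarrow> nat" where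
  "form_degree n Conn = 1"
| "form_degree n Ghost = 0"
| "form_degree n AGhost = 0"
| "form_degree n Mult = 0"
| "form_degree n (BF g) = n - g"
| "form_degree n (CBar k g) = n - g - k"
| "form_degree n (PiF k g) = n - g - k"
| "form_degree n SrcGamma = n + 1"
| "form_degree n SrcTau = n + 2"
| "form_degree n (SrcB g) = g + 2"

definition fields :: "nat \<Rightarrow> field set" where
  "fields n = {Conn, Ghost, AGhost, Mult, SrcGamma, SrcTau}
     \<union> {BF g |g. g \<le> n} \<union> {SrcB g |g. g \<le> n}
     \<union> {CBar k g |k g. 1 \<le> k \<and> k \<le> n \<and> g \<le> n - k}
     \<union> {PiF k g |k g. 1 \<le> k \<and> k \<le> n \<and> g \<le> n - k}"

section \<open>Local forms\<close>

type_synonym 'd vector = "(real, 'd) vec"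
type_synonym 'd matrix = "((real, 'd) vec, 'd) vec"

text \<open>
  Functionals of (partly anticommuting) fields are treated algebraically. A jet variable is a
  partial derivative of a component of a field; \<open>Jet \<phi> a I \<alpha>\<close> stands for \<open>\<partial>_\<alpha> \<phi>^a_I\<close>, where
  \<open>a\<close> labels a basis of the Lie algebra, \<open>\<alpha>\<close> is a multi-index, and a form field
  is written \<open>\<phi>^a = \<Sum>_I \<phi>^a_I dx^I\<close> with \<open>dx^I\<close> the increasing product of the \<open>dx^\<mu>\<close>, \<open>\<mu> \<in> I\<close>.
  The parity of a jet variable is that of the ghost number of its field.
  A local form is an element of the free graded commutative real algebra generated by the jet
  variables and the odd \<open>dx^\<mu>\<close>, so that the sign rule is governed by ghost number plus form degree.
\<close>

datatype ('a, 'd) jet =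
  Jet (jet_field: field) (jet_lie: 'a) (jet_comp: "'d set") (jet_derivs: "'d multiset")

instance jet :: (countable, finite) countable
proof
  show "\<exists>f :: ('a, 'b) jet \<Rightarrow> nat. inj f"
  proof
    show "inj (\<lambda>v :: ('a, 'b) jet. to_nat (jet_field v, jet_lie v, jet_comp v, jet_derivs v))"
      by (rule injI) (simp add: jet.expand)
  qed
qed

definition odd_jet :: "('a, 'd) jet \<Rightarrow> bool" where
  "odd_jet v \<longleftrightarrow> odd (ghost_number (jet_field v))"

text \<open>
  \<open>(M, I)\<close> denotes the monomial with jet variables \<open>M\<close> followed by \<open>dx^I\<close>; odd variables of \<open>M\<close>
  are multiplied in increasing order of their code \<open>to_nat\<close>, and occur at most once.
\<close>

type_synonym ('a, 'd) monomial = "('a, 'd) jet multiset \<times> 'd set"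

definition reduced :: "('a, 'd) jet multiset \<Rightarrow> bool" where
  "reduced M \<longleftrightarrow> (\<forall>v. odd_jet v \<longrightarrow> count M v \<le> 1)"

typedef ('a, 'd) lform =
  "{f :: ('a, 'd) monomial \<Rightarrow> real. finite {m. f m \<noteq> 0} \<and> (\<forall>m. f m \<noteq> 0 \<longrightarrow> reduced (fst m))}"
  morphisms coeff Abs_lform
  by (rule exI[of _ "\<lambda>_. 0"]) simp

setup_lifting type_definition_lform

instantiation lform :: (type, type) real_vector
begin

lift_definition zero_lform :: "('a, 'b) lform" is "\<lambda>_. 0" by simp

lift_definition plus_lform :: "('a, 'b) lform \<Rightarrow> ('a, 'b) lform \<Rightarrow> ('a, 'b) lform"
  is "\<lambda>f g m. f m + g m"
proof -
  fix f g :: "('a, 'b) monomial \<Rightarrow> real"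
  assume f: "finite {m. f m \<noteq> 0} \<and> (\<forall>m. f m \<noteq> 0 \<longrightarrow> reduced (fst m))"
    and g: "finite {m. g m \<noteq> 0} \<and> (\<forall>m. g m \<noteq> 0 \<longrightarrow> reduced (fst m))"
  have "{m. f m + g m \<noteq> 0} \<subseteq> {m. f m \<noteq> 0} \<union> {m. g m \<noteq> 0}" by auto
  then have "finite {m. f m + g m \<noteq> 0}" using f g by (meson finite_UnI finite_subset)
  moreover have "\<forall>m. f m + g m \<noteq> 0 \<longrightarrow> reduced (fst m)"
    using f g by (metis add.right_neutral)
  ultimately show "finite {m. f m + g m \<noteq> 0} \<and> (\<forall>m. f m + g m \<noteq> 0 \<longrightarrow> reduced (fst m))"
    by blast
qed

lift_definition uminus_lform :: "('a, 'b) lform \<Rightarrow> ('a, 'b) lform" is "\<lambda>f m. - f m" by simp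

definition minus_lform :: "('a, 'b) lform \<Rightarrow> ('a, 'b) lform \<Rightarrow> ('a, 'b) lform" where
  "minus_lform x y = x + - y"

lift_definition scaleR_lform :: "real \<Rightarrow> ('a, 'b) lform \<Rightarrow> ('a, 'b) lform" is "\<lambda>r f m. r * f m"
  by (auto elim: finite_subset[rotated])

instance
  by standard (unfold minus_lform_def, (transfer, simp add: fun_eq_iff algebra_simps)+)

end

lift_definition mono_form :: "('a, 'd) monomial \<Rightarrow> ('a, 'd) lform"
  is "\<lambda>m p. if p = m \<and> reduced (fst m) then 1 else 0"
  by auto

text \<open>Linear extension of a map given on monomials.\<close>

definition lin :: "(('a, 'd) monomial \<Rightarrow> 'v :: real_vector) \<Rightarrow> ('a, 'd) lform \<Rightarrow> 'v" where
  "lin F x = (\<Sum>m | coeff x m \<noteq> 0. coeff x m *\<^sub>R F m)"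

definition odd_count :: "('a, 'd) jet multiset \<Rightarrow> nat" where
  "odd_count M = size (filter_mset odd_jet M)"

definition jet_inversions ::
    "('a :: countable, 'd :: finite) jet multiset \<Rightarrow> ('a, 'd) jet multiset \<Rightarrow> nat" where
  "jet_inversions M N = card {(v, w). v \<in># M \<and> w \<in># N \<and> odd_jet v \<and> odd_jet w \<and> to_nat w < to_nat v}"

definition dx_inversions :: "'d :: linorder set \<Rightarrow> 'd set \<Rightarrow> nat" where
  "dx_inversions I J = card {(\<mu>, \<nu>). \<mu> \<in> I \<and> \<nu> \<in> J \<and> \<nu> < \<mu>}"

definition mono_times ::
    "('a :: countable, 'd :: {finite, linorder}) monomial \<Rightarrow> ('a, 'd) monomial \<Rightarrow> ('a, 'd) lform" where
  "mono_times m m' = (case m of (M, I) \<Rightarrow> case m' of (N, J) \<Rightarrow>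
     if I \<inter> J = {}
     then (-1) ^ (jet_inversions M N + card I * odd_count N + dx_inversions I J) *\<^sub>R mono_form (M + N, I \<union> J)
     else 0)"

instantiation lform :: (countable, "{finite, linorder}") "{one, times}"
begin

definition one_lform :: "('a, 'b) lform" where
  "one_lform = mono_form ({#}, {})"

definition times_lform :: "('a, 'b) lform \<Rightarrow> ('a, 'b) lform \<Rightarrow> ('a, 'b) lform" where
  "times_lform x y = lin (\<lambda>m. lin (\<lambda>m'. mono_times m m') y) x"

instance ..

end

lemma finite_support: "finite {m. coeff x m \<noteq> 0}"
  using coeff[of x] by simp

lemma coeff_reduced: "coeff x m \<noteq> 0 \<Longrightarrow> reduced (fst m)"
  using coeff[of x] by blast

lemma lin_superset: "finite A \<Longrightarrow> {m. coeff x m \<noteq> 0} \<subseteq> A \<Longrightarrow> lin F x = (\<Sum>m\<in>A. coeff x m *\<^sub>R F m)"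
  unfolding lin_def by (rule sum.mono_neutral_left) auto

lemma linear_lin: "linear (lin F)"
proof (rule linearI)
  fix x y :: "('a, 'b) lform" and r :: real
  let ?A = "{m. coeff x m \<noteq> 0} \<union> {m. coeff y m \<noteq> 0}"
  have fin: "finite ?A" by (simp add: finite_support)
  have "{m. coeff (x + y) m \<noteq> 0} \<subseteq> ?A" by (auto simp: plus_lform.rep_eq)
  then have "lin F (x + y) = (\<Sum>m\<in>?A. coeff (x + y) m *\<^sub>R F m)" by (rule lin_superset[OF fin])
  also have "\<dots> = lin F x + lin F y"
    by (simp add: lin_superset[OF fin] plus_lform.rep_eq scaleR_left_distrib sum.distrib)
  finally show "lin F (x + y) = lin F x + lin F y" .
  have "{m. coeff (r *\<^sub>R x) m \<noteq> 0} \<subseteq> ?A" by (auto simp: scaleR_lform.rep_eq)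
  then have "lin F (r *\<^sub>R x) = (\<Sum>m\<in>?A. coeff (r *\<^sub>R x) m *\<^sub>R F m)" by (rule lin_superset[OF fin])
  also have "\<dots> = r *\<^sub>R lin F x"
    by (simp add: lin_superset[OF fin] scaleR_lform.rep_eq scaleR_sum_right)
  finally show "lin F (r *\<^sub>R x) = r *\<^sub>R lin F x" .
qed

lemma lin_mono_form: "lin F (mono_form m) = (if reduced (fst m) then F m else 0)"
proof (cases "reduced (fst m)")
  case True
  then have "{p. coeff (mono_form m) p \<noteq> 0} = {m}" by (auto simp: mono_form.rep_eq)
  then show ?thesis using True by (simp add: lin_def mono_form.rep_eq)
next
  case False
  then show ?thesis by (simp add: lin_def mono_form.rep_eq)
qed

lemma coeff_sum: "coeff (\<Sum>i\<in>A. f i) p = (\<Sum>i\<in>A. coeff (f i) p)"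
  by (induction A rule: infinite_finite_induct) (auto simp: zero_lform.rep_eq plus_lform.rep_eq)

lemma lin_mono_form_id: "lin mono_form x = x"
proof -
  have "coeff (lin mono_form x) p = coeff x p" for p
  proof -
    have "coeff (lin mono_form x) p = (\<Sum>m | coeff x m \<noteq> 0. coeff x m * coeff (mono_form m) p)"
      by (simp add: lin_def coeff_sum scaleR_lform.rep_eq)
    also have "\<dots> = (\<Sum>m | coeff x m \<noteq> 0. if m = p then coeff x m else 0)"
      by (rule sum.cong) (auto simp: mono_form.rep_eq coeff_reduced)
    also have "\<dots> = coeff x p"
      using finite_support[of x] by simp
    finally show ?thesis .
  qed
  then show ?thesis by (metis coeff_inject ext)
qed

lemma linear_eq_mono:
  assumes "linear f" "linear h" "\<And>m. reduced (fst m) \<Longrightarrow> f (mono_form m) = h (mono_form m)"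
  shows "f x = h x"
proof -
  have "f (lin mono_form x) = h (lin mono_form x)"
    unfolding lin_def using assms(3)
    by (simp add: linear_sum[OF assms(1)] linear_sum[OF assms(2)] linear_scale[OF assms(1)]
        linear_scale[OF assms(2)] coeff_reduced)
  then show ?thesis by (simp add: lin_mono_form_id)
qed

lemma times_left_linear: "linear (\<lambda>x :: ('a :: countable, 'd :: {finite, linorder}) lform. x * y)"
  unfolding times_lform_def by (rule linear_lin)

lemma times_right_linear: "linear (\<lambda>y :: ('a :: countable, 'd :: {finite, linorder}) lform. x * y)"
proof (rule linearI)
  fix y z :: "('a, 'd) lform" and r :: real
  show "x * (y + z) = x * y + x * z"
    unfolding times_lform_def linear_add[OF linear_lin]
    by (simp add: lin_def scaleR_right_distrib sum.distrib)
  show "x * (r *\<^sub>R y) = r *\<^sub>R (x * y)"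
    unfolding times_lform_def linear_scale[OF linear_lin]
    by (simp add: lin_def scaleR_sum_right mult.left_commute)
qed

lemma mono_form_not_reduced: "\<not> reduced (fst m) \<Longrightarrow> mono_form m = 0"
  by transfer auto

lemma reduced_plusD: "reduced (M + N) \<Longrightarrow> reduced M \<and> reduced N"
  unfolding reduced_def by (metis add_leD1 add_leD2 count_union)

lemma mono_form_times:
  "mono_form (M, I) * mono_form (N, J) =
     (if I \<inter> J = {} then
       (-1) ^ (jet_inversions M N + card I * odd_count N + dx_inversions I J) *\<^sub>R mono_form (M + N, I \<union> J)
      else 0)"
proof (cases "reduced M \<and> reduced N")
  case True
  then show ?thesis by (simp add: times_lform_def lin_mono_form mono_times_def)
next
  case False
  then have "\<not> reduced (M + N)" using reduced_plusD by blast
  then have "mono_form (M + N, I \<union> J) = (0 :: ('a, 'b) lform)" by (simp add: mono_form_not_reduced)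
  moreover have "mono_form (M, I) * mono_form (N, J) = (0 :: ('a, 'b) lform)"
  proof (cases "reduced M")
    case True
    then show ?thesis using False by (simp add: times_lform_def lin_mono_form)
  next
    case False
    then show ?thesis by (simp add: times_lform_def lin_mono_form)
  qed
  ultimately show ?thesis by simp
qed

lemma jet_inversions_alt:
  "jet_inversions M N = (\<Sum>v | v \<in># M \<and> odd_jet v. card {w. w \<in># N \<and> odd_jet w \<and> to_nat w < to_nat v})"
proof -
  let ?A = "{v. v \<in># M \<and> odd_jet v}" and ?B = "\<lambda>v. {w. w \<in># N \<and> odd_jet w \<and> to_nat w < to_nat v}"
  have fin: "finite ?A" "finite (?B v)" for v
    by (rule finite_subset[of _ "set_mset M"], blast, simp, rule finite_subset[of _ "set_mset N"], blast, simp)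
  have "{(v, w). v \<in># M \<and> w \<in># N \<and> odd_jet v \<and> odd_jet w \<and> to_nat w < to_nat v} = Sigma ?A ?B"
    by blast
  moreover have "card (Sigma ?A ?B) = (\<Sum>v \<in> ?A. card (?B v))"
    using fin by (intro card_SigmaI) blast+
  ultimately show ?thesis
    unfolding jet_inversions_def by simp
qed

lemma reduced_disjoint:
  assumes "reduced (M + N)" "odd_jet v" "v \<in># M" "v \<in># N"
  shows False
proof -
  have "count (M + N) v \<le> 1" using assms(1,2) by (simp add: reduced_def)
  moreover have "count M v > 0" "count N v > 0" using assms(3,4) by auto
  ultimately show False by simp
qed

lemma jet_inversions_add_left:
  assumes "reduced (M + N)"
  shows "jet_inversions (M + N) P = jet_inversions M P + jet_inversions N P"
proof -
  have "{v. v \<in># M + N \<and> odd_jet v} = {v. v \<in># M \<and> odd_jet v} \<union> {v. v \<in># N \<and> odd_jet v}" by auto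
  then show ?thesis unfolding jet_inversions_alt
    using reduced_disjoint[OF assms] by (subst sum.union_disjoint[symmetric]) auto
qed

lemma jet_inversions_add_right:
  assumes "reduced (N + P)"
  shows "jet_inversions M (N + P) = jet_inversions M N + jet_inversions M P"
proof -
  have "card {w. w \<in># N + P \<and> odd_jet w \<and> to_nat w < to_nat v} =
      card {w. w \<in># N \<and> odd_jet w \<and> to_nat w < to_nat v} + card {w. w \<in># P \<and> odd_jet w \<and> to_nat w < to_nat v}" for v :: "('a, 'b) jet"
    using reduced_disjoint[OF assms] by (subst card_Un_disjoint[symmetric]) (auto intro: arg_cong[where f = card])
  then show ?thesis unfolding jet_inversions_alt by (simp add: sum.distrib)
qed

lemma dx_inversions_Un:
  fixes I J K :: "'d :: {finite, linorder} set"
  shows "I \<inter> J = {} \<Longrightarrow> dx_inversions (I \<union> J) K = dx_inversions I K + dx_inversions J K"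
    and "J \<inter> K = {} \<Longrightarrow> dx_inversions I (J \<union> K) = dx_inversions I J + dx_inversions I K"
proof -
  assume "I \<inter> J = {}"
  then show "dx_inversions (I \<union> J) K = dx_inversions I K + dx_inversions J K"
    unfolding dx_inversions_def
    by (subst card_Un_disjoint[symmetric]) (auto intro: arg_cong[where f = card])
next
  assume "J \<inter> K = {}"
  then show "dx_inversions I (J \<union> K) = dx_inversions I J + dx_inversions I K"
    unfolding dx_inversions_def
    by (subst card_Un_disjoint[symmetric]) (auto intro: arg_cong[where f = card])
qed

lemma mono_form_assoc:
  fixes M N P :: "('a :: countable, 'd :: {finite, linorder}) jet multiset"
  shows "(mono_form (M, I) * mono_form (N, J)) * mono_form (P, K) = mono_form (M, I) * (mono_form (N, J) * mono_form (P, K))"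
proof -
  note [simp] = linear_scale[OF times_left_linear] linear_scale[OF times_right_linear]
    linear_0[OF times_left_linear] linear_0[OF times_right_linear]
  have disj: "(I \<union> J) \<inter> K = {} \<longleftrightarrow> I \<inter> K = {} \<and> J \<inter> K = {}" "I \<inter> (J \<union> K) = {} \<longleftrightarrow> I \<inter> J = {} \<and> I \<inter> K = {}"
    by auto
  consider "I \<inter> J = {}" "I \<inter> K = {}" "J \<inter> K = {}" "reduced (M + N + P)"
    | "\<not> (I \<inter> J = {} \<and> I \<inter> K = {} \<and> J \<inter> K = {})" | "\<not> reduced (M + N + P)" by blast
  then show ?thesis
  proof cases
    case 1
    then have red: "reduced (M + N)" "reduced (N + P)"
      using reduced_plusD[of M "N + P"] reduced_plusD[of "M + N" P] by (auto simp: add.assoc)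
    have card_eq: "card (I \<union> J) = card I + card J" using 1 by (simp add: card_Un_disjoint)
    have odd_eq: "odd_count (N + P) = odd_count N + odd_count P" by (simp add: odd_count_def)
    let ?l = "jet_inversions M N + card I * odd_count N + dx_inversions I J
        + (jet_inversions (M + N) P + card (I \<union> J) * odd_count P + dx_inversions (I \<union> J) K)"
    let ?r = "jet_inversions N P + card J * odd_count P + dx_inversions J K
        + (jet_inversions M (N + P) + card I * odd_count (N + P) + dx_inversions I (J \<union> K))"
    have "?l = ?r"
      by (simp add: card_eq odd_eq jet_inversions_add_left[OF red(1)] jet_inversions_add_right[OF red(2)]
          dx_inversions_Un(1)[OF 1(1)] dx_inversions_Un(2)[OF 1(3)] algebra_simps)
    moreover have "(mono_form (M, I) * mono_form (N, J)) * mono_form (P, K) = (-1) ^ ?l *\<^sub>R mono_form (M + N + P, I \<union> J \<union> K)"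
      using 1(1-3) disj by (simp add: mono_form_times power_add)
    moreover have "mono_form (M, I) * (mono_form (N, J) * mono_form (P, K)) = (-1) ^ ?r *\<^sub>R mono_form (M + (N + P), I \<union> (J \<union> K))"
      using 1(1-3) disj by (simp add: mono_form_times power_add)
    ultimately show ?thesis by (simp only: add.assoc Un_assoc)
  next
    case 2
    then have "(I \<inter> J = {} \<longrightarrow> (I \<union> J) \<inter> K \<noteq> {})" "(J \<inter> K = {} \<longrightarrow> I \<inter> (J \<union> K) \<noteq> {})" using disj by blast+
    then show ?thesis by (simp add: mono_form_times)
  next
    case 3
    then have "mono_form (M + N + P, I \<union> J \<union> K) = 0" "mono_form (M + (N + P), I \<union> (J \<union> K)) = 0"
      using mono_form_not_reduced[of "(M + N + P, I \<union> J \<union> K)"] by (simp_all add: add.assoc Un_assoc)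
    then show ?thesis by (simp add: mono_form_times)
  qed
qed

instance lform :: (countable, "{finite, linorder}") real_algebra_1
proof
  fix x y z :: "('a, 'b) lform" and r :: real
  show "(x + y) * z = x * z + y * z" by (rule linear_add[OF times_left_linear])
  show "x * (y + z) = x * y + x * z" by (rule linear_add[OF times_right_linear])
  show "(r *\<^sub>R x) * y = r *\<^sub>R (x * y)" by (rule linear_scale[OF times_left_linear])
  show "x * (r *\<^sub>R y) = r *\<^sub>R (x * y)" by (rule linear_scale[OF times_right_linear])
  show "1 * x = x"
    by (rule linear_eq_mono[where f = "\<lambda>x. 1 * x" and h = "\<lambda>x. x"])
      (auto simp: times_right_linear linear_id[unfolded id_def] one_lform_def mono_form_times
        jet_inversions_def dx_inversions_def)
  show "x * 1 = x"
    by (rule linear_eq_mono[where f = "\<lambda>x. x * 1" and h = "\<lambda>x. x"])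
      (auto simp: times_left_linear linear_id[unfolded id_def] one_lform_def mono_form_times
        jet_inversions_def dx_inversions_def odd_count_def)
  have L: "linear (\<lambda>x :: ('a, 'b) lform. (x * y) * z)" "linear (\<lambda>x :: ('a, 'b) lform. x * (y * z))" for y z
    by (rule linear_compose[OF times_left_linear times_left_linear, unfolded o_def], rule times_left_linear)
  have M: "linear (\<lambda>y :: ('a, 'b) lform. (x * y) * z)" "linear (\<lambda>y :: ('a, 'b) lform. x * (y * z))" for x z
    by (rule linear_compose[OF times_right_linear times_left_linear, unfolded o_def],
        rule linear_compose[OF times_left_linear times_right_linear, unfolded o_def])
  have R: "linear (\<lambda>z :: ('a, 'b) lform. (x * y) * z)" "linear (\<lambda>z :: ('a, 'b) lform. x * (y * z))" for x y
    by (rule times_right_linear, rule linear_compose[OF times_right_linear times_right_linear, unfolded o_def])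
  show "(x * y) * z = x * (y * z)"
    apply (rule linear_eq_mono[OF L])
    apply (rule linear_eq_mono[OF M])
    apply (rule linear_eq_mono[OF R])
    subgoal for m m' m'' by (cases m; cases m'; cases m'') (simp only: mono_form_assoc)
    done
  have "coeff (1 :: ('a, 'b) lform) ({#}, {}) = 1" by (simp add: one_lform_def mono_form.rep_eq reduced_def)
  moreover have "coeff (0 :: ('a, 'b) lform) ({#}, {}) = 0" by (simp add: zero_lform.rep_eq)
  ultimately show "(0 :: ('a, 'b) lform) \<noteq> 1" by auto
qed

section \<open>Derivations\<close>

definition jvar :: "('a, 'd) jet \<Rightarrow> ('a, 'd) lform" where
  "jvar v = mono_form ({#v#}, {})"

definition dx :: "'d \<Rightarrow> ('a, 'd) lform" where
  "dx \<mu> = mono_form ({#}, {\<mu>})"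

text \<open>Left partial derivatives with respect to the generators.\<close>

definition pderiv_jet ::
    "('a :: countable, 'd :: finite) jet \<Rightarrow> ('a, 'd) lform \<Rightarrow> ('a, 'd) lform" where
  "pderiv_jet v = lin (\<lambda>(M, I).
     if v \<notin># M then 0
     else (if odd_jet v then (-1) ^ jet_inversions {#v#} (M - {#v#}) else real (count M v))
       *\<^sub>R mono_form (M - {#v#}, I))"

definition pderiv_dx :: "'d :: linorder \<Rightarrow> ('a, 'd) lform \<Rightarrow> ('a, 'd) lform" where
  "pderiv_dx \<mu> = lin (\<lambda>(M, I).
     if \<mu> \<notin> I then 0 else (-1) ^ (odd_count M + card {\<nu> \<in> I. \<nu> < \<mu>}) *\<^sub>R mono_form (M, I - {\<mu>}))"

text \<open>The left derivation \<open>\<Sum>_v V_v \<partial>/\<partial>v\<close>, which annihilates the \<open>dx^\<mu>\<close>.\<close>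

definition derivation :: "(('a, 'd) jet \<Rightarrow> ('a, 'd) lform)
    \<Rightarrow> ('a :: countable, 'd :: {finite, linorder}) lform \<Rightarrow> ('a, 'd) lform" where
  "derivation V = lin (\<lambda>m. \<Sum>v \<in> set_mset (fst m). V v * pderiv_jet v (mono_form m))"

definition total_deriv ::
    "'d \<Rightarrow> ('a :: countable, 'd :: {finite, linorder}) lform \<Rightarrow> ('a, 'd) lform" where
  "total_deriv \<mu> = derivation (\<lambda>v. case v of Jet \<phi> a I \<alpha> \<Rightarrow> jvar (Jet \<phi> a I (add_mset \<mu> \<alpha>)))"

definition total_derivs ::
    "'d multiset \<Rightarrow> ('a :: countable, 'd :: {finite, linorder}) lform \<Rightarrow> ('a, 'd) lform" where
  "total_derivs \<alpha> x = foldr total_deriv (sorted_list_of_multiset \<alpha>) x"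

definition ext_d :: "('a :: countable, 'd :: {finite, linorder}) lform \<Rightarrow> ('a, 'd) lform" where
  "ext_d x = (\<Sum>\<mu> \<in> UNIV. dx \<mu> * total_deriv \<mu> x)"

text \<open>
  The components of a constant vector \<open>\<xi>\<close> are commuting numbers, so \<open>i_\<xi>\<close> is an odd derivation.
\<close>

definition inner_deriv ::
    "'d vector \<Rightarrow> ('a, 'd :: {finite, linorder}) lform \<Rightarrow> ('a, 'd) lform" where
  "inner_deriv \<xi> x = (\<Sum>\<mu> \<in> UNIV. (\<xi> $ \<mu>) *\<^sub>R pderiv_dx \<mu> x)"

definition metric_form ::
    "'d matrix \<Rightarrow> 'd vector \<Rightarrow> ('a, 'd :: {finite, linorder}) lform" where
  "metric_form g \<xi> = (\<Sum>\<mu> \<in> UNIV. \<Sum>\<nu> \<in> UNIV. (g $ \<mu> $ \<nu> * \<xi> $ \<mu>) *\<^sub>R dx \<nu>)"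

text \<open>
  The local functional with integrand \<open>x\<close>: integrands are identified when they differ by an
  exact local form.
\<close>

definition integral_of ::
    "('a :: countable, 'd :: {finite, linorder}) lform \<Rightarrow> ('a, 'd) lform set" where
  "integral_of x = {x + ext_d \<theta> |\<theta>. True}"

text \<open>
  Hodge dual, linear over the jet variables, which stand to the left of the \<open>dx^\<mu>\<close>. The sign
  convention is that of \<open>*1 = vol\<close> and \<open>*(g(\<xi>) \<omega>) = (-1)^(D+1) i_\<xi> *\<omega>\<close> in dimension \<open>D\<close>;
  in components, with the Levi-Civita tensor \<open>\<epsilon>\<close> of \<open>g\<close>,
  \<open>*\<omega> = 1/(p!(D-p)!) \<epsilon>_{\<nu>1...\<nu>(D-p) \<mu>p...\<mu>1} \<omega>^{\<mu>1...\<mu>p} dx^\<nu>1...dx^\<nu>(D-p)\<close>.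
  On \<open>p\<close>-forms this is \<open>(-1)^(pD + p(p+1)/2)\<close> times the dual normalised by \<open>\<omega> *\<omega> = <\<omega>,\<omega>> vol\<close>.
\<close>

definition volume_form :: "'d matrix \<Rightarrow> ('a, 'd :: finite) lform" where
  "volume_form g = sqrt \<bar>det g\<bar> *\<^sub>R mono_form ({#}, UNIV)"

definition hodge_dx :: "'d matrix \<Rightarrow> 'd set \<Rightarrow> ('a, 'd :: {finite, linorder}) lform" where
  "hodge_dx g I = foldr (\<lambda>\<mu> x. (-1) ^ (CARD('d) + 1) *\<^sub>R inner_deriv (matrix_inv g $ \<mu>) x)
     (sorted_list_of_set I) (volume_form g)"

definition hodge :: "'d matrix
    \<Rightarrow> ('a :: countable, 'd :: {finite, linorder}) lform \<Rightarrow> ('a, 'd) lform" where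
  "hodge g = lin (\<lambda>(M, I). mono_form (M, {}) * hodge_dx g I)"

section \<open>Lie algebra valued forms\<close>

text \<open>
  The Lie algebra is \<open>real ^ 'a\<close> with bracket \<open>br\<close>, and \<open>tr\<close> is the bilinear form \<open>(X, Y) \<mapsto> Tr (X Y)\<close>.
  Of the trace only invariance, symmetry and nondegeneracy are required.
\<close>

definition lie_algebra :: "(('a :: finite) vector \<Rightarrow> 'a vector \<Rightarrow> 'a vector) \<Rightarrow> bool" where
  "lie_algebra br \<longleftrightarrow> bilinear br \<and> (\<forall>x. br x x = 0) \<and>
     (\<forall>x y z. br x (br y z) + br y (br z x) + br z (br x y) = 0)"

definition simple_lie_algebra :: "(('a :: finite) vector \<Rightarrow> 'a vector \<Rightarrow> 'a vector) \<Rightarrow> bool" where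
  "simple_lie_algebra br \<longleftrightarrow> lie_algebra br \<and> (\<exists>x y. br x y \<noteq> 0) \<and>
     (\<forall>S. subspace S \<and> (\<forall>x. \<forall>y \<in> S. br x y \<in> S) \<longrightarrow> S = {0} \<or> S = UNIV)"

definition invariant_form ::
    "(('a :: finite) vector \<Rightarrow> 'a vector \<Rightarrow> 'a vector) \<Rightarrow> ('a vector \<Rightarrow> 'a vector \<Rightarrow> real) \<Rightarrow> bool" where
  "invariant_form br tr \<longleftrightarrow> bilinear tr \<and> (\<forall>x y. tr x y = tr y x) \<and>
     (\<forall>x y z. tr (br x y) z = tr x (br y z)) \<and> (\<forall>x. (\<forall>y. tr x y = 0) \<longrightarrow> x = 0)"

type_synonym ('a, 'd) gform = "(('a, 'd) lform, 'a) vec"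

definition Tr :: "('a vector \<Rightarrow> 'a vector \<Rightarrow> real) \<Rightarrow> ('a, 'd) gform
    \<Rightarrow> ('a :: finite, 'd :: {finite, linorder}) gform \<Rightarrow> ('a, 'd) lform" where
  "Tr tr X Y = (\<Sum>a \<in> UNIV. \<Sum>b \<in> UNIV. tr (axis a 1) (axis b 1) *\<^sub>R (X $ a * Y $ b))"

text \<open>Graded commutator: \<open>[X, Y] = X^a Y^b [T_a, T_b]\<close> for a basis \<open>T_a\<close> of the Lie algebra.\<close>

definition bracket :: "('a vector \<Rightarrow> 'a vector \<Rightarrow> 'a vector) \<Rightarrow> ('a, 'd) gform
    \<Rightarrow> ('a :: finite, 'd :: {finite, linorder}) gform \<Rightarrow> ('a, 'd) gform" where
  "bracket br X Y =
     (\<chi> c. \<Sum>a \<in> UNIV. \<Sum>b \<in> UNIV. (br (axis a 1) (axis b 1) $ c) *\<^sub>R (X $ a * Y $ b))"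

definition gd :: "('a :: finite, 'd :: {finite, linorder}) gform \<Rightarrow> ('a, 'd) gform" where
  "gd X = (\<chi> a. ext_d (X $ a))"

definition gi :: "'d vector \<Rightarrow> ('a :: finite, 'd :: {finite, linorder}) gform \<Rightarrow> ('a, 'd) gform" where
  "gi \<xi> X = (\<chi> a. inner_deriv \<xi> (X $ a))"

definition gstar :: "'d matrix
    \<Rightarrow> ('a :: finite, 'd :: {finite, linorder}) gform \<Rightarrow> ('a, 'd) gform" where
  "gstar g X = (\<chi> a. hodge g (X $ a))"

definition gmetric :: "'d matrix \<Rightarrow> 'd vector
    \<Rightarrow> ('a :: finite, 'd :: {finite, linorder}) gform \<Rightarrow> ('a, 'd) gform" where
  "gmetric g \<xi> X = (\<chi> a. metric_form g \<xi> * X $ a)"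

text \<open>\<open>[i_\<xi>, d]\<close> for the odd operators \<open>i_\<xi>\<close> and \<open>d\<close>.\<close>

definition gLie :: "'d vector \<Rightarrow> ('a :: finite, 'd :: {finite, linorder}) gform \<Rightarrow> ('a, 'd) gform" where
  "gLie \<xi> X = gi \<xi> (gd X) + gd (gi \<xi> X)"

section \<open>Field operators and functional derivatives\<close>

definition field_form :: "nat \<Rightarrow> field \<Rightarrow> ('a :: finite, 'd :: {finite, linorder}) gform" where
  "field_form n \<phi> = (if \<phi> \<in> fields n
     then (\<chi> a. \<Sum>I | card I = form_degree n \<phi>. mono_form ({#Jet \<phi> a I {#}#}, I)) else 0)"

text \<open>The coefficient of \<open>dx^I\<close>.\<close>

definition component :: "('a, 'd) lform \<Rightarrow> 'd set \<Rightarrow> ('a, 'd) lform" where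
  "component x I = lin (\<lambda>(M, J). if J = I then mono_form (M, {}) else 0) x"

text \<open>
  The functional differential operator \<open>\<integral> Tr \<Sum>_\<phi> \<delta>\<phi> \<delta>/\<delta>\<phi>\<close> on local forms: the derivation that
  sends \<open>\<partial>_\<alpha> \<phi>^a_I\<close> to \<open>\<partial>_\<alpha> (\<delta>\<phi>)^a_I\<close>. Jet variables that do not belong to a component of one of the
  \<open>fields n\<close> play no role and are annihilated.
\<close>

definition field_operator :: "nat \<Rightarrow> (field \<Rightarrow> ('a, 'd) gform)
    \<Rightarrow> ('a :: finite, 'd :: {finite, linorder}) lform \<Rightarrow> ('a, 'd) lform" where
  "field_operator n \<delta> = derivation (\<lambda>v. case v of Jet \<phi> a I \<alpha> \<Rightarrow>
     if \<phi> \<in> fields n \<and> card I = form_degree n \<phi>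
     then total_derivs \<alpha> (component (\<delta> \<phi> $ a) I) else 0)"

text \<open>Left Euler-Lagrange derivative with respect to \<open>\<phi>^a_I\<close>.\<close>

definition euler_lagrange :: "field \<Rightarrow> 'a \<Rightarrow> 'd set
    \<Rightarrow> ('a :: countable, 'd :: {finite, linorder}) lform \<Rightarrow> ('a, 'd) lform" where
  "euler_lagrange \<phi> a I x =
     (\<Sum>\<alpha> | \<exists>m. coeff x m \<noteq> 0 \<and> Jet \<phi> a I \<alpha> \<in># fst m.
        (-1) ^ size \<alpha> *\<^sub>R total_derivs \<alpha> (pderiv_jet (Jet \<phi> a I \<alpha>) x))"

text \<open>
  The functional derivative of \<open>\<integral> L\<close> with respect to a \<open>p\<close>-form \<open>\<phi>\<close> is the \<open>(D-p)\<close>-form given by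
  \<open>\<delta>(\<integral> L) = \<integral> Tr (\<delta>\<phi> \<delta>L/\<delta>\<phi>)\<close>. Stripping \<open>\<delta>\<phi>^b_I dx^I\<close> off from the left amounts to applying
  \<open>i_{\<mu>p} ... i_{\<mu>1}\<close>, \<open>I = {\<mu>1 < ... < \<mu>p}\<close>, to the Euler-Lagrange derivative, and the Lie algebra
  index is raised with the inverse of the matrix of \<open>tr\<close>.
\<close>

definition functional_deriv :: "nat \<Rightarrow> ('a vector \<Rightarrow> 'a vector \<Rightarrow> real)
    \<Rightarrow> ('a :: finite, 'd :: {finite, linorder}) lform \<Rightarrow> field \<Rightarrow> ('a, 'd) gform" where
  "functional_deriv n tr x \<phi> = (\<chi> a. \<Sum>b \<in> UNIV.
     (matrix_inv (\<chi> a b. tr (axis a 1) (axis b 1)) $ a $ b) *\<^sub>R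
     (\<Sum>I | card I = form_degree n \<phi>.
        fold pderiv_dx (sorted_list_of_set I) (euler_lagrange \<phi> b I x)))"

section \<open>The model\<close>

text \<open>
  \<open>antighost n k g\<close> and \<open>multiplier n k g\<close> are the entry \<open>g\<close> of row \<open>k\<close> of the triangle
  \<open>1 \<le> k \<le> n\<close>, \<open>0 \<le> g \<le> n - k\<close>, and zero outside of it, also for \<open>g = -1\<close>: in the
  transformations below \<open>g \<plusminus> 1\<close> moves within a row.
\<close>

definition antighost :: "nat \<Rightarrow> nat \<Rightarrow> int \<Rightarrow> ('a :: finite, 'd :: {finite, linorder}) gform" where
  "antighost n k g = (if 1 \<le> k \<and> k \<le> n \<and> 0 \<le> g \<and> g \<le> int n - int k
     then field_form n (CBar k (nat g)) else 0)"

definition multiplier :: "nat \<Rightarrow> nat \<Rightarrow> int \<Rightarrow> ('a :: finite, 'd :: {finite, linorder}) gform" where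
  "multiplier n k g = (if 1 \<le> k \<and> k \<le> n \<and> 0 \<le> g \<and> g \<le> int n - int k
     then field_form n (PiF k (nat g)) else 0)"

definition gamma_hat :: "nat \<Rightarrow> 'd matrix \<Rightarrow> ('a :: finite, 'd :: {finite, linorder}) gform" where
  "gamma_hat n g = field_form n SrcGamma - gstar g (gd (field_form n AGhost))"

definition b_hat :: "nat \<Rightarrow> 'd matrix \<Rightarrow> nat \<Rightarrow> ('a :: finite, 'd :: {finite, linorder}) gform" where
  "b_hat n g j = (if j < n
     then field_form n (SrcB j) + (-1) ^ (j + 1) *\<^sub>R gstar g (gd (antighost n 1 (int j)))
     else field_form n (SrcB j))"

definition ladder1 :: "nat \<Rightarrow> 'd matrix \<Rightarrow> nat \<Rightarrow> ('a :: finite, 'd :: {finite, linorder}) gform" where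
  "ladder1 n g p = (if p = 0 then field_form n Ghost else if p = 1 then field_form n Conn
     else if p \<le> n + 2 then b_hat n g (p - 2) else 0)"

definition ladder2 :: "nat \<Rightarrow> 'd matrix \<Rightarrow> nat \<Rightarrow> ('a :: finite, 'd :: {finite, linorder}) gform" where
  "ladder2 n g p = (if p \<le> n then field_form n (BF (n - p)) else if p = n + 1 then gamma_hat n g
     else if p = n + 2 then field_form n SrcTau else 0)"

definition Sigma_hat :: "nat \<Rightarrow> 'd matrix \<Rightarrow> ('a vector \<Rightarrow> 'a vector \<Rightarrow> 'a vector)
    \<Rightarrow> ('a vector \<Rightarrow> 'a vector \<Rightarrow> real) \<Rightarrow> ('a :: finite, 'd :: {finite, linorder}) lform" where
  "Sigma_hat n g br tr =
     (\<Sum>p = 0..n+1. Tr tr (ladder1 n g p) (gd (ladder2 n g (n + 1 - p))))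
   + (1/2) *\<^sub>R (\<Sum>p = 0..n+2. \<Sum>q = 0..n+2-p.
       Tr tr (bracket br (ladder1 n g p) (ladder1 n g q)) (ladder2 n g (n + 2 - p - q)))"

text \<open>
  In the last sum \<open>\<Pi>^g_{n-g-k}\<close> (\<open>k\<close> odd, \<open>g \<ge> 1\<close>) has positive ghost number, so it is the entry
  \<open>g - 1\<close> of row \<open>k + 1\<close>.
\<close>

definition Sigma_Pi :: "nat \<Rightarrow> 'd matrix \<Rightarrow> ('a vector \<Rightarrow> 'a vector \<Rightarrow> real)
    \<Rightarrow> (nat \<Rightarrow> nat \<Rightarrow> nat \<Rightarrow> real) \<Rightarrow> ('a :: finite, 'd :: {finite, linorder}) lform" where
  "Sigma_Pi n g tr x =
     - Tr tr (gd (field_form n Mult)) (gstar g (field_form n Conn))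
     - (\<Sum>j = 0..<n. Tr tr (gd (multiplier n 1 (int j))) (gstar g (field_form n (BF j))))
     + (\<Sum>k = 2..n. \<Sum>j = 0..n-k.
         - Tr tr (gd (multiplier n k (int j))) (gstar g (antighost n (k - 1) (int j)))
         + (-1) ^ (n + 1) *\<^sub>R Tr tr (gd (antighost n k (int j))) (gstar g (multiplier n (k - 1) (int j))))
     + (\<Sum>k | 1 \<le> k \<and> k \<le> n \<and> odd k. \<Sum>j = 1..n-k.
         x k j n *\<^sub>R Tr tr (multiplier n k (int j)) (gstar g (multiplier n (k + 1) (int j - 1))))"

definition Sigma_action :: "nat \<Rightarrow> 'd matrix \<Rightarrow> ('a vector \<Rightarrow> 'a vector \<Rightarrow> 'a vector)
    \<Rightarrow> ('a vector \<Rightarrow> 'a vector \<Rightarrow> real) \<Rightarrow> (nat \<Rightarrow> nat \<Rightarrow> nat \<Rightarrow> real)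
    \<Rightarrow> ('a :: finite, 'd :: {finite, linorder}) lform" where
  "Sigma_action n g br tr x = Sigma_hat n g br tr + Sigma_Pi n g tr x"

subsection \<open>Supersymmetry and translations\<close>

fun susy_antighosts :: "nat \<Rightarrow> 'd matrix \<Rightarrow> 'd vector \<Rightarrow> field
    \<Rightarrow> ('a :: finite, 'd :: {finite, linorder}) gform" where
  "susy_antighosts n g \<xi> AGhost = 0"
| "susy_antighosts n g \<xi> Mult = gLie \<xi> (field_form n AGhost)"
| "susy_antighosts n g \<xi> (CBar k j) = (if odd k
     then (-1) ^ (n + (k + 1) div 2) *\<^sub>R gmetric g \<xi> (antighost n k (int j + 1))
     else (-1) ^ (k div 2 + 1) *\<^sub>R gi \<xi> (antighost n k (int j - 1)))"
| "susy_antighosts n g \<xi> (PiF k j) = (if odd k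
     then (-1) ^ (n + (k + 1) div 2) *\<^sub>R gmetric g \<xi> (multiplier n k (int j + 1))
     else (-1) ^ (k div 2 + 1) *\<^sub>R gi \<xi> (multiplier n k (int j - 1)))
     + gLie \<xi> (antighost n k (int j))"
| "susy_antighosts n g \<xi> _ = 0"

text \<open>
  In the transformation of \<open>SrcB j\<close> the variation of \<open>*dC-bar\<close> is the one induced by the
  transformation of the antighosts.
\<close>

fun susy :: "nat \<Rightarrow> 'd matrix \<Rightarrow> 'd vector \<Rightarrow> field
    \<Rightarrow> ('a :: finite, 'd :: {finite, linorder}) gform" where
  "susy n g \<xi> Ghost = - gi \<xi> (ladder1 n g 1)"
| "susy n g \<xi> Conn = - gi \<xi> (ladder1 n g 2)"
| "susy n g \<xi> (BF j) = - gi \<xi> (ladder2 n g (n - j + 1))"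
| "susy n g \<xi> SrcGamma = - gi \<xi> (field_form n SrcTau)"
| "susy n g \<xi> SrcTau = 0"
| "susy n g \<xi> (SrcB j) = (if j < n
     then - gi \<xi> (b_hat n g (j + 1)) - (-1) ^ (j + 1) *\<^sub>R
       (\<chi> a. field_operator n (susy_antighosts n g \<xi>) (gstar g (gd (antighost n 1 (int j))) $ a))
     else 0)"
| "susy n g \<xi> \<phi> = susy_antighosts n g \<xi> \<phi>"

definition W_susy :: "nat \<Rightarrow> 'd matrix \<Rightarrow> 'd vector
    \<Rightarrow> ('a :: finite, 'd :: {finite, linorder}) lform \<Rightarrow> ('a, 'd) lform" where
  "W_susy n g \<xi> = field_operator n (susy n g \<xi>)"

definition W_trans :: "nat \<Rightarrow> 'd vector
    \<Rightarrow> ('a :: finite, 'd :: {finite, linorder}) lform \<Rightarrow> ('a, 'd) lform" where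
  "W_trans n \<epsilon> = field_operator n (\<lambda>\<phi>. gLie \<epsilon> (field_form n \<phi>))"

subsection \<open>Linearized Slavnov operator\<close>

text \<open>\<open>S\<close> is the integrand of the action.\<close>

fun slavnov_transf :: "nat \<Rightarrow> ('a vector \<Rightarrow> 'a vector \<Rightarrow> real)
    \<Rightarrow> ('a :: finite, 'd :: {finite, linorder}) lform \<Rightarrow> field \<Rightarrow> ('a, 'd) gform" where
  "slavnov_transf n tr S (BF j) = functional_deriv n tr S (SrcB j)"
| "slavnov_transf n tr S (SrcB j) = functional_deriv n tr S (BF j)"
| "slavnov_transf n tr S Conn = functional_deriv n tr S SrcGamma"
| "slavnov_transf n tr S SrcGamma = functional_deriv n tr S Conn"
| "slavnov_transf n tr S Ghost = functional_deriv n tr S SrcTau"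
| "slavnov_transf n tr S SrcTau = functional_deriv n tr S Ghost"
| "slavnov_transf n tr S AGhost = field_form n Mult"
| "slavnov_transf n tr S (CBar k j) = multiplier n k (int j)"
| "slavnov_transf n tr S Mult = 0"
| "slavnov_transf n tr S (PiF k j) = 0"

definition slavnov :: "nat \<Rightarrow> ('a vector \<Rightarrow> 'a vector \<Rightarrow> real)
    \<Rightarrow> ('a :: finite, 'd :: {finite, linorder}) lform \<Rightarrow> ('a, 'd) lform \<Rightarrow> ('a, 'd) lform" where
  "slavnov n tr S = field_operator n (slavnov_transf n tr S)"

subsection \<open>The classical breaking\<close>

text \<open>In the last two terms \<open>d * i_\<xi>\<close> acts on the source only.\<close>

definition Delta_susy :: "nat \<Rightarrow> 'd matrix \<Rightarrow> ('a vector \<Rightarrow> 'a vector \<Rightarrow> real) \<Rightarrow> 'd vector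
    \<Rightarrow> ('a :: finite, 'd :: {finite, linorder}) lform" where
  "Delta_susy n g tr \<xi> =
     - (\<Sum>j = 0..n. Tr tr (field_form n (SrcB j)) (gLie \<xi> (field_form n (BF j))))
     + (-1) ^ n *\<^sub>R Tr tr (field_form n SrcGamma) (gLie \<xi> (field_form n Conn))
     + (-1) ^ n *\<^sub>R Tr tr (field_form n SrcTau) (gLie \<xi> (field_form n Ghost))
     + Tr tr (gd (gstar g (gi \<xi> (field_form n (SrcB 0))))) (field_form n Mult)
     + Tr tr (gd (gstar g (gi \<xi> (field_form n SrcGamma)))) (multiplier n 1 0)"

text \<open>The graded commutator of two odd operators.\<close>

definition odd_commutator ::
    "(('a, 'd) lform \<Rightarrow> ('a, 'd) lform) \<Rightarrow> (('a, 'd) lform \<Rightarrow> ('a, 'd) lform)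
      \<Rightarrow> ('a, 'd) lform \<Rightarrow> ('a, 'd) lform" where
  "odd_commutator P Q x = P (Q x) + Q (P x)"

end

theory Submission
  imports Defs
begin

text \<open>
  Let \<open>\<Phi>1\<close> and \<open>\<Phi>2\<close> be the sums of the two ladders, of total degrees 1 and n. The ladder part of the action
  is the top degree part of \<open>Tr (\<Phi>1 d\<Phi>2 + [\<Phi>1, \<Phi>1] \<Phi>2 / 2)\<close>, supersymmetry acts on both sums as \<open>- i_\<xi>\<close>, and by
  the first variation formula the Slavnov operator acts as \<open>\<Phi>1 \<mapsto> E1 = d\<Phi>1 + [\<Phi>1, \<Phi>1] / 2\<close> and
  \<open>\<Phi>2 \<mapsto> E2 = d\<Phi>2 + [\<Phi>1, \<Phi>2]\<close>. Nilpotency is the Bianchi identity, and the anticommutators reduce to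
  \<open>[i_\<xi>, d] = L_\<xi>\<close> and \<open>[i_\<xi>, i_\<eta>] = 0\<close>: the operators are graded derivations commuting with total derivatives, hence
  are determined by their values on the fields.

  In the Ward identity the ladders contribute \<open>- Tr \<Phi>1 L_\<xi> \<Phi>2\<close>, because \<open>i_\<xi>\<close> of a form has no top degree part.
  In the gauge-fixing part, adjacent rows of antighosts are transformed by \<open>i_\<xi>\<close> and by multiplication with \<open>g(\<xi>)\<close>,
  which are conjugate under the Hodge dual, and the sum over a row telescopes; for even rows it does so only together
  with the quadratic terms in the multipliers, which fixes the gauge parameters.
\<close>

section \<open>Grading\<close>

text \<open>The shifts by Hodge duals of \<open>d\<close> of the antighosts are what makes the
  ladders simple. The contribution of \<open>Sigma_Pi\<close> to the functional derivatives is
  cancelled by the Slavnov variation of the shifts, and the sources are transformed so that the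
  supersymmetry variation of the shifts drops out; on shifted ladders neither operator sees the
  gauge fixing.

  Functional derivatives are defined by jets and components, which cannot reasonably be unfolded for
  the action. Instead the variation is a derivation into fresh jet variables. Since the
  Euler-Lagrange operator annihilates exact forms, writing the variation of the action as
  \<open>Tr (\<delta>\<phi> X)\<close> up to an exact form identifies \<open>X\<close>.

  In every row the Lie derivatives coming from the multipliers pair off to the Lie derivative of a
  top form, which is exact. In odd rows \<open>d\<close> meets only multiplication by
  \<open>g(\<xi>)\<close>, with which it anticommutes. In even rows it meets \<open>i_\<xi>\<close>,
  and terms with \<open>i_\<xi> d\<close> survive; the quadratic terms cancel one family of them and
  complete the other to a Lie derivative.\<close>

definition sg :: "int \<Rightarrow> real" where
  "sg e = (if even e then 1 else -1)"

lemma sg_simps [simp]: "sg 0 = 1" "sg 1 = -1" "sg e * sg e = 1" "sg e * (sg e * r) = r" "sg (- e) = sg e"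
  by (auto simp: sg_def)

lemma sg_add: "sg (a + b) = sg a * sg b"
  by (auto simp: sg_def)

lemma sg_cong: "even a = even b \<Longrightarrow> sg a = sg b"
  by (simp add: sg_def)

text \<open>Ghost numbers may be negative, so signs are handled as a function of an integer; the
  powers of -1 in the definitions enter through this equation.\<close>

lemma sg_of_nat: "(-1) ^ k = sg (int k)"
  by (auto simp: sg_def minus_one_power_iff)

text \<open>Parity, form degree and the set of occurring jets are all conditions on the monomials of
  a form; closure under linear maps and products is proved once for an arbitrary condition.\<close>

definition supp :: "(('a, 'd) monomial \<Rightarrow> bool) \<Rightarrow> ('a, 'd) lform \<Rightarrow> bool" where
  "supp P x \<longleftrightarrow> (\<forall>m. coeff x m \<noteq> 0 \<longrightarrow> P m)"

lemma supp_0 [simp]: "supp P 0"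
  by (simp add: supp_def zero_lform.rep_eq)

lemma supp_add: "supp P x \<Longrightarrow> supp P y \<Longrightarrow> supp P (x + y)"
  unfolding supp_def plus_lform.rep_eq by (metis add.left_neutral)

lemma supp_scaleR: "supp P x \<Longrightarrow> supp P (r *\<^sub>R x)"
  by (simp add: supp_def scaleR_lform.rep_eq)

lemma supp_sum: "(\<And>i. i \<in> A \<Longrightarrow> supp P (f i)) \<Longrightarrow> supp P (\<Sum>i\<in>A. f i)"
  by (induction A rule: infinite_finite_induct) (auto intro: supp_add)

lemma supp_mono_form: "(reduced (fst m) \<Longrightarrow> P m) \<Longrightarrow> supp P (mono_form m)"
  by (auto simp: supp_def mono_form.rep_eq)

lemma linear_expand:
  assumes "linear f"
  shows "f x = (\<Sum>m | coeff x m \<noteq> 0. coeff x m *\<^sub>R f (mono_form m))"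
proof -
  have "f x = f (lin mono_form x)" by (simp add: lin_mono_form_id)
  then show ?thesis
    by (simp add: lin_def linear_sum[OF assms] linear_scale[OF assms])
qed

lemma supp_linear:
  assumes "linear f" "\<And>m. P m \<Longrightarrow> supp Q (f (mono_form m))" "supp P x"
  shows "supp Q (f x)"
  unfolding linear_expand[OF assms(1), of x]
  using assms(2,3) by (intro supp_sum supp_scaleR) (auto simp: supp_def)

text \<open>This turns an identity for homogeneous forms into one for monomials: a hypothesis such
  as \<open>par e x\<close> becomes an assumption on the monomial at hand.\<close>

lemma supp_eq:
  assumes "linear f" "linear h" "\<And>m. P m \<Longrightarrow> f (mono_form m) = h (mono_form m)" "supp P x"
  shows "f x = h x"
  unfolding linear_expand[OF assms(1), of x] linear_expand[OF assms(2), of x]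
  using assms(3,4) by (intro sum.cong) (auto simp: supp_def)

definition mpar :: "('a, 'd) monomial \<Rightarrow> int" where
  "mpar m = int (odd_count (fst m)) + int (card (snd m))"

text \<open>Only \<open>e\<close> modulo 2 matters, and 0 has every parity. The grading is ghost
  number plus form degree, which for a monomial is the number of odd jets plus the number of
  \<open>dx\<close>.\<close>

definition par :: "int \<Rightarrow> ('a, 'd) lform \<Rightarrow> bool" where
  "par e = supp (\<lambda>m. even (mpar m) \<longleftrightarrow> even e)"

definition deg :: "nat \<Rightarrow> ('a, 'd) lform \<Rightarrow> bool" where
  "deg p = supp (\<lambda>m. card (snd m) = p)"

lemma par_0 [simp]: "par e 0" and deg_0 [simp]: "deg p 0"
  by (simp_all add: par_def deg_def)

lemma par_add: "par e x \<Longrightarrow> par e y \<Longrightarrow> par e (x + y)"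
  and par_scaleR: "par e x \<Longrightarrow> par e (r *\<^sub>R x)"
  and par_sum: "(\<And>i. i \<in> A \<Longrightarrow> par e (f i)) \<Longrightarrow> par e (\<Sum>i\<in>A. f i)"
  by (auto simp: par_def intro!: supp_add supp_scaleR supp_sum)

lemma deg_add: "deg p x \<Longrightarrow> deg p y \<Longrightarrow> deg p (x + y)"
  and deg_scaleR: "deg p x \<Longrightarrow> deg p (r *\<^sub>R x)"
  and deg_sum: "(\<And>i. i \<in> A \<Longrightarrow> deg p (f i)) \<Longrightarrow> deg p (\<Sum>i\<in>A. f i)"
  by (auto simp: deg_def intro!: supp_add supp_scaleR supp_sum)

lemma par_uminus: "par e x \<Longrightarrow> par e (- x)" and deg_uminus: "deg p x \<Longrightarrow> deg p (- x)"
  using par_scaleR[of e x "-1"] deg_scaleR[of p x "-1"] by simp_all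

lemma par_diff: "par e x \<Longrightarrow> par e y \<Longrightarrow> par e (x - y)"
  and deg_diff: "deg p x \<Longrightarrow> deg p y \<Longrightarrow> deg p (x - y)"
  using par_add[of e x "- y"] par_uminus[of e y] deg_add[of p x "- y"] deg_uminus[of p y] by simp_all

lemma par_cong: "par e x \<Longrightarrow> even e = even f \<Longrightarrow> par f x"
  by (simp add: par_def)

lemma par_mono_form: "even (mpar m) = even e \<Longrightarrow> par e (mono_form m)"
  and deg_mono_form: "card (snd m) = p \<Longrightarrow> deg p (mono_form m)"
  by (auto simp: par_def deg_def intro: supp_mono_form)

definition vpar :: "('a, 'd) jet \<Rightarrow> int" where
  "vpar v = ghost_number (jet_field v)"

text \<open>Left derivations of parity \<open>e\<close>. The last conjunct makes the signs in
  iterated applications computable, which commutators require.\<close>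

definition is_der :: "int \<Rightarrow> (('a :: countable, 'd :: {finite, linorder}) lform \<Rightarrow> ('a, 'd) lform) \<Rightarrow> bool" where
  "is_der e Q \<longleftrightarrow> linear Q \<and>
     (\<forall>f x y. par f x \<longrightarrow> Q (x * y) = Q x * y + sg (e * f) *\<^sub>R (x * Q y)) \<and>
     (\<forall>f x. par f x \<longrightarrow> par (e + f) (Q x))"


section \<open>Products of homogeneous forms and graded commutativity\<close>

lemma supp_times:
  fixes x y :: "('a :: countable, 'd :: {finite, linorder}) lform"
  assumes "supp P x" "supp Q y"
    "\<And>M I N J. P (M, I) \<Longrightarrow> Q (N, J) \<Longrightarrow> I \<inter> J = {} \<Longrightarrow> R (M + N, I \<union> J)"
  shows "supp R (x * y)"
proof (rule supp_linear[OF times_left_linear _ assms(1)])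
  fix m :: "('a, 'd) monomial" assume m: "P m"
  show "supp R (mono_form m * y)"
  proof (rule supp_linear[OF times_right_linear _ assms(2)])
    fix m' :: "('a, 'd) monomial" assume "Q m'"
    then show "supp R (mono_form m * mono_form m')"
      using m assms(3) by (cases m; cases m') (auto simp: mono_form_times intro!: supp_scaleR supp_mono_form)
  qed
qed

lemma par_times:
  fixes x y :: "('a :: countable, 'd :: {finite, linorder}) lform"
  shows "par e x \<Longrightarrow> par f y \<Longrightarrow> par (e + f) (x * y)"
  unfolding par_def
  by (erule supp_times, assumption) (auto simp: mpar_def odd_count_def card_Un_disjoint)

lemma deg_times:
  fixes x y :: "('a :: countable, 'd :: {finite, linorder}) lform"
  shows "deg p x \<Longrightarrow> deg q y \<Longrightarrow> deg (p + q) (x * y)"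
  unfolding deg_def by (erule supp_times, assumption) (auto simp: card_Un_disjoint)

lemma deg_too_big: "deg p (x :: ('a :: countable, 'd :: {finite, linorder}) lform) \<Longrightarrow> CARD('d) < p \<Longrightarrow> x = 0"
proof -
  assume a: "deg p x" "CARD('d) < p"
  have "coeff x m = 0" for m
  proof (rule ccontr)
    assume "coeff x m \<noteq> 0"
    then have "card (snd m) = p" using a(1) unfolding deg_def supp_def by blast
    then show False using a(2) card_mono[of UNIV "snd m"] by simp
  qed
  then have "coeff x = coeff 0" by (auto simp: zero_lform.rep_eq)
  then show "x = 0" by (simp add: coeff_inject)
qed

lemma par_1: "par 0 (1 :: ('a :: countable, 'd :: {finite, linorder}) lform)" and deg_1: "deg 0 (1 :: ('a, 'd) lform)"
  unfolding one_lform_def by (auto intro!: par_mono_form deg_mono_form simp: mpar_def odd_count_def)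

lemma odd_vpar: "odd (vpar v) = odd_jet v"
  by (simp add: vpar_def odd_jet_def)

lemma odd_count_add_mset [simp]: "odd_count (add_mset v M) = (if odd_jet v then 1 else 0) + odd_count M"
  by (simp add: odd_count_def)

lemma odd_count_empty [simp]: "odd_count {#} = 0"
  by (simp add: odd_count_def)

lemma par_jvar: "even e = even (vpar v) \<Longrightarrow> par e (jvar v :: ('a :: countable, 'd :: {finite, linorder}) lform)" and deg_jvar: "deg 0 (jvar v :: ('a, 'd) lform)"
  using odd_vpar[of v] by (auto simp: jvar_def mpar_def intro!: par_mono_form deg_mono_form)

lemma par_dx: "odd e \<Longrightarrow> par e (dx \<mu> :: ('a :: countable, 'd :: {finite, linorder}) lform)" and deg_dx: "deg 1 (dx \<mu> :: ('a, 'd) lform)"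
  by (auto simp: dx_def mpar_def intro!: par_mono_form deg_mono_form)

text \<open>No odd variable occurs on both sides, so each pair of odd variables, one from either
  side, is an inversion for exactly one of the two orders.\<close>

lemma jet_inversions_swap:
  fixes M N :: "('a :: countable, 'd :: {finite, linorder}) jet multiset"
  assumes "reduced (M + N)"
  shows "jet_inversions M N + jet_inversions N M = odd_count M * odd_count N"
proof -
  have r: "reduced M" "reduced N" using reduced_plusD[OF assms] by auto
  \<comment> \<open>Odd variables of a reduced multiset do not repeat, hence counting them with
    multiplicity gives a cardinality.\<close>
  have oc: "odd_count K = card {v. v \<in># K \<and> odd_jet v}" if "reduced K" for K :: "('a, 'd) jet multiset"
  proof -
    have "\<forall>v. count (filter_mset odd_jet K) v \<le> 1" using that by (auto simp: reduced_def)
    then have "filter_mset odd_jet K = mset_set (set_mset (filter_mset odd_jet K))"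
      by (intro multiset_eqI) (metis One_nat_def count_eq_zero_iff count_mset_set(1) count_mset_set(3) finite_set_mset le_Suc_eq le_zero_eq)
    then have "size (filter_mset odd_jet K) = card (set_mset (filter_mset odd_jet K))"
      by (metis size_mset_set)
    then show ?thesis by (simp add: odd_count_def)
  qed
  let ?A = "{(v, w). v \<in># M \<and> w \<in># N \<and> odd_jet v \<and> odd_jet w \<and> to_nat w < to_nat v}"
  let ?B = "{(v, w). v \<in># M \<and> w \<in># N \<and> odd_jet v \<and> odd_jet w \<and> to_nat v < to_nat w}"
  have "card {(v, w). v \<in># N \<and> w \<in># M \<and> odd_jet v \<and> odd_jet w \<and> to_nat w < to_nat v} = card ?B"
    by (rule bij_betw_same_card[where f = "\<lambda>(v, w). (w, v)"]) (auto simp: bij_betw_def inj_on_def image_def)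
  moreover have un: "?A \<union> ?B = {v. v \<in># M \<and> odd_jet v} \<times> {v. v \<in># N \<and> odd_jet v}"
  proof -
    have "to_nat v \<noteq> to_nat w" if "v \<in># M" "w \<in># N" "odd_jet v" for v w
      using reduced_disjoint[OF assms that(3)] that(1,2) by (metis inj_to_nat injD)
    then show ?thesis by (auto simp: not_less_iff_gr_or_eq)
  qed
  moreover have "finite (?A \<union> ?B)" unfolding un by simp
  then have "card (?A \<union> ?B) = card ?A + card ?B"
    by (intro card_Un_disjoint) (auto intro: finite_subset)
  ultimately show ?thesis
    unfolding oc[OF r(1)] oc[OF r(2)] by (simp add: jet_inversions_def card_cartesian_product)
qed

lemma dx_inversions_swap:
  fixes I J :: "('d :: {finite, linorder}) set"
  assumes "I \<inter> J = {}"
  shows "dx_inversions I J + dx_inversions J I = card I * card J"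
proof -
  let ?A = "{(v, w). v \<in> I \<and> w \<in> J \<and> w < v}"
  let ?B = "{(v, w). v \<in> I \<and> w \<in> J \<and> v < w}"
  have "card {(v, w). v \<in> J \<and> w \<in> I \<and> w < v} = card ?B"
    by (rule bij_betw_same_card[where f = "\<lambda>(v, w). (w, v)"]) (auto simp: bij_betw_def inj_on_def image_def)
  moreover have un: "?A \<union> ?B = I \<times> J"
  proof -
    have "v \<noteq> w" if "v \<in> I" "w \<in> J" for v w using assms that by auto
    then show ?thesis by (auto simp: not_less_iff_gr_or_eq)
  qed
  moreover have "finite (?A \<union> ?B)" unfolding un by simp
  then have "card (?A \<union> ?B) = card ?A + card ?B"
    by (intro card_Un_disjoint) (auto intro: finite_subset)
  ultimately show ?thesis
    by (simp add: dx_inversions_def card_cartesian_product)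
qed

text \<open>The two inversion counts contribute the products of the numbers of odd jets and of the
  numbers of \<open>dx\<close>; carrying \<open>dx\<close> past odd jets contributes the two mixed
  products. Together these are the product of the total parities.\<close>

lemma mono_form_commute:
  fixes m m' :: "('a :: countable, 'd :: {finite, linorder}) monomial"
  shows "mono_form m * mono_form m' = sg (mpar m * mpar m') *\<^sub>R (mono_form m' * mono_form m)"
proof (cases m; cases m')
  fix M N I J assume m: "m = (M, I)" "m' = (N, J)"
  consider "I \<inter> J \<noteq> {}" | "\<not> reduced (M + N)" | "I \<inter> J = {}" "reduced (M + N)" by blast
  then show ?thesis
  proof cases
    case 1
    then show ?thesis by (simp add: m mono_form_times Int_commute)
  next
    case 2
    then have "mono_form (M + N, I \<union> J) = 0" by (simp add: mono_form_not_reduced)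
    then show ?thesis by (simp add: m mono_form_times Int_commute Un_commute add.commute)
  next
    case 3
    have "even (jet_inversions M N) = even (jet_inversions N M + odd_count M * odd_count N)"
      using jet_inversions_swap[OF 3(2)] by (metis even_add)
    moreover have "even (dx_inversions I J) = even (dx_inversions J I + card I * card J)"
      using dx_inversions_swap[OF 3(1)] by (metis even_add)
    ultimately show ?thesis
      using 3 by (auto simp: m mono_form_times Int_commute Un_commute add.commute mpar_def sg_def minus_one_power_iff)
  qed
qed

lemma graded_commute:
  fixes x y :: "('a :: countable, 'd :: {finite, linorder}) lform"
  assumes "par e x" "par f y"
  shows "x * y = sg (e * f) *\<^sub>R (y * x)"
proof (rule supp_eq[where f = "\<lambda>x. x * y" and h = "\<lambda>x. sg (e * f) *\<^sub>R (y * x)", OF times_left_linear _ _ assms(1)[unfolded par_def]])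
  show "linear (\<lambda>x. sg (e * f) *\<^sub>R (y * x))" by (intro linear_compose_scale_right times_right_linear)
  fix m :: "('a, 'd) monomial" assume m: "even (mpar m) = even e"
  show "mono_form m * y = sg (e * f) *\<^sub>R (y * mono_form m)"
  proof (rule supp_eq[where f = "\<lambda>y. mono_form m * y" and h = "\<lambda>y. sg (e * f) *\<^sub>R (y * mono_form m)", OF times_right_linear _ _ assms(2)[unfolded par_def]])
    show "linear (\<lambda>y. sg (e * f) *\<^sub>R (y * mono_form m))" by (intro linear_compose_scale_right times_left_linear)
    fix m' :: "('a, 'd) monomial" assume "even (mpar m') = even f"
    then have "sg (mpar m * mpar m') = sg (e * f)" using m by (intro sg_cong) simp
    then show "mono_form m * mono_form m' = sg (e * f) *\<^sub>R (mono_form m' * mono_form m)"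
      by (simp add: mono_form_commute[of m m'])
  qed
qed

section \<open>Graded derivations\<close>

lemma mono_form_add_mset:
  "mono_form (add_mset v M, I) = sg (jet_inversions {#v#} M) *\<^sub>R (jvar v * mono_form (M, I) :: ('a :: countable, 'd :: {finite, linorder}) lform)"
  by (simp add: jvar_def mono_form_times dx_inversions_def flip: sg_of_nat power_add)

lemma jvar_times:
  "jvar v * mono_form (M, I) = sg (jet_inversions {#v#} M) *\<^sub>R (mono_form (add_mset v M, I) :: ('a :: countable, 'd :: {finite, linorder}) lform)"
  by (simp add: mono_form_add_mset)

lemma dx_times:
  "dx \<mu> * mono_form (M, I) = (if \<mu> \<in> I then 0 else
     sg (odd_count M + card {\<nu> \<in> I. \<nu> < \<mu>}) *\<^sub>R (mono_form (M, insert \<mu> I) :: ('a :: countable, 'd :: {finite, linorder}) lform))"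
proof -
  have "{(\<mu>', \<nu>). \<mu>' \<in> {\<mu>} \<and> \<nu> \<in> I \<and> \<nu> < \<mu>'} = Pair \<mu> ` {\<nu> \<in> I. \<nu> < \<mu>}" by auto
  then have "dx_inversions {\<mu>} I = card {\<nu> \<in> I. \<nu> < \<mu>}"
    by (simp add: dx_inversions_def card_image inj_on_def)
  then show ?thesis
    by (simp add: dx_def mono_form_times jet_inversions_def sg_of_nat)
qed

lemma mono_form_insert:
  "\<mu> \<notin> I \<Longrightarrow> mono_form (M, insert \<mu> I) = sg (odd_count M + card {\<nu> \<in> I. \<nu> < \<mu>}) *\<^sub>R (dx \<mu> * mono_form (M, I) :: ('a :: countable, 'd :: {finite, linorder}) lform)"
  by (simp add: dx_times)

lemma mono_form_split: "mono_form (M, I) = (mono_form (M, {}) * mono_form ({#}, I) :: ('a :: countable, 'd :: {finite, linorder}) lform)"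
  by (simp add: mono_form_times jet_inversions_def dx_inversions_def)

lemma lform_expand: "(x :: ('a :: countable, 'd :: {finite, linorder}) lform) = (\<Sum>m | coeff x m \<noteq> 0. coeff x m *\<^sub>R mono_form m)"
  using linear_expand[OF linear_id, of x] by simp

text \<open>Up to sign, every monomial arises from 1 by multiplying with \<open>dx\<close> and then
  with jet variables from the left, so the generators suffice for an induction.\<close>

lemma lform_induct [case_names one add scale jvar dx]:
  fixes x :: "('a :: countable, 'd :: {finite, linorder}) lform"
  assumes one: "P 1" and add: "\<And>x y. P x \<Longrightarrow> P y \<Longrightarrow> P (x + y)" and scale: "\<And>r x. P x \<Longrightarrow> P (r *\<^sub>R x)"
    and jvar: "\<And>v x. P x \<Longrightarrow> P (jvar v * x)" and dx: "\<And>\<mu> x. P x \<Longrightarrow> P (dx \<mu> * x)"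
  shows "P x"
proof -
  have "P (mono_form ({#}, I))" for I :: "'d set"
  proof (induction I rule: infinite_finite_induct)
    case empty
    then show ?case using one by (simp add: one_lform_def)
  next
    case (insert \<mu> I)
    then show ?case by (simp add: mono_form_insert scale dx)
  qed simp
  then have *: "P (mono_form (M, I))" for M and I :: "'d set"
    by (induction M) (auto simp: mono_form_add_mset intro: scale jvar)
  have "P (\<Sum>m\<in>A. c m *\<^sub>R mono_form m)" for A c
  proof (induction A rule: infinite_finite_induct)
    case (insert m A)
    then show ?case by (cases m) (simp add: add scale *)
  qed (use scale[OF one, of 0] in simp_all)
  then show ?thesis by (subst lform_expand)
qed

lemma is_der_linear: "is_der e Q \<Longrightarrow> linear Q"
  and is_der_times: "is_der e Q \<Longrightarrow> par f x \<Longrightarrow> Q (x * y) = Q x * y + sg (e * f) *\<^sub>R (x * Q y)"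
  and is_der_par: "is_der e Q \<Longrightarrow> par f x \<Longrightarrow> par (e + f) (Q x)"
  by (simp_all add: is_der_def)

lemmas is_der_simps = linear_0[OF is_der_linear] linear_add[OF is_der_linear] linear_diff[OF is_der_linear]
  linear_neg[OF is_der_linear] linear_scale[OF is_der_linear] linear_sum[OF is_der_linear]

lemma is_der_1: "is_der e Q \<Longrightarrow> Q 1 = 0"
  using is_der_times[OF _ par_1, where y = 1] by fastforce

lemma is_der_jvar: "is_der e Q \<Longrightarrow> Q (jvar v * y) = Q (jvar v) * y + sg (e * vpar v) *\<^sub>R (jvar v * Q y)"
  by (rule is_der_times[OF _ par_jvar]) auto

lemma is_der_dx: "is_der e Q \<Longrightarrow> Q (dx \<mu> * y) = Q (dx \<mu>) * y + sg e *\<^sub>R (dx \<mu> * Q y)"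
  using is_der_times[OF _ par_dx, of e Q 1 \<mu> y] by simp

text \<open>The Leibniz rule need only be known for a generator times an arbitrary form. Peeling off
  generators extends it to monomials, and linearity to homogeneous forms; the parity shift is
  carried through the same inductions.\<close>

lemma is_derI:
  fixes Q :: "('a :: countable, 'd :: {finite, linorder}) lform \<Rightarrow> ('a, 'd) lform"
  assumes lin: "linear Q" and one: "Q 1 = 0"
    and jv: "\<And>v y. Q (jvar v * y) = Q (jvar v) * y + sg (e * vpar v) *\<^sub>R (jvar v * Q y)"
    and dx: "\<And>\<mu> y. Q (dx \<mu> * y) = Q (dx \<mu>) * y + sg e *\<^sub>R (dx \<mu> * Q y)"
    and pj: "\<And>v. par (e + vpar v) (Q (jvar v))" and pd: "\<And>\<mu>. par (e + 1) (Q (dx \<mu>))"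
  shows "is_der e Q"
proof -
  have Qs: "Q (r *\<^sub>R x) = r *\<^sub>R Q x" for r x by (rule linear_scale[OF lin])
  have both: "Q (mono_form m * y) = Q (mono_form m) * y + sg (e * mpar m) *\<^sub>R (mono_form m * Q y) \<and>
     par (e + mpar m) (Q (mono_form m))" for m y
  proof (cases m)
    case (Pair M I)
    have "\<forall>y. Q (mono_form ({#}, I) * y) = Q (mono_form ({#}, I)) * y + sg (e * mpar (({#}, I) :: ('a, 'd) monomial)) *\<^sub>R (mono_form ({#}, I) * Q y) \<and>
     par (e + mpar (({#}, I) :: ('a, 'd) monomial)) (Q (mono_form ({#}, I)))"
    proof (induction I rule: infinite_finite_induct)
      case empty
      have "mono_form ({#}, {}) = (1 :: ('a, 'd) lform)" by (simp add: one_lform_def)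
      then show ?case by (simp add: one mpar_def)
    next
      case (insert \<mu> I)
      let ?s = "sg (odd_count ({#} :: ('a, 'd) jet multiset) + card {\<nu> \<in> I. \<nu> < \<mu>})" and ?y = "mono_form ({#}, I)"
      have m: "mono_form ({#}, insert \<mu> I) = ?s *\<^sub>R (dx \<mu> * ?y)" using insert by (subst mono_form_insert) auto
      have s: "sg (e * mpar (({#}, insert \<mu> I) :: ('a, 'd) monomial)) = sg e * sg (e * mpar (({#}, I) :: ('a, 'd) monomial))"
        using insert by (auto simp: mpar_def sg_def)
      have "par (e + mpar (({#}, insert \<mu> I) :: ('a, 'd) monomial)) (Q (dx \<mu> * ?y))"
        unfolding dx
      proof (rule par_add[OF par_cong par_scaleR[OF par_cong]])
        show "par (e + 1 + mpar (({#}, I) :: ('a, 'd) monomial)) (Q (dx \<mu>) * ?y)"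
          by (intro par_times pd par_mono_form) simp
        show "par (1 + (e + mpar (({#}, I) :: ('a, 'd) monomial))) (dx \<mu> * Q ?y)"
          using insert by (intro par_times par_dx) auto
      qed (use insert in \<open>auto simp: mpar_def\<close>)
      then have "par (e + mpar (({#}, insert \<mu> I) :: ('a, 'd) monomial)) (Q (mono_form ({#}, insert \<mu> I)))"
        unfolding m Qs by (rule par_scaleR)
      moreover have "Q (mono_form ({#}, insert \<mu> I) * y) = Q (mono_form ({#}, insert \<mu> I)) * y
          + sg (e * mpar (({#}, insert \<mu> I) :: ('a, 'd) monomial)) *\<^sub>R (mono_form ({#}, insert \<mu> I) * Q y)" for y
        using insert.IH unfolding m s by (simp add: Qs dx mult.assoc algebra_simps scaleR_right_distrib)
      ultimately show ?case by blast
    qed simp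
    then have "\<forall>y. Q (mono_form (M, I) * y) = Q (mono_form (M, I)) * y + sg (e * mpar (M, I)) *\<^sub>R (mono_form (M, I) * Q y) \<and>
     par (e + mpar (M, I)) (Q (mono_form (M, I)))"
    proof (induction M)
      case (add v M)
      let ?s = "sg (jet_inversions {#v#} M)" and ?y = "mono_form (M, I)"
      have s: "sg (e * mpar (add_mset v M, I)) = sg (e * vpar v) * sg (e * mpar (M, I))"
        using odd_vpar[of v] by (auto simp: mpar_def sg_def)
      have "par (e + mpar (add_mset v M, I)) (Q (jvar v * ?y))"
        unfolding jv
      proof (rule par_add[OF par_cong par_scaleR[OF par_cong]])
        show "par (e + vpar v + mpar (M, I)) (Q (jvar v) * ?y)"
          by (intro par_times pj par_mono_form) simp
        show "par (vpar v + (e + mpar (M, I))) (jvar v * Q ?y)"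
          using add by (intro par_times par_jvar) auto
      qed (use odd_vpar[of v] in \<open>auto simp: mpar_def\<close>)
      then have "par (e + mpar (add_mset v M, I)) (Q (mono_form (add_mset v M, I)))"
        unfolding mono_form_add_mset Qs by (rule par_scaleR)
      moreover have "Q (mono_form (add_mset v M, I) * y) = Q (mono_form (add_mset v M, I)) * y
          + sg (e * mpar (add_mset v M, I)) *\<^sub>R (mono_form (add_mset v M, I) * Q y)" for y
        using add unfolding mono_form_add_mset s by (simp add: Qs jv mult.assoc algebra_simps scaleR_right_distrib)
      ultimately show ?case by blast
    qed simp
    then show ?thesis using Pair by simp
  qed
  show ?thesis unfolding is_der_def
  proof (intro conjI allI impI lin)
    fix f and x y :: "('a, 'd) lform" assume x: "par f x"
    show "Q (x * y) = Q x * y + sg (e * f) *\<^sub>R (x * Q y)"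
    proof (rule supp_eq[where f = "\<lambda>x. Q (x * y)" and h = "\<lambda>x. Q x * y + sg (e * f) *\<^sub>R (x * Q y)", OF _ _ _ x[unfolded par_def]])
      show "linear (\<lambda>x. Q (x * y))"
        using linear_compose[OF times_left_linear lin] by (simp add: o_def)
      show "linear (\<lambda>x. Q x * y + sg (e * f) *\<^sub>R (x * Q y))"
        using linear_compose[OF lin times_left_linear]
        by (intro linear_compose_add linear_compose_scale_right times_left_linear) (simp add: o_def)
      fix m :: "('a, 'd) monomial" assume "even (mpar m) = even f"
      then have "sg (e * mpar m) = sg (e * f)" by (intro sg_cong) simp
      then show "Q (mono_form m * y) = Q (mono_form m) * y + sg (e * f) *\<^sub>R (mono_form m * Q y)"
        using both[of m y] by simp
    qed
    show "par (e + f) (Q x)"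
      unfolding par_def
    proof (rule supp_linear[OF lin _ x[unfolded par_def]])
      fix m :: "('a, 'd) monomial" assume "even (mpar m) = even f"
      then show "supp (\<lambda>m. even (mpar m) = even (e + f)) (Q (mono_form m))"
        using both[of m] by (auto simp: par_def)
    qed
  qed
qed

lemma is_der_eqI:
  assumes Q: "is_der e Q" and R: "is_der e R"
    and "\<And>v. Q (jvar v) = R (jvar v)" "\<And>\<mu>. Q (dx \<mu>) = R (dx \<mu>)"
  shows "Q x = R x"
proof (induction x rule: lform_induct)
  case one
  then show ?case by (simp add: is_der_1[OF Q] is_der_1[OF R])
next
  case (jvar v x)
  then show ?case by (simp add: is_der_jvar[OF Q] is_der_jvar[OF R] assms)
next
  case (dx \<mu> x)
  then show ?case by (simp add: is_der_dx[OF Q] is_der_dx[OF R] assms)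
qed (simp_all add: is_der_simps[OF Q] is_der_simps[OF R])

lemma is_der_cong: "is_der e Q \<Longrightarrow> even e = even f \<Longrightarrow> is_der f Q"
  unfolding is_der_def by (auto simp: sg_def par_def)

lemma is_der_zero: "is_der e (\<lambda>_. 0)"
  unfolding is_der_def by (auto simp: linear_iff)

lemma is_der_add: "is_der e Q \<Longrightarrow> is_der e R \<Longrightarrow> is_der e (\<lambda>x. Q x + R x)"
  unfolding is_der_def
  by (auto intro!: par_add linear_compose_add simp: algebra_simps scaleR_right_distrib)

lemma is_der_scaleR: "is_der e Q \<Longrightarrow> is_der e (\<lambda>x. r *\<^sub>R Q x)"
  unfolding is_der_def
  by (auto intro!: par_scaleR linear_compose_scale_right simp: scaleR_right_distrib)

lemma is_der_sum: "(\<And>i. i \<in> A \<Longrightarrow> is_der e (Q i)) \<Longrightarrow> is_der e (\<lambda>x. \<Sum>i\<in>A. Q i x)"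
  by (induction A rule: infinite_finite_induct) (auto intro: is_der_add simp: is_der_zero)

lemma is_der_times_left:
  fixes Q :: "('a :: countable, 'd :: {finite, linorder}) lform \<Rightarrow> ('a, 'd) lform"
  assumes c: "par f c" and Q: "is_der e Q"
  shows "is_der (f + e) (\<lambda>x. c * Q x)"
  unfolding is_der_def
proof (intro conjI allI impI)
  show "linear (\<lambda>x. c * Q x)"
    using linear_compose[OF is_der_linear[OF Q] times_right_linear] by (simp add: o_def)
  fix h and x y :: "('a, 'd) lform" assume x: "par h x"
  have "c * (x * Q y) = sg (f * h) *\<^sub>R (x * (c * Q y))"
    using graded_commute[OF c x] by (metis mult.assoc mult_scaleR_left)
  then show "c * Q (x * y) = c * Q x * y + sg ((f + e) * h) *\<^sub>R (x * (c * Q y))"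
    by (simp add: is_der_times[OF Q x] algebra_simps sg_add)
  show "par (f + e + h) (c * Q x)"
    using par_times[OF c is_der_par[OF Q x]] by (simp add: add.assoc)
qed

text \<open>The mixed terms, in which one operator acts on each factor, cancel because each operator
  shifts the parity seen by the other.\<close>

lemma is_der_commutator:
  fixes Q :: "('a :: countable, 'd :: {finite, linorder}) lform \<Rightarrow> ('a, 'd) lform"
  assumes Q: "is_der e Q" and R: "is_der f R"
  shows "is_der (e + f) (\<lambda>x. Q (R x) - sg (e * f) *\<^sub>R R (Q x))"
  unfolding is_der_def
proof (intro conjI allI impI)
  show "linear (\<lambda>x. Q (R x) - sg (e * f) *\<^sub>R R (Q x))"
    using linear_compose[OF is_der_linear[OF R] is_der_linear[OF Q]] linear_compose[OF is_der_linear[OF Q] is_der_linear[OF R]]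
    by (intro linear_compose_sub linear_compose_scale_right) (simp_all add: o_def)
  fix h and x y :: "('a, 'd) lform" assume x: "par h x"
  have "sg (e * (f + h)) = sg (e * f) * sg (e * h)" "sg (f * (e + h)) = sg (e * f) * sg (f * h)"
    "sg ((e + f) * h) = sg (e * h) * sg (f * h)"
    by (auto simp: sg_def)
  then show "Q (R (x * y)) - sg (e * f) *\<^sub>R R (Q (x * y)) =
    (Q (R x) - sg (e * f) *\<^sub>R R (Q x)) * y + sg ((e + f) * h) *\<^sub>R (x * (Q (R y) - sg (e * f) *\<^sub>R R (Q y)))"
    by (simp add: is_der_times[OF Q x] is_der_times[OF R x] is_der_simps[OF Q] is_der_simps[OF R]
        is_der_times[OF Q is_der_par[OF R x]] is_der_times[OF R is_der_par[OF Q x]] algebra_simps)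
  show "par (e + f + h) (Q (R x) - sg (e * f) *\<^sub>R R (Q x))"
    using is_der_par[OF Q is_der_par[OF R x]] is_der_par[OF R is_der_par[OF Q x]]
    by (intro par_diff par_scaleR) (simp_all add: algebra_simps)
qed

subsection \<open>Partial derivatives\<close>

lemma linear_pderiv_jet: "linear (pderiv_jet v)" and linear_pderiv_dx: "linear (pderiv_dx \<mu>)"
  and linear_derivation: "linear (derivation V)" and linear_hodge: "linear (hodge g)"
  unfolding pderiv_jet_def pderiv_dx_def derivation_def hodge_def by (rule linear_lin)+

lemma linear_times:
  fixes f :: "('a :: countable, 'd :: {finite, linorder}) lform \<Rightarrow> ('a, 'd) lform"
  assumes "linear f"
  shows "linear (\<lambda>x. c * f x)" "linear (\<lambda>x. f x * c)"
  using linear_compose[OF assms times_right_linear] linear_compose[OF assms times_left_linear]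
  by (simp_all add: o_def)

lemma linear_of_times:
  fixes f :: "('a :: countable, 'd :: {finite, linorder}) lform \<Rightarrow> ('a, 'd) lform"
  assumes "linear f"
  shows "linear (\<lambda>x. f (c * x))" "linear (\<lambda>x. f (x * c))"
  using linear_compose[OF times_right_linear assms] linear_compose[OF times_left_linear assms]
  by (simp_all add: o_def)

lemma linear_if_id: "linear (\<lambda>y. if b then y else 0)"
  by (cases b) (simp_all add: linear_iff)

lemma pderiv_jet_mono_form:
  "reduced M \<Longrightarrow> pderiv_jet v (mono_form (M, I)) = (if v \<notin># M then 0
     else (if odd_jet v then sg (jet_inversions {#v#} (M - {#v#})) else real (count M v))
       *\<^sub>R mono_form (M - {#v#}, I))"
  by (simp add: pderiv_jet_def lin_mono_form sg_of_nat)

lemma pderiv_dx_mono_form: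
  "reduced M \<Longrightarrow> pderiv_dx \<mu> (mono_form (M, I)) = (if \<mu> \<notin> I then 0 else
     sg (odd_count M + card {\<nu> \<in> I. \<nu> < \<mu>}) *\<^sub>R mono_form (M, I - {\<mu>}))"
  by (simp add: pderiv_dx_def lin_mono_form sg_of_nat)

lemma reduced_add_mset: "reduced (add_mset w M) \<longleftrightarrow> reduced M \<and> \<not> (odd_jet w \<and> w \<in># M)"
proof
  assume "reduced (add_mset w M)"
  then show "reduced M \<and> \<not> (odd_jet w \<and> w \<in># M)"
    using reduced_disjoint[of "{#w#}" M w] reduced_plusD[of "{#w#}" M] by auto
qed (auto simp: reduced_def not_in_iff)

lemma reduced_minus: "reduced M \<Longrightarrow> reduced (M - N)"
  unfolding reduced_def by (metis count_diff diff_le_self le_trans)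

lemma jet_inversions_single:
  "jet_inversions {#v#} {#w#} = (if odd_jet v \<and> odd_jet w \<and> to_nat w < to_nat v then 1 else 0)"
proof -
  have "{(v', w'). v' \<in># {#v#} \<and> w' \<in># {#w#} \<and> odd_jet v' \<and> odd_jet w' \<and> to_nat w' < to_nat v'}
    = (if odd_jet v \<and> odd_jet w \<and> to_nat w < to_nat v then {(v, w)} else {})" by auto
  then show ?thesis by (simp add: jet_inversions_def)
qed

text \<open>Codes of distinct variables differ, so for two odd variables exactly one of the two
  orders is an inversion.\<close>

lemma jet_inversions_single_swap:
  "v \<noteq> w \<Longrightarrow> sg (jet_inversions {#v#} {#w#}) * sg (jet_inversions {#w#} {#v#}) = sg (vpar v * vpar w)"
  using odd_vpar[of v] odd_vpar[of w] injD[OF inj_to_nat, of v w]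
  by (auto simp: jet_inversions_single sg_def)

lemma jet_inversions_even: "\<not> odd_jet v \<Longrightarrow> jet_inversions {#v#} M = 0"
  by (simp add: jet_inversions_alt)

text \<open>The canonical (anti)commutation relation between derivative and multiplication. For even
  variables it is the count of multiplicities; for odd ones the sign of moving \<open>v\<close> past
  \<open>w\<close>. If an odd \<open>w\<close> already occurs, the product vanishes, and for
  \<open>v = w\<close> the two terms on the right cancel.\<close>

lemma pderiv_jet_jvar_times:
  fixes y :: "('a :: countable, 'd :: {finite, linorder}) lform"
  shows "pderiv_jet v (jvar w * y) = (if v = w then y else 0) + sg (vpar v * vpar w) *\<^sub>R (jvar w * pderiv_jet v y)"
proof (rule linear_eq_mono[where f = "\<lambda>y. pderiv_jet v (jvar w * y)"
      and h = "\<lambda>y. (if v = w then y else 0) + sg (vpar v * vpar w) *\<^sub>R (jvar w * pderiv_jet v y)"])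
  show "linear (\<lambda>y. pderiv_jet v (jvar w * y))"
    by (rule linear_of_times[OF linear_pderiv_jet])
  show "linear (\<lambda>y. (if v = w then y else 0) + sg (vpar v * vpar w) *\<^sub>R (jvar w * pderiv_jet v y))"
    by (intro linear_compose_add linear_if_id linear_compose_scale_right linear_times linear_pderiv_jet)
  fix m :: "('a, 'd) monomial" assume "reduced (fst m)"
  then obtain M I where m: "m = (M, I)" and red: "reduced M" by (cases m) auto
  note pj = pderiv_jet_mono_form[OF red] and ps = linear_scale[OF linear_pderiv_jet]
  have sv: "odd_jet v \<Longrightarrow> sg (vpar v * vpar v) = -1" using odd_vpar[of v] by (simp add: sg_def)
  have se: "\<not> odd_jet v \<Longrightarrow> sg (vpar v * e) = 1" for e using odd_vpar[of v] by (simp add: sg_def)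
  show "pderiv_jet v (jvar w * mono_form m) = (if v = w then mono_form m else 0) + sg (vpar v * vpar w) *\<^sub>R (jvar w * pderiv_jet v (mono_form m))"
  proof (cases "reduced (add_mset w M)")
    case False
    then have w: "odd_jet w" "w \<in># M" using red by (auto simp: reduced_add_mset)
    have 0: "jvar w * mono_form m = 0"
      using False by (simp add: m jvar_times mono_form_not_reduced)
    show ?thesis
    proof (cases "v = w")
      case True
      then show ?thesis using w sv unfolding 0
        by (simp add: m pj jvar_times linear_0[OF linear_pderiv_jet])
    next
      case False
      have "\<not> reduced (add_mset w (M - {#v#}))" using w False by (auto simp: reduced_add_mset in_diff_count)
      then have "jvar w * mono_form (M - {#v#}, I) = 0"
        by (simp add: jvar_times mono_form_not_reduced)
      then show ?thesis using False unfolding 0 by (simp add: m pj linear_0[OF linear_pderiv_jet])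
    qed
  next
    case True
    note pj' = pderiv_jet_mono_form[OF True]
    consider "v = w" "odd_jet v" | "v = w" "\<not> odd_jet v" | "v \<noteq> w" "v \<notin># M" | "v \<noteq> w" "v \<in># M" "odd_jet v"
      | "v \<noteq> w" "v \<in># M" "\<not> odd_jet v" by blast
    then show ?thesis
    proof cases
      case 1
      then have "v \<notin># M" using True by (simp add: reduced_add_mset)
      then show ?thesis using 1 by (simp add: m jvar_times ps pj pj')
    next
      case 2
      then show ?thesis
        using not_in_iff[of v M] se[of "vpar v"] by (cases "v \<in># M") (simp_all add: m jvar_times ps pj pj' se jet_inversions_even algebra_simps)
    next
      case 3
      then show ?thesis by (simp add: m jvar_times ps pj pj')
    next
      case 4
      have "jet_inversions {#w#} M = jet_inversions {#w#} (M - {#v#}) + jet_inversions {#w#} {#v#}"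
        using jet_inversions_add_right[of "M - {#v#}" "{#v#}" "{#w#}"] 4 red by simp
      moreover have "add_mset w M - {#v#} = (M - {#v#}) + {#w#}" using 4 by (simp add: diff_add_mset_swap)
      moreover have "reduced ((M - {#v#}) + {#w#})"
        using reduced_minus[OF True, of "{#v#}"] calculation(2) by simp
      then have "jet_inversions {#v#} ((M - {#v#}) + {#w#}) = jet_inversions {#v#} (M - {#v#}) + jet_inversions {#v#} {#w#}"
        by (rule jet_inversions_add_right)
      ultimately show ?thesis
        using 4 jet_inversions_single_swap[OF 4(1)]
        by (simp add: m jvar_times ps pj pj' sg_add mult.assoc) (simp add: mult.left_commute mult.commute)
    next
      case 5
      have "jet_inversions {#w#} M = jet_inversions {#w#} (M - {#v#}) + jet_inversions {#w#} {#v#}"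
        using jet_inversions_add_right[of "M - {#v#}" "{#v#}" "{#w#}"] 5 red by simp
      then have "jet_inversions {#w#} M = jet_inversions {#w#} (M - {#v#})"
        using 5 by (simp add: jet_inversions_single)
      moreover have "add_mset w M - {#v#} = add_mset w (M - {#v#})" using 5 by (simp add: diff_add_mset_swap)
      ultimately show ?thesis using 5 by (simp add: m jvar_times ps pj pj' se)
    qed
  qed
qed

lemma pderiv_jet_dx_times:
  fixes y :: "('a :: countable, 'd :: {finite, linorder}) lform"
  shows "pderiv_jet v (dx \<mu> * y) = sg (vpar v) *\<^sub>R (dx \<mu> * pderiv_jet v y)"
proof (rule linear_eq_mono[where f = "\<lambda>y. pderiv_jet v (dx \<mu> * y)" and h = "\<lambda>y. sg (vpar v) *\<^sub>R (dx \<mu> * pderiv_jet v y)"])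
  show "linear (\<lambda>y. pderiv_jet v (dx \<mu> * y))" "linear (\<lambda>y. sg (vpar v) *\<^sub>R (dx \<mu> * pderiv_jet v y))"
    by (rule linear_of_times[OF linear_pderiv_jet], intro linear_compose_scale_right linear_times linear_pderiv_jet)
  fix m :: "('a, 'd) monomial" assume "reduced (fst m)"
  then obtain M I where m: "m = (M, I)" and red: "reduced M" by (cases m) auto
  show "pderiv_jet v (dx \<mu> * mono_form m) = sg (vpar v) *\<^sub>R (dx \<mu> * pderiv_jet v (mono_form m))"
  proof (cases "\<mu> \<in> I \<or> v \<notin># M")
    case True
    then show ?thesis
      by (auto simp: m dx_times linear_0[OF linear_pderiv_jet] linear_scale[OF linear_pderiv_jet] pderiv_jet_mono_form[OF red])
  next
    case False
    then have "M = add_mset v (M - {#v#})" by simp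
    then have "odd_count M = (if odd_jet v then 1 else 0) + odd_count (M - {#v#})"
      by (metis odd_count_add_mset)
    then have "sg (odd_count M + k) = sg (vpar v) * sg (odd_count (M - {#v#}) + k)" for k
      using odd_vpar[of v] by (auto simp: sg_def)
    then show ?thesis using False
      by (simp add: m dx_times linear_scale[OF linear_pderiv_jet] pderiv_jet_mono_form[OF red] mult.commute)
  qed
qed

lemma pderiv_jet_1 [simp]: "pderiv_jet v 1 = 0"
  by (simp add: one_lform_def pderiv_jet_mono_form reduced_def)

lemma pderiv_jet_jvar [simp]: "pderiv_jet v (jvar w) = (if v = w then 1 else 0 :: ('a :: countable, 'd :: {finite, linorder}) lform)"
  using pderiv_jet_jvar_times[of v w 1] by simp

lemma pderiv_jet_dx [simp]: "pderiv_jet v (dx \<mu>) = (0 :: ('a :: countable, 'd :: {finite, linorder}) lform)"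
  using pderiv_jet_dx_times[of v \<mu> 1] by simp

lemma is_der_pderiv_jet: "is_der (vpar v) (pderiv_jet v)"
  by (rule is_derI)
    (auto simp: linear_pderiv_jet pderiv_jet_jvar_times pderiv_jet_dx_times intro: par_cong[OF par_1])

lemma pderiv_dx_jvar_times:
  fixes y :: "('a :: countable, 'd :: {finite, linorder}) lform"
  shows "pderiv_dx \<nu> (jvar w * y) = sg (vpar w) *\<^sub>R (jvar w * pderiv_dx \<nu> y)"
proof (rule linear_eq_mono[where f = "\<lambda>y. pderiv_dx \<nu> (jvar w * y)" and h = "\<lambda>y. sg (vpar w) *\<^sub>R (jvar w * pderiv_dx \<nu> y)"])
  show "linear (\<lambda>y. pderiv_dx \<nu> (jvar w * y))" "linear (\<lambda>y. sg (vpar w) *\<^sub>R (jvar w * pderiv_dx \<nu> y))"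
    by (rule linear_of_times[OF linear_pderiv_dx], intro linear_compose_scale_right linear_times linear_pderiv_dx)
  fix m :: "('a, 'd) monomial" assume "reduced (fst m)"
  then obtain M I where m: "m = (M, I)" and red: "reduced M" by (cases m) auto
  have s: "sg (odd_count (add_mset w M) + k) = sg (vpar w) * sg (odd_count M + k)" for k
    using odd_vpar[of w] by (auto simp: sg_def)
  show "pderiv_dx \<nu> (jvar w * mono_form m) = sg (vpar w) *\<^sub>R (jvar w * pderiv_dx \<nu> (mono_form m))"
  proof (cases "reduced (add_mset w M)")
    case True
    then show ?thesis
      using s by (simp add: m jvar_times linear_scale[OF linear_pderiv_dx] pderiv_dx_mono_form[OF red] pderiv_dx_mono_form[OF True] mult.commute
          del: odd_count_add_mset)
  next
    case False
    then show ?thesis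
      by (simp add: m jvar_times mono_form_not_reduced pderiv_dx_mono_form[OF red] linear_0[OF linear_pderiv_dx])
  qed
qed

text \<open>The Clifford-type relation of contraction and exterior multiplication; the sign in the
  case of distinct indices comes from the one of them that precedes the other.\<close>

lemma pderiv_dx_dx_times:
  fixes y :: "('a :: countable, 'd :: {finite, linorder}) lform"
  shows "pderiv_dx \<nu> (dx \<mu> * y) = (if \<mu> = \<nu> then y else 0) - dx \<mu> * pderiv_dx \<nu> y"
proof (rule linear_eq_mono[where f = "\<lambda>y. pderiv_dx \<nu> (dx \<mu> * y)" and h = "\<lambda>y. (if \<mu> = \<nu> then y else 0) - dx \<mu> * pderiv_dx \<nu> y"])
  show "linear (\<lambda>y. pderiv_dx \<nu> (dx \<mu> * y))" "linear (\<lambda>y. (if \<mu> = \<nu> then y else 0) - dx \<mu> * pderiv_dx \<nu> y)"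
    by (rule linear_of_times[OF linear_pderiv_dx], intro linear_compose_sub linear_if_id linear_times linear_pderiv_dx)
  fix m :: "('a, 'd) monomial" assume "reduced (fst m)"
  then obtain M I where m: "m = (M, I)" and red: "reduced M" by (cases m) auto
  note simps = m dx_times linear_0[OF linear_pderiv_dx] linear_scale[OF linear_pderiv_dx] pderiv_dx_mono_form[OF red]
  consider "\<mu> = \<nu>" | "\<mu> \<noteq> \<nu>" "\<mu> \<in> I \<or> \<nu> \<notin> I" | "\<mu> \<noteq> \<nu>" "\<mu> \<notin> I" "\<nu> \<in> I" by blast
  then show "pderiv_dx \<nu> (dx \<mu> * mono_form m) = (if \<mu> = \<nu> then mono_form m else 0) - dx \<mu> * pderiv_dx \<nu> (mono_form m)"
  proof cases
    case 1
    have "{\<nu>' \<in> I. \<nu>' \<noteq> \<nu> \<and> \<nu>' < \<nu>} = {\<nu>' \<in> I. \<nu>' < \<nu>}" "{\<nu>'. (\<nu>' = \<nu> \<or> \<nu>' \<in> I) \<and> \<nu>' < \<nu>} = {\<nu>' \<in> I. \<nu>' < \<nu>}"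
      by auto
    then show ?thesis using 1 by (simp add: simps insert_absorb)
  next
    case 2
    then show ?thesis by (auto simp: simps)
  next
    case 3
    have "{\<nu>' \<in> I. \<nu>' < \<mu>} = (if \<nu> < \<mu> then {\<nu>} else {}) \<union> {\<nu>' \<in> I - {\<nu>}. \<nu>' < \<mu>}" using 3 by auto
    then have c1: "card {\<nu>' \<in> I. \<nu>' < \<mu>} = (if \<nu> < \<mu> then 1 else 0) + card {\<nu>' \<in> I - {\<nu>}. \<nu>' < \<mu>}"
      by (simp add: card_Un_disjoint)
    have "{\<nu>' \<in> insert \<mu> I. \<nu>' < \<nu>} = (if \<mu> < \<nu> then {\<mu>} else {}) \<union> {\<nu>' \<in> I. \<nu>' < \<nu>}" using 3 by auto
    then have c2: "card {\<nu>' \<in> insert \<mu> I. \<nu>' < \<nu>} = (if \<mu> < \<nu> then 1 else 0) + card {\<nu>' \<in> I. \<nu>' < \<nu>}"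
      using 3 by (simp add: card_Un_disjoint)
    have "insert \<mu> I - {\<nu>} = insert \<mu> (I - {\<nu>})" using 3 by auto
    moreover have "sg (int (odd_count M) + int (card {\<nu>' \<in> I. \<nu>' < \<mu>})) * sg (int (odd_count M) + int (card {\<nu>' \<in> insert \<mu> I. \<nu>' < \<nu>}))
      = - (sg (int (odd_count M) + int (card {\<nu>' \<in> I. \<nu>' < \<nu>})) * sg (int (odd_count M) + int (card {\<nu>' \<in> I - {\<nu>}. \<nu>' < \<mu>})))"
      unfolding c1 c2 using 3(1) by (auto simp: sg_def)
    ultimately show ?thesis using 3 by (simp add: simps)
  qed
qed

lemma pderiv_dx_1 [simp]: "pderiv_dx \<mu> 1 = 0"
  by (simp add: one_lform_def pderiv_dx_mono_form reduced_def)

lemma pderiv_dx_jvar [simp]: "pderiv_dx \<nu> (jvar w) = (0 :: ('a :: countable, 'd :: {finite, linorder}) lform)"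
  using pderiv_dx_jvar_times[of \<nu> w 1] by simp

lemma pderiv_dx_dx [simp]: "pderiv_dx \<nu> (dx \<mu>) = (if \<mu> = \<nu> then 1 else 0 :: ('a :: countable, 'd :: {finite, linorder}) lform)"
  using pderiv_dx_dx_times[of \<nu> \<mu> 1] by simp

lemma is_der_pderiv_dx: "is_der 1 (pderiv_dx \<mu>)"
  by (rule is_derI)
    (auto simp: linear_pderiv_dx pderiv_dx_jvar_times pderiv_dx_dx_times intro: par_cong[OF par_1])

subsection \<open>Derivations with given values on the jet variables\<close>

definition jets :: "('a, 'd) lform \<Rightarrow> ('a, 'd) jet set" where
  "jets x = (\<Union>m \<in> {m. coeff x m \<noteq> 0}. set_mset (fst m))"

lemma finite_jets: "finite (jets x)"
  by (simp add: jets_def finite_support)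

lemma jets_subset: "jets x \<subseteq> F \<longleftrightarrow> supp (\<lambda>m. set_mset (fst m) \<subseteq> F) x"
  by (simp add: jets_def supp_def UN_subset_iff)

lemma jets_times:
  fixes x y :: "('a :: countable, 'd :: {finite, linorder}) lform"
  shows "jets (x * y) \<subseteq> jets x \<union> jets y"
  unfolding jets_subset
  by (rule supp_times[where P = "\<lambda>m. set_mset (fst m) \<subseteq> jets x" and Q = "\<lambda>m. set_mset (fst m) \<subseteq> jets y"])
    (auto simp flip: jets_subset)

lemma pderiv_jet_not_in:
  fixes x :: "('a :: countable, 'd :: {finite, linorder}) lform"
  assumes "v \<notin> jets x"
  shows "pderiv_jet v x = 0"
proof (rule supp_eq[where f = "pderiv_jet v" and h = "\<lambda>_. 0" and P = "\<lambda>m. v \<notin># fst m"])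
  show "supp (\<lambda>m. v \<notin># fst m) x" using assms by (auto simp: supp_def jets_def)
  fix m :: "('a, 'd) monomial" assume "v \<notin># fst m"
  then show "pderiv_jet v (mono_form m) = 0"
    by (cases m) (simp add: pderiv_jet_def lin_mono_form)
qed (rule linear_pderiv_jet, rule linear_zero)

text \<open>The definition sums over the variables of each monomial separately. Over a common finite
  set the derivation becomes a fixed sum of derivations, from which the Leibniz rule is
  inherited.\<close>

lemma derivation_eq_sum:
  fixes x :: "('a :: countable, 'd :: {finite, linorder}) lform"
  assumes F: "finite F" "jets x \<subseteq> F"
  shows "derivation V x = (\<Sum>v\<in>F. V v * pderiv_jet v x)"
proof (rule supp_eq[where f = "derivation V" and h = "\<lambda>x. \<Sum>v\<in>F. V v * pderiv_jet v x", OF _ _ _ F(2)[unfolded jets_subset]])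
  show "linear (\<lambda>x. \<Sum>v\<in>F. V v * pderiv_jet v x)"
    by (intro linear_compose_sum ballI linear_times linear_pderiv_jet)
  fix m :: "('a, 'd) monomial" assume m: "set_mset (fst m) \<subseteq> F"
  show "derivation V (mono_form m) = (\<Sum>v\<in>F. V v * pderiv_jet v (mono_form m))"
  proof (cases "reduced (fst m)")
    case True
    have "pderiv_jet v (mono_form m) = 0" if "v \<notin> set_mset (fst m)" for v
      using True that by (cases m) (simp add: pderiv_jet_mono_form)
    then show ?thesis using True m F(1)
      by (simp add: derivation_def lin_mono_form) (rule sum.mono_neutral_left; simp)
  next
    case False
    then show ?thesis
      by (simp add: mono_form_not_reduced linear_0[OF linear_pderiv_jet] linear_0[OF linear_derivation])
  qed
qed (rule linear_derivation)

lemma is_der_derivation: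
  fixes V :: "('a :: countable, 'd :: {finite, linorder}) jet \<Rightarrow> ('a, 'd) lform"
  assumes "\<And>v. par (e + vpar v) (V v)"
  shows "is_der e (derivation V)"
proof -
  have D: "is_der e (\<lambda>x. \<Sum>v\<in>F. V v * pderiv_jet v x)" for F
    by (intro is_der_sum is_der_cong[OF is_der_times_left[OF assms is_der_pderiv_jet]]) simp
  show ?thesis unfolding is_der_def
  proof (intro conjI allI impI linear_derivation)
    fix f and x y :: "('a, 'd) lform" assume x: "par f x"
    let ?F = "jets x \<union> jets y"
    have F: "finite ?F" "jets x \<subseteq> ?F" "jets y \<subseteq> ?F" "jets (x * y) \<subseteq> ?F"
      using jets_times[of x y] by (auto simp: finite_jets)
    show "derivation V (x * y) = derivation V x * y + sg (e * f) *\<^sub>R (x * derivation V y)"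
      unfolding derivation_eq_sum[OF F(1) F(2)] derivation_eq_sum[OF F(1) F(3)] derivation_eq_sum[OF F(1) F(4)]
      by (rule is_der_times[OF D x])
    show "par (e + f) (derivation V x)"
      unfolding derivation_eq_sum[OF F(1) F(2)] by (rule is_der_par[OF D x])
  qed
qed

lemma derivation_jvar [simp]: "derivation V (jvar v) = V v"
proof -
  have "jets (jvar v) \<subseteq> {v}"
    by (auto simp: jets_def jvar_def mono_form.rep_eq split: if_splits)
  then show ?thesis by (subst derivation_eq_sum[of "{v}"]) simp_all
qed

lemma derivation_dx [simp]: "derivation V (dx \<mu>) = 0"
proof -
  have "jets (dx \<mu>) \<subseteq> {}"
    by (auto simp: jets_def dx_def mono_form.rep_eq split: if_splits)
  then show ?thesis by (subst derivation_eq_sum[of "{}"]) simp_all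
qed

text \<open>The graded commutator is a derivation, so it vanishes as soon as it vanishes on the
  generators.\<close>

lemma commutator_eqI:
  assumes Q: "is_der e Q" and R: "is_der f R"
    and "\<And>v. Q (R (jvar v)) = sg (e * f) *\<^sub>R R (Q (jvar v))"
    and "\<And>\<mu>. Q (R (dx \<mu>)) = sg (e * f) *\<^sub>R R (Q (dx \<mu>))"
  shows "Q (R x) = sg (e * f) *\<^sub>R R (Q x)"
  using is_der_eqI[OF is_der_commutator[OF Q R] is_der_zero, of x] assms(3,4) by simp

subsection \<open>Differential operators\<close>

lemma is_der_total_deriv: "is_der 0 (total_deriv \<mu>)"
  unfolding total_deriv_def
  by (rule is_der_derivation) (auto split: jet.split intro!: par_jvar simp: vpar_def)

lemma total_deriv_jvar [simp]: "total_deriv \<mu> (jvar (Jet \<phi> a I \<alpha>)) = jvar (Jet \<phi> a I (add_mset \<mu> \<alpha>))"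
  by (simp add: total_deriv_def)

lemma total_deriv_dx [simp]: "total_deriv \<mu> (dx \<nu>) = 0"
  by (simp add: total_deriv_def)

lemmas total_deriv_simps = is_der_simps[OF is_der_total_deriv]

lemma total_deriv_commute: "total_deriv \<mu> (total_deriv \<nu> x) = total_deriv \<nu> (total_deriv \<mu> x)"
proof -
  have "total_deriv \<mu> (total_deriv \<nu> (jvar v)) = total_deriv \<nu> (total_deriv \<mu> (jvar v))" for v
    by (cases v) (simp add: add_mset_commute)
  then show ?thesis
    using commutator_eqI[OF is_der_total_deriv is_der_total_deriv, where x = x] by (auto simp: total_deriv_simps)
qed

lemma total_derivs_empty [simp]: "total_derivs {#} x = x"
  by (simp add: total_derivs_def)

text \<open>The definition orders the multi-index; as total derivatives commute, the order is
  immaterial and induction over multisets becomes available.\<close>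

lemma total_derivs_add_mset [simp]: "total_derivs (add_mset \<mu> \<alpha>) x = total_deriv \<mu> (total_derivs \<alpha> x)"
proof -
  have "foldr total_deriv (insort \<mu> xs) x = total_deriv \<mu> (foldr total_deriv xs x)" for xs
    by (induction xs) (auto simp: total_deriv_commute)
  then show ?thesis by (simp add: total_derivs_def)
qed

lemma total_derivs_commute:
  assumes "\<And>\<mu> x. Q (total_deriv \<mu> x) = total_deriv \<mu> (Q x)"
  shows "Q (total_derivs \<alpha> x) = total_derivs \<alpha> (Q x)"
  by (induction \<alpha>) (simp_all add: assms)

lemma linear_total_derivs: "linear (total_derivs \<alpha>)"
proof (induction \<alpha>)
  case empty
  then show ?case by (simp add: linear_iff)
next
  case (add \<mu> \<alpha>)
  then show ?case
    using linear_compose[OF add is_der_linear[OF is_der_total_deriv]] by (simp add: o_def)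
qed

lemma total_derivs_jvar: "total_derivs \<alpha> (jvar (Jet \<phi> a I \<beta>)) = jvar (Jet \<phi> a I (\<alpha> + \<beta>))"
  by (induction \<alpha>) simp_all

lemma par_total_derivs: "par e x \<Longrightarrow> par e (total_derivs \<alpha> x)"
  by (induction \<alpha>) (auto dest: is_der_par[OF is_der_total_deriv])

lemma is_der_inner: "is_der 1 (inner_deriv \<xi>)"
  unfolding inner_deriv_def[abs_def] by (intro is_der_sum is_der_scaleR is_der_pderiv_dx)

lemmas inner_simps = is_der_simps[OF is_der_inner]

lemma inner_jvar [simp]:
  fixes v :: "('a :: countable, 'd :: {finite, linorder}) jet"
  shows "inner_deriv \<xi> (jvar v) = 0"
  by (simp add: inner_deriv_def)

lemma inner_dx [simp]:
  "inner_deriv \<xi> (dx \<mu>) = (\<xi> $ \<mu>) *\<^sub>R (1 :: ('a :: countable, 'd :: {finite, linorder}) lform)"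
  by (simp add: inner_deriv_def if_distrib[of "scaleR _"] cong: if_cong)

lemma inner_dx_times: "inner_deriv \<xi> (dx \<mu> * x) = (\<xi> $ \<mu>) *\<^sub>R x - dx \<mu> * inner_deriv \<xi> x"
  using is_der_dx[OF is_der_inner, of \<xi> \<mu> x] by simp

lemma eq_neg_imp_0: "x = - x \<Longrightarrow> x = 0" for x :: "'v :: real_vector"
  by (simp add: eq_neg_iff_add_eq_0 flip: scaleR_2)

lemma inner_anticommute: "inner_deriv \<xi> (inner_deriv \<eta> x) = - inner_deriv \<eta> (inner_deriv \<xi> (x :: ('a :: countable, 'd :: {finite, linorder}) lform))"
  using commutator_eqI[OF is_der_inner is_der_inner, of \<xi> \<eta> x]
  by (simp add: inner_simps is_der_1[OF is_der_inner])

lemma inner_inner [simp]: "inner_deriv \<xi> (inner_deriv \<xi> (x :: ('a :: countable, 'd :: {finite, linorder}) lform)) = 0"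
  by (rule eq_neg_imp_0, rule inner_anticommute)

lemma deg_inner:
  fixes x :: "('a :: countable, 'd :: {finite, linorder}) lform"
  shows "deg p x \<Longrightarrow> deg (p - 1) (inner_deriv \<xi> x)"
  unfolding deg_def
proof (erule supp_linear[OF is_der_linear[OF is_der_inner], rotated])
  fix m :: "('a, 'd) monomial" assume m: "card (snd m) = p"
  have "deg (p - 1) (pderiv_dx \<mu> (mono_form m))" for \<mu>
    by (cases m; cases "reduced (fst m)")
      (use m in \<open>auto simp: pderiv_dx_mono_form mono_form_not_reduced linear_0[OF linear_pderiv_dx] intro!: deg_scaleR deg_mono_form\<close>)
  then show "supp (\<lambda>m. card (snd m) = p - 1) (inner_deriv \<xi> (mono_form m))"
    unfolding inner_deriv_def deg_def[symmetric] by (intro deg_sum deg_scaleR)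
qed

lemma inner_deg_0:
  fixes x :: "('a :: countable, 'd :: {finite, linorder}) lform"
  assumes "deg 0 x"
  shows "inner_deriv \<xi> x = 0"
proof (rule supp_eq[where f = "inner_deriv \<xi>" and h = "\<lambda>_. 0", OF is_der_linear[OF is_der_inner] linear_zero _ assms[unfolded deg_def]])
  fix m :: "('a, 'd) monomial" assume "card (snd m) = 0"
  then have "pderiv_dx \<mu> (mono_form m) = 0" for \<mu>
    by (cases m; cases "reduced (fst m)")
      (auto simp: pderiv_dx_mono_form mono_form_not_reduced linear_0[OF linear_pderiv_dx])
  then show "inner_deriv \<xi> (mono_form m) = 0" by (simp add: inner_deriv_def)
qed

lemma is_der_ext_d: "is_der 1 ext_d"
  unfolding ext_d_def[abs_def]
  by (intro is_der_sum is_der_cong[OF is_der_times_left[OF par_dx[of 1] is_der_total_deriv]]) auto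

lemmas ext_d_simps = is_der_simps[OF is_der_ext_d]

lemma ext_d_dx [simp]: "ext_d (dx \<mu>) = 0"
  by (simp add: ext_d_def)

lemma dx_anticommute: "dx \<mu> * dx \<nu> = - (dx \<nu> * dx \<mu> :: ('a :: countable, 'd :: {finite, linorder}) lform)"
  using graded_commute[OF par_dx[of 1] par_dx[of 1]] by simp

lemma dx_left_anticommute: "dx \<mu> * (dx \<nu> * x) = - (dx \<nu> * (dx \<mu> * (x :: ('a :: countable, 'd :: {finite, linorder}) lform)))"
proof -
  have "dx \<mu> * (dx \<nu> * x) = (dx \<mu> * dx \<nu>) * x" by (simp only: mult.assoc)
  also have "\<dots> = - ((dx \<nu> * dx \<mu>) * x)" by (subst dx_anticommute) simp
  finally show ?thesis by (simp only: mult.assoc)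
qed

subsection \<open>Vertical and evolutionary derivations\<close>

text \<open>Sending jet variables to zero-forms and \<open>dx\<close> to 0 is what makes these
  derivations preserve the form degree and commute, up to sign, with \<open>i_\<xi>\<close> and the
  Hodge dual.\<close>

definition vert :: "int \<Rightarrow> (('a :: countable, 'd :: {finite, linorder}) lform \<Rightarrow> ('a, 'd) lform) \<Rightarrow> bool" where
  "vert e Q \<longleftrightarrow> is_der e Q \<and> (\<forall>\<mu>. Q (dx \<mu>) = 0) \<and> (\<forall>v. deg 0 (Q (jvar v)))"

lemma vert_is_der: "vert e Q \<Longrightarrow> is_der e Q" and vert_dx: "vert e Q \<Longrightarrow> Q (dx \<mu>) = 0"
  and vert_jvar: "vert e Q \<Longrightarrow> deg 0 (Q (jvar v))"
  by (simp_all add: vert_def)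

lemma vert_dx_form:
  assumes "vert e Q"
  shows "Q (mono_form ({#}, I)) = 0"
proof (induction I rule: infinite_finite_induct)
  case empty
  then show ?case using is_der_1[OF vert_is_der[OF assms]] by (simp add: one_lform_def)
next
  case (insert \<mu> I)
  then show ?case
    by (simp add: mono_form_insert is_der_simps[OF vert_is_der[OF assms]] is_der_dx[OF vert_is_der[OF assms]] vert_dx[OF assms])
qed simp

lemma vert_times_dx_form:
  fixes x :: "('a :: countable, 'd :: {finite, linorder}) lform"
  assumes "vert e Q"
  shows "Q (x * mono_form ({#}, I)) = Q x * mono_form ({#}, I)"
proof (rule linear_eq_mono[where f = "\<lambda>x. Q (x * mono_form ({#}, I))" and h = "\<lambda>x. Q x * mono_form ({#}, I)"])
  note lin = is_der_linear[OF vert_is_der[OF assms]]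
  show "linear (\<lambda>x. Q (x * mono_form ({#}, I)))" "linear (\<lambda>x. Q x * mono_form ({#}, I))"
    using linear_of_times(2)[OF lin] linear_times(2)[OF lin] by blast+
  fix m :: "('a, 'd) monomial"
  show "Q (mono_form m * mono_form ({#}, I)) = Q (mono_form m) * mono_form ({#}, I)"
    using is_der_times[OF vert_is_der[OF assms] par_mono_form[OF refl]] by (simp add: vert_dx_form[OF assms])
qed

lemma vert_deg:
  fixes x :: "('a :: countable, 'd :: {finite, linorder}) lform"
  assumes Q: "vert e Q" and x: "deg p x"
  shows "deg p (Q x)"
  unfolding deg_def
proof (rule supp_linear[OF is_der_linear[OF vert_is_der[OF Q]] _ x[unfolded deg_def]])
  fix m :: "('a, 'd) monomial" assume m: "card (snd m) = p"
  have "deg 0 (Q (mono_form (M, {})))" for M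
  proof (induction M)
    case empty
    then show ?case using vert_dx_form[OF Q] by simp
  next
    case (add v M)
    then have "deg (0 + 0) (Q (jvar v) * mono_form (M, {}))" "deg (0 + 0) (jvar v * Q (mono_form (M, {})))"
      by (intro deg_times vert_jvar[OF Q] deg_mono_form deg_jvar; simp)+
    then show ?case
      by (simp add: mono_form_add_mset is_der_simps[OF vert_is_der[OF Q]] is_der_jvar[OF vert_is_der[OF Q]] deg_scaleR deg_add)
  qed
  then have "deg (0 + p) (Q (mono_form (fst m, {})) * mono_form ({#}, snd m))"
    using m by (intro deg_times deg_mono_form) auto
  then show "supp (\<lambda>m. card (snd m) = p) (Q (mono_form m))"
    using vert_times_dx_form[OF Q, of "mono_form (fst m, {})" "snd m"] mono_form_split[of "fst m" "snd m"]
    by (simp add: deg_def)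
qed

lemma vert_inner:
  assumes Q: "vert e Q"
  shows "Q (inner_deriv \<xi> x) = sg e *\<^sub>R inner_deriv \<xi> (Q x)"
  using commutator_eqI[OF vert_is_der[OF Q] is_der_inner, of \<xi> x]
  by (simp add: vert_dx[OF Q] inner_simps is_der_simps[OF vert_is_der[OF Q]] is_der_1[OF vert_is_der[OF Q]] inner_deg_0[OF vert_jvar[OF Q]])

lemma vertI: "is_der e Q \<Longrightarrow> (\<And>\<mu>. Q (dx \<mu>) = 0) \<Longrightarrow> (\<And>v. deg 0 (Q (jvar v))) \<Longrightarrow> vert e Q"
  by (simp add: vert_def)

lemma vert_total_deriv: "vert 0 (total_deriv \<mu>)"
proof (rule vertI[OF is_der_total_deriv])
  fix v :: "('a, 'b) jet"
  show "deg 0 (total_deriv \<mu> (jvar v))" by (cases v) (simp add: deg_jvar)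
qed simp

lemma vert_pderiv_jet: "vert (vpar v) (pderiv_jet v)"
  by (rule vertI[OF is_der_pderiv_jet]) (auto simp: deg_1)

lemma total_derivs_deg: "deg p x \<Longrightarrow> deg p (total_derivs \<alpha> x)"
  by (induction \<alpha>) (auto dest: vert_deg[OF vert_total_deriv])

lemma deg_ext_d: "deg p x \<Longrightarrow> deg (p + 1) (ext_d x)"
  unfolding ext_d_def
  using deg_times[OF deg_dx vert_deg[OF vert_total_deriv]] by (auto intro!: deg_sum)

text \<open>Evolutionary derivations: commuting with total derivatives, they pass through
  \<open>d\<close> up to sign and are fixed by their values on undifferentiated jet
  variables.\<close>

definition evol :: "int \<Rightarrow> (('a :: countable, 'd :: {finite, linorder}) lform \<Rightarrow> ('a, 'd) lform) \<Rightarrow> bool" where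
  "evol e Q \<longleftrightarrow> vert e Q \<and> (\<forall>\<mu> x. Q (total_deriv \<mu> x) = total_deriv \<mu> (Q x))"

lemma evol_vert: "evol e Q \<Longrightarrow> vert e Q" and evol_is_der: "evol e Q \<Longrightarrow> is_der e Q"
  and evol_total_deriv: "evol e Q \<Longrightarrow> Q (total_deriv \<mu> x) = total_deriv \<mu> (Q x)"
  by (simp_all add: evol_def vert_def)

lemma evol_ext_d:
  assumes "evol e Q"
  shows "Q (ext_d x) = sg e *\<^sub>R ext_d (Q x)"
  unfolding ext_d_def
  by (simp add: is_der_simps[OF evol_is_der[OF assms]] is_der_dx[OF evol_is_der[OF assms]]
      vert_dx[OF evol_vert[OF assms]] evol_total_deriv[OF assms] scaleR_sum_right)

lemma evol_commutator:
  assumes Q: "evol e Q" and R: "evol f R"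
  shows "evol (e + f) (\<lambda>x. Q (R x) - sg (e * f) *\<^sub>R R (Q x))"
  unfolding evol_def
proof (intro conjI allI vertI is_der_commutator evol_is_der[OF Q] evol_is_der[OF R])
  fix \<mu> v x
  show "Q (R (dx \<mu>)) - sg (e * f) *\<^sub>R R (Q (dx \<mu>)) = 0"
    using vert_dx[OF evol_vert[OF Q]] vert_dx[OF evol_vert[OF R]]
    by (simp add: is_der_simps[OF evol_is_der[OF Q]] is_der_simps[OF evol_is_der[OF R]])
  show "deg 0 (Q (R (jvar v)) - sg (e * f) *\<^sub>R R (Q (jvar v)))"
    by (intro deg_diff deg_scaleR vert_deg[OF evol_vert[OF Q]] vert_deg[OF evol_vert[OF R]] deg_jvar)
  show "Q (R (total_deriv \<mu> x)) - sg (e * f) *\<^sub>R R (Q (total_deriv \<mu> x))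
      = total_deriv \<mu> (Q (R x) - sg (e * f) *\<^sub>R R (Q x))"
    by (simp add: evol_total_deriv[OF Q] evol_total_deriv[OF R] total_deriv_simps)
qed

lemma evol_cong: "evol e Q \<Longrightarrow> even e = even f \<Longrightarrow> evol f Q"
  unfolding evol_def vert_def using is_der_cong by blast

lemma evol_total_deriv_self: "evol 0 (total_deriv \<mu>)"
  by (simp add: evol_def vert_total_deriv total_deriv_commute)

text \<open>Total derivatives are symmetric in the two indices and \<open>dx\<close> products
  antisymmetric, so the double sum equals its own negative.\<close>

lemma ext_d_ext_d [simp]: "ext_d (ext_d x) = 0"
proof -
  have d: "ext_d (ext_d x) = (\<Sum>\<mu>\<in>UNIV. \<Sum>\<nu>\<in>UNIV. dx \<mu> * (dx \<nu> * total_deriv \<mu> (total_deriv \<nu> x)))"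
    unfolding ext_d_def by (simp add: total_deriv_simps is_der_dx[OF is_der_total_deriv] sum_distrib_left)
  also have "\<dots> = (\<Sum>\<mu>\<in>UNIV. \<Sum>\<nu>\<in>UNIV. dx \<nu> * (dx \<mu> * total_deriv \<nu> (total_deriv \<mu> x)))"
    by (rule sum.swap)
  also have "\<dots> = (\<Sum>\<mu>\<in>UNIV. \<Sum>\<nu>\<in>UNIV. - (dx \<mu> * (dx \<nu> * total_deriv \<mu> (total_deriv \<nu> x))))"
    by (intro sum.cong refl, subst total_deriv_commute, rule dx_left_anticommute)
  also have "\<dots> = - (\<Sum>\<mu>\<in>UNIV. \<Sum>\<nu>\<in>UNIV. dx \<mu> * (dx \<nu> * total_deriv \<mu> (total_deriv \<nu> x)))"
    by (simp add: sum_negf)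
  finally have "ext_d (ext_d x) = - ext_d (ext_d x)" by (simp only: d)
  then show ?thesis by (rule eq_neg_imp_0)
qed

text \<open>For a constant vector the Lie derivative is a combination of total derivatives with
  constant coefficients. Hence it is an even evolutionary derivation and commutes with all
  evolutionary operators.\<close>

lemma Lie_eq: "inner_deriv \<xi> (ext_d x) + ext_d (inner_deriv \<xi> x) = (\<Sum>\<mu>\<in>UNIV. (\<xi> $ \<mu>) *\<^sub>R total_deriv \<mu> x)"
proof -
  have "inner_deriv \<xi> (ext_d x) = (\<Sum>\<mu>\<in>UNIV. (\<xi> $ \<mu>) *\<^sub>R total_deriv \<mu> x) - ext_d (inner_deriv \<xi> x)"
    unfolding ext_d_def using vert_inner[OF vert_total_deriv, of _ \<xi> x]
    by (simp add: inner_simps inner_dx_times sum_subtractf)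
  then show ?thesis by simp
qed

lemma evol_zero: "evol e (\<lambda>_. 0)"
  by (auto simp: evol_def vert_def is_der_zero total_deriv_simps)

lemma evol_add: "evol e Q \<Longrightarrow> evol e R \<Longrightarrow> evol e (\<lambda>x. Q x + R x)"
  by (auto simp: evol_def vert_def is_der_add total_deriv_simps intro: deg_add)

lemma evol_scaleR: "evol e Q \<Longrightarrow> evol e (\<lambda>x. r *\<^sub>R Q x)"
  by (auto simp: evol_def vert_def is_der_scaleR total_deriv_simps intro: deg_scaleR)

lemma evol_sum: "(\<And>i. i \<in> A \<Longrightarrow> evol e (Q i)) \<Longrightarrow> evol e (\<lambda>x. \<Sum>i\<in>A. Q i x)"
  by (induction A rule: infinite_finite_induct) (auto intro: evol_add simp: evol_zero)

lemma evol_Lie: "evol 0 (\<lambda>x. inner_deriv \<xi> (ext_d x) + ext_d (inner_deriv \<xi> x))"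
  unfolding Lie_eq by (intro evol_sum evol_scaleR evol_total_deriv_self)

lemma evol_Lie_commute:
  assumes "evol e Q"
  shows "Q (inner_deriv \<xi> (ext_d x) + ext_d (inner_deriv \<xi> x)) = inner_deriv \<xi> (ext_d (Q x)) + ext_d (inner_deriv \<xi> (Q x))"
  unfolding Lie_eq by (simp add: is_der_simps[OF evol_is_der[OF assms]] evol_total_deriv[OF assms])

subsection \<open>Homogeneous parts\<close>

definition part :: "nat \<Rightarrow> ('a, 'd) lform \<Rightarrow> ('a, 'd) lform" where
  "part p = lin (\<lambda>m. if card (snd m) = p then mono_form m else 0)"

lemma linear_part: "linear (part p)"
  unfolding part_def by (rule linear_lin)

lemmas part_simps = linear_0[OF linear_part] linear_add[OF linear_part] linear_diff[OF linear_part]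
  linear_neg[OF linear_part] linear_scale[OF linear_part] linear_sum[OF linear_part]

lemma part_mono_form: "part p (mono_form m) = (if card (snd m) = p then mono_form m else 0)"
  by (auto simp: part_def lin_mono_form mono_form_not_reduced)

lemma deg_part: "deg p (part p x)"
  unfolding deg_def
  by (rule supp_linear[OF linear_part, where P = "\<lambda>_. True"])
    (auto simp: part_mono_form intro: supp_mono_form simp: supp_def[of "\<lambda>_. True"])

lemma par_part: "par e x \<Longrightarrow> par e (part p x)"
  unfolding par_def
  by (erule supp_linear[OF linear_part, rotated]) (auto simp: part_mono_form intro: supp_mono_form)

lemma part_deg: "deg q x \<Longrightarrow> part p x = (if p = q then x else 0)"
  by (rule supp_eq[where f = "part p" and h = "\<lambda>x. if p = q then x else 0", OF linear_part linear_if_id])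
    (auto simp: deg_def part_mono_form)

lemma sum_part:
  fixes x :: "('a :: countable, 'd :: {finite, linorder}) lform"
  shows "(\<Sum>p\<le>CARD('d). part p x) = x"
proof (rule linear_eq_mono[where f = "\<lambda>x. \<Sum>p\<le>CARD('d). part p x" and h = "\<lambda>x. x"])
  show "linear (\<lambda>x. \<Sum>p\<le>CARD('d). part p x)"
    by (intro linear_compose_sum ballI linear_part)
  fix m :: "('a, 'd) monomial"
  have "card (snd m) \<le> CARD('d)" by (rule card_mono) auto
  then show "(\<Sum>p\<le>CARD('d). part p (mono_form m)) = mono_form m"
    by (simp add: part_mono_form)
qed (simp add: linear_iff)

text \<open>Both sides are compared on each homogeneous part of \<open>x\<close>. The shift is
  upwards, so it involves no truncated subtraction; contraction is treated separately.\<close>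

lemma part_shift:
  fixes x :: "('a :: countable, 'd :: {finite, linorder}) lform"
  assumes "linear Q" "\<And>q x. deg q x \<Longrightarrow> deg (q + k) (Q x)"
  shows "part (p + k) (Q x) = Q (part p x)"
proof -
  have "part (p + k) (Q (\<Sum>q\<le>CARD('d). part q x)) = Q (part p (\<Sum>q\<le>CARD('d). part q x))"
    unfolding linear_sum[OF assms(1)] part_simps
    by (intro sum.cong refl)
      (auto simp: part_deg[OF deg_part] part_deg[OF assms(2)[OF deg_part]] linear_0[OF assms(1)] linear_sum[OF assms(1)] intro!: sum.cong)
  then show ?thesis by (simp add: sum_part)
qed

lemma part_ext_d: "part (Suc p) (ext_d x) = ext_d (part p x)"
  using part_shift[OF is_der_linear[OF is_der_ext_d] deg_ext_d, of p x] by simp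

lemma part_vert: "vert e Q \<Longrightarrow> part p (Q x) = Q (part p x)"
  using part_shift[OF is_der_linear[OF vert_is_der], of e Q 0 p x] vert_deg by auto

text \<open>Contraction lowers the degree, and on degree 0 the truncated \<open>p - 1\<close> would
  be misleading; there the contraction vanishes instead.\<close>

lemma part_inner:
  fixes x :: "('a :: countable, 'd :: {finite, linorder}) lform"
  shows "part p (inner_deriv \<xi> x) = inner_deriv \<xi> (part (Suc p) x)"
proof -
  have "part p (inner_deriv \<xi> (\<Sum>q\<le>CARD('d). part q x)) = inner_deriv \<xi> (part (Suc p) (\<Sum>q\<le>CARD('d). part q x))"
    unfolding inner_simps part_simps
  proof (intro sum.cong refl)
    fix q
    show "part p (inner_deriv \<xi> (part q x)) = inner_deriv \<xi> (part (Suc p) (part q x))"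
    proof (cases q)
      case 0
      have "inner_deriv \<xi> (part 0 x) = 0" by (rule inner_deg_0[OF deg_part])
      then show ?thesis using 0 by (simp add: part_simps inner_simps part_deg[OF deg_part])
    next
      case (Suc r)
      then show ?thesis
        using part_deg[OF deg_inner[OF deg_part[of q x]], of p \<xi>] by (simp add: inner_simps part_deg[OF deg_part])
    qed
  qed
  then show ?thesis by (simp add: sum_part)
qed

section \<open>Hodge dual\<close>

lemma deg_volume_form: "deg CARD('d) (volume_form g :: ('a :: countable, 'd :: {finite, linorder}) lform)"
  and par_volume_form: "par (int CARD('d)) (volume_form g :: ('a :: countable, 'd :: {finite, linorder}) lform)"
  unfolding volume_form_def by (auto intro!: deg_scaleR deg_mono_form par_scaleR par_mono_form simp: mpar_def)

text \<open>The sign of the chosen Hodge convention. With it, exchanging multiplication by a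
  one-form with contraction under the dual costs one factor that does not depend on the form
  degree.\<close>

definition hsign :: "'d itself \<Rightarrow> real" where
  "hsign _ = (-1) ^ (CARD('d) + 1)"

lemma hsign_sq [simp]: "hsign T * hsign T = 1" "hsign T * (hsign T * r) = r"
  by (auto simp: hsign_def minus_one_power_iff)

lemma hodge_dx_eq: "hodge_dx g I = foldr (\<lambda>\<mu> x. hsign TYPE('d) *\<^sub>R inner_deriv (matrix_inv g $ \<mu>) x)
     (sorted_list_of_set I) (volume_form g :: ('a, 'd :: {finite, linorder}) lform)"
  by (simp add: hodge_dx_def hsign_def)

text \<open>The definition contracts in increasing order of the indices. Bringing the contraction
  for \<open>\<mu>\<close> to the front moves it past those with smaller index, each at the cost of
  a sign.\<close>

lemma hodge_dx_insert:
  fixes I :: "'d :: {finite, linorder} set"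
  assumes "\<mu> \<notin> I"
  shows "hodge_dx g (insert \<mu> I) = (sg (card {\<nu> \<in> I. \<nu> < \<mu>}) * hsign TYPE('d)) *\<^sub>R
    inner_deriv (matrix_inv g $ \<mu>) (hodge_dx g I :: ('a :: countable, 'd) lform)"
proof -
  let ?f = "\<lambda>\<mu> (x :: ('a, 'd) lform). hsign TYPE('d) *\<^sub>R inner_deriv (matrix_inv g $ \<mu>) x"
  have "foldr ?f (insort \<mu> xs) v = sg (length (filter (\<lambda>\<nu>. \<nu> < \<mu>) xs)) *\<^sub>R ?f \<mu> (foldr ?f xs v)"
    if "sorted xs" "\<mu> \<notin> set xs" for xs v
    using that
  proof (induction xs)
    case (Cons \<nu> xs)
    show ?case
    proof (cases "\<mu> < \<nu>")
      case True
      then have fl: "filter (\<lambda>\<nu>. \<nu> < \<mu>) (\<nu> # xs) = []" using Cons.prems by (auto simp: filter_empty_conv)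
      then show ?thesis using True less_imp_le[OF True] unfolding fl by simp
    next
      case False
      have "inner_deriv (matrix_inv g $ \<nu>) (inner_deriv (matrix_inv g $ \<mu>) y) = - inner_deriv (matrix_inv g $ \<mu>) (inner_deriv (matrix_inv g $ \<nu>) y)"
        for y :: "('a, 'd) lform" by (rule inner_anticommute)
      then show ?thesis using False Cons
        by (auto simp: inner_simps sg_add)
    qed
  qed simp
  moreover have "length (filter (\<lambda>\<nu>. \<nu> < \<mu>) (sorted_list_of_set I)) = card {\<nu> \<in> I. \<nu> < \<mu>}"
    by (subst distinct_card[symmetric]) (auto intro: arg_cong[where f = card])
  ultimately show ?thesis using assms unfolding hodge_dx_eq
    by (simp add: sorted_list_of_set_insert)
qed

lemma inner_hodge_dx:
  fixes I :: "'d :: {finite, linorder} set"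
  assumes "\<mu> \<in> I"
  shows "inner_deriv (matrix_inv g $ \<mu>) (hodge_dx g I :: ('a :: countable, 'd) lform) = 0"
proof -
  obtain J where "I = insert \<mu> J" "\<mu> \<notin> J" using assms by (meson mk_disjoint_insert)
  then show ?thesis by (simp add: hodge_dx_insert inner_simps)
qed

lemma deg_hodge_dx: "deg (CARD('d) - card I) (hodge_dx g I :: ('a :: countable, 'd :: {finite, linorder}) lform)"
  and par_hodge_dx: "par (int CARD('d) + int (card I)) (hodge_dx g I :: ('a :: countable, 'd) lform)"
proof -
  have "deg (CARD('d) - card I) (hodge_dx g I :: ('a, 'd) lform) \<and> par (int CARD('d) + int (card I)) (hodge_dx g I :: ('a, 'd) lform)"
  proof (induction I rule: infinite_finite_induct)
    case empty
    then show ?case by (simp add: hodge_dx_eq deg_volume_form par_volume_form)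
  next
    case (insert \<mu> I)
    then show ?case
      using deg_inner[of "CARD('d) - card I" "hodge_dx g I :: ('a, 'd) lform" "matrix_inv g $ \<mu>"]
        is_der_par[OF is_der_inner, of "int CARD('d) + int (card I)" "hodge_dx g I :: ('a, 'd) lform" "matrix_inv g $ \<mu>"]
      by (auto simp: hodge_dx_insert algebra_simps intro!: deg_scaleR par_scaleR)
  qed simp
  then show "deg (CARD('d) - card I) (hodge_dx g I :: ('a, 'd) lform)" "par (int CARD('d) + int (card I)) (hodge_dx g I :: ('a, 'd) lform)"
    by blast+
qed

lemmas hodge_simps = linear_0[OF linear_hodge] linear_add[OF linear_hodge] linear_diff[OF linear_hodge]
  linear_neg[OF linear_hodge] linear_scale[OF linear_hodge] linear_sum[OF linear_hodge]

lemma hodge_mono_form: "hodge g (mono_form (M, I)) = mono_form (M, {}) * hodge_dx g I"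
  by (simp add: hodge_def lin_mono_form mono_form_not_reduced)

lemma hodge_1: "hodge g 1 = volume_form g"
  using hodge_mono_form[of g "{#}" "{}"] by (simp add: hodge_dx_eq flip: one_lform_def)

lemma hodge_deg_0_times:
  fixes x y :: "('a :: countable, 'd :: {finite, linorder}) lform"
  assumes "deg 0 x"
  shows "hodge g (x * y) = x * hodge g y"
proof (rule supp_eq[where f = "\<lambda>x. hodge g (x * y)" and h = "\<lambda>x. x * hodge g y", OF linear_of_times(2)[OF linear_hodge] times_left_linear _ assms[unfolded deg_def]])
  fix m :: "('a, 'd) monomial" assume m: "card (snd m) = 0"
  show "hodge g (mono_form m * y) = mono_form m * hodge g y"
  proof (rule linear_eq_mono[where f = "\<lambda>y. hodge g (mono_form m * y)" and h = "\<lambda>y. mono_form m * hodge g y", OF linear_of_times(1)[OF linear_hodge] linear_times(1)[OF linear_hodge]])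
    fix m' :: "('a, 'd) monomial"
    show "hodge g (mono_form m * mono_form m') = mono_form m * hodge g (mono_form m')"
      using m by (cases m; cases m') (simp add: mono_form_times hodge_mono_form hodge_simps dx_inversions_def flip: mult.assoc)
  qed
qed

lemma hodge_jvar_times: "hodge g (jvar v * x) = jvar v * hodge g x"
  by (rule hodge_deg_0_times[OF deg_jvar])

text \<open>For a new index the sign of sorting \<open>dx \<mu>\<close> into the monomial is the one
  in \<open>hodge_dx_insert\<close>; for a repeated index both sides vanish, the right one because
  the contraction is applied twice.\<close>

lemma hodge_dx_times:
  fixes x :: "('a :: countable, 'd :: {finite, linorder}) lform"
  shows "hodge g (dx \<mu> * x) = hsign TYPE('d) *\<^sub>R inner_deriv (matrix_inv g $ \<mu>) (hodge g x)"
proof (rule linear_eq_mono[where f = "\<lambda>x. hodge g (dx \<mu> * x)" and h = "\<lambda>x. hsign TYPE('d) *\<^sub>R inner_deriv (matrix_inv g $ \<mu>) (hodge g x)"])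
  show "linear (\<lambda>x. hodge g (dx \<mu> * x) :: ('a, 'd) lform)" by (rule linear_of_times(1)[OF linear_hodge])
  show "linear (\<lambda>x. hsign TYPE('d) *\<^sub>R inner_deriv (matrix_inv g $ \<mu>) (hodge g x) :: ('a, 'd) lform)"
    using linear_compose[OF linear_hodge is_der_linear[OF is_der_inner]]
    by (intro linear_compose_scale_right) (simp add: o_def)
  fix m :: "('a, 'd) monomial"
  obtain M I where m: "m = (M, I)" by (cases m)
  have "par (int (odd_count M)) (mono_form (M, {}) :: ('a, 'd) lform)" by (rule par_mono_form) (simp add: mpar_def)
  note i = is_der_times[OF is_der_inner this] inner_deg_0[OF deg_mono_form[of "(M, {})" 0]]
  show "hodge g (dx \<mu> * mono_form m) = hsign TYPE('d) *\<^sub>R inner_deriv (matrix_inv g $ \<mu>) (hodge g (mono_form m))"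
    by (cases "\<mu> \<in> I")
      (auto simp: m dx_times hodge_mono_form hodge_simps i inner_hodge_dx hodge_dx_insert sg_add mult_ac)
qed

lemma deg_hodge:
  fixes x :: "('a :: countable, 'd :: {finite, linorder}) lform"
  assumes "deg p x"
  shows "deg (CARD('d) - p) (hodge g x)"
  unfolding deg_def
proof (rule supp_linear[OF linear_hodge _ assms[unfolded deg_def]])
  fix m :: "('a, 'd) monomial" assume "card (snd m) = p"
  then show "supp (\<lambda>m. card (snd m) = CARD('d) - p) (hodge g (mono_form m))"
    using deg_times[OF deg_mono_form[OF refl] deg_hodge_dx, of "(fst m, {})" "snd m" g]
    by (cases m) (simp add: hodge_mono_form deg_def)
qed

lemma par_hodge:
  fixes x :: "('a :: countable, 'd :: {finite, linorder}) lform"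
  assumes "par e x"
  shows "par (e + int CARD('d)) (hodge g x)"
  unfolding par_def
proof (rule supp_linear[OF linear_hodge _ assms[unfolded par_def]])
  fix m :: "('a, 'd) monomial" assume m: "even (mpar m) = even e"
  obtain M I where MI: "m = (M, I)" by (cases m)
  have "par (int (odd_count M) + (int CARD('d) + int (card I))) (mono_form (M, {}) * hodge_dx g I)"
    by (intro par_times par_hodge_dx par_mono_form) (simp add: mpar_def)
  then have "par (e + int CARD('d)) (mono_form (M, {}) * hodge_dx g I)"
    by (rule par_cong) (use m in \<open>auto simp: MI mpar_def\<close>)
  then show "supp (\<lambda>m. even (mpar m) = even (e + int CARD('d))) (hodge g (mono_form m))"
    by (simp add: MI hodge_mono_form par_def)
qed

text \<open>No sign appears even for odd \<open>Q\<close>: the sign picked up at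
  \<open>dx \<mu>\<close> before dualizing is the one picked up at the contraction after
  dualizing.\<close>

lemma vert_hodge:
  assumes Q: "vert e Q"
  shows "Q (hodge g x) = hodge g (Q x)"
proof -
  note D = vert_is_der[OF Q] and s = is_der_simps[OF vert_is_der[OF Q]]
  show ?thesis
  proof (induction x rule: lform_induct)
    case one
    then show ?case by (simp add: hodge_1 is_der_1[OF D] volume_form_def s vert_dx_form[OF Q] hodge_simps)
  next
    case (jvar v x)
    then show ?case
      by (simp add: hodge_jvar_times is_der_jvar[OF D] hodge_simps hodge_deg_0_times[OF vert_jvar[OF Q]])
  next
    case (dx \<mu> x)
    then show ?case
      by (simp add: hodge_dx_times is_der_dx[OF D] vert_dx[OF Q] s hodge_simps vert_inner[OF Q] mult_ac)
  qed (simp_all add: s hodge_simps)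
qed

lemma ext_d_hodge_Lie: "inner_deriv \<xi> (ext_d (hodge g x)) + ext_d (inner_deriv \<xi> (hodge g x)) =
    hodge g (inner_deriv \<xi> (ext_d x) + ext_d (inner_deriv \<xi> x))"
  unfolding Lie_eq by (simp add: hodge_simps vert_hodge[OF vert_total_deriv])

section \<open>Multiplication by \<open>g(\<xi>)\<close> and contraction with \<open>\<xi>\<close>
  as dual operations\<close>

lemma metric_form_eq: "metric_form g \<xi> = (\<Sum>\<nu>\<in>UNIV. (\<Sum>\<mu>\<in>UNIV. g $ \<mu> $ \<nu> * \<xi> $ \<mu>) *\<^sub>R dx \<nu>)"
  unfolding metric_form_def by (subst sum.swap) (simp add: scaleR_sum_left)

lemma par_metric_form: "par 1 (metric_form g \<xi> :: ('a :: countable, 'd :: {finite, linorder}) lform)"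
  and deg_metric_form: "deg 1 (metric_form g \<xi> :: ('a :: countable, 'd :: {finite, linorder}) lform)"
  unfolding metric_form_def using deg_dx by (auto intro!: par_sum par_scaleR par_dx deg_sum deg_scaleR)

lemma vert_metric_form: "vert e Q \<Longrightarrow> Q (metric_form g \<xi>) = 0"
  by (simp add: metric_form_def is_der_simps[OF vert_is_der] vert_dx)

lemma vert_metric_form_times:
  assumes "vert e Q"
  shows "Q (metric_form g \<xi> * x) = sg e *\<^sub>R (metric_form g \<xi> * Q x)"
  using is_der_times[OF vert_is_der[OF assms] par_metric_form] by (simp add: vert_metric_form[OF assms])

lemma ext_d_metric_form_times: "ext_d (metric_form g \<xi> * x) = - (metric_form g \<xi> * ext_d (x :: ('a :: countable, 'd :: {finite, linorder}) lform))"
proof -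
  have "ext_d (metric_form g \<xi>) = (0 :: ('a, 'd) lform)" by (simp add: metric_form_def ext_d_simps)
  then show ?thesis using is_der_times[OF is_der_ext_d par_metric_form, of g \<xi> x] by simp
qed

lemma metric_form_anticommute:
  "metric_form g \<xi> * (metric_form g \<eta> * x) = - (metric_form g \<eta> * (metric_form g \<xi> * (x :: ('a :: countable, 'd :: {finite, linorder}) lform)))"
proof -
  have "metric_form g \<xi> * (metric_form g \<eta> * x) = (metric_form g \<xi> * metric_form g \<eta>) * x" by (simp only: mult.assoc)
  also have "\<dots> = - ((metric_form g \<eta> * metric_form g \<xi>) * x)"
    by (subst graded_commute[OF par_metric_form par_metric_form]) simp
  finally show ?thesis by (simp only: mult.assoc)
qed

lemma invertible_matrix_inv:
  fixes A :: "'k :: semiring_1 ^ 'n ^ 'm"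
  assumes "invertible A"
  shows "A ** matrix_inv A = mat 1" "matrix_inv A ** A = mat 1"
  using someI_ex[OF assms[unfolded invertible_def]] by (simp_all add: matrix_inv_def)

context
  fixes g :: "('d :: {finite, linorder}) matrix"
  assumes inv: "invertible g" and sym: "transpose g = g"
begin

lemma g_inv: "(\<Sum>\<nu>\<in>UNIV. matrix_inv g $ \<mu> $ \<nu> * g $ \<nu> $ \<rho>) = (if \<mu> = \<rho> then 1 else 0)"
proof -
  have "matrix_inv g ** g = mat 1" using inv by (rule invertible_matrix_inv)
  then have "(matrix_inv g ** g) $ \<mu> $ \<rho> = mat 1 $ \<mu> $ \<rho>" by simp
  then show ?thesis by (simp add: matrix_matrix_mult_def mat_def)
qed

lemma g_inv': "(\<Sum>\<nu>\<in>UNIV. g $ \<mu> $ \<nu> * matrix_inv g $ \<nu> $ \<rho>) = (if \<mu> = \<rho> then 1 else 0)"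
proof -
  have "g ** matrix_inv g = mat 1" using inv by (rule invertible_matrix_inv)
  then have "(g ** matrix_inv g) $ \<mu> $ \<rho> = mat 1 $ \<mu> $ \<rho>" by simp
  then show ?thesis by (simp add: matrix_matrix_mult_def mat_def)
qed

lemma g_sym: "g $ \<mu> $ \<nu> = g $ \<nu> $ \<mu>"
  using sym by (metis transpose_def vec_lambda_beta)

lemma inner_metric_form:
  "inner_deriv (matrix_inv g $ \<mu>) (metric_form g \<xi> * x) =
     (\<xi> $ \<mu>) *\<^sub>R x - metric_form g \<xi> * inner_deriv (matrix_inv g $ \<mu>) (x :: ('a :: countable, 'd) lform)"
proof -
  have "(\<Sum>\<rho>\<in>UNIV. \<Sum>\<nu>\<in>UNIV. g $ \<rho> $ \<nu> * \<xi> $ \<rho> * matrix_inv g $ \<mu> $ \<nu>)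
      = (\<Sum>\<rho>\<in>UNIV. \<xi> $ \<rho> * (\<Sum>\<nu>\<in>UNIV. matrix_inv g $ \<mu> $ \<nu> * g $ \<nu> $ \<rho>))"
    unfolding sum_distrib_left by (intro sum.cong refl) (subst g_sym, simp)
  also have "\<dots> = \<xi> $ \<mu>"
    unfolding g_inv by (simp add: if_distrib[of "(*) _"] cong: if_cong)
  finally have "inner_deriv (matrix_inv g $ \<mu>) (metric_form g \<xi> :: ('a, 'd) lform) = (\<xi> $ \<mu>) *\<^sub>R 1"
    by (simp add: metric_form_def inner_simps flip: scaleR_sum_left)
  then show ?thesis
    using is_der_times[OF is_der_inner par_metric_form, of "matrix_inv g $ \<mu>" g \<xi> x] by simp
qed

text \<open>The one-form \<open>g(\<xi>)\<close> has components with lowered index, each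
  \<open>dx\<close> becomes a contraction with raised index, and the two matrices cancel.\<close>

lemma hodge_metric_form_times:
  "hodge g (metric_form g \<xi> * x) = hsign TYPE('d) *\<^sub>R inner_deriv \<xi> (hodge g (x :: ('a :: countable, 'd) lform))"
proof -
  define c where "c \<nu> = (\<Sum>\<mu>\<in>UNIV. g $ \<mu> $ \<nu> * \<xi> $ \<mu>)" for \<nu>
  have c: "(\<Sum>\<nu>\<in>UNIV. c \<nu> * matrix_inv g $ \<nu> $ \<rho>) = \<xi> $ \<rho>" for \<rho>
  proof -
    have "(\<Sum>\<nu>\<in>UNIV. c \<nu> * matrix_inv g $ \<nu> $ \<rho>)
       = (\<Sum>\<nu>\<in>UNIV. \<Sum>\<mu>\<in>UNIV. \<xi> $ \<mu> * (g $ \<mu> $ \<nu> * matrix_inv g $ \<nu> $ \<rho>))"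
      unfolding c_def sum_distrib_right by (simp add: mult_ac)
    also have "\<dots> = (\<Sum>\<mu>\<in>UNIV. \<xi> $ \<mu> * (\<Sum>\<nu>\<in>UNIV. g $ \<mu> $ \<nu> * matrix_inv g $ \<nu> $ \<rho>))"
      by (subst sum.swap) (simp add: sum_distrib_left)
    finally show ?thesis by (simp add: g_inv' if_distrib[of "(*) _"] cong: if_cong)
  qed
  have "(\<Sum>\<nu>\<in>UNIV. c \<nu> *\<^sub>R inner_deriv (matrix_inv g $ \<nu>) y) = (\<Sum>\<rho>\<in>UNIV. \<Sum>\<nu>\<in>UNIV. (c \<nu> * matrix_inv g $ \<nu> $ \<rho>) *\<^sub>R pderiv_dx \<rho> y)"
    for y :: "('a, 'd) lform"
    unfolding inner_deriv_def by (subst sum.swap) (simp add: scaleR_sum_right)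
  then have "(\<Sum>\<nu>\<in>UNIV. c \<nu> *\<^sub>R inner_deriv (matrix_inv g $ \<nu>) y) = inner_deriv \<xi> y" for y :: "('a, 'd) lform"
    by (simp add: inner_deriv_def c flip: scaleR_sum_left)
  moreover have "hodge g (metric_form g \<xi> * x) = hsign TYPE('d) *\<^sub>R (\<Sum>\<nu>\<in>UNIV. c \<nu> *\<^sub>R inner_deriv (matrix_inv g $ \<nu>) (hodge g x))"
    unfolding metric_form_eq c_def[symmetric]
    by (simp add: sum_distrib_right hodge_simps hodge_dx_times scaleR_sum_right mult.commute)
  ultimately show ?thesis by simp
qed

text \<open>Induction over generators. On 1 both sides vanish, \<open>g(\<xi>)\<close> times the
  volume form having too large a degree; at \<open>dx \<mu>\<close> the identity is the relation
  between multiplication by \<open>g(\<xi>)\<close> and contraction.\<close>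

lemma hodge_inner:
  "hodge g (inner_deriv \<xi> x) = hsign TYPE('d) *\<^sub>R (metric_form g \<xi> * hodge g (x :: ('a :: countable, 'd) lform))"
proof (induction x rule: lform_induct)
  case one
  have "deg (1 + CARD('d)) (metric_form g \<xi> * volume_form g :: ('a, 'd) lform)"
    by (intro deg_times deg_metric_form deg_volume_form)
  then have "metric_form g \<xi> * volume_form g = (0 :: ('a, 'd) lform)" by (rule deg_too_big) simp
  then show ?case by (simp add: is_der_1[OF is_der_inner] hodge_1 hodge_simps)
next
  case (jvar v x)
  have "jvar v * (metric_form g \<xi> * y) = sg (vpar v) *\<^sub>R (metric_form g \<xi> * (jvar v * y))" for y :: "('a, 'd) lform"
    using graded_commute[OF par_jvar[OF refl] par_metric_form, of v g \<xi>] by (simp flip: mult.assoc)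
  then show ?case using jvar
    by (simp add: is_der_jvar[OF is_der_inner] hodge_simps hodge_jvar_times mult_ac)
next
  case (dx \<mu> x)
  have "hodge g (inner_deriv \<xi> (dx \<mu> * x)) = (\<xi> $ \<mu>) *\<^sub>R hodge g x
      - inner_deriv (matrix_inv g $ \<mu>) (metric_form g \<xi> * hodge g x)"
    by (simp add: inner_dx_times hodge_simps hodge_dx_times dx inner_simps)
  also have "\<dots> = metric_form g \<xi> * inner_deriv (matrix_inv g $ \<mu>) (hodge g x)"
    by (simp add: inner_metric_form)
  finally show ?case by (simp add: hodge_dx_times)
qed (simp_all add: inner_simps hodge_simps algebra_simps)

text \<open>Each \<open>dx \<mu>\<close> is the one-form of the vector given by row
  \<open>\<mu>\<close> of the inverse metric, so identities for \<open>g(\<xi>)\<close> apply to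
  single generators.\<close>

lemma dx_eq_metric_form: "dx \<mu> = (metric_form g (matrix_inv g $ \<mu>) :: ('a :: countable, 'd) lform)"
proof -
  have "(\<Sum>\<rho>\<in>UNIV. g $ \<rho> $ \<nu> * matrix_inv g $ \<mu> $ \<rho>) = (if \<mu> = \<nu> then 1 else 0)" for \<nu>
    using g_inv[of \<mu> \<nu>] by (simp add: mult.commute)
  then show ?thesis
    by (simp add: metric_form_eq if_distrib[of "\<lambda>r. r *\<^sub>R _"] cong: if_cong)
qed

text \<open>The product \<open>x * hodge g y\<close> exceeds the top degree and is 0; contracting it
  with \<open>\<xi>\<close> moves the contraction from one factor to the other.\<close>

lemma times_hodge_metric_form:
  fixes x y :: "('a :: countable, 'd) lform"
  assumes "par e x" "deg (Suc p) x" "deg p y"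
  shows "x * hodge g (metric_form g \<xi> * y) = - (sg e * hsign TYPE('d)) *\<^sub>R (inner_deriv \<xi> x * hodge g y)"
proof (cases "p \<le> CARD('d)")
  case True
  have "deg (Suc p + (CARD('d) - p)) (x * hodge g y)"
    by (intro deg_times deg_hodge assms)
  then have "x * hodge g y = 0" using True by (intro deg_too_big) auto
  then have "inner_deriv \<xi> x * hodge g y + sg e *\<^sub>R (x * inner_deriv \<xi> (hodge g y)) = 0"
    using is_der_times[OF is_der_inner assms(1), of \<xi> "hodge g y"] by (simp add: inner_simps)
  then have "sg e *\<^sub>R (inner_deriv \<xi> x * hodge g y + sg e *\<^sub>R (x * inner_deriv \<xi> (hodge g y))) = 0" by simp
  then have "x * inner_deriv \<xi> (hodge g y) = - (sg e *\<^sub>R (inner_deriv \<xi> x * hodge g y))"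
    by (simp add: scaleR_right_distrib eq_neg_iff_add_eq_0 add.commute)
  then show ?thesis by (simp add: hodge_metric_form_times mult.commute)
next
  case False
  then have "x = 0" "y = 0" using deg_too_big[OF assms(2)] deg_too_big[OF assms(3)] by auto
  then show ?thesis by (simp add: hodge_simps)
qed

lemma times_hodge_inner:
  fixes x y :: "('a :: countable, 'd) lform"
  assumes "par e x"
  shows "x * hodge g (inner_deriv \<xi> y) = (sg e * hsign TYPE('d)) *\<^sub>R (metric_form g \<xi> * x * hodge g y)"
  using graded_commute[OF assms par_metric_form, of g \<xi>]
  by (simp add: hodge_inner mult.commute flip: mult.assoc)

text \<open>Induction on the degree: one \<open>dx\<close> is split off \<open>x\<close> and reaches
  \<open>y\<close> as a contraction, the induction hypothesis exchanges the remaining factors, and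
  \<open>times_hodge_metric_form\<close> brings the \<open>dx\<close> back.\<close>

lemma hodge_symmetric:
  fixes x y :: "('a :: countable, 'd) lform"
  assumes "par e x" "par f y" "deg p x" "deg p y"
  shows "x * hodge g y = sg (e * f + int p) *\<^sub>R (y * hodge g x)"
  using assms
proof (induction p arbitrary: e f x y)
  case 0
  have "x * hodge g y = (x * y) * volume_form g" "y * hodge g x = (y * x) * volume_form g"
    using hodge_deg_0_times[OF 0(4), of g 1] hodge_deg_0_times[OF 0(3), of g 1] by (simp_all add: hodge_1 mult.assoc)
  then show ?case using graded_commute[OF 0(1,2)] by simp
next
  case (Suc p)
  have "supp (\<lambda>m. even (mpar m) = even e \<and> card (snd m) = Suc p) x"
    using Suc.prems(1,3) by (auto simp: par_def deg_def supp_def)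
  then show ?case
  proof (rule supp_eq[where f = "\<lambda>x. x * hodge g y" and h = "\<lambda>x. sg (e * f + int (Suc p)) *\<^sub>R (y * hodge g x)", OF times_left_linear, rotated 2])
    show "linear (\<lambda>x. sg (e * f + int (Suc p)) *\<^sub>R (y * hodge g x))"
      by (intro linear_compose_scale_right linear_times linear_hodge)
    fix m :: "('a, 'd) monomial" assume m: "even (mpar m) = even e \<and> card (snd m) = Suc p"
    obtain M J where mJ: "m = (M, J)" by (cases m)
    then obtain \<mu> I where J: "J = insert \<mu> I" "\<mu> \<notin> I" "card I = p"
      using m by (auto simp: card_Suc_eq)
    let ?z = "mono_form (M, I) :: ('a, 'd) lform" and ?s = "sg (odd_count M + card {\<nu> \<in> I. \<nu> < \<mu>})" and ?h = "hsign TYPE('d)"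
    let ?i = "inner_deriv (matrix_inv g $ \<mu>)"
    have mz: "mono_form m = ?s *\<^sub>R (dx \<mu> * ?z)" using J by (simp add: mJ mono_form_insert)
    have z: "par (e - 1) ?z" "deg p ?z"
      using m J by (auto simp: mJ mpar_def intro!: par_mono_form deg_mono_form)
    have "dx \<mu> * ?z * hodge g y = sg (e - 1) *\<^sub>R (?z * (dx \<mu> * hodge g y))"
      using graded_commute[OF par_dx[of 1] z(1), of \<mu>] by (simp add: mult.assoc)
    also have "\<dots> = (sg (e - 1) * ?h) *\<^sub>R (?z * hodge g (?i y))"
      by (simp add: hodge_inner dx_eq_metric_form)
    also have "\<dots> = (sg (e - 1) * ?h * sg ((e - 1) * (1 + f) + int p)) *\<^sub>R (?i y * hodge g ?z)"
      using deg_inner[OF Suc.prems(4)] by (subst Suc.IH[OF z(1) is_der_par[OF is_der_inner Suc.prems(2)] z(2)]) auto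
    also have "sg (e - 1) * ?h * sg ((e - 1) * (1 + f) + int p) = sg (e * f + int (Suc p)) * (- (sg f * ?h))"
      by (auto simp: sg_def)
    also have "(sg (e * f + int (Suc p)) * (- (sg f * ?h))) *\<^sub>R (?i y * hodge g ?z) = sg (e * f + int (Suc p)) *\<^sub>R (y * hodge g (dx \<mu> * ?z))"
      unfolding dx_eq_metric_form using times_hodge_metric_form[OF Suc.prems(2,4) z(2)] by simp
    finally show "mono_form m * hodge g y = sg (e * f + int (Suc p)) *\<^sub>R (y * hodge g (mono_form m))"
      unfolding mz by (simp add: hodge_simps mult_ac)
  qed
qed

lemma supp_singleton: "supp (\<lambda>m'. m' = m) x \<Longrightarrow> x = coeff x m *\<^sub>R mono_form m"
  unfolding coeff_inject[symmetric] fun_eq_iff scaleR_lform.rep_eq mono_form.rep_eq supp_def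
  using coeff_reduced[of x m] by auto

text \<open>In the double dual a \<open>dx\<close> becomes a contraction and then a
  \<open>dx\<close> again, with the two factors \<open>hsign\<close> cancelling. The constant is
  therefore the same in every form degree; its value is irrelevant for the exactness argument it
  serves.\<close>

lemma hodge_hodge: "\<exists>\<kappa>. \<forall>x :: ('a :: countable, 'd) lform. hodge g (hodge g x) = \<kappa> *\<^sub>R x"
proof -
  have "\<exists>c. hodge_dx g UNIV = (c *\<^sub>R 1 :: ('a, 'd) lform)"
  proof -
    have 1: "supp (\<lambda>m. fst m = {#}) (hodge_dx g I :: ('a, 'd) lform)" for I
    proof (induction I rule: infinite_finite_induct)
      case empty
      then show ?case by (auto simp: hodge_dx_eq volume_form_def intro!: supp_scaleR supp_mono_form)
    next
      case (insert \<mu> I)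
      have "supp (\<lambda>m. fst m = {#}) (inner_deriv \<zeta> (hodge_dx g I :: ('a, 'd) lform))" for \<zeta>
      proof (rule supp_linear[OF is_der_linear[OF is_der_inner] _ insert.IH])
        fix m :: "('a, 'd) monomial" assume "fst m = {#}"
        then show "supp (\<lambda>m. fst m = {#}) (inner_deriv \<zeta> (mono_form m))"
          by (cases m) (auto simp: inner_deriv_def pderiv_dx_mono_form reduced_def intro!: supp_sum supp_scaleR supp_mono_form)
      qed
      then show ?case using insert by (simp add: hodge_dx_insert supp_scaleR)
    qed simp
    \<comment> \<open>There are no jet variables, and contracting the volume form with every index
      leaves degree 0, so only the unit monomial can occur.\<close>
    have "supp (\<lambda>m. m = ({#}, {})) (hodge_dx g UNIV :: ('a, 'd) lform)"
      using 1[of UNIV] deg_hodge_dx[of UNIV g, where 'a = 'a] by (auto simp: supp_def deg_def)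
    then show ?thesis using supp_singleton unfolding one_lform_def by blast
  qed
  then obtain c where c: "hodge_dx g UNIV = (c *\<^sub>R 1 :: ('a, 'd) lform)" by blast
  have "hodge g (hodge g x) = (sqrt \<bar>det g\<bar> * c) *\<^sub>R x" for x :: "('a, 'd) lform"
  proof (induction x rule: lform_induct)
    case one
    then show ?case by (simp add: hodge_1 volume_form_def hodge_simps hodge_mono_form c flip: one_lform_def)
  next
    case (dx \<mu> x)
    then show ?case by (simp add: hodge_dx_times hodge_simps hodge_inner flip: dx_eq_metric_form)
  qed (simp_all add: hodge_simps hodge_jvar_times algebra_simps)
  then show ?thesis by blast
qed

end

section \<open>Field operators\<close>

lemma linear_component: "linear (\<lambda>x. component x I)"
  unfolding component_def by (rule linear_lin)

lemma component_mono_form: "component (mono_form (M, J)) I = (if J = I then mono_form (M, {}) else 0)"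
  by (auto simp: component_def lin_mono_form mono_form_not_reduced)

lemma deg_component: "deg 0 (component x I)"
  unfolding deg_def
proof (rule supp_linear[OF linear_component, where P = "\<lambda>_. True"])
  fix m :: "('a, 'b) monomial"
  show "supp (\<lambda>m. card (snd m) = 0) (component (mono_form m) I)"
    by (cases m) (auto simp: component_mono_form intro!: supp_mono_form)
qed (simp add: supp_def)

lemma par_component:
  assumes "par e x"
  shows "par (e + int (card I)) (component x I)"
  unfolding par_def
proof (rule supp_linear[OF linear_component _ assms[unfolded par_def]])
  fix m :: "('a, 'b) monomial" assume "even (mpar m) = even e"
  then show "supp (\<lambda>m. even (mpar m) = even (e + int (card I))) (component (mono_form m) I)"
    by (cases m) (auto simp: component_mono_form mpar_def intro!: supp_mono_form)
qed

lemma component_deg_0_times: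
  fixes y :: "('a :: countable, 'd :: {finite, linorder}) lform"
  assumes "deg 0 y"
  shows "component (y * mono_form ({#}, J)) I = (if J = I then y else 0)"
proof (rule supp_eq[where f = "\<lambda>y. component (y * mono_form ({#}, J)) I" and h = "\<lambda>y. if J = I then y else 0", OF _ _ _ assms[unfolded deg_def]])
  show "linear (\<lambda>y. component (y * mono_form ({#}, J)) I)"
    using linear_compose[OF times_left_linear linear_component] by (simp add: o_def)
  fix m :: "('a, 'd) monomial" assume "card (snd m) = 0"
  then show "component (mono_form m * mono_form ({#}, J)) I = (if J = I then mono_form m else 0)"
    by (cases m) (auto simp: component_mono_form simp flip: mono_form_split)
qed (rule linear_if_id)

lemma sum_component:
  fixes x :: "('a :: countable, 'd :: {finite, linorder}) lform"
  assumes "deg p x"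
  shows "(\<Sum>I | card I = p. component x I * mono_form ({#}, I)) = x"
proof (rule supp_eq[where f = "\<lambda>x. \<Sum>I | card I = p. component x I * mono_form ({#}, I)" and h = "\<lambda>x. x", OF _ _ _ assms[unfolded deg_def]])
  show "linear (\<lambda>x. \<Sum>I | card I = p. component x I * mono_form ({#}, I))"
    by (intro linear_compose_sum ballI linear_times linear_component)
  fix m :: "('a, 'd) monomial" assume m: "card (snd m) = p"
  obtain M J where MJ: "m = (M, J)" by (cases m)
  have "(\<Sum>I | card I = p. component (mono_form m) I * mono_form ({#}, I)) = (\<Sum>I\<in>{J}. component (mono_form m) I * mono_form ({#}, I))"
    using m by (intro sum.mono_neutral_right) (auto simp: MJ component_mono_form)
  then show "(\<Sum>I | card I = p. component (mono_form m) I * mono_form ({#}, I)) = mono_form m"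
    by (simp add: MJ component_mono_form flip: mono_form_split)
qed (simp add: linear_iff)

definition gmap :: "(('a :: finite, 'd) lform \<Rightarrow> ('a, 'd) lform) \<Rightarrow> ('a, 'd) gform \<Rightarrow> ('a, 'd) gform" where
  "gmap Q X = (\<chi> a. Q (X $ a))"

definition gpar :: "int \<Rightarrow> ('a :: finite, 'd) gform \<Rightarrow> bool" where
  "gpar e X \<longleftrightarrow> (\<forall>a. par e (X $ a))"

definition gdeg :: "nat \<Rightarrow> ('a :: finite, 'd) gform \<Rightarrow> bool" where
  "gdeg p X \<longleftrightarrow> (\<forall>a. deg p (X $ a))"

lemma gmap_nth [simp]: "gmap Q X $ a = Q (X $ a)"
  by (simp add: gmap_def)

definition fpar :: "nat \<Rightarrow> field \<Rightarrow> int" where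
  "fpar n \<phi> = ghost_number \<phi> + int (form_degree n \<phi>)"

lemma gpar_field_form: "gpar (fpar n \<phi>) (field_form n \<phi>)"
  and gdeg_field_form: "gdeg (form_degree n \<phi>) (field_form n \<phi>)"
proof -
  show "gpar (fpar n \<phi>) (field_form n \<phi>)"
    by (auto simp: gpar_def field_form_def fpar_def mpar_def odd_jet_def intro!: par_sum par_mono_form split: if_splits)
  show "gdeg (form_degree n \<phi>) (field_form n \<phi>)"
    by (auto simp: gdeg_def field_form_def intro!: deg_sum deg_mono_form)
qed

lemma field_form_nth:
  "\<phi> \<in> fields n \<Longrightarrow> field_form n \<phi> $ a = (\<Sum>I | card I = form_degree n \<phi>.
     jvar (Jet \<phi> a I {#}) * mono_form ({#}, I) :: ('a :: finite, 'd :: {finite, linorder}) lform)"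
  unfolding field_form_def jvar_def by (simp flip: mono_form_split)

lemma vert_field_form:
  assumes "vert e Q" "\<phi> \<in> fields n"
  shows "Q (field_form n \<phi> $ a) = (\<Sum>I | card I = form_degree n \<phi>. Q (jvar (Jet \<phi> a I {#})) * mono_form ({#}, I))"
  by (simp add: field_form_nth[OF assms(2)] is_der_simps[OF vert_is_der[OF assms(1)]] vert_times_dx_form[OF assms(1)])

text \<open>The condition under which a table of variations defines an evolutionary derivation of
  parity \<open>e\<close>: each variation has the form degree of its field and a parity shifted by
  \<open>e\<close>.\<close>

definition homogeneous :: "nat \<Rightarrow> int \<Rightarrow> (field \<Rightarrow> ('a :: finite, 'd) gform) \<Rightarrow> bool" where
  "homogeneous n e \<delta> \<longleftrightarrow> (\<forall>\<phi>\<in>fields n. gpar (e + fpar n \<phi>) (\<delta> \<phi>) \<and> gdeg (form_degree n \<phi>) (\<delta> \<phi>))"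

lemma evol_field_operator:
  fixes \<delta> :: "field \<Rightarrow> ('a :: finite, 'd :: {finite, linorder}) gform"
  assumes "homogeneous n e \<delta>"
  shows "evol e (field_operator n \<delta>)"
proof -
  define V :: "('a, 'd) jet \<Rightarrow> ('a, 'd) lform" where "V v = (case v of Jet \<phi> a I \<alpha> \<Rightarrow>
     if \<phi> \<in> fields n \<and> card I = form_degree n \<phi>
     then total_derivs \<alpha> (component (\<delta> \<phi> $ a) I) else 0)" for v
  have op: "field_operator n \<delta> = derivation V" by (simp add: field_operator_def V_def[abs_def])
  have "par (e + vpar v) (V v)" for v
  proof (cases v)
    case (Jet \<phi> a I \<alpha>)
    show ?thesis
    proof (cases "\<phi> \<in> fields n \<and> card I = form_degree n \<phi>")
      case True
      \<comment> \<open>The form degree enters twice, in \<open>fpar\<close> and as the size of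
        \<open>I\<close>; modulo 2 only the ghost number remains, which is the parity of the jet
        variable.\<close>
      then have "par (e + fpar n \<phi> + card I) (component (\<delta> \<phi> $ a) I)"
        using assms by (intro par_component) (auto simp: homogeneous_def gpar_def)
      then show ?thesis using True
        by (auto simp: V_def Jet vpar_def fpar_def elim!: par_cong intro!: par_total_derivs)
    qed (auto simp: V_def Jet)
  qed
  then have D: "is_der e (derivation V)" by (rule is_der_derivation)
  have "deg 0 (V v)" for v by (cases v) (auto simp: V_def intro: total_derivs_deg deg_component)
  moreover have "derivation V (total_deriv \<mu> (jvar v)) = total_deriv \<mu> (derivation V (jvar v))" for \<mu> v
    by (cases v) (simp add: V_def total_deriv_simps)
  then have "derivation V (total_deriv \<mu> x) = total_deriv \<mu> (derivation V x)" for \<mu> x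
    using commutator_eqI[OF D is_der_total_deriv, of \<mu> x] by (simp add: is_der_simps[OF D] total_deriv_simps)
  ultimately show ?thesis
    unfolding op evol_def by (auto intro: vertI D)
qed

lemma field_operator_field_form:
  fixes \<delta> :: "field \<Rightarrow> ('a :: finite, 'd :: {finite, linorder}) gform"
  assumes "homogeneous n e \<delta>" "\<phi> \<in> fields n"
  shows "gmap (field_operator n \<delta>) (field_form n \<phi>) = \<delta> \<phi>"
proof -
  have "field_operator n \<delta> (field_form n \<phi> $ a) = \<delta> \<phi> $ a" for a
  proof -
    have "field_operator n \<delta> (jvar (Jet \<phi> a I {#})) = component (\<delta> \<phi> $ a) I" if "card I = form_degree n \<phi>" for I
      using that assms(2) by (simp add: field_operator_def)
    then have "field_operator n \<delta> (field_form n \<phi> $ a) = (\<Sum>I | card I = form_degree n \<phi>. component (\<delta> \<phi> $ a) I * mono_form ({#}, I))"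
      by (simp add: vert_field_form[OF evol_vert[OF evol_field_operator[OF assms(1)]] assms(2)])
    also have "\<dots> = \<delta> \<phi> $ a"
      using assms by (intro sum_component) (auto simp: homogeneous_def gdeg_def)
    finally show ?thesis .
  qed
  then show ?thesis by (simp add: vec_eq_iff)
qed

definition field_jet :: "nat \<Rightarrow> ('a, 'd) jet \<Rightarrow> bool" where
  "field_jet n v \<longleftrightarrow> jet_field v \<in> fields n \<and> card (jet_comp v) = form_degree n (jet_field v)"

lemma field_operator_not_field_jet: "\<not> field_jet n v \<Longrightarrow> field_operator n \<delta> (jvar v) = 0"
  by (cases v) (auto simp: field_operator_def field_jet_def)

lemma evol_jvar:
  assumes "evol e Q"
  shows "Q (jvar (Jet \<phi> a I \<alpha>)) = total_derivs \<alpha> (Q (jvar (Jet \<phi> a I {#})))"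
  using total_derivs_commute[of Q \<alpha> "jvar (Jet \<phi> a I {#})", OF evol_total_deriv[OF assms]]
  by (simp add: total_derivs_jvar)

text \<open>The value on a jet variable is a total derivative of the value on the undifferentiated
  one, which in turn is a component of the value on the field form. Jet variables belonging to no
  component of a field are not reached in this way and are covered by
  \<open>not_field\<close>.\<close>

lemma evol_eqI:
  fixes Q R :: "('a :: finite, 'd :: {finite, linorder}) lform \<Rightarrow> ('a, 'd) lform"
  assumes Q: "evol e Q" and R: "evol e R"
    and not_field: "\<And>v. \<not> field_jet n v \<Longrightarrow> Q (jvar v) = R (jvar v)"
    and eq: "\<And>\<phi>. \<phi> \<in> fields n \<Longrightarrow> gmap Q (field_form n \<phi>) = gmap R (field_form n \<phi>)"
  shows "Q = R"
proof
  have comp: "P (jvar (Jet \<phi> a I {#})) = component (P (field_form n \<phi> $ a)) I"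
    if P: "evol e P" and "\<phi> \<in> fields n" "card I = form_degree n \<phi>" for P :: "('a, 'd) lform \<Rightarrow> ('a, 'd) lform" and \<phi> a I
  proof -
    have "component (P (field_form n \<phi> $ a)) I = (\<Sum>J | card J = form_degree n \<phi>. if J = I then P (jvar (Jet \<phi> a J {#})) else 0)"
      by (simp add: vert_field_form[OF evol_vert[OF P] that(2)] linear_sum[OF linear_component]
          component_deg_0_times vert_jvar[OF evol_vert[OF P]])
    then show ?thesis using that(3) by simp
  qed
  have jv: "Q (jvar v) = R (jvar v)" for v
  proof (cases "field_jet n v")
    case True
    obtain \<phi> a I \<alpha> where v: "v = Jet \<phi> a I \<alpha>" by (cases v)
    then have "\<phi> \<in> fields n" "card I = form_degree n \<phi>" using True by (auto simp: field_jet_def)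
    moreover have "Q (field_form n \<phi> $ a) = R (field_form n \<phi> $ a)"
      using eq[OF calculation(1)] by (metis gmap_nth)
    ultimately show ?thesis
      unfolding v evol_jvar[OF Q, of \<phi> a I \<alpha>] evol_jvar[OF R, of \<phi> a I \<alpha>] by (simp add: comp[OF Q] comp[OF R])
  qed (rule not_field)
  fix x
  show "Q x = R x"
    by (rule is_der_eqI[OF evol_is_der[OF Q] evol_is_der[OF R] jv])
      (simp add: vert_dx[OF evol_vert[OF Q]] vert_dx[OF evol_vert[OF R]])
qed

section \<open>Lie algebra valued forms\<close>

lemma gop_gmap: "gd X = gmap ext_d X" "gi \<xi> X = gmap (inner_deriv \<xi>) X" "gstar g X = gmap (hodge g) X"
  "gmetric g \<xi> X = gmap ((*) (metric_form g \<xi>)) X"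
  "gLie \<xi> X = gmap (\<lambda>x. inner_deriv \<xi> (ext_d x) + ext_d (inner_deriv \<xi> x)) X"
  by (simp_all add: gd_def gi_def gstar_def gmetric_def gLie_def gmap_def vec_eq_iff)

lemma gop_nth [simp]: "gd X $ a = ext_d (X $ a)" "gi \<xi> X $ a = inner_deriv \<xi> (X $ a)"
  "gstar g X $ a = hodge g (X $ a)" "gmetric g \<xi> X $ a = metric_form g \<xi> * X $ a"
  "gLie \<xi> X $ a = inner_deriv \<xi> (ext_d (X $ a)) + ext_d (inner_deriv \<xi> (X $ a))"
  by (simp_all add: gop_gmap)

lemma linear_gmap: "linear Q \<Longrightarrow> linear (gmap Q)"
  by (auto simp: linear_iff vec_eq_iff)

lemma linear_gop: "linear gd" "linear (gi \<xi>)" "linear (gstar g)" "linear (gmetric g \<xi>)" "linear (gLie \<xi>)"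
  by (auto simp: linear_iff vec_eq_iff ext_d_simps inner_simps hodge_simps algebra_simps)

lemmas gd_simps = linear_0[OF linear_gop(1)] linear_add[OF linear_gop(1)] linear_diff[OF linear_gop(1)]
  linear_neg[OF linear_gop(1)] linear_scale[OF linear_gop(1)] linear_sum[OF linear_gop(1)]
lemmas gi_simps = linear_0[OF linear_gop(2)] linear_add[OF linear_gop(2)] linear_diff[OF linear_gop(2)]
  linear_neg[OF linear_gop(2)] linear_scale[OF linear_gop(2)] linear_sum[OF linear_gop(2)]
lemmas gstar_simps = linear_0[OF linear_gop(3)] linear_add[OF linear_gop(3)] linear_diff[OF linear_gop(3)]
  linear_neg[OF linear_gop(3)] linear_scale[OF linear_gop(3)] linear_sum[OF linear_gop(3)]
lemmas gmetric_simps = linear_0[OF linear_gop(4)] linear_add[OF linear_gop(4)] linear_diff[OF linear_gop(4)]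
  linear_neg[OF linear_gop(4)] linear_scale[OF linear_gop(4)] linear_sum[OF linear_gop(4)]
lemmas gLie_simps = linear_0[OF linear_gop(5)] linear_add[OF linear_gop(5)] linear_diff[OF linear_gop(5)]
  linear_neg[OF linear_gop(5)] linear_scale[OF linear_gop(5)] linear_sum[OF linear_gop(5)]
lemmas gop_simps = gd_simps gi_simps gstar_simps gmetric_simps gLie_simps

lemma is_der_gmap_linear: "is_der e Q \<Longrightarrow> linear (gmap Q)"
  by (intro linear_gmap is_der_linear)

lemmas gmap_simps = linear_0[OF is_der_gmap_linear] linear_add[OF is_der_gmap_linear]
  linear_diff[OF is_der_gmap_linear] linear_neg[OF is_der_gmap_linear]
  linear_scale[OF is_der_gmap_linear] linear_sum[OF is_der_gmap_linear]

lemma gmap_part_linear: "linear (gmap (part p))"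
  by (intro linear_gmap linear_part)

lemmas gpart_simps = linear_0[OF gmap_part_linear] linear_add[OF gmap_part_linear]
  linear_diff[OF gmap_part_linear] linear_neg[OF gmap_part_linear]
  linear_scale[OF gmap_part_linear] linear_sum[OF gmap_part_linear]

lemma gpar_intros:
  "gpar e X \<Longrightarrow> gpar e Y \<Longrightarrow> gpar e (X + Y)" "gpar e X \<Longrightarrow> gpar e Y \<Longrightarrow> gpar e (X - Y)"
  "gpar e X \<Longrightarrow> gpar e (- X)" "gpar e X \<Longrightarrow> gpar e (r *\<^sub>R X)" "gpar e 0"
  by (auto simp: gpar_def intro: par_add par_diff par_uminus par_scaleR)

lemma gpar_sum: "(\<And>i. i \<in> A \<Longrightarrow> gpar e (X i)) \<Longrightarrow> gpar e (\<Sum>i\<in>A. X i)"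
  by (auto simp: gpar_def intro: par_sum)

lemma gdeg_intros:
  "gdeg e X \<Longrightarrow> gdeg e Y \<Longrightarrow> gdeg e (X + Y)" "gdeg e X \<Longrightarrow> gdeg e Y \<Longrightarrow> gdeg e (X - Y)"
  "gdeg e X \<Longrightarrow> gdeg e (- X)" "gdeg e X \<Longrightarrow> gdeg e (r *\<^sub>R X)" "gdeg e 0"
  by (auto simp: gdeg_def intro: deg_add deg_diff deg_uminus deg_scaleR)

lemma gpar_cong: "gpar e X \<Longrightarrow> even e = even f \<Longrightarrow> gpar f X"
  by (auto simp: gpar_def intro: par_cong)

lemma gpar_der: "is_der e Q \<Longrightarrow> gpar f X \<Longrightarrow> gpar (e + f) (gmap Q X)"
  by (auto simp: gpar_def intro: is_der_par)

lemma gdeg_vert: "vert e Q \<Longrightarrow> gdeg p X \<Longrightarrow> gdeg p (gmap Q X)"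
  by (auto simp: gdeg_def intro: vert_deg)

lemma gpar_gop:
  fixes X :: "('a :: finite, 'd :: {finite, linorder}) gform"
  shows "gpar e X \<Longrightarrow> gpar (e + 1) (gd X)" "gpar e X \<Longrightarrow> gpar (e + 1) (gi \<xi> X)"
  "gpar e X \<Longrightarrow> gpar (e + int CARD('d)) (gstar g X)" "gpar e X \<Longrightarrow> gpar (e + 1) (gmetric g \<xi> X)"
  "gpar e X \<Longrightarrow> gpar e (gLie \<xi> X)"
proof -
  assume X: "gpar e X"
  show "gpar (e + 1) (gd X)" "gpar (e + 1) (gi \<xi> X)"
    using gpar_der[OF is_der_ext_d X] gpar_der[OF is_der_inner X, of \<xi>] by (simp_all add: gop_gmap add.commute)
  show "gpar (e + int CARD('d)) (gstar g X)"
    using X by (auto simp: gpar_def intro: par_hodge)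
  show "gpar (e + 1) (gmetric g \<xi> X)"
    unfolding gpar_def gop_nth add.commute[of e 1] using X[unfolded gpar_def] by (intro allI par_times par_metric_form) blast
  show "gpar e (gLie \<xi> X)"
    using gpar_der[OF evol_is_der[OF evol_Lie] X, of \<xi>] by (simp add: gop_gmap)
qed

lemma gdeg_gop:
  fixes X :: "('a :: finite, 'd :: {finite, linorder}) gform"
  shows "gdeg p X \<Longrightarrow> gdeg (p + 1) (gd X)" "gdeg p X \<Longrightarrow> gdeg (p - 1) (gi \<xi> X)"
  "gdeg p X \<Longrightarrow> gdeg (CARD('d) - p) (gstar g X)" "gdeg p X \<Longrightarrow> gdeg (p + 1) (gmetric g \<xi> X)"
  "gdeg p X \<Longrightarrow> gdeg p (gLie \<xi> X)"
proof -
  assume X: "gdeg p X"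
  show "gdeg (p + 1) (gd X)" "gdeg (p - 1) (gi \<xi> X)" "gdeg (CARD('d) - p) (gstar g X)"
    unfolding gdeg_def gop_nth using X by (auto simp: gdeg_def intro: deg_ext_d[simplified] deg_inner[simplified] deg_hodge)
  show "gdeg (p + 1) (gmetric g \<xi> X)"
    unfolding gdeg_def gop_nth add.commute[of p 1] using X[unfolded gdeg_def] by (intro allI deg_times deg_metric_form) blast
  show "gdeg p (gLie \<xi> X)"
    using gdeg_vert[OF evol_vert[OF evol_Lie] X, of \<xi>] by (simp add: gop_gmap)
qed

lemma evol_gop:
  assumes "evol e Q"
  shows "gmap Q (gd X) = sg e *\<^sub>R gd (gmap Q X)" "gmap Q (gi \<xi> X) = sg e *\<^sub>R gi \<xi> (gmap Q X)"
    "gmap Q (gstar g X) = gstar g (gmap Q X)" "gmap Q (gmetric g \<xi> X) = sg e *\<^sub>R gmetric g \<xi> (gmap Q X)"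
    "gmap Q (gLie \<xi> X) = gLie \<xi> (gmap Q X)"
  by (simp_all add: vec_eq_iff evol_ext_d[OF assms] vert_inner[OF evol_vert[OF assms]] vert_hodge[OF evol_vert[OF assms]]
      vert_metric_form_times[OF evol_vert[OF assms]] evol_Lie_commute[OF assms])

lemma gpart_evol: "evol e Q \<Longrightarrow> gmap (part p) (gmap Q X) = gmap Q (gmap (part p) X)"
  by (simp add: vec_eq_iff part_vert[OF evol_vert])

lemma gpart_gdeg: "gdeg q X \<Longrightarrow> gmap (part p) X = (if p = q then X else 0)"
  by (auto simp: gdeg_def vec_eq_iff part_deg[of q])

lemma gdeg_gpart: "gdeg p (gmap (part p) X)"
  by (simp add: gdeg_def deg_part)

lemma gdeg_too_big: "gdeg p (X :: ('a :: finite, 'd :: {finite, linorder}) gform) \<Longrightarrow> CARD('d) < p \<Longrightarrow> X = 0"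
  by (auto simp: gdeg_def vec_eq_iff intro: deg_too_big)

lemma gd_gd [simp]: "gd (gd X) = 0" and gi_gi [simp]: "gi \<xi> (gi \<xi> X) = 0"
  by (simp_all add: vec_eq_iff)

lemma gi_anticommute: "gi \<xi> (gi \<eta> X) = - gi \<eta> (gi \<xi> X)"
  by (simp add: vec_eq_iff inner_anticommute[of \<xi> \<eta>])

lemma gmetric_anticommute: "gmetric g \<xi> (gmetric g \<eta> X) = - gmetric g \<eta> (gmetric g \<xi> X)"
  by (simp add: vec_eq_iff metric_form_anticommute[of g \<xi> \<eta>])

lemma gd_gmetric: "gd (gmetric g \<xi> X) = - gmetric g \<xi> (gd X)"
  by (simp add: vec_eq_iff ext_d_metric_form_times)

lemma gLie_gstar: "gLie \<xi> (gstar g X) = gstar g (gLie \<xi> X)"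
  by (simp add: vec_eq_iff ext_d_hodge_Lie)

lemma gLie_gd: "gLie \<xi> (gd X) = gd (gLie \<xi> X)"
  by (simp add: gLie_def gop_simps)

lemma gLie_gmetric: "gLie \<xi> (gmetric g \<eta> X) = gmetric g \<eta> (gLie \<xi> X)"
  using evol_gop(4)[OF evol_Lie, of \<xi> g \<eta> X] by (simp add: gop_gmap)

lemma gLie_gi: "gLie \<xi> (gi \<eta> X) = gi \<eta> (gLie \<xi> X)"
  using evol_gop(2)[OF evol_Lie, of \<xi> \<eta> X] by (simp add: gop_gmap)

subsection \<open>Trace and bracket\<close>

lemma Tr_linear: "linear (\<lambda>X. Tr tr X Y)" "linear (\<lambda>Y. Tr tr X Y)"
  by (auto simp: linear_iff Tr_def algebra_simps sum.distrib scaleR_sum_right)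

lemmas Tr_simps = linear_0[OF Tr_linear(1)] linear_add[OF Tr_linear(1)] linear_diff[OF Tr_linear(1)]
  linear_neg[OF Tr_linear(1)] linear_scale[OF Tr_linear(1)] linear_sum[OF Tr_linear(1)]
  linear_0[OF Tr_linear(2)] linear_add[OF Tr_linear(2)] linear_diff[OF Tr_linear(2)]
  linear_neg[OF Tr_linear(2)] linear_scale[OF Tr_linear(2)] linear_sum[OF Tr_linear(2)]

lemma bracket_linear: "linear (\<lambda>X. bracket br X Y)" "linear (\<lambda>Y. bracket br X Y)"
  by (auto simp: linear_iff bracket_def vec_eq_iff algebra_simps sum.distrib scaleR_sum_right)

lemmas bracket_simps = linear_0[OF bracket_linear(1)] linear_add[OF bracket_linear(1)] linear_diff[OF bracket_linear(1)]
  linear_neg[OF bracket_linear(1)] linear_scale[OF bracket_linear(1)] linear_sum[OF bracket_linear(1)]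
  linear_0[OF bracket_linear(2)] linear_add[OF bracket_linear(2)] linear_diff[OF bracket_linear(2)]
  linear_neg[OF bracket_linear(2)] linear_scale[OF bracket_linear(2)] linear_sum[OF bracket_linear(2)]

lemma deg_Tr: "gdeg p X \<Longrightarrow> gdeg q Y \<Longrightarrow> deg (p + q) (Tr tr X Y)"
  by (auto simp: Tr_def gpar_def gdeg_def intro!: par_sum par_scaleR par_times deg_sum deg_scaleR deg_times)

lemma gpar_bracket: "gpar e X \<Longrightarrow> gpar f Y \<Longrightarrow> gpar (e + f) (bracket br X Y)"
  and gdeg_bracket: "gdeg p X \<Longrightarrow> gdeg q Y \<Longrightarrow> gdeg (p + q) (bracket br X Y)"
  by (auto simp: bracket_def gpar_def gdeg_def intro!: par_sum par_scaleR par_times deg_sum deg_scaleR deg_times)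

lemma is_der_Tr:
  assumes "is_der e Q" "gpar f X"
  shows "Q (Tr tr X Y) = Tr tr (gmap Q X) Y + sg (e * f) *\<^sub>R Tr tr X (gmap Q Y)"
  unfolding Tr_def
  by (simp add: is_der_simps[OF assms(1)] is_der_times[OF assms(1) assms(2)[unfolded gpar_def, rule_format]] sum.distrib scaleR_sum_right algebra_simps)

lemma is_der_bracket:
  assumes "is_der e Q" "gpar f X"
  shows "gmap Q (bracket br X Y) = bracket br (gmap Q X) Y + sg (e * f) *\<^sub>R bracket br X (gmap Q Y)"
  unfolding bracket_def
  by (simp add: vec_eq_iff is_der_simps[OF assms(1)] is_der_times[OF assms(1) assms(2)[unfolded gpar_def, rule_format]] sum.distrib scaleR_sum_right algebra_simps)

lemma Tr_commute:
  assumes "gpar e X" "gpar f Y" "\<And>x y. tr x y = tr y x"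
  shows "Tr tr X Y = sg (e * f) *\<^sub>R Tr tr Y X"
proof -
  have "Tr tr X Y = (\<Sum>a\<in>UNIV. \<Sum>b\<in>UNIV. tr (axis a 1) (axis b 1) *\<^sub>R (sg (e * f) *\<^sub>R (Y $ b * X $ a)))"
    using assms(1,2) unfolding Tr_def gpar_def by (intro sum.cong refl) (metis graded_commute)
  also have "\<dots> = (\<Sum>b\<in>UNIV. \<Sum>a\<in>UNIV. tr (axis b 1) (axis a 1) *\<^sub>R (sg (e * f) *\<^sub>R (Y $ b * X $ a)))"
    by (subst sum.swap) (simp add: assms(3))
  finally show ?thesis by (simp add: Tr_def scaleR_sum_right mult.commute)
qed

lemma bracket_commute:
  assumes "gpar e X" "gpar f Y" "\<And>x y. br x y = - br y x"
  shows "bracket br X Y = - sg (e * f) *\<^sub>R bracket br Y X"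
proof -
  have "bracket br X Y $ c = (- sg (e * f) *\<^sub>R bracket br Y X) $ c" for c
  proof -
    have sw: "br (axis a 1) (axis b 1) $ c = - br (axis b 1) (axis a 1) $ c" for a b
      by (subst assms(3)) simp
    have "bracket br X Y $ c = (\<Sum>a\<in>UNIV. \<Sum>b\<in>UNIV. (br (axis a 1) (axis b 1) $ c) *\<^sub>R (sg (e * f) *\<^sub>R (Y $ b * X $ a)))"
      using assms(1,2) unfolding bracket_def gpar_def vec_lambda_beta by (intro sum.cong refl) (metis graded_commute)
    also have "\<dots> = (\<Sum>b\<in>UNIV. \<Sum>a\<in>UNIV. (- br (axis b 1) (axis a 1) $ c) *\<^sub>R (sg (e * f) *\<^sub>R (Y $ b * X $ a)))"
      by (subst sum.swap, intro sum.cong refl) (subst sw, simp)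
    finally show ?thesis by (simp add: bracket_def scaleR_sum_right sum_negf mult.commute)
  qed
  then show ?thesis by (simp add: vec_eq_iff)
qed

section \<open>Functional derivatives\<close>

lemma jets_add: "jets (x + y) \<subseteq> jets x \<union> jets y"
  unfolding jets_subset by (intro supp_add) (auto simp: supp_def jets_def)

lemma jets_scaleR: "jets (r *\<^sub>R x) \<subseteq> jets x"
  unfolding jets_subset by (intro supp_scaleR) (auto simp: supp_def jets_def)

text \<open>The index set in the definition depends on \<open>x\<close>. Enlarging it adds only zero
  terms, so different forms can be compared over a common finite set.\<close>

lemma euler_lagrange_eq:
  fixes x :: "('a :: countable, 'd :: {finite, linorder}) lform"
  assumes "finite A" "\<And>\<alpha>. Jet \<phi> a I \<alpha> \<in> jets x \<Longrightarrow> \<alpha> \<in> A"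
  shows "euler_lagrange \<phi> a I x = (\<Sum>\<alpha>\<in>A. (-1) ^ size \<alpha> *\<^sub>R total_derivs \<alpha> (pderiv_jet (Jet \<phi> a I \<alpha>) x))"
proof -
  have "{\<alpha>. \<exists>m. coeff x m \<noteq> 0 \<and> Jet \<phi> a I \<alpha> \<in># fst m} = {\<alpha>. Jet \<phi> a I \<alpha> \<in> jets x}"
    by (auto simp: jets_def)
  then show ?thesis
    unfolding euler_lagrange_def using assms
    by (simp, intro sum.mono_neutral_left) (auto simp: pderiv_jet_not_in linear_0[OF linear_total_derivs])
qed

definition jet_indices :: "('a, 'd) lform \<Rightarrow> 'd multiset set" where
  "jet_indices x = jet_derivs ` jets x"

lemma finite_jet_indices [simp]: "finite (jet_indices x)"
  by (simp add: jet_indices_def finite_jets)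

lemma jet_indices_Jet: "Jet \<phi> a I \<alpha> \<in> jets x \<Longrightarrow> \<alpha> \<in> jet_indices x"
  unfolding jet_indices_def by (metis image_eqI jet.sel(4))

lemma linear_euler_lagrange: "linear (euler_lagrange \<phi> a I :: ('a :: countable, 'd :: {finite, linorder}) lform \<Rightarrow> _)"
proof (rule linearI)
  fix x y :: "('a, 'd) lform" and r :: real
  let ?A = "jet_indices x \<union> jet_indices y"
  have "euler_lagrange \<phi> a I (x + y) = (\<Sum>\<alpha>\<in>?A. (-1) ^ size \<alpha> *\<^sub>R total_derivs \<alpha> (pderiv_jet (Jet \<phi> a I \<alpha>) (x + y)))"
    by (rule euler_lagrange_eq) (simp, metis UnCI UnE jet_indices_Jet jets_add subsetD)
  also have "\<dots> = euler_lagrange \<phi> a I x + euler_lagrange \<phi> a I y"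
    using euler_lagrange_eq[of ?A \<phi> a I x] euler_lagrange_eq[of ?A \<phi> a I y]
    by (simp add: jet_indices_Jet linear_add[OF linear_pderiv_jet] linear_add[OF linear_total_derivs] scaleR_right_distrib sum.distrib)
  finally show "euler_lagrange \<phi> a I (x + y) = euler_lagrange \<phi> a I x + euler_lagrange \<phi> a I y" .
  have "euler_lagrange \<phi> a I (r *\<^sub>R x) = (\<Sum>\<alpha>\<in>jet_indices x. (-1) ^ size \<alpha> *\<^sub>R total_derivs \<alpha> (pderiv_jet (Jet \<phi> a I \<alpha>) (r *\<^sub>R x)))"
    by (rule euler_lagrange_eq) (simp, metis jet_indices_Jet jets_scaleR subsetD)
  also have "\<dots> = r *\<^sub>R euler_lagrange \<phi> a I x"
    using euler_lagrange_eq[of "jet_indices x" \<phi> a I x]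
    by (simp add: jet_indices_Jet linear_scale[OF linear_pderiv_jet] linear_scale[OF linear_total_derivs] scaleR_sum_right mult.commute)
  finally show "euler_lagrange \<phi> a I (r *\<^sub>R x) = r *\<^sub>R euler_lagrange \<phi> a I x" .
qed

text \<open>The commutator of the two operators is a derivation; on generators it is nonzero only
  where the total derivative creates the variable differentiated by.\<close>

lemma pderiv_jet_total_deriv:
  fixes x :: "('a :: countable, 'd :: {finite, linorder}) lform"
  shows "pderiv_jet (Jet \<phi> a I \<alpha>) (total_deriv \<mu> x) = total_deriv \<mu> (pderiv_jet (Jet \<phi> a I \<alpha>) x)
    + (if \<mu> \<in># \<alpha> then pderiv_jet (Jet \<phi> a I (\<alpha> - {#\<mu>#})) x else 0)"
proof -
  let ?v = "Jet \<phi> a I \<alpha>" and ?w = "Jet \<phi> a I (\<alpha> - {#\<mu>#})"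
  have C: "is_der (ghost_number \<phi>) (\<lambda>x :: ('a, 'd) lform. pderiv_jet ?v (total_deriv \<mu> x) - total_deriv \<mu> (pderiv_jet ?v x))"
    using is_der_commutator[OF is_der_pderiv_jet is_der_total_deriv, of ?v \<mu>] by (simp add: vpar_def)
  have P: "is_der (ghost_number \<phi>) (\<lambda>x :: ('a, 'd) lform. if \<mu> \<in># \<alpha> then pderiv_jet ?w x else 0)"
    using is_der_pderiv_jet[of ?w] is_der_zero by (cases "\<mu> \<in># \<alpha>") (simp_all add: vpar_def)
  have "pderiv_jet ?v (total_deriv \<mu> x) - total_deriv \<mu> (pderiv_jet ?v x) = (if \<mu> \<in># \<alpha> then pderiv_jet ?w x else 0)"
  proof (rule is_der_eqI[OF C P])
    fix v :: "('a, 'd) jet"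
    show "pderiv_jet ?v (total_deriv \<mu> (jvar v)) - total_deriv \<mu> (pderiv_jet ?v (jvar v)) = (if \<mu> \<in># \<alpha> then pderiv_jet ?w (jvar v) else 0)"
    proof (cases v)
      case (Jet \<psi> b K \<beta>)
      have "\<mu> \<in># \<alpha> \<Longrightarrow> \<alpha> - {#\<mu>#} = \<beta> \<longleftrightarrow> \<alpha> = add_mset \<mu> \<beta>"
        by (metis add_mset_remove_trivial insert_DiffM)
      then show ?thesis
        using is_der_1[OF is_der_total_deriv] by (auto simp: Jet total_deriv_simps)
    qed
  qed (simp add: total_deriv_simps linear_0[OF linear_pderiv_jet])
  then show ?thesis by (simp add: algebra_simps)
qed

text \<open>The two terms of the commutation rule cancel after the substitution of
  \<open>add_mset \<mu> \<alpha>\<close> for \<open>\<alpha>\<close>, which raises the size by 1 and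
  so reverses the sign.\<close>

lemma euler_lagrange_total_deriv:
  fixes x :: "('a :: countable, 'd :: {finite, linorder}) lform"
  shows "euler_lagrange \<phi> a I (total_deriv \<mu> x) = 0"
proof -
  let ?S = "jet_indices x" and ?P = "\<lambda>\<alpha>. pderiv_jet (Jet \<phi> a I \<alpha>) x"
  let ?A = "?S \<union> add_mset \<mu> ` ?S \<union> jet_indices (total_deriv \<mu> x)"
  have tc: "total_derivs \<alpha> (total_deriv \<mu> y) = total_deriv \<mu> (total_derivs \<alpha> y)" for \<alpha> and y :: "('a, 'd) lform"
    by (rule total_derivs_commute[of "total_deriv \<mu>", OF total_deriv_commute, symmetric])
  have P0: "?P \<alpha> = 0" if "\<alpha> \<notin> ?S" for \<alpha>
    using that by (intro pderiv_jet_not_in) (auto dest: jet_indices_Jet)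
  have "euler_lagrange \<phi> a I (total_deriv \<mu> x) = (\<Sum>\<alpha>\<in>?A. (-1) ^ size \<alpha> *\<^sub>R total_derivs \<alpha> (pderiv_jet (Jet \<phi> a I \<alpha>) (total_deriv \<mu> x)))"
    by (rule euler_lagrange_eq) (auto dest: jet_indices_Jet)
  also have "\<dots> = (\<Sum>\<alpha>\<in>?A. (-1) ^ size \<alpha> *\<^sub>R total_derivs \<alpha> (total_deriv \<mu> (?P \<alpha>)))
      + (\<Sum>\<alpha>\<in>?A. (-1) ^ size \<alpha> *\<^sub>R total_derivs \<alpha> (if \<mu> \<in># \<alpha> then ?P (\<alpha> - {#\<mu>#}) else 0))"
    by (simp add: pderiv_jet_total_deriv linear_add[OF linear_total_derivs] scaleR_right_distrib sum.distrib)
  also have "(\<Sum>\<alpha>\<in>?A. (-1) ^ size \<alpha> *\<^sub>R total_derivs \<alpha> (total_deriv \<mu> (?P \<alpha>)))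
      = (\<Sum>\<alpha>\<in>?S. (-1) ^ size \<alpha> *\<^sub>R total_derivs \<alpha> (total_deriv \<mu> (?P \<alpha>)))"
    by (rule sum.mono_neutral_right) (auto simp: P0 total_deriv_simps linear_0[OF linear_total_derivs])
  also have "(\<Sum>\<alpha>\<in>?A. (-1) ^ size \<alpha> *\<^sub>R total_derivs \<alpha> (if \<mu> \<in># \<alpha> then ?P (\<alpha> - {#\<mu>#}) else 0))
      = (\<Sum>\<alpha>\<in>add_mset \<mu> ` ?S. (-1) ^ size \<alpha> *\<^sub>R total_derivs \<alpha> (if \<mu> \<in># \<alpha> then ?P (\<alpha> - {#\<mu>#}) else 0))"
  proof (rule sum.mono_neutral_right)
    have "?P (\<alpha> - {#\<mu>#}) = 0" if "\<mu> \<in># \<alpha>" "\<alpha> \<notin> add_mset \<mu> ` ?S" for \<alpha>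
      using that by (intro P0) (metis image_eqI insert_DiffM)
    then show "\<forall>\<alpha>\<in>?A - add_mset \<mu> ` ?S. (-1) ^ size \<alpha> *\<^sub>R total_derivs \<alpha> (if \<mu> \<in># \<alpha> then ?P (\<alpha> - {#\<mu>#}) else 0) = 0"
      by (auto simp: linear_0[OF linear_total_derivs])
  qed auto
  also have "\<dots> = - (\<Sum>\<alpha>\<in>?S. (-1) ^ size \<alpha> *\<^sub>R total_derivs \<alpha> (total_deriv \<mu> (?P \<alpha>)))"
    by (subst sum.reindex) (auto simp: inj_on_def sum_negf tc)
  finally show ?thesis by simp
qed

lemma euler_lagrange_dx_times:
  fixes x :: "('a :: countable, 'd :: {finite, linorder}) lform"
  shows "euler_lagrange \<phi> a I (dx \<mu> * x) = sg (ghost_number \<phi>) *\<^sub>R (dx \<mu> * euler_lagrange \<phi> a I x)"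
proof -
  have t: "total_derivs \<alpha> (dx \<mu> * y) = dx \<mu> * total_derivs \<alpha> y" for \<alpha> and y :: "('a, 'd) lform"
    by (induction \<alpha>) (simp_all add: is_der_dx[OF is_der_total_deriv])
  let ?A = "jet_indices x \<union> jet_indices (dx \<mu> * x)"
  have "euler_lagrange \<phi> a I (dx \<mu> * x) = (\<Sum>\<alpha>\<in>?A. (-1) ^ size \<alpha> *\<^sub>R total_derivs \<alpha> (pderiv_jet (Jet \<phi> a I \<alpha>) (dx \<mu> * x)))"
    by (rule euler_lagrange_eq) (auto dest: jet_indices_Jet)
  also have "\<dots> = sg (ghost_number \<phi>) *\<^sub>R (dx \<mu> * (\<Sum>\<alpha>\<in>?A. (-1) ^ size \<alpha> *\<^sub>R total_derivs \<alpha> (pderiv_jet (Jet \<phi> a I \<alpha>) x)))"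
    by (simp add: pderiv_jet_dx_times vpar_def t linear_scale[OF linear_total_derivs] sum_distrib_left scaleR_sum_right mult.commute)
  also have "(\<Sum>\<alpha>\<in>?A. (-1) ^ size \<alpha> *\<^sub>R total_derivs \<alpha> (pderiv_jet (Jet \<phi> a I \<alpha>) x)) = euler_lagrange \<phi> a I x"
    by (rule euler_lagrange_eq[symmetric]) (auto dest: jet_indices_Jet)
  finally show ?thesis .
qed

text \<open>Hence functional derivatives depend only on the local functional and not on the
  integrand that represents it.\<close>

lemma euler_lagrange_ext_d: "euler_lagrange \<phi> a I (ext_d x) = 0"
  unfolding ext_d_def
  by (simp add: linear_sum[OF linear_euler_lagrange] euler_lagrange_dx_times euler_lagrange_total_deriv)

text \<open>With the indices increasing, the head of the list is the leftmost \<open>dx\<close>, and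
  \<open>fold\<close> strips it first; no sign arises.\<close>

lemma fold_pderiv_dx:
  fixes y :: "('a :: countable, 'd :: {finite, linorder}) lform"
  assumes "sorted xs" "distinct xs" "\<And>\<mu>. \<mu> \<in> set xs \<Longrightarrow> pderiv_dx \<mu> y = 0"
  shows "fold pderiv_dx xs (mono_form ({#}, set xs) * y) = y"
  using assms
proof (induction xs)
  case Nil
  then show ?case by (simp flip: one_lform_def)
next
  case (Cons \<mu> xs)
  let ?z = "mono_form ({#}, set xs) * y"
  have e: "{\<nu> \<in> set xs. \<nu> < \<mu>} = {}" using Cons.prems(1) by auto
  have "mono_form ({#}, set (\<mu> # xs)) = (dx \<mu> * mono_form ({#}, set xs) :: ('a, 'd) lform)"
    using Cons.prems(2) mono_form_insert[of \<mu> "set xs" "{#}"] unfolding e by simp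
  then have m: "mono_form ({#}, set (\<mu> # xs)) * y = dx \<mu> * ?z" by (simp add: mult.assoc)
  have "pderiv_dx \<mu> (mono_form ({#}, set xs) :: ('a, 'd) lform) = 0"
    using Cons.prems(2) by (simp add: pderiv_dx_mono_form reduced_def)
  then have "pderiv_dx \<mu> ?z = 0"
    using is_der_times[OF is_der_pderiv_dx par_mono_form[OF refl], of \<mu> "({#}, set xs)" y] Cons.prems(3) by simp
  then have "pderiv_dx \<mu> (dx \<mu> * ?z) = ?z" by (simp add: pderiv_dx_dx_times)
  then show ?case using Cons unfolding m by simp
qed

lemma linear_fold_pderiv_dx: "linear (fold pderiv_dx xs)"
proof (induction xs)
  case (Cons \<mu> xs)
  show ?case using linear_compose[OF linear_pderiv_dx Cons] by (simp add: o_def comp_def)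
qed (simp add: linear_iff id_def)

text \<open>For a monomial with \<open>dx\<close> indices \<open>K\<close> only the complement of
  \<open>K\<close> contributes: any other \<open>J\<close> of the right size meets \<open>K\<close>,
  which makes the product zero. The sum in \<open>functional_deriv\<close> thus recovers a form of
  complementary degree.\<close>

lemma sum_fold_pderiv_dx:
  fixes x :: "('a :: countable, 'd :: {finite, linorder}) lform"
  assumes "deg (CARD('d) - p) x" "p \<le> CARD('d)"
  shows "(\<Sum>J | card J = p. fold pderiv_dx (sorted_list_of_set J) (mono_form ({#}, J) * x)) = x"
proof (rule supp_eq[where f = "\<lambda>x. \<Sum>J | card J = p. fold pderiv_dx (sorted_list_of_set J) (mono_form ({#}, J) * x)" and h = "\<lambda>x. x",
    OF _ _ _ assms(1)[unfolded deg_def]])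
  show "linear (\<lambda>x. \<Sum>J | card J = p. fold pderiv_dx (sorted_list_of_set J) (mono_form ({#}, J) * x) :: ('a, 'd) lform)"
    by (intro linear_compose_sum ballI linear_of_times linear_fold_pderiv_dx)
  fix m :: "('a, 'd) monomial" assume m: "card (snd m) = CARD('d) - p"
  obtain M K where MK: "m = (M, K)" by (cases m)
  have c: "card (- K) = p" using m assms(2) by (simp add: MK Compl_eq_Diff_UNIV card_Diff_subset)
  have "mono_form ({#}, J) * mono_form m = 0" if J: "card J = p" "J \<noteq> - K" for J
  proof -
    have "\<not> J \<subseteq> - K" using J c card_subset_eq[of "- K" J] by auto
    then show ?thesis by (auto simp: MK mono_form_times)
  qed
  then have "(\<Sum>J | card J = p. fold pderiv_dx (sorted_list_of_set J) (mono_form ({#}, J) * mono_form m))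
    = (\<Sum>J\<in>{- K}. fold pderiv_dx (sorted_list_of_set J) (mono_form ({#}, J) * mono_form m))"
    using c by (intro sum.mono_neutral_right) (auto simp: linear_0[OF linear_fold_pderiv_dx])
  also have "\<dots> = mono_form m"
  proof -
    have "pderiv_dx \<mu> (mono_form m) = 0" if "\<mu> \<notin> K" for \<mu>
      using that by (cases "reduced M") (simp_all add: MK pderiv_dx_mono_form mono_form_not_reduced linear_0[OF linear_pderiv_dx])
    then show ?thesis
      using fold_pderiv_dx[of "sorted_list_of_set (- K)" "mono_form m"] by simp
  qed
  finally show "(\<Sum>J | card J = p. fold pderiv_dx (sorted_list_of_set J) (mono_form ({#}, J) * mono_form m)) = mono_form m" .
qed (simp add: linear_iff)

section \<open>Integrands modulo exact forms, and independence of a given field\<close>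

definition exact :: "('a :: countable, 'd :: {finite, linorder}) lform \<Rightarrow> bool" where
  "exact x \<longleftrightarrow> (\<exists>\<theta>. x = ext_d \<theta>)"

lemma exact_ext_d [simp]: "exact (ext_d \<theta>)" and exact_0 [simp]: "exact 0"
  unfolding exact_def by (blast, metis linear_0[OF is_der_linear[OF is_der_ext_d]])

lemma exact_add: "exact x \<Longrightarrow> exact y \<Longrightarrow> exact (x + y)"
  and exact_scaleR: "exact x \<Longrightarrow> exact (r *\<^sub>R x)"
  unfolding exact_def by (metis linear_add[OF is_der_linear[OF is_der_ext_d]], metis linear_scale[OF is_der_linear[OF is_der_ext_d]])

lemma exact_uminus: "exact x \<Longrightarrow> exact (- x)"
  using exact_scaleR[of x "-1"] by simp

lemma exact_diff: "exact x \<Longrightarrow> exact y \<Longrightarrow> exact (x - y)"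
  using exact_add[of x "- y"] exact_uminus[of y] by simp

lemma exact_sum: "(\<And>i. i \<in> A \<Longrightarrow> exact (f i)) \<Longrightarrow> exact (\<Sum>i\<in>A. f i)"
  by (induction A rule: infinite_finite_induct) (auto intro: exact_add)

lemma integral_of_eqI:
  assumes "exact (x - y)"
  shows "integral_of x = integral_of y"
proof -
  obtain \<theta> where t: "x = y + ext_d \<theta>" using assms by (auto simp: exact_def algebra_simps)
  have "y + ext_d \<eta> = x + ext_d (\<eta> - \<theta>)" "x + ext_d \<eta> = y + ext_d (\<theta> + \<eta>)" for \<eta>
    by (simp_all add: t ext_d_simps)
  then show ?thesis unfolding integral_of_def by blast
qed

text \<open>Stated by vanishing derivatives rather than by absent variables, so that it passes
  through every operation obeying a product or commutation rule with
  \<open>pderiv_jet\<close>.\<close>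

definition field_free :: "field \<Rightarrow> ('a :: finite, 'd :: {finite, linorder}) gform \<Rightarrow> bool" where
  "field_free t X \<longleftrightarrow> (\<forall>a I \<alpha>. gmap (pderiv_jet (Jet t a I \<alpha>)) X = 0)"

definition lfield_free :: "field \<Rightarrow> ('a :: finite, 'd :: {finite, linorder}) lform \<Rightarrow> bool" where
  "lfield_free t x \<longleftrightarrow> (\<forall>a I \<alpha>. pderiv_jet (Jet t a I \<alpha>) x = 0)"

lemma field_free_nth: "field_free t X \<longleftrightarrow> (\<forall>c. lfield_free t (X $ c))"
  by (auto simp: field_free_def lfield_free_def vec_eq_iff)

lemma lfield_free_intros:
  "lfield_free t 0" "lfield_free t x \<Longrightarrow> lfield_free t y \<Longrightarrow> lfield_free t (x + y)"
  "lfield_free t x \<Longrightarrow> lfield_free t y \<Longrightarrow> lfield_free t (x - y)"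
  "lfield_free t x \<Longrightarrow> lfield_free t (- x)" "lfield_free t x \<Longrightarrow> lfield_free t (r *\<^sub>R x)"
  by (simp_all add: lfield_free_def linear_0[OF linear_pderiv_jet] linear_add[OF linear_pderiv_jet] linear_diff[OF linear_pderiv_jet]
      linear_neg[OF linear_pderiv_jet] linear_scale[OF linear_pderiv_jet])

lemma lfield_free_sum: "(\<And>i. i \<in> A \<Longrightarrow> lfield_free t (f i)) \<Longrightarrow> lfield_free t (\<Sum>i\<in>A. f i)"
  by (induction A rule: infinite_finite_induct) (auto intro: lfield_free_intros)

lemma field_free_intros:
  "field_free t 0" "field_free t X \<Longrightarrow> field_free t Y \<Longrightarrow> field_free t (X + Y)"
  "field_free t X \<Longrightarrow> field_free t Y \<Longrightarrow> field_free t (X - Y)"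
  "field_free t X \<Longrightarrow> field_free t (- X)" "field_free t X \<Longrightarrow> field_free t (r *\<^sub>R X)"
  by (simp_all add: field_free_nth lfield_free_intros)

lemma field_free_sum: "(\<And>i. i \<in> A \<Longrightarrow> field_free t (X i)) \<Longrightarrow> field_free t (\<Sum>i\<in>A. X i)"
  by (induction A rule: infinite_finite_induct) (auto intro: field_free_intros)

lemma field_free_gd: "field_free t X \<Longrightarrow> field_free t (gd X)"
  and field_free_gstar: "field_free t X \<Longrightarrow> field_free t (gstar g X)"
  and field_free_gpart: "field_free t X \<Longrightarrow> field_free t (gmap (part p) X)"
  by (simp_all add: field_free_nth lfield_free_def vert_hodge[OF vert_pderiv_jet] hodge_simps part_simps part_vert[OF vert_pderiv_jet, symmetric]
      ext_d_def linear_sum[OF linear_pderiv_jet] pderiv_jet_dx_times pderiv_jet_total_deriv total_deriv_simps cong: if_cong)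

lemma lfield_free_Tr: "field_free t X \<Longrightarrow> field_free t Y \<Longrightarrow> gpar e X \<Longrightarrow> lfield_free t (Tr tr X Y)"
  by (simp add: field_free_def lfield_free_def is_der_Tr[OF is_der_pderiv_jet] Tr_simps)

lemma field_free_bracket: "field_free t X \<Longrightarrow> field_free t Y \<Longrightarrow> gpar e X \<Longrightarrow> field_free t (bracket br X Y)"
  by (simp add: field_free_def lfield_free_def is_der_bracket[OF is_der_pderiv_jet] bracket_simps)

lemma field_free_field_form: "t \<noteq> \<phi> \<Longrightarrow> field_free t (field_form n \<phi>)"
proof (cases "\<phi> \<in> fields n")
  case True
  then show "t \<noteq> \<phi> \<Longrightarrow> field_free t (field_form n \<phi>)"
    by (auto simp: field_free_nth lfield_free_def vert_field_form[OF vert_pderiv_jet])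
next
  case False
  then show "field_free t (field_form n \<phi>)"
    by (simp add: field_form_def field_free_intros)
qed

text \<open>
  A field \<open>t\<close> outside of \<open>fields n\<close> plays the role of the variation of \<open>\<phi>\<close>: its jet variables are independent of
  those in the action, and it is chosen with the ghost parity of \<open>\<phi>\<close> so that the variation is an even derivation.
\<close>

definition variation :: "field \<Rightarrow> field \<Rightarrow> ('a :: finite, 'd :: {finite, linorder}) lform \<Rightarrow> ('a, 'd) lform" where
  "variation \<phi> t = derivation (\<lambda>v. case v of Jet \<psi> a I \<alpha> \<Rightarrow> if \<psi> = \<phi> then jvar (Jet t a I \<alpha>) else 0)"

text \<open>This is the form field made of the jets of \<open>t\<close>. It is defined anew because
  \<open>field_form\<close> is 0 for a field outside of \<open>fields n\<close>.\<close>

definition test_form :: "nat \<Rightarrow> field \<Rightarrow> ('a :: finite, 'd :: {finite, linorder}) gform" where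
  "test_form p t = (\<chi> a. \<Sum>I | card I = p. jvar (Jet t a I {#}) * mono_form ({#}, I))"

lemma evol_variation:
  assumes "even (ghost_number t) = even (ghost_number \<phi>)"
  shows "evol 0 (variation \<phi> t :: ('a :: finite, 'd :: {finite, linorder}) lform \<Rightarrow> _)"
proof -
  have D: "is_der 0 (variation \<phi> t :: ('a, 'd) lform \<Rightarrow> _)"
    unfolding variation_def using assms
    by (intro is_der_derivation) (auto split: jet.split intro!: par_jvar simp: vpar_def)
  have "variation \<phi> t (total_deriv \<mu> (jvar v)) = total_deriv \<mu> (variation \<phi> t (jvar v))" for \<mu> and v :: "('a, 'd) jet"
    by (cases v) (simp add: variation_def total_deriv_simps)
  moreover have "variation \<phi> t (total_deriv \<mu> (dx \<nu>)) = total_deriv \<mu> (variation \<phi> t (dx \<nu> :: ('a, 'd) lform))" for \<mu> \<nu>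
    by (simp add: is_der_simps[OF D]) (simp add: variation_def total_deriv_simps)
  ultimately have "variation \<phi> t (total_deriv \<mu> x) = total_deriv \<mu> (variation \<phi> t x)" for \<mu> and x :: "('a, 'd) lform"
    using commutator_eqI[OF D is_der_total_deriv, of \<mu> x] by simp
  then show ?thesis
    unfolding evol_def
    by (auto intro!: vertI D) (auto simp: variation_def deg_jvar split: jet.split)
qed

lemma variation_field_form:
  assumes "even (ghost_number t) = even (ghost_number \<phi>)" "\<psi> \<in> fields n"
  shows "gmap (variation \<phi> t) (field_form n \<psi>) = (if \<psi> = \<phi> then test_form (form_degree n \<phi>) t else 0)"
  by (auto simp: vec_eq_iff vert_field_form[OF evol_vert[OF evol_variation[OF assms(1)]] assms(2)] test_form_def)
    (simp_all add: variation_def)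

lemma gpar_test_form: "gpar (ghost_number t + int p) (test_form p t)"
  and gdeg_test_form: "gdeg p (test_form p t)"
proof -
  show "gpar (ghost_number t + int p) (test_form p t)"
    by (auto simp: gpar_def test_form_def vpar_def mpar_def intro!: par_sum par_times par_jvar par_mono_form)
  show "gdeg p (test_form p t)"
    using deg_times[OF deg_jvar deg_mono_form, of "({#}, _)" p] by (auto simp: gdeg_def test_form_def intro!: deg_sum)
qed

text \<open>The commutator of the two operators is a derivation that agrees with the derivative by
  the jet of \<open>\<phi>\<close> on all generators: the variation turns exactly that variable into
  the jet of \<open>t\<close>.\<close>

lemma pderiv_jet_variation:
  fixes x :: "('a :: finite, 'd :: {finite, linorder}) lform"
  assumes "even (ghost_number t) = even (ghost_number \<phi>)"
  shows "pderiv_jet (Jet t a I \<alpha>) (variation \<phi> t x) = pderiv_jet (Jet \<phi> a I \<alpha>) x + variation \<phi> t (pderiv_jet (Jet t a I \<alpha>) x)"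
proof -
  let ?v = "Jet \<phi> a I \<alpha>" and ?w = "Jet t a I \<alpha>" and ?V = "variation \<phi> t :: ('a, 'd) lform \<Rightarrow> _"
  note D = evol_is_der[OF evol_variation[OF assms]]
  have C: "is_der (ghost_number t) (\<lambda>x. pderiv_jet ?w (?V x) - ?V (pderiv_jet ?w x))"
    using is_der_commutator[OF is_der_pderiv_jet D, of ?w] by (simp add: vpar_def)
  have P: "is_der (ghost_number t) (pderiv_jet ?v)"
    by (rule is_der_cong[OF is_der_pderiv_jet]) (simp add: vpar_def assms)
  have "pderiv_jet ?w (?V x) - ?V (pderiv_jet ?w x) = pderiv_jet ?v x"
  proof (rule is_der_eqI[OF C P])
    fix v :: "('a, 'd) jet"
    have "?V 1 = 0" by (rule is_der_1[OF D])
    then have "?V (if ?w = v then 1 else 0) = 0" by (simp add: is_der_simps[OF D])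
    moreover have "pderiv_jet ?w (?V (jvar v)) = pderiv_jet ?v (jvar v)"
      by (cases v) (auto simp: variation_def linear_0[OF linear_pderiv_jet])
    ultimately show "pderiv_jet ?w (?V (jvar v)) - ?V (pderiv_jet ?w (jvar v)) = pderiv_jet ?v (jvar v)" by simp
  qed (simp add: is_der_simps[OF D] vert_dx[OF evol_vert[OF evol_variation[OF assms]]] linear_0[OF linear_pderiv_jet])
  then show ?thesis by (simp add: algebra_simps)
qed

text \<open>The variation is linear in the jets of \<open>t\<close>, with the partial derivatives by
  the jets of \<open>\<phi>\<close> as coefficients, since \<open>x\<close> itself does not involve
  \<open>t\<close>.\<close>

lemma euler_lagrange_variation:
  fixes x :: "('a :: finite, 'd :: {finite, linorder}) lform"
  assumes "even (ghost_number t) = even (ghost_number \<phi>)" "lfield_free t x"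
  shows "euler_lagrange t a I (variation \<phi> t x) = euler_lagrange \<phi> a I x"
proof -
  let ?A = "jet_indices x \<union> jet_indices (variation \<phi> t x)"
  have p: "pderiv_jet (Jet t a I \<alpha>) (variation \<phi> t x) = pderiv_jet (Jet \<phi> a I \<alpha>) x" for \<alpha>
    using assms(2) pderiv_jet_variation[OF assms(1), of a I \<alpha> x]
    by (simp add: lfield_free_def is_der_simps(1)[OF evol_is_der[OF evol_variation[OF assms(1)]]])
  have "euler_lagrange t a I (variation \<phi> t x) = (\<Sum>\<alpha>\<in>?A. (-1) ^ size \<alpha> *\<^sub>R total_derivs \<alpha> (pderiv_jet (Jet t a I \<alpha>) (variation \<phi> t x)))"
    by (rule euler_lagrange_eq) (auto dest: jet_indices_Jet)
  also have "\<dots> = euler_lagrange \<phi> a I x"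
    unfolding p by (rule euler_lagrange_eq[symmetric]) (auto dest: jet_indices_Jet)
  finally show ?thesis .
qed

text \<open>The test form enters undifferentiated, so only the empty multi-index contributes to the
  Euler-Lagrange sum.\<close>

lemma euler_lagrange_Tr_test_form:
  fixes X :: "('a :: finite, 'd :: {finite, linorder}) gform"
  assumes "field_free t X" "card J = p"
  shows "euler_lagrange t b J (Tr tr (test_form p t) X) = (\<Sum>c\<in>UNIV. tr (axis b 1) (axis c 1) *\<^sub>R (mono_form ({#}, J) * X $ c))"
proof -
  let ?L = "Tr tr (test_form p t) X"
  have p1: "pderiv_jet (Jet t b J \<alpha>) (test_form p t $ a) = (if a = b \<and> \<alpha> = {#} then mono_form ({#}, J) else 0 :: ('a, 'd) lform)" for \<alpha> a
  proof -
    have "pderiv_jet (Jet t b J \<alpha>) (test_form p t $ a) =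
       (\<Sum>I | card I = p. if Jet t b J \<alpha> = Jet t a I {#} then mono_form ({#}, I) else 0 :: ('a, 'd) lform)"
      unfolding test_form_def
      by (simp add: linear_sum[OF linear_pderiv_jet] vert_times_dx_form[OF vert_pderiv_jet] if_distrib[of "\<lambda>x. x * _"] cong: if_cong)
    also have "\<dots> = (\<Sum>I | card I = p. if J = I then if a = b \<and> \<alpha> = {#} then mono_form ({#}, J) else 0 else 0)"
      by (intro sum.cong refl) auto
    also have "\<dots> = (if a = b \<and> \<alpha> = {#} then mono_form ({#}, J) else 0 :: ('a, 'd) lform)"
      using assms(2) by (subst sum.delta') auto
    finally show ?thesis .
  qed
  have p2: "pderiv_jet (Jet t b J \<alpha>) ?L = (if \<alpha> = {#} then \<Sum>c\<in>UNIV. tr (axis b 1) (axis c 1) *\<^sub>R (mono_form ({#}, J) * X $ c) else 0)" for \<alpha>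
  proof -
    have "pderiv_jet (Jet t b J \<alpha>) ?L = Tr tr (gmap (pderiv_jet (Jet t b J \<alpha>)) (test_form p t)) X"
      using assms(1) by (simp add: is_der_Tr[OF is_der_pderiv_jet gpar_test_form] field_free_def Tr_simps)
    also have "\<dots> = (\<Sum>a\<in>UNIV. if a = b then (if \<alpha> = {#} then \<Sum>c\<in>UNIV. tr (axis b 1) (axis c 1) *\<^sub>R (mono_form ({#}, J) * X $ c) else 0) else 0)"
      unfolding Tr_def by (intro sum.cong refl) (simp add: p1)
    finally show ?thesis by simp
  qed
  have "euler_lagrange t b J ?L = (\<Sum>\<alpha>\<in>insert {#} (jet_indices ?L). (-1) ^ size \<alpha> *\<^sub>R total_derivs \<alpha> (pderiv_jet (Jet t b J \<alpha>) ?L))"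
    by (rule euler_lagrange_eq) (auto dest: jet_indices_Jet)
  also have "\<dots> = (\<Sum>\<alpha>\<in>{{#}}. (-1) ^ size \<alpha> *\<^sub>R total_derivs \<alpha> (pderiv_jet (Jet t b J \<alpha>) ?L))"
    by (rule sum.mono_neutral_right) (auto simp: p2 linear_0[OF linear_total_derivs])
  finally show ?thesis by (simp add: p2)
qed

text \<open>Nondegeneracy says that the Gram matrix has trivial kernel, and a square matrix with
  trivial kernel is invertible.\<close>

lemma gram_inverse:
  fixes tr :: "('a :: finite) vector \<Rightarrow> 'a vector \<Rightarrow> real"
  assumes "invariant_form br tr"
  shows "(\<Sum>b\<in>UNIV. matrix_inv (\<chi> a b. tr (axis a 1) (axis b 1)) $ a $ b * tr (axis b 1) (axis c 1)) = (if a = c then 1 else 0)"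
proof -
  let ?K = "\<chi> a b. tr (axis a 1) (axis b 1)"
  have bil: "bilinear tr" and sym: "\<And>x y. tr x y = tr y x" and nondeg: "\<And>x. (\<And>y. tr x y = 0) \<Longrightarrow> x = 0"
    using assms by (auto simp: invariant_form_def)
  have expand: "tr y x = (\<Sum>a\<in>UNIV. y $ a * (\<Sum>b\<in>UNIV. tr (axis a 1) (axis b 1) * x $ b))" for x y
  proof -
    have "tr y x = tr (\<Sum>a\<in>UNIV. y $ a *\<^sub>R axis a 1) (\<Sum>b\<in>UNIV. x $ b *\<^sub>R axis b 1)"
      using basis_expansion[of x] basis_expansion[of y] by (simp add: scalar_mult_eq_scaleR)
    also have "\<dots> = (\<Sum>a\<in>UNIV. \<Sum>b\<in>UNIV. y $ a * (x $ b * tr (axis a 1) (axis b 1)))"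
      by (simp add: bilinear_sum[OF bil] sum.cartesian_product bilinear_lmul[OF bil] bilinear_rmul[OF bil] case_prod_beta mult_ac)
    finally show ?thesis by (simp add: sum_distrib_left mult_ac)
  qed
  have "x = 0" if "?K *v x = 0" for x
  proof (rule nondeg)
    fix y
    have "(\<Sum>b\<in>UNIV. tr (axis a 1) (axis b 1) * x $ b) = 0" for a
      using arg_cong[OF that, of "\<lambda>v. v $ a"] by (simp add: matrix_vector_mult_def)
    then show "tr x y = 0" using sym[of x y] by (simp add: expand[of y x])
  qed
  then have "\<exists>B. B ** ?K = mat 1" by (simp add: matrix_left_invertible_ker)
  then have "invertible ?K" by (simp add: invertible_left_inverse)
  then have "(matrix_inv ?K ** ?K) $ a $ c = mat 1 $ a $ c" by (simp add: invertible_matrix_inv)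
  then show ?thesis by (simp add: matrix_matrix_mult_def mat_def)
qed

text \<open>The Euler-Lagrange derivative by \<open>t\<close> ignores the exact difference and reads
  off the coefficient of the test form. The contractions then recover \<open>X\<close>, and the
  inverse Gram matrix undoes the trace.\<close>

lemma functional_deriv_eqI:
  fixes X :: "('a :: finite, 'd :: {finite, linorder}) gform"
  assumes tr: "invariant_form br tr"
    and t: "even (ghost_number t) = even (ghost_number \<phi>)" "lfield_free t L" "field_free t X"
    and deg: "gdeg (CARD('d) - form_degree n \<phi>) X" "form_degree n \<phi> \<le> CARD('d)"
    and var: "exact (variation \<phi> t L - Tr tr (test_form (form_degree n \<phi>) t) X)"
  shows "functional_deriv n tr L \<phi> = X"
proof -
  let ?p = "form_degree n \<phi>" and ?K = "\<lambda>a b. matrix_inv (\<chi> a b. tr (axis a 1) (axis b 1)) $ a $ b"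
  let ?F = "\<lambda>J. fold pderiv_dx (sorted_list_of_set J) :: ('a, 'd) lform \<Rightarrow> _"
  have EL: "euler_lagrange \<phi> b J L = (\<Sum>c\<in>UNIV. tr (axis b 1) (axis c 1) *\<^sub>R (mono_form ({#}, J) * X $ c))" if "card J = ?p" for b J
  proof -
    obtain \<theta> where "variation \<phi> t L = Tr tr (test_form ?p t) X + ext_d \<theta>"
      using var by (auto simp: exact_def algebra_simps)
    then have "euler_lagrange t b J (variation \<phi> t L) = euler_lagrange t b J (Tr tr (test_form ?p t) X)"
      by (simp add: linear_add[OF linear_euler_lagrange] euler_lagrange_ext_d)
    then show ?thesis
      by (simp add: euler_lagrange_variation[OF t(1,2)] euler_lagrange_Tr_test_form[OF t(3) that])
  qed
  have "functional_deriv n tr L \<phi> $ a = X $ a" for a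
  proof -
    let ?G = "\<lambda>c. \<Sum>J | card J = ?p. ?F J (mono_form ({#}, J) * X $ c)"
    have "(\<Sum>J | card J = ?p. ?F J (euler_lagrange \<phi> b J L)) = (\<Sum>c\<in>UNIV. tr (axis b 1) (axis c 1) *\<^sub>R ?G c)" for b
      by (simp add: EL linear_sum[OF linear_fold_pderiv_dx] linear_scale[OF linear_fold_pderiv_dx] scaleR_sum_right) (rule sum.swap)
    moreover have "?G c = X $ c" for c
      using deg by (intro sum_fold_pderiv_dx) (auto simp: gdeg_def)
    ultimately have "functional_deriv n tr L \<phi> $ a = (\<Sum>b\<in>UNIV. \<Sum>c\<in>UNIV. (?K a b * tr (axis b 1) (axis c 1)) *\<^sub>R X $ c)"
      by (simp add: functional_deriv_def scaleR_sum_right)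
    also have "\<dots> = (\<Sum>c\<in>UNIV. (\<Sum>b\<in>UNIV. ?K a b * tr (axis b 1) (axis c 1)) *\<^sub>R X $ c)"
      by (subst sum.swap) (simp add: scaleR_sum_left)
    also have "\<dots> = X $ a"
      by (simp add: gram_inverse[OF tr] if_distrib[of "\<lambda>r. r *\<^sub>R _"] cong: if_cong)
    finally show ?thesis .
  qed
  then show ?thesis by (simp add: vec_eq_iff)
qed

section \<open>The BF model\<close>

lemma part_Tr:
  fixes X Y :: "('a :: finite, 'd :: {finite, linorder}) gform"
  assumes "gdeg p X"
  shows "part m (Tr tr X Y) = (if p \<le> m then Tr tr X (gmap (part (m - p)) Y) else 0)"
proof -
  have Y: "Y = (\<Sum>q\<le>CARD('d). gmap (part q) Y)"
    by (simp add: vec_eq_iff sum_part)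
  have "part m (Tr tr X (gmap (part q) Y)) = (if p \<le> m then Tr tr X (gmap (part (m - p)) (gmap (part q) Y)) else 0)" for q
    unfolding part_deg[OF deg_Tr[OF assms gdeg_gpart]] gpart_gdeg[OF gdeg_gpart] by (auto simp: Tr_simps)
  then show ?thesis
    by (subst (1 2) Y) (simp add: Tr_simps part_simps gpart_simps)
qed

lemma sum_gpart:
  fixes X :: "('a :: finite, 'd :: {finite, linorder}) gform"
  shows "(\<Sum>p\<le>CARD('d). gmap (part p) X) = X"
  by (simp add: vec_eq_iff sum_part)

lemma gpart_gd: "gmap (part p) (gd X) = (if p = 0 then 0 else gd (gmap (part (p - 1)) X))"
proof (cases p)
  case 0
  have "part 0 (ext_d x) = 0" for x :: "('a, 'b) lform"
  proof -
    have "part 0 (ext_d (part q x)) = 0" for q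
      by (simp add: part_deg[OF deg_ext_d[OF deg_part]])
    then have "part 0 (ext_d (\<Sum>q\<le>CARD('b). part q x)) = 0" by (simp add: ext_d_simps part_simps)
    then show ?thesis by (simp add: sum_part)
  qed
  then show ?thesis using 0 by (simp add: vec_eq_iff)
qed (simp add: vec_eq_iff part_ext_d)

lemma gpart_gi: "gmap (part p) (gi \<xi> X) = gi \<xi> (gmap (part (Suc p)) X)"
  by (simp add: vec_eq_iff part_inner)

text \<open>The fields underlying the ladders, indexed by form degree. Along each ladder the parity
  is constant, 1 for the first and that of \<open>n\<close> for the second, so the sums over a
  ladder have definite parity.\<close>

definition lfield1 :: "nat \<Rightarrow> field" where
  "lfield1 p = (if p = 0 then Ghost else if p = 1 then Conn else SrcB (p - 2))"

definition lfield2 :: "nat \<Rightarrow> nat \<Rightarrow> field" where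
  "lfield2 n p = (if p \<le> n then BF (n - p) else if p = n + 1 then SrcGamma else SrcTau)"

lemma lfield1_props:
  assumes "p \<le> n + 2"
  shows "lfield1 p \<in> fields n" "form_degree n (lfield1 p) = p" "fpar n (lfield1 p) = 1"
  using assms by (auto simp: lfield1_def fields_def fpar_def)

lemma lfield2_props:
  assumes "p \<le> n + 2"
  shows "lfield2 n p \<in> fields n" "form_degree n (lfield2 n p) = p" "fpar n (lfield2 n p) = int n"
  using assms by (auto simp: lfield2_def fields_def fpar_def le_Suc_eq)

lemma lfield1_inj: "lfield1 p = lfield1 q \<longleftrightarrow> p = q"
  by (auto simp: lfield1_def)

lemma lfield2_inj: "p \<le> n + 2 \<Longrightarrow> q \<le> n + 2 \<Longrightarrow> lfield2 n p = lfield2 n q \<longleftrightarrow> p = q"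
  by (auto simp: lfield2_def)

lemma lfield_neq: "lfield1 p \<noteq> lfield2 n q" "lfield1 p \<noteq> CBar k j" "lfield1 p \<noteq> PiF k j" "lfield1 p \<noteq> AGhost" "lfield1 p \<noteq> Mult"
  "lfield2 n p \<noteq> CBar k j" "lfield2 n p \<noteq> PiF k j" "lfield2 n p \<noteq> AGhost" "lfield2 n p \<noteq> Mult"
  by (auto simp: lfield1_def lfield2_def)

lemma fields_cases:
  assumes "\<phi> \<in> fields n"
  obtains "\<phi> = AGhost" | "\<phi> = Mult" | p where "p \<le> n + 2" "\<phi> = lfield1 p" | p where "p \<le> n + 2" "\<phi> = lfield2 n p"
    | k j where "1 \<le> k" "k \<le> n" "j \<le> n - k" "\<phi> = CBar k j" | k j where "1 \<le> k" "k \<le> n" "j \<le> n - k" "\<phi> = PiF k j"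
proof -
  consider "\<phi> = AGhost" | "\<phi> = Mult" | "\<phi> = Conn" | "\<phi> = Ghost" | "\<phi> = SrcGamma" | "\<phi> = SrcTau"
    | j where "\<phi> = BF j" "j \<le> n" | j where "\<phi> = SrcB j" "j \<le> n"
    | k j where "1 \<le> k" "k \<le> n" "j \<le> n - k" "\<phi> = CBar k j" | k j where "1 \<le> k" "k \<le> n" "j \<le> n - k" "\<phi> = PiF k j"
    using assms unfolding fields_def by blast
  then show thesis
  proof cases
    case 3
    then show thesis by (intro that(3)[of 1]) (simp_all add: lfield1_def)
  next
    case 4
    then show thesis by (intro that(3)[of 0]) (simp_all add: lfield1_def)
  next
    case 5
    then show thesis by (intro that(4)[of "n + 1"]) (simp_all add: lfield2_def)
  next
    case 6
    then show thesis by (intro that(4)[of "n + 2"]) (simp_all add: lfield2_def)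
  next
    case (7 j)
    then show thesis by (intro that(4)[of "n - j"]) (simp_all add: lfield2_def)
  next
    case (8 j)
    then show thesis by (intro that(3)[of "j + 2"]) (simp_all add: lfield1_def)
  qed (use that in blast)+
qed

lemma antighost_field_form: "1 \<le> k \<Longrightarrow> k \<le> n \<Longrightarrow> j \<le> n - k \<Longrightarrow> antighost n k (int j) = field_form n (CBar k j)"
  and multiplier_field_form: "1 \<le> k \<Longrightarrow> k \<le> n \<Longrightarrow> j \<le> n - k \<Longrightarrow> multiplier n k (int j) = field_form n (PiF k j)"
  by (auto simp: antighost_def multiplier_def)

lemma antighost_0: "\<not> (1 \<le> k \<and> k \<le> n \<and> 0 \<le> j \<and> j \<le> int n - int k) \<Longrightarrow> antighost n k j = 0"
  and multiplier_0: "\<not> (1 \<le> k \<and> k \<le> n \<and> 0 \<le> j \<and> j \<le> int n - int k) \<Longrightarrow> multiplier n k j = 0"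
  by (auto simp: antighost_def multiplier_def)

text \<open>The ghost numbers \<open>gam k g\<close> are such that the parity depends neither on the
  row nor on the entry: that of \<open>n\<close> for antighosts and the opposite one for
  multipliers. This keeps the signs uniform over the triangle.\<close>

lemma gpar_antighost: "gpar (int n) (antighost n k j)"
  and gdeg_antighost: "gdeg (nat (int n - j - int k)) (antighost n k j)"
  and gpar_multiplier: "gpar (int n + 1) (multiplier n k j)"
  and gdeg_multiplier: "gdeg (nat (int n - j - int k)) (multiplier n k j)"
proof -
  consider "\<not> (1 \<le> k \<and> k \<le> n \<and> 0 \<le> j \<and> j \<le> int n - int k)"
    | i where "j = int i" "1 \<le> k" "k \<le> n" "i \<le> n - k" by (metis (no_types) int_nat_eq le_diff_iff of_nat_diff nat_le_iff nonneg_int_cases of_nat_le_iff)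
  then have "gpar (int n) (antighost n k j) \<and> gpar (int n + 1) (multiplier n k j) \<and>
    gdeg (nat (int n - j - int k)) (antighost n k j) \<and> gdeg (nat (int n - j - int k)) (multiplier n k j)"
  proof cases
    case (2 i)
    have "nat (int n - j - int k) = n - i - k" using 2 by auto
    moreover have "even (fpar n (CBar k i)) = even (int n)" "even (fpar n (PiF k i)) = even (int n + 1)"
      using 2(2-4) by (auto simp: fpar_def gam_def even_diff_nat of_nat_diff)
    ultimately show ?thesis
      unfolding 2(1) antighost_field_form[OF 2(2-4)] multiplier_field_form[OF 2(2-4)]
      using gpar_cong[OF gpar_field_form] gdeg_field_form by (metis form_degree.simps(6,7))
  qed (auto simp: antighost_0 multiplier_0 intro: gpar_intros gdeg_intros)
  then show "gpar (int n) (antighost n k j)" "gdeg (nat (int n - j - int k)) (antighost n k j)"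
    "gpar (int n + 1) (multiplier n k j)" "gdeg (nat (int n - j - int k)) (multiplier n k j)" by auto
qed

text \<open>One formula covers all degrees because the entry index is an integer: for
  \<open>p\<close> equal to 0, 1 or \<open>n + 2\<close> the entry \<open>p - 2\<close> lies outside
  of row 1, and the shift is zero.\<close>

lemma ladder1_eq: "p \<le> n + 2 \<Longrightarrow> ladder1 n g p = field_form n (lfield1 p) + (-1) ^ (p + 1) *\<^sub>R gstar g (gd (antighost n 1 (int p - 2)))"
proof -
  assume p: "p \<le> n + 2"
  consider "p = 0" | "p = 1" | j where "p = j + 2" "j < n" | "p = n + 2" using p by (metis One_nat_def Suc_1 add_2_eq_Suc' add_le_cancel_right le_neq_implies_less not0_implies_Suc)
  then show ?thesis
    by cases (auto simp: ladder1_def lfield1_def b_hat_def antighost_def gop_simps)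
qed

lemma ladder2_eq: "p \<le> n + 2 \<Longrightarrow> ladder2 n g p = field_form n (lfield2 n p) - (if p = n + 1 then gstar g (gd (field_form n AGhost)) else 0)"
  by (auto simp: ladder2_def lfield2_def gamma_hat_def)

lemma bilinear_lsum: "bilinear f \<Longrightarrow> f (sum h A) y = (\<Sum>i\<in>A. f (h i) y)"
  and bilinear_rsum: "bilinear f \<Longrightarrow> f y (sum h A) = (\<Sum>i\<in>A. f y (h i))"
  using linear_sum[of "\<lambda>x. f x y" h A] by (auto simp: bilinear_def linear_sum)

lemma sum_rotate: "(\<Sum>a\<in>A. \<Sum>b\<in>B. \<Sum>c\<in>C. f a b c) = (\<Sum>b\<in>B. \<Sum>c\<in>C. \<Sum>a\<in>A. f a b c)"
  by (rule trans[OF sum.swap], rule sum.cong[OF refl], rule sum.swap)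

lemma sum_rotate4: "(\<Sum>c\<in>C. \<Sum>d\<in>D. \<Sum>a\<in>A. \<Sum>b\<in>B. f a b c d) = (\<Sum>a\<in>A. \<Sum>b\<in>B. \<Sum>d\<in>D. \<Sum>c\<in>C. f a b c d)"
  by (rule trans[OF sum.cong[OF refl sum_rotate]], rule trans[OF sum.swap], rule sum.cong[OF refl], rule sum_rotate)

locale bf_model =
  fixes n :: nat and g :: "('d :: {finite, linorder}) matrix"
    and br :: "('a :: finite) vector \<Rightarrow> 'a vector \<Rightarrow> 'a vector"
    and tr :: "'a vector \<Rightarrow> 'a vector \<Rightarrow> real"
  assumes n: "n \<ge> 1" and dim: "CARD('d) = n + 2" and sym: "transpose g = g" and inv: "invertible g"
    and lie: "lie_algebra br" and tr: "invariant_form br tr"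
begin

abbreviation F :: "field \<Rightarrow> ('a, 'd) gform" where "F \<equiv> field_form n"
abbreviation Cb :: "nat \<Rightarrow> int \<Rightarrow> ('a, 'd) gform" where "Cb \<equiv> antighost n"
abbreviation Pi :: "nat \<Rightarrow> int \<Rightarrow> ('a, 'd) gform" where "Pi \<equiv> multiplier n"
abbreviation l1 :: "nat \<Rightarrow> ('a, 'd) gform" where "l1 \<equiv> ladder1 n g"
abbreviation l2 :: "nat \<Rightarrow> ('a, 'd) gform" where "l2 \<equiv> ladder2 n g"

definition Phi1 :: "('a, 'd) gform" where "Phi1 = (\<Sum>p\<le>CARD('d). l1 p)"
definition Phi2 :: "('a, 'd) gform" where "Phi2 = (\<Sum>p\<le>CARD('d). l2 p)"

section \<open>Antisymmetry, invariance and the Jacobi identity carried over to forms\<close>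

lemma br_antisym: "br x y = - br y x" and br_bilinear: "bilinear br"
  and tr_sym: "tr x y = tr y x" and tr_bilinear: "bilinear tr"
proof -
  show bil: "bilinear br" and "bilinear tr" "tr x y = tr y x"
    using lie tr unfolding lie_algebra_def invariant_form_def by blast+
  have "br (x + y) (x + y) = 0" "br x x = 0" "br y y = 0" using lie by (auto simp: lie_algebra_def)
  then have "br x y + br y x = 0" by (simp add: bilinear_ladd[OF bil] bilinear_radd[OF bil] add.commute)
  then show "br x y = - br y x" by (simp add: eq_neg_iff_add_eq_0)
qed

lemma tr_invariant: "tr (br x y) z = tr x (br y z)"
  using tr unfolding invariant_form_def by blast

lemma axis_expand: "x = (\<Sum>c\<in>UNIV. x $ c *\<^sub>R axis c 1)" for x :: "'a vector"
  using basis_expansion[of x] by (simp add: scalar_mult_eq_scaleR)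

text \<open>The coefficient forms stand in the same order on both sides, so invariance carries over
  without graded signs.\<close>

lemma Tr_bracket: "Tr tr (bracket br X Y) Z = Tr tr X (bracket br Y Z)"
proof -
  let ?e = "\<lambda>a. axis a 1 :: 'a vector"
  have L: "(\<Sum>c\<in>UNIV. br (?e a) (?e b) $ c * tr (?e c) (?e d)) = tr (br (?e a) (?e b)) (?e d)" for a b d
    by (subst (2) axis_expand[of "br (?e a) (?e b)"])
      (simp add: bilinear_lsum[OF tr_bilinear] bilinear_lmul[OF tr_bilinear])
  have R: "(\<Sum>c\<in>UNIV. br (?e b) (?e d) $ c * tr (?e a) (?e c)) = tr (?e a) (br (?e b) (?e d))" for a b d
    by (subst (2) axis_expand[of "br (?e b) (?e d)"])
      (simp add: bilinear_rsum[OF tr_bilinear] bilinear_rmul[OF tr_bilinear])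
  have "Tr tr (bracket br X Y) Z = (\<Sum>c\<in>UNIV. \<Sum>d\<in>UNIV. \<Sum>a\<in>UNIV. \<Sum>b\<in>UNIV.
      (br (?e a) (?e b) $ c * tr (?e c) (?e d)) *\<^sub>R (X $ a * Y $ b * Z $ d))"
    by (simp add: Tr_def bracket_def sum_distrib_right scaleR_sum_right mult_ac)
  also have "\<dots> = (\<Sum>a\<in>UNIV. \<Sum>b\<in>UNIV. \<Sum>d\<in>UNIV. \<Sum>c\<in>UNIV.
      (br (?e a) (?e b) $ c * tr (?e c) (?e d)) *\<^sub>R (X $ a * Y $ b * Z $ d))"
    by (rule sum_rotate4)
  also have "\<dots> = (\<Sum>a\<in>UNIV. \<Sum>b\<in>UNIV. \<Sum>d\<in>UNIV. tr (?e a) (br (?e b) (?e d)) *\<^sub>R (X $ a * Y $ b * Z $ d))"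
    by (simp only: scaleR_sum_left[symmetric] L tr_invariant)
  also have "\<dots> = (\<Sum>a\<in>UNIV. \<Sum>b\<in>UNIV. \<Sum>d\<in>UNIV. \<Sum>c\<in>UNIV.
      (br (?e b) (?e d) $ c * tr (?e a) (?e c)) *\<^sub>R (X $ a * Y $ b * Z $ d))"
    by (simp add: R flip: scaleR_sum_left)
  also have "\<dots> = (\<Sum>a\<in>UNIV. \<Sum>c\<in>UNIV. \<Sum>b\<in>UNIV. \<Sum>d\<in>UNIV.
      (br (?e b) (?e d) $ c * tr (?e a) (?e c)) *\<^sub>R (X $ a * Y $ b * Z $ d))"
    by (rule sum.cong[OF refl], rule sum_rotate[symmetric])
  also have "\<dots> = Tr tr X (bracket br Y Z)"
    by (simp add: Tr_def bracket_def sum_distrib_left scaleR_sum_right mult_ac)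
  finally show ?thesis .
qed

text \<open>The Jacobi identity in Leibniz form. Only the last term exchanges the coefficients of
  \<open>X\<close> and \<open>Y\<close>, whence its sign.\<close>

lemma bracket_jacobi:
  assumes X: "gpar e X" and Y: "gpar f Y"
  shows "bracket br X (bracket br Y Z) = bracket br (bracket br X Y) Z + sg (e * f) *\<^sub>R bracket br Y (bracket br X Z)"
proof -
  let ?e = "\<lambda>a. axis a 1 :: 'a vector"
  let ?m = "\<lambda>a b d. X $ a * (Y $ b * Z $ d)"
  have rnest: "bracket br U (bracket br V Z) $ c = (\<Sum>a\<in>UNIV. \<Sum>b\<in>UNIV. \<Sum>d\<in>UNIV. (br (?e a) (br (?e b) (?e d)) $ c) *\<^sub>R (U $ a * (V $ b * Z $ d)))"
    for U V c
  proof -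
    have R: "(\<Sum>h\<in>UNIV. br (?e b) (?e d) $ h * br (?e a) (?e h) $ c) = br (?e a) (br (?e b) (?e d)) $ c" for a b d
      by (subst (2) axis_expand[of "br (?e b) (?e d)"])
        (simp add: bilinear_rsum[OF br_bilinear] bilinear_rmul[OF br_bilinear])
    have "bracket br U (bracket br V Z) $ c = (\<Sum>a\<in>UNIV. \<Sum>h\<in>UNIV. \<Sum>b\<in>UNIV. \<Sum>d\<in>UNIV.
        (br (?e b) (?e d) $ h * br (?e a) (?e h) $ c) *\<^sub>R (U $ a * (V $ b * Z $ d)))"
      by (simp add: bracket_def sum_distrib_left scaleR_sum_right mult_ac)
    also have "\<dots> = (\<Sum>a\<in>UNIV. \<Sum>b\<in>UNIV. \<Sum>d\<in>UNIV. \<Sum>h\<in>UNIV.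
        (br (?e b) (?e d) $ h * br (?e a) (?e h) $ c) *\<^sub>R (U $ a * (V $ b * Z $ d)))"
      by (rule sum.cong[OF refl], rule sum_rotate)
    finally show ?thesis by (simp add: R flip: scaleR_sum_left)
  qed
  have lnest: "bracket br (bracket br X Y) Z $ c = (\<Sum>a\<in>UNIV. \<Sum>b\<in>UNIV. \<Sum>d\<in>UNIV. (br (br (?e a) (?e b)) (?e d) $ c) *\<^sub>R ?m a b d)" for c
  proof -
    have L: "(\<Sum>h\<in>UNIV. br (?e a) (?e b) $ h * br (?e h) (?e d) $ c) = br (br (?e a) (?e b)) (?e d) $ c" for a b d
      by (subst (2) axis_expand[of "br (?e a) (?e b)"])
        (simp add: bilinear_lsum[OF br_bilinear] bilinear_lmul[OF br_bilinear])
    have "bracket br (bracket br X Y) Z $ c = (\<Sum>h\<in>UNIV. \<Sum>d\<in>UNIV. \<Sum>a\<in>UNIV. \<Sum>b\<in>UNIV.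
        (br (?e a) (?e b) $ h * br (?e h) (?e d) $ c) *\<^sub>R ?m a b d)"
      by (simp add: bracket_def sum_distrib_right scaleR_sum_right mult_ac mult.assoc)
    also have "\<dots> = (\<Sum>a\<in>UNIV. \<Sum>b\<in>UNIV. \<Sum>d\<in>UNIV. \<Sum>h\<in>UNIV.
        (br (?e a) (?e b) $ h * br (?e h) (?e d) $ c) *\<^sub>R ?m a b d)"
      by (rule sum_rotate4)
    finally show ?thesis by (simp add: L flip: scaleR_sum_left)
  qed
  have "br (?e b) (br (?e a) (?e d)) = br (?e a) (br (?e b) (?e d)) - br (br (?e a) (?e b)) (?e d)" for a b d
  proof -
    have "br (?e a) (br (?e b) (?e d)) + br (?e b) (br (?e d) (?e a)) + br (?e d) (br (?e a) (?e b)) = 0"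
      using lie by (simp add: lie_algebra_def)
    moreover have "br (?e b) (br (?e d) (?e a)) = - br (?e b) (br (?e a) (?e d))"
      by (subst br_antisym[of "?e d"]) (simp add: bilinear_rneg[OF br_bilinear])
    moreover have "br (?e d) (br (?e a) (?e b)) = - br (br (?e a) (?e b)) (?e d)" by (rule br_antisym)
    ultimately have "br (?e a) (br (?e b) (?e d)) - br (?e b) (br (?e a) (?e d)) - br (br (?e a) (?e b)) (?e d) = 0"
      by (simp only: diff_conv_add_uminus)
    then show ?thesis by (simp only: diff_diff_eq add.commute diff_eq_eq eq_diff_eq add_0)
  qed
  then have jac_c: "(br (?e a) (br (?e b) (?e d)) - br (br (?e a) (?e b)) (?e d)) $ c = br (?e b) (br (?e a) (?e d)) $ c" for a b c d
    by metis
  have "Y $ b * (X $ a * z) = sg (e * f) *\<^sub>R (X $ a * (Y $ b * z))" for a b z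
  proof -
    have "X $ a * Y $ b = sg (e * f) *\<^sub>R (Y $ b * X $ a)"
      using X Y unfolding gpar_def by (intro graded_commute) auto
    then have "(X $ a * Y $ b) * z = sg (e * f) *\<^sub>R ((Y $ b * X $ a) * z)" by simp
    then show ?thesis by (simp add: mult.assoc)
  qed
  then have "bracket br Y (bracket br X Z) $ c = (\<Sum>b\<in>UNIV. \<Sum>a\<in>UNIV. \<Sum>d\<in>UNIV. (br (?e b) (br (?e a) (?e d)) $ c) *\<^sub>R (sg (e * f) *\<^sub>R ?m a b d))" for c
    unfolding rnest by simp
  then have "bracket br Y (bracket br X Z) $ c = sg (e * f) *\<^sub>R (\<Sum>a\<in>UNIV. \<Sum>b\<in>UNIV. \<Sum>d\<in>UNIV. (br (?e b) (br (?e a) (?e d)) $ c) *\<^sub>R ?m a b d)" for c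
    unfolding scaleR_sum_right by (simp only: scaleR_scaleR mult.commute[of "sg _"]) (rule sum.swap)
  then have "bracket br Y (bracket br X Z) $ c = sg (e * f) *\<^sub>R (bracket br X (bracket br Y Z) $ c - bracket br (bracket br X Y) Z $ c)" for c
    unfolding rnest[of X Y] lnest sum_subtractf[symmetric] vector_minus_component[symmetric] scaleR_diff_left[symmetric] jac_c .
  then show ?thesis by (simp add: vec_eq_iff)
qed

text \<open>The Hodge dual of \<open>d\<close> of an antighost has the parity and the form degree of
  the source it is added to, which is where the dimension \<open>n + 2\<close> enters.\<close>

lemma gpar_l1: "gpar 1 (l1 p)" and gdeg_l1: "gdeg p (l1 p)"
  and gpar_l2: "gpar (int n) (l2 p)" and gdeg_l2: "gdeg p (l2 p)"
proof -
  have "gpar 1 (l1 p) \<and> gdeg p (l1 p) \<and> gpar (int n) (l2 p) \<and> gdeg p (l2 p)"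
  proof (cases "p \<le> n + 2")
    case True
    have "gpar (int n + 1 + int CARD('d)) (gstar g (gd (Cb 1 (int p - 2))))"
      by (intro gpar_gop gpar_antighost)
    then have a: "gpar 1 (gstar g (gd (Cb 1 (int p - 2))))" by (rule gpar_cong) (simp add: dim)
    have b: "gdeg p (gstar g (gd (Cb 1 (int p - 2))))"
    proof (cases "2 \<le> p \<and> p \<le> n + 1")
      case True
      have "gdeg (CARD('d) - (nat (int n - (int p - 2) - int 1) + 1)) (gstar g (gd (Cb 1 (int p - 2))))"
        by (intro gdeg_gop gdeg_antighost)
      moreover have "CARD('d) - (nat (int n - (int p - 2) - int 1) + 1) = p" using True by (auto simp: dim)
      ultimately show ?thesis by simp
    next
      case False
      then have "Cb 1 (int p - 2) = 0" by (auto simp: antighost_def)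
      then show ?thesis by (simp add: gop_simps gdeg_intros)
    qed
    have "fpar n AGhost = -1" by (simp add: fpar_def)
    then have "gpar (- 1 + 1 + int CARD('d)) (gstar g (gd (F AGhost)))"
      by (intro gpar_gop) (metis gpar_field_form)
    then have c: "gpar (int n) (gstar g (gd (F AGhost)))" by (rule gpar_cong) (simp add: dim)
    have d: "gdeg (n + 1) (gstar g (gd (F AGhost)))"
      using gdeg_gop(3)[OF gdeg_gop(1)[OF gdeg_field_form[of n AGhost]], of g] by (simp add: dim)
    show ?thesis
      using True gpar_field_form[of n "lfield1 p"] gdeg_field_form[of n "lfield1 p"] gpar_field_form[of n "lfield2 n p"] gdeg_field_form[of n "lfield2 n p"] a b c d
      by (auto simp: ladder1_eq ladder2_eq lfield1_props lfield2_props intro!: gpar_intros gdeg_intros)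
  next
    case False
    then show ?thesis by (auto simp: ladder1_def ladder2_def intro: gpar_intros gdeg_intros)
  qed
  then show "gpar 1 (l1 p)" "gdeg p (l1 p)" "gpar (int n) (l2 p)" "gdeg p (l2 p)" by auto
qed

lemma gpar_Phi1: "gpar 1 Phi1" and gpar_Phi2: "gpar (int n) Phi2"
  by (auto simp: Phi1_def Phi2_def intro!: gpar_sum gpar_l1 gpar_l2)

lemma l1_big: "p > n + 2 \<Longrightarrow> l1 p = 0" and l2_big: "p > n + 2 \<Longrightarrow> l2 p = 0"
  by (auto simp: ladder1_def ladder2_def)

lemma gpart_Phi1: "gmap (part p) Phi1 = l1 p" and gpart_Phi2: "gmap (part p) Phi2 = l2 p"
  by (cases "p \<le> n + 2"; simp add: dim Phi1_def Phi2_def gpart_simps gpart_gdeg[OF gdeg_l1] gpart_gdeg[OF gdeg_l2] l1_big l2_big del: sum.atMost_Suc)+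

subsection \<open>The action as a top degree part\<close>

definition Lagr :: "('a, 'd) lform" where
  "Lagr = Tr tr Phi1 (gd Phi2) + (1/2) *\<^sub>R Tr tr (bracket br Phi1 Phi1) Phi2"

text \<open>The curvature of the generalized connection \<open>Phi1\<close>.\<close>

definition E1 :: "('a, 'd) gform" where
  "E1 = gd Phi1 + (1/2) *\<^sub>R bracket br Phi1 Phi1"

text \<open>The covariant derivative of \<open>Phi2\<close> with respect to
  \<open>Phi1\<close>.\<close>

definition E2 :: "('a, 'd) gform" where
  "E2 = gd Phi2 + bracket br Phi1 Phi2"

lemma gpar_E1: "gpar 2 E1" and gpar_E2: "gpar (int n + 1) E2"
  using gpar_gop(1)[OF gpar_Phi1] gpar_bracket[OF gpar_Phi1 gpar_Phi1] gpar_gop(1)[OF gpar_Phi2] gpar_bracket[OF gpar_Phi1 gpar_Phi2]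
  by (auto simp: E1_def E2_def add.commute intro!: gpar_intros)

lemma Sigma_hat_eq: "Sigma_hat n g br tr = part (n + 2) Lagr"
proof -
  have "part (n + 2) (Tr tr Phi1 (gd Phi2)) = (\<Sum>p\<le>CARD('d). part (n + 2) (Tr tr (l1 p) (gd Phi2)))"
    by (simp add: Phi1_def Tr_simps part_simps)
  also have "\<dots> = (\<Sum>p\<le>CARD('d). if p = n + 2 then 0 else Tr tr (l1 p) (gd (l2 (n + 1 - p))))"
    by (intro sum.cong refl) (auto simp: dim part_Tr[OF gdeg_l1] gpart_gd gpart_Phi2 Tr_simps)
  also have "\<dots> = (\<Sum>p = 0..n + 1. Tr tr (l1 p) (gd (l2 (n + 1 - p))))"
    by (intro sum.mono_neutral_cong_right) (auto simp: dim)
  finally have 1: "part (n + 2) (Tr tr Phi1 (gd Phi2)) = (\<Sum>p = 0..n + 1. Tr tr (l1 p) (gd (l2 (n + 1 - p))))" .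
  have "part (n + 2) (Tr tr (bracket br Phi1 Phi1) Phi2) = (\<Sum>p\<le>CARD('d). \<Sum>q\<le>CARD('d). part (n + 2) (Tr tr (bracket br (l1 p) (l1 q)) Phi2))"
    by (simp add: Phi1_def Tr_simps part_simps bracket_simps) (rule sum.swap)
  also have "\<dots> = (\<Sum>p = 0..n + 2. \<Sum>q = 0..n + 2 - p. Tr tr (bracket br (l1 p) (l1 q)) (l2 (n + 2 - p - q)))"
  proof (rule sum.cong)
    fix p assume "p \<in> {0..n + 2}"
    have "(\<Sum>q\<le>CARD('d). part (n + 2) (Tr tr (bracket br (l1 p) (l1 q)) Phi2))
       = (\<Sum>q\<le>CARD('d). if p + q \<le> n + 2 then Tr tr (bracket br (l1 p) (l1 q)) (l2 (n + 2 - p - q)) else 0)"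
      by (intro sum.cong refl) (simp add: part_Tr[OF gdeg_bracket[OF gdeg_l1 gdeg_l1]] gpart_Phi2)
    also have "\<dots> = (\<Sum>q = 0..n + 2 - p. Tr tr (bracket br (l1 p) (l1 q)) (l2 (n + 2 - p - q)))"
      using \<open>p \<in> {0..n + 2}\<close> by (intro sum.mono_neutral_cong_right) (auto simp: dim)
    finally show "(\<Sum>q\<le>CARD('d). part (n + 2) (Tr tr (bracket br (l1 p) (l1 q)) Phi2)) =
      (\<Sum>q = 0..n + 2 - p. Tr tr (bracket br (l1 p) (l1 q)) (l2 (n + 2 - p - q)))" .
  qed (auto simp: dim)
  finally show ?thesis
    unfolding Sigma_hat_def Lagr_def part_simps 1 by (simp only:)
qed

text \<open>The first variation. The even parity of \<open>Q\<close> avoids signs; the two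
  variations of the bracket are equal and absorb the factor one half, and the exact term comes from
  moving \<open>d\<close> off the variation of \<open>Phi2\<close>.\<close>

lemma evol_Lagr:
  assumes Q: "evol 0 Q"
  shows "Q Lagr = Tr tr (gmap Q Phi1) E2 + Tr tr (gmap Q Phi2) E1 - ext_d (Tr tr Phi1 (gmap Q Phi2))"
proof -
  note D = evol_is_der[OF Q]
  let ?X = "gmap Q Phi1" and ?Y = "gmap Q Phi2"
  have X: "gpar 1 ?X" and Y: "gpar (int n) ?Y"
    using gpar_der[OF D gpar_Phi1] gpar_der[OF D gpar_Phi2] by auto
  have d: "ext_d (Tr tr Phi1 ?Y) = Tr tr (gd Phi1) ?Y - Tr tr Phi1 (gd ?Y)"
    using is_der_Tr[OF is_der_ext_d gpar_Phi1] by (simp add: gop_gmap)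
  have B: "gpar 2 (bracket br Phi1 Phi1)" using gpar_bracket[OF gpar_Phi1 gpar_Phi1] by simp
  have "bracket br Phi1 ?X = bracket br ?X Phi1"
    using bracket_commute[OF gpar_Phi1 X, of br, OF br_antisym] by simp
  moreover have "Q Lagr = Tr tr ?X (gd Phi2) + Tr tr Phi1 (gd ?Y) + (1/2) *\<^sub>R (Tr tr (bracket br ?X Phi1 + bracket br Phi1 ?X) Phi2 + Tr tr (bracket br Phi1 Phi1) ?Y)"
    unfolding Lagr_def
    by (simp add: is_der_simps[OF D] is_der_Tr[OF D gpar_Phi1] is_der_Tr[OF D B] is_der_bracket[OF D gpar_Phi1] evol_gop(1)[OF Q])
  moreover have "Tr tr (bracket br Phi1 Phi1) ?Y = Tr tr ?Y (bracket br Phi1 Phi1)" "Tr tr (gd Phi1) ?Y = Tr tr ?Y (gd Phi1)"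
    using Tr_commute[OF B Y, of tr, OF tr_sym] Tr_commute[OF gpar_gop(1)[OF gpar_Phi1] Y, of tr, OF tr_sym] by (simp_all add: sg_def)
  ultimately show ?thesis
    by (simp add: d E1_def E2_def Tr_simps Tr_bracket scaleR_right_distrib flip: scaleR_2)
qed

lemma Tr_hodge_commute:
  assumes "gpar e X" "gpar f Y" "gdeg p X" "gdeg p Y"
  shows "Tr tr X (gstar g Y) = sg (e * f + int p) *\<^sub>R Tr tr Y (gstar g X)"
proof -
  have "X $ a * hodge g (Y $ b) = sg (e * f + int p) *\<^sub>R (Y $ b * hodge g (X $ a))" for a b
    using assms unfolding gpar_def gdeg_def by (intro hodge_symmetric[OF inv sym]) auto
  then have "Tr tr X (gstar g Y) = (\<Sum>a\<in>UNIV. \<Sum>b\<in>UNIV. tr (axis b 1) (axis a 1) *\<^sub>R (sg (e * f + int p) *\<^sub>R (Y $ b * hodge g (X $ a))))"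
    by (simp add: Tr_def tr_sym[of "axis _ 1" "axis _ 1"])
  also have "\<dots> = sg (e * f + int p) *\<^sub>R Tr tr Y (gstar g X)"
    by (subst sum.swap) (simp add: Tr_def scaleR_sum_right mult.commute)
  finally show ?thesis .
qed

subsection \<open>Functional derivatives of the action\<close>

context
  fixes x :: "nat \<Rightarrow> nat \<Rightarrow> nat \<Rightarrow> real"
begin

abbreviation S0 :: "('a, 'd) lform" where "S0 \<equiv> Sigma_action n g br tr x"

text \<open>\<open>BF j\<close> has ghost number \<open>j\<close>, so the index can be chosen with
  either parity; beyond \<open>n\<close> it names no field of the model.\<close>

definition test_field :: "field \<Rightarrow> field" where
  "test_field \<phi> = BF (2 * n + 2 + (if even (ghost_number \<phi>) then 0 else 1))"

lemma test_field_props: "even (ghost_number (test_field \<phi>)) = even (ghost_number \<phi>)" "test_field \<phi> \<notin> fields n"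
  by (auto simp: test_field_def fields_def)

lemma field_free_F: "t \<notin> fields n \<Longrightarrow> field_free t (F \<phi>)"
  using field_free_field_form[of t \<phi> n] by (cases "t = \<phi>") (simp_all add: field_form_def field_free_intros)

lemma field_free_Cb: "t \<notin> fields n \<Longrightarrow> field_free t (Cb k j)" and field_free_Pi: "t \<notin> fields n \<Longrightarrow> field_free t (Pi k j)"
  by (auto simp: antighost_def multiplier_def field_free_intros field_free_F)

lemma field_free_l1: "t \<notin> fields n \<Longrightarrow> field_free t (l1 p)" and field_free_l2: "t \<notin> fields n \<Longrightarrow> field_free t (l2 p)"
  by (auto simp: ladder1_def ladder2_def b_hat_def gamma_hat_def
      intro!: field_free_intros field_free_F field_free_Cb field_free_gd field_free_gstar)

lemma field_free_Phi: "t \<notin> fields n \<Longrightarrow> field_free t Phi1" "t \<notin> fields n \<Longrightarrow> field_free t Phi2"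
  by (auto simp: Phi1_def Phi2_def intro!: field_free_sum field_free_l1 field_free_l2)

lemma field_free_E: "t \<notin> fields n \<Longrightarrow> field_free t E1" "t \<notin> fields n \<Longrightarrow> field_free t E2"
  by (auto simp: E1_def E2_def intro!: field_free_intros field_free_gd field_free_bracket[OF _ _ gpar_Phi1] field_free_Phi)

lemma lfield_free_part: "lfield_free t y \<Longrightarrow> lfield_free t (part p y)"
  by (simp add: lfield_free_def part_vert[OF vert_pderiv_jet, symmetric] part_simps)

lemma lfield_free_action:
  assumes "t \<notin> fields n"
  shows "lfield_free t S0"
proof -
  have "lfield_free t Lagr"
    unfolding Lagr_def
    by (intro lfield_free_intros lfield_free_Tr[OF _ _ gpar_Phi1] lfield_free_Tr[OF _ _ gpar_bracket[OF gpar_Phi1 gpar_Phi1]]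
        field_free_bracket[OF _ _ gpar_Phi1] field_free_gd field_free_Phi assms)
  then show ?thesis
    unfolding Sigma_action_def Sigma_hat_eq Sigma_Pi_def
    by (intro lfield_free_intros lfield_free_part lfield_free_sum
        lfield_free_Tr[OF _ _ gpar_gop(1)[OF gpar_field_form]] lfield_free_Tr[OF _ _ gpar_gop(1)[OF gpar_multiplier]]
        lfield_free_Tr[OF _ _ gpar_gop(1)[OF gpar_antighost]] lfield_free_Tr[OF _ _ gpar_multiplier]
        field_free_gd field_free_gstar field_free_F field_free_Cb field_free_Pi assms)
qed

context
  fixes \<phi> t :: field
  assumes t: "even (ghost_number t) = even (ghost_number \<phi>)"
    and \<phi>: "\<And>k j. \<phi> \<noteq> CBar k j" "\<And>k j. \<phi> \<noteq> PiF k j" "\<phi> \<noteq> Mult" "\<phi> \<noteq> AGhost"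
begin

abbreviation V :: "('a, 'd) lform \<Rightarrow> ('a, 'd) lform" where "V \<equiv> variation \<phi> t"

lemma evol_V: "evol 0 V" by (rule evol_variation[OF t])

lemmas V_F = variation_field_form[OF t]
lemmas V_simps = gmap_simps[OF evol_is_der[OF evol_V]]

lemma V_Cb: "gmap V (Cb k j) = 0" and V_Pi: "gmap V (Pi k j) = 0"
proof -
  have F: "\<psi> \<noteq> \<phi> \<Longrightarrow> gmap V (F \<psi>) = 0" for \<psi>
    using V_F[of \<psi> n] by (cases "\<psi> \<in> fields n") (auto simp: field_form_def V_simps)
  show "gmap V (Cb k j) = 0" "gmap V (Pi k j) = 0"
    using \<phi> by (auto simp: antighost_def multiplier_def V_simps intro!: F)
qed

lemma V_l1: "p \<le> n + 2 \<Longrightarrow> gmap V (l1 p) = (if lfield1 p = \<phi> then test_form p t else 0)"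
  and V_l2: "p \<le> n + 2 \<Longrightarrow> gmap V (l2 p) = (if lfield2 n p = \<phi> then test_form p t else 0)"
proof -
  have "AGhost \<in> fields n" by (simp add: fields_def)
  then have "gmap V (F AGhost) = 0" using \<phi> by (subst V_F) auto
  then show "p \<le> n + 2 \<Longrightarrow> gmap V (l1 p) = (if lfield1 p = \<phi> then test_form p t else 0)"
    "p \<le> n + 2 \<Longrightarrow> gmap V (l2 p) = (if lfield2 n p = \<phi> then test_form p t else 0)"
    by (auto simp: ladder1_eq ladder2_eq V_simps evol_gop[OF evol_V] V_Cb V_F lfield1_props lfield2_props gop_simps)
qed

text \<open>All other terms of the gauge fixing pair fields from the antighost rows, none of which
  is varied here.\<close>

lemma V_Sigma_Pi: "V (Sigma_Pi n g tr x) = - Tr tr (gd (F Mult)) (gstar g (gmap V (F Conn)))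
    - (\<Sum>j = 0..<n. Tr tr (gd (Pi 1 (int j))) (gstar g (gmap V (F (BF j)))))"
proof -
  note D = evol_is_der[OF evol_V]
  have M: "gmap V (F Mult) = 0" using \<phi> by (subst V_F) (auto simp: fields_def)
  show ?thesis
    unfolding Sigma_Pi_def
    by (simp add: is_der_simps[OF D] is_der_Tr[OF D gpar_gop(1)[OF gpar_field_form]] is_der_Tr[OF D gpar_gop(1)[OF gpar_multiplier]]
        is_der_Tr[OF D gpar_gop(1)[OF gpar_antighost]] is_der_Tr[OF D gpar_multiplier] evol_gop[OF evol_V] V_Cb V_Pi M gop_simps Tr_simps)
qed

end

text \<open>Varying the entry of degree \<open>q\<close> leaves \<open>Phi2\<close> fixed, so no
  exact remainder arises. The extra term at \<open>q = 1\<close> is the gauge fixing of the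
  connection, brought into place by the symmetry of the Hodge pairing.\<close>

lemma functional_deriv_lfield1:
  assumes q: "q \<le> n + 2"
  shows "functional_deriv n tr S0 (lfield1 q) = gmap (part (n + 2 - q)) E2 - (if q = 1 then gstar g (gd (F Mult)) else 0)"
    (is "_ = ?X")
proof -
  let ?\<phi> = "lfield1 q" and ?t = "test_field (lfield1 q)"
  let ?T = "test_form q ?t :: ('a, 'd) gform"
  note t = test_field_props[of ?\<phi>]
  note \<phi> = lfield_neq(2,3)[of q] lfield_neq(5)[of q] lfield_neq(4)[of q]
  have fd: "form_degree n ?\<phi> = q" "?\<phi> \<in> fields n" and fp: "fpar n ?\<phi> = 1" using lfield1_props[OF q] by auto
  have T1: "gpar 1 ?T"
    by (rule gpar_cong[OF gpar_test_form]) (use t(1) arg_cong[OF fp, of even] fd(1) in \<open>simp add: fpar_def\<close>)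
  show ?thesis
  proof (rule functional_deriv_eqI[OF tr t(1)])
    show "lfield_free ?t S0" by (rule lfield_free_action[OF t(2)])
    show "field_free ?t ?X"
      using t(2) by (cases "q = 1") (simp_all add: field_free_intros field_free_gpart field_free_E field_free_gd field_free_gstar field_free_F)
    have "gdeg (CARD('d) - 1) (gstar g (gd (F Mult)))"
      using gdeg_gop(3)[OF gdeg_gop(1)[OF gdeg_field_form[of n Mult]], of g] by simp
    then show "gdeg (CARD('d) - form_degree n ?\<phi>) ?X"
      by (auto simp: fd dim intro!: gdeg_intros gdeg_gpart)
    show "form_degree n ?\<phi> \<le> CARD('d)" using q by (simp add: fd dim)
    let ?V = "variation ?\<phi> ?t :: ('a, 'd) lform \<Rightarrow> _"
    note eV = evol_variation[OF t(1)]
    have "gmap ?V Phi1 = (\<Sum>p\<le>CARD('d). if q = p then ?T else 0)"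
      unfolding Phi1_def gmap_simps[OF evol_is_der[OF eV]]
      by (intro sum.cong refl) (auto simp: dim V_l1[OF t(1) \<phi>] lfield1_inj)
    then have 1: "gmap ?V Phi1 = ?T" using q by (simp add: dim del: sum.atMost_Suc)
    have 2: "gmap ?V Phi2 = 0"
      unfolding Phi2_def gmap_simps[OF evol_is_der[OF eV]]
      by (intro sum.neutral) (auto simp: dim V_l2[OF t(1) \<phi>] lfield_neq(1)[symmetric])
    have "?V (Sigma_hat n g br tr) = part (n + 2) (Tr tr ?T E2)"
      unfolding Sigma_hat_eq by (simp add: part_vert[OF evol_vert[OF eV], symmetric] evol_Lagr[OF eV] 1 2 Tr_simps ext_d_simps part_simps)
    then have A: "?V (Sigma_hat n g br tr) = Tr tr ?T (gmap (part (n + 2 - q)) E2)"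
      using q by (simp add: part_Tr[OF gdeg_test_form])
    have C: "gmap ?V (F Conn) = (if q = 1 then ?T else 0)"
      using variation_field_form[OF t(1), of Conn n] lfield1_inj[of 1 q] by (auto simp: fields_def lfield1_def fd)
    have B: "gmap ?V (F (BF j)) = 0" if "j < n" for j
      using variation_field_form[OF t(1), of "BF j" n] that by (auto simp: fields_def lfield1_def)
    have m: "gpar 1 (gd (F Mult))" "gdeg 1 (gd (F Mult))"
      using gpar_gop(1)[OF gpar_field_form[of n Mult]] gdeg_gop(1)[OF gdeg_field_form[of n Mult]] by (simp_all add: fpar_def)
    have "Tr tr (gd (F Mult)) (gstar g (gmap ?V (F Conn))) = Tr tr ?T (if q = 1 then gstar g (gd (F Mult)) else 0)"
      using Tr_hodge_commute[OF m(1) T1 m(2)] gdeg_test_form[of 1 ?t] by (auto simp: C gop_simps Tr_simps sg_def)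
    then have "?V (Sigma_Pi n g tr x) = - Tr tr ?T (if q = 1 then gstar g (gd (F Mult)) else 0)"
      by (simp add: V_Sigma_Pi[OF t(1) \<phi>] B gop_simps Tr_simps)
    then have "?V S0 = Tr tr ?T ?X"
      by (simp add: Sigma_action_def is_der_simps[OF evol_is_der[OF eV]] A Tr_simps)
    then show "exact (?V S0 - Tr tr (test_form (form_degree n ?\<phi>) ?t) ?X)" by (simp add: fd)
  qed
qed

text \<open>Here the integration by parts in \<open>evol_Lagr\<close> does leave an exact remainder.
  The gauge fixing contributes for \<open>1 \<le> q \<le> n\<close> only; elsewhere the entry
  \<open>n - q\<close> lies outside of row 1.\<close>

lemma functional_deriv_lfield2:
  assumes q: "q \<le> n + 2"
  shows "functional_deriv n tr S0 (lfield2 n q) = gmap (part (n + 2 - q)) E1 - sg (int n + int q) *\<^sub>R gstar g (gd (Pi 1 (int n - int q)))"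
    (is "_ = ?X")
proof -
  let ?\<phi> = "lfield2 n q" and ?t = "test_field (lfield2 n q)"
  let ?T = "test_form q ?t :: ('a, 'd) gform"
  note t = test_field_props[of ?\<phi>]
  note \<phi> = lfield_neq(6,7)[of n q] lfield_neq(9)[of n q] lfield_neq(8)[of n q]
  have fd: "form_degree n ?\<phi> = q" "?\<phi> \<in> fields n" and fp: "fpar n ?\<phi> = int n" using lfield2_props[OF q] by auto
  have T1: "gpar (int n) ?T"
    by (rule gpar_cong[OF gpar_test_form]) (use t(1) arg_cong[OF fp, of even] fd(1) in \<open>simp add: fpar_def\<close>)
  have P0: "Pi 1 (int n - int q) = 0" if "\<not> (1 \<le> q \<and> q \<le> n)"
    using that by (auto simp: multiplier_def)
  have P: "gpar (int n) (gd (Pi 1 j))" for j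
    by (rule gpar_cong[OF gpar_gop(1)[OF gpar_multiplier]]) simp
  have Pd: "gdeg q (gd (Pi 1 (int n - int q)))"
  proof (cases "1 \<le> q \<and> q \<le> n")
    case True
    then have "nat (int n - (int n - int q) - int 1) + 1 = q" by auto
    then show ?thesis using gdeg_gop(1)[OF gdeg_multiplier[of n "int n - int q" 1]] by simp
  next
    case False
    then show ?thesis unfolding P0[OF False] by (simp add: gop_simps gdeg_intros)
  qed
  show ?thesis
  proof (rule functional_deriv_eqI[OF tr t(1)])
    show "lfield_free ?t S0" by (rule lfield_free_action[OF t(2)])
    show "field_free ?t ?X"
      by (auto intro!: field_free_intros field_free_gpart field_free_E field_free_gd field_free_gstar field_free_Pi t)
    show "gdeg (CARD('d) - form_degree n ?\<phi>) ?X"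
      using gdeg_gop(3)[OF Pd, of g] by (auto simp: fd dim intro!: gdeg_intros gdeg_gpart)
    show "form_degree n ?\<phi> \<le> CARD('d)" using q by (simp add: fd dim)
    let ?V = "variation ?\<phi> ?t :: ('a, 'd) lform \<Rightarrow> _"
    note eV = evol_variation[OF t(1)]
    have "gmap ?V Phi2 = (\<Sum>p\<le>CARD('d). if q = p then ?T else 0)"
      unfolding Phi2_def gmap_simps[OF evol_is_der[OF eV]]
      using q by (intro sum.cong refl) (auto simp: dim V_l2[OF t(1) \<phi>] lfield2_inj)
    then have 1: "gmap ?V Phi2 = ?T" using q by (simp add: dim del: sum.atMost_Suc)
    have 2: "gmap ?V Phi1 = 0"
      unfolding Phi1_def gmap_simps[OF evol_is_der[OF eV]]
      by (intro sum.neutral) (auto simp: dim V_l1[OF t(1) \<phi>] lfield_neq(1))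
    have "?V (Sigma_hat n g br tr) = part (n + 2) (Tr tr ?T E1) - ext_d (part (n + 1) (Tr tr Phi1 ?T))"
      unfolding Sigma_hat_eq using part_ext_d[of "n + 1" "Tr tr Phi1 ?T"]
      by (simp add: part_vert[OF evol_vert[OF eV], symmetric] evol_Lagr[OF eV] 1 2 Tr_simps part_simps)
    then have A: "?V (Sigma_hat n g br tr) = Tr tr ?T (gmap (part (n + 2 - q)) E1) - ext_d (part (n + 1) (Tr tr Phi1 ?T))"
      using q by (simp add: part_Tr[OF gdeg_test_form])
    have C: "gmap ?V (F Conn) = 0"
      using variation_field_form[OF t(1), of Conn n] by (auto simp: fields_def lfield2_def)
    have B: "gmap ?V (F (BF j)) = (if q \<le> n \<and> j = n - q then ?T else 0)" if "j < n" for j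
      using variation_field_form[OF t(1), of "BF j" n] that by (auto simp: fields_def lfield2_def fd)
    have "(\<Sum>j = 0..<n. Tr tr (gd (Pi 1 (int j))) (gstar g (gmap ?V (F (BF j)))))
      = (\<Sum>j = 0..<n. if j = n - q then (if q \<le> n then Tr tr (gd (Pi 1 (int j))) (gstar g ?T) else 0) else 0)"
      by (intro sum.cong refl) (auto simp: B gop_simps Tr_simps)
    also have "\<dots> = Tr tr (gd (Pi 1 (int n - int q))) (gstar g ?T)"
    proof (cases "1 \<le> q \<and> q \<le> n")
      case True
      then show ?thesis using n by (auto simp: of_nat_diff)
    next
      case False
      then show ?thesis unfolding P0[OF False] by (auto simp: gop_simps Tr_simps intro!: sum.neutral)
    qed
    also have "\<dots> = sg (int n + int q) *\<^sub>R Tr tr ?T (gstar g (gd (Pi 1 (int n - int q))))"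
      using Tr_hodge_commute[OF P T1 Pd gdeg_test_form] sg_cong[of "int n * int n + int q" "int n + int q"] by simp
    finally have "?V (Sigma_Pi n g tr x) = - sg (int n + int q) *\<^sub>R Tr tr ?T (gstar g (gd (Pi 1 (int n - int q))))"
      by (simp add: V_Sigma_Pi[OF t(1) \<phi>] C gop_simps Tr_simps)
    then have "?V S0 - Tr tr ?T ?X = - ext_d (part (n + 1) (Tr tr Phi1 ?T))"
      by (simp add: Sigma_action_def is_der_simps[OF evol_is_der[OF eV]] A Tr_simps)
    then show "exact (?V S0 - Tr tr (test_form (form_degree n ?\<phi>) ?t) ?X)" by (simp add: fd exact_uminus)
  qed
qed

text \<open>The pairing of fields and sources in the Slavnov operator exchanges degree
  \<open>p\<close> of one ladder with the complementary degree \<open>n + 2 - p\<close> of the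
  other, so the case distinctions of its definition collapse.\<close>

lemma slavnov_lfield1:
  assumes p: "p \<le> n + 2"
  shows "slavnov_transf n tr S0 (lfield1 p) = gmap (part p) E1 + (-1) ^ (p + 1) *\<^sub>R gstar g (gd (Pi 1 (int p - 2)))"
proof -
  have "slavnov_transf n tr S0 (lfield1 p) = functional_deriv n tr S0 (lfield2 n (n + 2 - p))"
    using p by (auto simp: lfield1_def lfield2_def)
  also have "\<dots> = gmap (part p) E1 - sg (int n + int (n + 2 - p)) *\<^sub>R gstar g (gd (Pi 1 (int n - int (n + 2 - p))))"
    using p by (subst functional_deriv_lfield2) auto
  also have "int n - int (n + 2 - p) = int p - 2" using p by simp
  also have "sg (int n + int (n + 2 - p)) = - ((-1) ^ (p + 1))"
    using p by (simp add: sg_def minus_one_power_iff)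
  finally show ?thesis by simp
qed

lemma slavnov_lfield2:
  assumes p: "p \<le> n + 2"
  shows "slavnov_transf n tr S0 (lfield2 n p) = gmap (part p) E2 - (if p = n + 1 then gstar g (gd (F Mult)) else 0)"
proof -
  have "slavnov_transf n tr S0 (lfield2 n p) = functional_deriv n tr S0 (lfield1 (n + 2 - p))"
    using p by (auto simp: lfield1_def lfield2_def le_Suc_eq)
  also have "\<dots> = gmap (part p) E2 - (if p = n + 1 then gstar g (gd (F Mult)) else 0)"
    using p by (subst functional_deriv_lfield1) auto
  finally show ?thesis .
qed

end

subsection \<open>Equality of operators\<close>

lemma gpar_F: "gpar (fpar n \<phi>) (F \<phi>)" and gdeg_F: "gdeg (form_degree n \<phi>) (F \<phi>)"
  by (rule gpar_field_form, rule gdeg_field_form)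

lemma gpar_Pi: "gpar (int n + 1) (Pi k j)" and gdeg_Pi: "gdeg (nat (int n - j - int k)) (Pi k j)"
  by (rule gpar_multiplier, rule gdeg_multiplier)

lemma field_form_ladder:
  assumes "p \<le> n + 2"
  shows "F (lfield1 p) = l1 p - (-1) ^ (p + 1) *\<^sub>R gstar g (gd (Cb 1 (int p - 2)))"
    "F (lfield2 n p) = l2 p + (if p = n + 1 then gstar g (gd (F AGhost)) else 0)"
  using assms by (simp_all add: ladder1_eq ladder2_eq)

text \<open>Comparing operators on the shifted ladders is as good as on the bare fields, since the
  shifts are built from antighosts, on which agreement is assumed as well.\<close>

lemma model_eqI:
  assumes Q: "evol 0 Q" and R: "evol 0 R"
    and nf: "\<And>v. \<not> field_jet n v \<Longrightarrow> Q (jvar v) = R (jvar v)"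
    and l1: "\<And>p. p \<le> n + 2 \<Longrightarrow> gmap Q (l1 p) = gmap R (l1 p)"
    and l2: "\<And>p. p \<le> n + 2 \<Longrightarrow> gmap Q (l2 p) = gmap R (l2 p)"
    and AG: "gmap Q (F AGhost) = gmap R (F AGhost)" and M: "gmap Q (F Mult) = gmap R (F Mult)"
    and C: "\<And>k j. 1 \<le> k \<Longrightarrow> k \<le> n \<Longrightarrow> j \<le> n - k \<Longrightarrow> gmap Q (Cb k (int j)) = gmap R (Cb k (int j))"
    and P: "\<And>k j. 1 \<le> k \<Longrightarrow> k \<le> n \<Longrightarrow> j \<le> n - k \<Longrightarrow> gmap Q (Pi k (int j)) = gmap R (Pi k (int j))"
  shows "Q = R"
proof (rule evol_eqI[OF Q R nf])
  note s = gmap_simps[OF evol_is_der[OF Q]] gmap_simps[OF evol_is_der[OF R]] evol_gop[OF Q] evol_gop[OF R]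
  have C1: "gmap Q (Cb 1 j) = gmap R (Cb 1 j)" for j
  proof (cases "0 \<le> j \<and> j \<le> int n - 1")
    case True
    then show ?thesis using C[of 1 "nat j"] n by auto
  next
    case False
    then have "Cb 1 j = 0" by (auto simp: antighost_def)
    then show ?thesis by (simp add: s)
  qed
  fix \<phi> assume "\<phi> \<in> fields n"
  then show "gmap Q (F \<phi>) = gmap R (F \<phi>)"
  proof (cases rule: fields_cases)
    case (3 p)
    then show ?thesis unfolding 3(2) field_form_ladder[OF 3(1)] by (simp add: s C1[simplified] l1)
  next
    case (4 p)
    then show ?thesis unfolding 4(2) field_form_ladder[OF 4(1)] by (simp add: s AG l2)
  next
    case (5 k j)
    then show ?thesis using C[of k j] by (simp add: antighost_field_form)
  next
    case (6 k j)
    then show ?thesis using P[of k j] by (simp add: multiplier_field_form)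
  qed (simp_all add: AG M)
qed

lemma ladder_of_total:
  assumes "evol e Q"
  shows "gmap Q (l1 p) = gmap (part p) (gmap Q Phi1)" "gmap Q (l2 p) = gmap (part p) (gmap Q Phi2)"
  by (simp_all add: gpart_evol[OF assms] gpart_Phi1 gpart_Phi2)

subsection \<open>Translations\<close>

lemma homogeneous_trans: "homogeneous n 0 (\<lambda>\<phi>. gLie \<epsilon> (F \<phi>))"
  by (auto simp: homogeneous_def intro!: gpar_gop gdeg_gop gpar_field_form gdeg_field_form)

lemma evol_W_trans: "evol 0 (W_trans n \<epsilon> :: ('a, 'd) lform \<Rightarrow> _)"
  unfolding W_trans_def by (rule evol_field_operator[OF homogeneous_trans])

lemma W_trans_F: "\<phi> \<in> fields n \<Longrightarrow> gmap (W_trans n \<epsilon>) (F \<phi>) = gLie \<epsilon> (F \<phi>)"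
  unfolding W_trans_def by (rule field_operator_field_form[OF homogeneous_trans])

lemma W_trans_Cb: "gmap (W_trans n \<epsilon>) (Cb k j) = gLie \<epsilon> (Cb k j)"
  and W_trans_Pi: "gmap (W_trans n \<epsilon>) (Pi k j) = gLie \<epsilon> (Pi k j)"
  by (auto simp: antighost_def multiplier_def gmap_simps[OF evol_is_der[OF evol_W_trans]] gop_simps fields_def le_diff_conv2 of_nat_diff nat_le_iff intro!: W_trans_F)

lemma W_trans_ladder: "p \<le> n + 2 \<Longrightarrow> gmap (W_trans n \<epsilon>) (l1 p) = gLie \<epsilon> (l1 p)"
  "p \<le> n + 2 \<Longrightarrow> gmap (W_trans n \<epsilon>) (l2 p) = gLie \<epsilon> (l2 p)"
proof -
  have "AGhost \<in> fields n" by (simp add: fields_def)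
  then show "p \<le> n + 2 \<Longrightarrow> gmap (W_trans n \<epsilon>) (l1 p) = gLie \<epsilon> (l1 p)"
    "p \<le> n + 2 \<Longrightarrow> gmap (W_trans n \<epsilon>) (l2 p) = gLie \<epsilon> (l2 p)"
    by (auto simp: ladder1_eq ladder2_eq gmap_simps[OF evol_is_der[OF evol_W_trans]] evol_gop[OF evol_W_trans] gop_simps
        W_trans_F W_trans_Cb lfield1_props lfield2_props gLie_gstar gLie_gd)
qed

subsection \<open>Supersymmetry\<close>

lemma susy_antighosts_other:
  "susy_antighosts n g \<xi> \<phi> = 0" if "\<phi> \<noteq> Mult" "\<And>k j. \<phi> \<noteq> CBar k j" "\<And>k j. \<phi> \<noteq> PiF k j"
  using that by (cases \<phi>) auto

lemma fields_CBar: "CBar k j \<in> fields n \<longleftrightarrow> 1 \<le> k \<and> k \<le> n \<and> j \<le> n - k"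
  and fields_PiF: "PiF k j \<in> fields n \<longleftrightarrow> 1 \<le> k \<and> k \<le> n \<and> j \<le> n - k"
  by (auto simp: fields_def)

text \<open>Multiplication by \<open>g(\<xi>)\<close> raises the degree just as the step to entry
  \<open>j + 1\<close> lowers it. At the end of a row the truncated degree would be off by one, but
  there the neighbour is zero.\<close>

lemma gdeg_gmetric_row:
  assumes "gdeg (nat (int n - (int j + 1) - int k)) X" "int j + 1 > int n - int k \<Longrightarrow> X = 0"
  shows "gdeg (n - j - k) (gmetric g \<xi> X)"
proof (cases "int j + 1 > int n - int k")
  case False
  then have "nat (int n - (int j + 1) - int k) + 1 = n - j - k" by auto
  then show ?thesis using gdeg_gop(4)[OF assms(1)] by simp
qed (simp add: assms(2) gop_simps gdeg_intros)

lemma homogeneous_susy_antighosts: "homogeneous n 1 (susy_antighosts n g \<xi> :: field \<Rightarrow> ('a, 'd) gform)"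
  unfolding homogeneous_def
proof
  fix \<phi> assume \<phi>: "\<phi> \<in> fields n"
  show "gpar (1 + fpar n \<phi>) (susy_antighosts n g \<xi> \<phi> :: ('a, 'd) gform) \<and> gdeg (form_degree n \<phi>) (susy_antighosts n g \<xi> \<phi> :: ('a, 'd) gform)"
  proof (cases "\<phi> = Mult \<or> (\<exists>k j. \<phi> = CBar k j) \<or> (\<exists>k j. \<phi> = PiF k j)")
    case False
    then show ?thesis by (subst (1 2) susy_antighosts_other) (auto intro: gpar_intros gdeg_intros)
  next
    case True
    then consider "\<phi> = Mult" | k j where "\<phi> = CBar k j" | k j where "\<phi> = PiF k j" by blast
    then show ?thesis
    proof cases
      case 1
      have "gpar (fpar n AGhost) (gLie \<xi> (F AGhost))" "gdeg 0 (gLie \<xi> (F AGhost))"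
        using gpar_gop(5)[OF gpar_field_form[of n AGhost]] gdeg_gop(5)[OF gdeg_field_form[of n AGhost]] by auto
      then show ?thesis using 1 by (auto simp: fpar_def elim!: gpar_cong)
    next
      case (2 k j)
      then have kj: "1 \<le> k" "k \<le> n" "j \<le> n - k" using \<phi> by (auto simp: fields_CBar)
      have par: "even (1 + fpar n \<phi>) = even (int n + 1)"
        using kj 2 by (auto simp: fpar_def gam_def of_nat_diff)
      have p: "gpar (1 + fpar n \<phi>) (gmetric g \<xi> (Cb k i))" "gpar (1 + fpar n \<phi>) (gi \<xi> (Cb k i))" for i
        by (rule gpar_cong[OF gpar_gop(4)[OF gpar_antighost]] gpar_cong[OF gpar_gop(2)[OF gpar_antighost]], use par in simp)+
      have d1: "gdeg (n - j - k) (gmetric g \<xi> (Cb k (int j + 1)))"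
        by (rule gdeg_gmetric_row[OF gdeg_antighost]) (auto intro: antighost_0)
      have "nat (int n - (int j - 1) - int k) - 1 = n - j - k" using kj by auto
      then have d2: "gdeg (n - j - k) (gi \<xi> (Cb k (int j - 1)))"
        using gdeg_gop(2)[OF gdeg_antighost[of n "int j - 1" k], of \<xi>] by simp
      show ?thesis using p d1 d2 unfolding 2 by (auto intro!: gpar_intros gdeg_intros)
    next
      case (3 k j)
      then have kj: "1 \<le> k" "k \<le> n" "j \<le> n - k" using \<phi> by (auto simp: fields_PiF)
      have par: "even (1 + fpar n \<phi>) = even (int n)"
        using kj 3 by (auto simp: fpar_def gam_def of_nat_diff)
      have p: "gpar (1 + fpar n \<phi>) (gmetric g \<xi> (Pi k i))" "gpar (1 + fpar n \<phi>) (gi \<xi> (Pi k i))" "gpar (1 + fpar n \<phi>) (gLie \<xi> (Cb k i))" for i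
        by (rule gpar_cong[OF gpar_gop(4)[OF gpar_multiplier]] gpar_cong[OF gpar_gop(2)[OF gpar_multiplier]] gpar_cong[OF gpar_gop(5)[OF gpar_antighost]], use par in simp)+
      have d1: "gdeg (n - j - k) (gmetric g \<xi> (Pi k (int j + 1)))"
        by (rule gdeg_gmetric_row[OF gdeg_multiplier]) (auto intro: multiplier_0)
      have "nat (int n - (int j - 1) - int k) - 1 = n - j - k" using kj by auto
      then have d2: "gdeg (n - j - k) (gi \<xi> (Pi k (int j - 1)))"
        using gdeg_gop(2)[OF gdeg_multiplier[of n "int j - 1" k], of \<xi>] by simp
      have "nat (int n - int j - int k) = n - j - k" using kj by auto
      then have d3: "gdeg (n - j - k) (gLie \<xi> (Cb k (int j)))"
        using gdeg_gop(5)[OF gdeg_antighost[of n "int j" k], of \<xi>] by simp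
      show ?thesis using p d1 d2 d3 unfolding 3 by (auto intro!: gpar_intros gdeg_intros)
    qed
  qed
qed

abbreviation Wa :: "'d vector \<Rightarrow> ('a, 'd) lform \<Rightarrow> ('a, 'd) lform" where "Wa \<xi> \<equiv> field_operator n (susy_antighosts n g \<xi>)"
abbreviation W :: "'d vector \<Rightarrow> ('a, 'd) lform \<Rightarrow> ('a, 'd) lform" where "W \<xi> \<equiv> W_susy n g \<xi>"

lemma evol_Wa: "evol 1 (Wa \<xi>)"
  by (rule evol_field_operator[OF homogeneous_susy_antighosts])

text \<open>The uniform version of the transformation of \<open>c\<close>, \<open>A\<close> and the
  sources; in degrees without a shift the second term vanishes.\<close>

lemma susy_lfield1: "p \<le> n + 2 \<Longrightarrow> susy n g \<xi> (lfield1 p) = - gi \<xi> (l1 (p + 1)) - (-1) ^ (p + 1) *\<^sub>R gmap (Wa \<xi>) (gstar g (gd (Cb 1 (int p - 2))))"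
proof -
  note z = gop_simps gmap_simps[OF evol_is_der[OF evol_Wa]]
  assume p: "p \<le> n + 2"
  consider "p = 0" | "p = 1" | j where "p = j + 2" "j < n" | "p = n + 2"
    using p by (metis One_nat_def Suc_1 add_2_eq_Suc' add_le_cancel_right le_neq_implies_less not0_implies_Suc)
  then show ?thesis
  proof cases
    case (3 j)
    have "gmap (Wa \<xi>) (gstar g (gd (Cb 1 (int j)))) = (\<chi> a. Wa \<xi> (gstar g (gd (Cb 1 (int j))) $ a))"
      by (simp add: gmap_def)
    then show ?thesis using 3 by (simp add: lfield1_def ladder1_def)
  next
    case 4
    have "Cb 1 (int n) = 0" by (simp add: antighost_def)
    then show ?thesis using 4 by (simp add: lfield1_def l1_big z)
  qed (simp_all add: lfield1_def antighost_def z numeral_2_eq_2)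
qed

lemma susy_lfield2: "p \<le> n + 2 \<Longrightarrow> susy n g \<xi> (lfield2 n p) = - gi \<xi> (l2 (p + 1))"
proof -
  assume "p \<le> n + 2"
  then consider "p \<le> n" | "p = n + 1" | "p = n + 2" by linarith
  then show ?thesis
    by cases (auto simp: lfield2_def ladder2_def gop_simps)
qed

lemma homogeneous_susy: "homogeneous n 1 (susy n g \<xi> :: field \<Rightarrow> ('a, 'd) gform)"
  unfolding homogeneous_def
proof
  fix \<phi> assume \<phi>: "\<phi> \<in> fields n"
  note h = homogeneous_susy_antighosts[of \<xi>, unfolded homogeneous_def, rule_format, OF \<phi>]
  from \<phi> show "gpar (1 + fpar n \<phi>) (susy n g \<xi> \<phi> :: ('a, 'd) gform) \<and> gdeg (form_degree n \<phi>) (susy n g \<xi> \<phi> :: ('a, 'd) gform)"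
  proof (cases rule: fields_cases)
    case (3 p)
    \<comment> \<open>The shift is the difference of ladder field and bare field, so its parity and
      degree need no separate computation.\<close>
    have "gpar 1 (l1 p - F (lfield1 p))" "gdeg p (l1 p - F (lfield1 p))"
      using gpar_F[of "lfield1 p"] gdeg_F[of "lfield1 p"] 3(1)
      by (simp_all add: lfield1_props gpar_intros gdeg_intros gpar_l1 gdeg_l1)
    then have "gpar (1 + 1) (gmap (Wa \<xi>) (l1 p - F (lfield1 p)))" "gdeg p (gmap (Wa \<xi>) (l1 p - F (lfield1 p)))"
      by (blast intro: gpar_der[OF evol_is_der[OF evol_Wa]] gdeg_vert[OF evol_vert[OF evol_Wa]])+
    moreover have "susy n g \<xi> (lfield1 p) = - gi \<xi> (l1 (p + 1)) - gmap (Wa \<xi>) (l1 p - F (lfield1 p))"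
      using 3(1) by (simp add: susy_lfield1 ladder1_eq gmap_simps[OF evol_is_der[OF evol_Wa]])
    moreover have "gpar (1 + 1) (gi \<xi> (l1 (p + 1)))" "gdeg p (gi \<xi> (l1 (p + 1)))"
      using gpar_gop(2)[OF gpar_l1] gdeg_gop(2)[OF gdeg_l1[of "p + 1"]] by auto
    ultimately show ?thesis using 3 by (auto simp: lfield1_props intro!: gpar_intros gdeg_intros)
  next
    case (4 p)
    have "gpar (int n + 1) (gi \<xi> (l2 (p + 1)))" "gdeg p (gi \<xi> (l2 (p + 1)))"
      using gpar_gop(2)[OF gpar_l2] gdeg_gop(2)[OF gdeg_l2[of "p + 1"]] by auto
    then show ?thesis using 4 by (auto simp: lfield2_props susy_lfield2 add.commute intro!: gpar_intros gdeg_intros)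
  qed (use h in simp_all)
qed

lemma evol_W: "evol 1 (W \<xi>)"
  unfolding W_susy_def by (rule evol_field_operator[OF homogeneous_susy])

lemma W_F: "\<phi> \<in> fields n \<Longrightarrow> gmap (W \<xi>) (F \<phi>) = susy n g \<xi> \<phi>"
  unfolding W_susy_def by (rule field_operator_field_form[OF homogeneous_susy])

lemma Wa_F: "\<phi> \<in> fields n \<Longrightarrow> gmap (Wa \<xi>) (F \<phi>) = susy_antighosts n g \<xi> \<phi>"
  by (rule field_operator_field_form[OF homogeneous_susy_antighosts])

lemmas W_simps = gmap_simps[OF evol_is_der[OF evol_W]] evol_gop[OF evol_W]

lemma W_AGhost: "gmap (W \<xi>) (F AGhost) = 0" and W_Mult: "gmap (W \<xi>) (F Mult) = gLie \<xi> (F AGhost)"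
  by (simp_all add: W_F fields_def)

lemma W_Cb: "1 \<le> k \<Longrightarrow> k \<le> n \<Longrightarrow> j \<le> n - k \<Longrightarrow> gmap (W \<xi>) (Cb k (int j)) = (if odd k
     then (-1) ^ (n + (k + 1) div 2) *\<^sub>R gmetric g \<xi> (Cb k (int j + 1))
     else (-1) ^ (k div 2 + 1) *\<^sub>R gi \<xi> (Cb k (int j - 1)))"
  by (simp add: antighost_field_form[of k n j] W_F fields_CBar)

lemma W_Pi: "1 \<le> k \<Longrightarrow> k \<le> n \<Longrightarrow> j \<le> n - k \<Longrightarrow> gmap (W \<xi>) (Pi k (int j)) = (if odd k
     then (-1) ^ (n + (k + 1) div 2) *\<^sub>R gmetric g \<xi> (Pi k (int j + 1))
     else (-1) ^ (k div 2 + 1) *\<^sub>R gi \<xi> (Pi k (int j - 1))) + gLie \<xi> (Cb k (int j))"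
  by (simp add: multiplier_field_form[of k n j] W_F fields_PiF)

text \<open>The full operator acts on antighosts as the restricted one used in the definition of the
  source transformations, which is therefore no circularity.\<close>

lemma W_Wa_Cb: "gmap (W \<xi>) (Cb k j) = gmap (Wa \<xi>) (Cb k j)"
proof (cases "1 \<le> k \<and> k \<le> n \<and> 0 \<le> j \<and> j \<le> int n - int k")
  case True
  then have "Cb k j = F (CBar k (nat j))" "CBar k (nat j) \<in> fields n" by (auto simp: antighost_def fields_CBar)
  then show ?thesis by (simp add: W_F Wa_F)
qed (simp add: antighost_0 W_simps gmap_simps[OF evol_is_der[OF evol_Wa]])

text \<open>The variation of the shift cancels the term that was subtracted in the transformation of
  the source; beyond degree \<open>n + 2\<close> both sides are zero.\<close>

lemma W_l1: "gmap (W \<xi>) (l1 p) = - gi \<xi> (l1 (p + 1))"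
proof (cases "p \<le> n + 2")
  case True
  have "gmap (W \<xi>) (gstar g (gd X)) = gmap (Wa \<xi>) (gstar g (gd X))" if "gmap (W \<xi>) X = gmap (Wa \<xi>) X" for X
    by (simp add: evol_gop[OF evol_W] evol_gop[OF evol_Wa] that)
  then have "gmap (W \<xi>) (gstar g (gd (Cb 1 (int p - 2)))) = gmap (Wa \<xi>) (gstar g (gd (Cb 1 (int p - 2))))" using W_Wa_Cb by blast
  then show ?thesis
    unfolding ladder1_eq[OF True] using True
    by (simp add: gmap_simps[OF evol_is_der[OF evol_W]] W_F lfield1_props susy_lfield1)
qed (simp add: l1_big W_simps gop_simps)

lemma W_l2: "gmap (W \<xi>) (l2 p) = - gi \<xi> (l2 (p + 1))"
proof (cases "p \<le> n + 2")
  case True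
  then show ?thesis
    unfolding ladder2_eq[OF True]
    by (auto simp: W_simps W_AGhost W_F lfield2_props susy_lfield2 gop_simps)
qed (simp add: l2_big W_simps gop_simps)

lemma gform_eqI: "(\<And>p. gmap (part p) X = gmap (part p) Y) \<Longrightarrow> X = (Y :: ('a, 'd) gform)"
  by (subst (1) sum_gpart[symmetric], subst (2) sum_gpart[symmetric]) (rule sum.cong[OF refl])

lemma W_Phi1: "gmap (W \<xi>) Phi1 = - gi \<xi> Phi1" and W_Phi2: "gmap (W \<xi>) Phi2 = - gi \<xi> Phi2"
  by (rule gform_eqI, simp add: gpart_evol[OF evol_W] gpart_Phi1 gpart_Phi2 W_l1 W_l2 gpart_simps gpart_gi)+

end

lemma evol_anticommutator: "evol 1 P \<Longrightarrow> evol 1 Q \<Longrightarrow> evol 0 (\<lambda>x. P (Q x) + Q (P x))"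
  by (rule evol_cong[of "1 + 1"]) (use evol_commutator[of 1 P 1 Q] in simp_all)

lemma gmap_anticommutator: "gmap (\<lambda>x. P (Q x) + Q (P x)) X = gmap P (gmap Q X) + gmap Q (gmap P X)"
  by (simp add: vec_eq_iff)

context bf_model
begin

subsection \<open>The Slavnov operator\<close>

context
  fixes x :: "nat \<Rightarrow> nat \<Rightarrow> nat \<Rightarrow> real"
begin

abbreviation S :: "('a, 'd) lform \<Rightarrow> ('a, 'd) lform" where "S \<equiv> slavnov n tr (Sigma_action n g br tr x)"
abbreviation sl :: "field \<Rightarrow> ('a, 'd) gform" where "sl \<equiv> slavnov_transf n tr (Sigma_action n g br tr x)"

lemma gpar_gpart: "gpar e X \<Longrightarrow> gpar e (gmap (part p) X)"
  by (auto simp: gpar_def intro: par_part)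

lemma homogeneous_slavnov: "homogeneous n 1 sl"
  unfolding homogeneous_def
proof
  fix \<phi> assume "\<phi> \<in> fields n"
  then show "gpar (1 + fpar n \<phi>) (sl \<phi>) \<and> gdeg (form_degree n \<phi>) (sl \<phi>)"
  proof (cases rule: fields_cases)
    case 1
    show ?thesis
      using gpar_F[of Mult] gdeg_F[of Mult]
      by (simp add: 1 fpar_def)
  next
    case (3 p)
    have a: "gpar (1 + 1) (gstar g (gd (Pi 1 (int p - 2))))"
      by (rule gpar_cong[OF gpar_gop(3)[OF gpar_gop(1)[OF gpar_multiplier]]]) (simp add: dim)
    have b: "gdeg p (gstar g (gd (Pi 1 (int p - 2))))"
    proof (cases "2 \<le> p \<and> p \<le> n + 1")
      case True
      then have "CARD('d) - (nat (int n - (int p - 2) - int 1) + 1) = p" by (auto simp: dim)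
      then show ?thesis using gdeg_gop(3)[OF gdeg_gop(1)[OF gdeg_multiplier[of n "int p - 2" 1]], of g] by simp
    next
      case False
      then have "Pi 1 (int p - 2) = 0" by (auto simp: multiplier_def)
      then show ?thesis by (simp only: gop_simps gdeg_intros)
    qed
    have c: "gpar (1 + 1) (gmap (part p) E1)" using gpar_gpart[OF gpar_E1] by simp
    show ?thesis
      unfolding 3(2) slavnov_lfield1[OF 3(1)] lfield1_props[OF 3(1)] by (intro conjI gpar_intros gdeg_intros a b c gdeg_gpart)
  next
    case (4 p)
    have a: "gpar (1 + int n) (gstar g (gd (F Mult)))"
      by (rule gpar_cong[OF gpar_gop(3)[OF gpar_gop(1)[OF gpar_field_form]]]) (simp add: dim fpar_def)
    have b: "gdeg (n + 1) (gstar g (gd (F Mult)))"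
      using gdeg_gop(3)[OF gdeg_gop(1)[OF gdeg_field_form[of n Mult]], of g] by (simp add: dim)
    have c: "gpar (1 + int n) (gmap (part p) E2)" using gpar_gpart[OF gpar_E2] by (simp add: add.commute)
    show ?thesis
      unfolding 4(2) slavnov_lfield2[OF 4(1)] lfield2_props[OF 4(1)] using a b c by (auto intro!: gpar_intros gdeg_intros gdeg_gpart)
  next
    case (5 k j)
    have "nat (int n - int j - int k) = n - j - k" by auto
    moreover have "even (1 + fpar n \<phi>) = even (int n + 1)"
      using 5 by (auto simp: fpar_def gam_def of_nat_diff)
    ultimately show ?thesis
      using gdeg_Pi[of "int j" k] gpar_cong[OF gpar_Pi[of k "int j"], of "1 + fpar n \<phi>"] by (simp add: 5(4))
  qed (simp_all add: gpar_intros gdeg_intros)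
qed

lemma evol_S: "evol 1 S"
  unfolding slavnov_def by (rule evol_field_operator[OF homogeneous_slavnov])

lemma S_F: "\<phi> \<in> fields n \<Longrightarrow> gmap S (F \<phi>) = sl \<phi>"
  unfolding slavnov_def by (rule field_operator_field_form[OF homogeneous_slavnov])

lemmas S_simps = gmap_simps[OF evol_is_der[OF evol_S]] evol_gop[OF evol_S]

lemma S_AGhost: "gmap S (F AGhost) = F Mult" and S_Mult: "gmap S (F Mult) = 0"
  by (simp_all add: S_F fields_def)

lemma S_Cb: "gmap S (Cb k j) = Pi k j" and S_Pi: "gmap S (Pi k j) = 0"
proof -
  have "gmap S (Cb k j) = Pi k j \<and> gmap S (Pi k j) = 0"
  proof (cases "1 \<le> k \<and> k \<le> n \<and> 0 \<le> j \<and> j \<le> int n - int k")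
    case True
    then have "CBar k (nat j) \<in> fields n" "PiF k (nat j) \<in> fields n" by (auto simp: fields_CBar fields_PiF)
    then show ?thesis using True by (simp add: antighost_def multiplier_def S_F S_simps)
  qed (simp add: antighost_0 multiplier_0 S_simps)
  then show "gmap S (Cb k j) = Pi k j" "gmap S (Pi k j) = 0" by auto
qed

lemma gpart_big: "p > n + 2 \<Longrightarrow> gmap (part p) (X :: ('a, 'd) gform) = 0"
  using gdeg_too_big[OF gdeg_gpart[of p X]] by (simp add: dim)

text \<open>The gauge-fixing term in the functional derivative is removed by the variation of the
  shift: antighosts go to multipliers, and the odd operator changes sign when passing
  \<open>d\<close>.\<close>

lemma S_l1: "gmap S (l1 p) = gmap (part p) E1" and S_l2: "gmap S (l2 p) = gmap (part p) E2"
proof -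
  have "gmap S (l1 p) = gmap (part p) E1 \<and> gmap S (l2 p) = gmap (part p) E2"
  proof (cases "p \<le> n + 2")
    case True
    then show ?thesis
      by (simp add: ladder1_eq ladder2_eq S_simps S_AGhost S_Cb S_F lfield1_props lfield2_props slavnov_lfield1 slavnov_lfield2 gop_simps)
  qed (simp add: l1_big l2_big S_simps gpart_big)
  then show "gmap S (l1 p) = gmap (part p) E1" "gmap S (l2 p) = gmap (part p) E2" by auto
qed

lemma S_Phi1: "gmap S Phi1 = E1" and S_Phi2: "gmap S Phi2 = E2"
  by (rule gform_eqI, simp add: gpart_evol[OF evol_S] gpart_Phi1 gpart_Phi2 S_l1 S_l2)+

text \<open>For odd \<open>Phi1\<close> the Jacobi identity yields the second claim. Applied to
  \<open>Phi1\<close> itself and combined with graded antisymmetry it makes three times the triple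
  bracket zero.\<close>

lemma bracket_Phi1_cubed: "bracket br (bracket br Phi1 Phi1) Phi1 = 0"
  and bracket_Phi1_Phi1: "bracket br (bracket br Phi1 Phi1) Z = 2 *\<^sub>R bracket br Phi1 (bracket br Phi1 Z)"
proof -
  have J: "bracket br Phi1 (bracket br Phi1 Z) = bracket br (bracket br Phi1 Phi1) Z - bracket br Phi1 (bracket br Phi1 Z)" for Z
    using bracket_jacobi[OF gpar_Phi1 gpar_Phi1, of Z] by simp
  then show J2: "bracket br (bracket br Phi1 Phi1) Z = 2 *\<^sub>R bracket br Phi1 (bracket br Phi1 Z)" for Z
    by (simp add: scaleR_2 eq_diff_eq)
  have "bracket br Phi1 (bracket br Phi1 Phi1) = - bracket br (bracket br Phi1 Phi1) Phi1"
    using bracket_commute[OF gpar_Phi1 gpar_bracket[OF gpar_Phi1 gpar_Phi1, of br], of br, OF br_antisym] by (simp add: sg_def)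
  then have "bracket br Phi1 (bracket br Phi1 Phi1) + 2 *\<^sub>R bracket br Phi1 (bracket br Phi1 Phi1) = 0"
    using J2[of Phi1] by (simp add: eq_neg_iff_add_eq_0)
  then have "(1 + 2) *\<^sub>R bracket br Phi1 (bracket br Phi1 Phi1) = 0"
    by (simp only: scaleR_add_left scaleR_one)
  then show "bracket br (bracket br Phi1 Phi1) Phi1 = 0" using J2[of Phi1] by simp
qed

lemma is_der_gd: "gpar e X \<Longrightarrow> gd (bracket br X Y) = bracket br (gd X) Y + sg e *\<^sub>R bracket br X (gd Y)"
  using is_der_bracket[OF is_der_ext_d, of e X br Y] by (simp add: gop_gmap)

lemma is_der_gi: "gpar e X \<Longrightarrow> gi \<xi> (bracket br X Y) = bracket br (gi \<xi> X) Y + sg e *\<^sub>R bracket br X (gi \<xi> Y)"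
  using is_der_bracket[OF is_der_inner, of e X \<xi> br Y] by (simp add: gop_gmap)

lemma bracket_Phi1_even: "gpar 2 X \<Longrightarrow> bracket br Phi1 X = - bracket br X Phi1"
  using bracket_commute[OF gpar_Phi1, of 2 X br, OF _ br_antisym] by (simp add: sg_def)

text \<open>The operator anticommutes with \<open>d\<close> and sends \<open>Phi1\<close> to its
  curvature, so the claim is the Bianchi identity \<open>gd E1 = bracket br E1 Phi1\<close>; the
  cubic term drops out.\<close>

lemma S_E1: "gmap S E1 = 0"
proof -
  have d: "gpar 2 (gd Phi1)" using gpar_gop(1)[OF gpar_Phi1] by simp
  have dE: "gd E1 = bracket br (gd Phi1) Phi1"
    by (simp add: E1_def gop_simps is_der_gd[OF gpar_Phi1] bracket_Phi1_even[OF d] flip: scaleR_2)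
  have "gmap S E1 = - gd E1 + bracket br E1 Phi1"
    by (subst E1_def) (simp add: S_simps is_der_bracket[OF evol_is_der[OF evol_S] gpar_Phi1] S_Phi1 bracket_Phi1_even[OF gpar_E1] flip: scaleR_2)
  also have "bracket br E1 Phi1 = bracket br (gd Phi1) Phi1"
    by (simp add: E1_def bracket_simps bracket_Phi1_cubed)
  finally show ?thesis by (simp add: dE)
qed

text \<open>The second Bianchi identity: the covariant derivative of \<open>E2\<close> is the
  bracket of the curvature with \<open>Phi2\<close>.\<close>

lemma S_E2: "gmap S E2 = 0"
proof -
  have "gd E2 = bracket br (gd Phi1) Phi2 - bracket br Phi1 (gd Phi2)"
    by (simp add: E2_def gop_simps is_der_gd[OF gpar_Phi1])
  moreover have "gmap S E2 = - gd E2 + bracket br E1 Phi2 - bracket br Phi1 E2"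
    by (subst E2_def) (simp add: S_simps is_der_bracket[OF evol_is_der[OF evol_S] gpar_Phi1] S_Phi1 S_Phi2)
  ultimately show ?thesis
    by (simp add: E1_def E2_def bracket_simps bracket_Phi1_Phi1)
qed

section \<open>The operator algebra, compared field by field\<close>

lemma not_field_jet: "\<not> field_jet n v \<Longrightarrow> S (jvar v) = 0" "\<not> field_jet n v \<Longrightarrow> W \<xi> (jvar v) = 0"
  "\<not> field_jet n v \<Longrightarrow> W_trans n \<xi> (jvar v) = (0 :: ('a, 'd) lform)"
  by (simp_all add: slavnov_def W_susy_def W_trans_def field_operator_not_field_jet)

lemmas ev0 = linear_0[OF is_der_linear[OF evol_is_der[OF evol_S]]] linear_0[OF is_der_linear[OF evol_is_der[OF evol_W]]]

text \<open>The square of an odd derivation is half its anticommutator with itself, an even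
  evolutionary operator to which \<open>model_eqI\<close> applies.\<close>

lemma S_S: "S (S y) = 0"
proof -
  have "(\<lambda>y. S (S y) + S (S y)) = (\<lambda>_. 0)"
    by (rule model_eqI[OF evol_anticommutator[OF evol_S evol_S] evol_zero])
      (simp_all add: gmap_anticommutator not_field_jet ev0 S_l1 S_l2 S_AGhost S_Mult S_Cb S_Pi gpart_evol[OF evol_S, symmetric]
        S_E1 S_E2 gpart_simps S_simps, simp_all add: gmap_def zero_vec_def)
  then have "S (S y) + S (S y) = 0" by metis
  then show ?thesis by (simp flip: scaleR_2)
qed

text \<open>On the total forms the brackets with contracted entries cancel between the two orders,
  leaving \<open>i_\<xi> d + d i_\<xi>\<close>. On the rows the ladder-like terms cancel because
  Slavnov maps antighosts to multipliers, and the Lie derivative in the multiplier transformation is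
  what remains.\<close>

lemma S_W: "odd_commutator S (W \<xi>) = W_trans n \<xi>"
proof -
  note bS = is_der_bracket[OF evol_is_der[OF evol_S] gpar_Phi1] and bW = is_der_bracket[OF evol_is_der[OF evol_W] gpar_Phi1]
  let ?C = "\<lambda>y. S (W \<xi> y) + W \<xi> (S y)"
  note evC = evol_anticommutator[OF evol_S evol_W[of \<xi>]]
  have 1: "gmap ?C Phi1 = gLie \<xi> Phi1"
  proof -
    have "gmap (W \<xi>) E1 = gd (gi \<xi> Phi1) - (1/2) *\<^sub>R (bracket br (gi \<xi> Phi1) Phi1 - bracket br Phi1 (gi \<xi> Phi1))"
      unfolding E1_def by (simp add: W_simps bW W_Phi1 gop_simps bracket_simps algebra_simps)
    moreover have "gi \<xi> E1 = gi \<xi> (gd Phi1) + (1/2) *\<^sub>R (bracket br (gi \<xi> Phi1) Phi1 - bracket br Phi1 (gi \<xi> Phi1))"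
      unfolding E1_def by (simp add: gop_simps is_der_gi[OF gpar_Phi1])
    moreover have "gmap ?C Phi1 = gi \<xi> E1 + gmap (W \<xi>) E1"
      by (simp add: gmap_anticommutator W_Phi1 S_simps S_Phi1)
    ultimately show ?thesis by (simp add: gLie_def)
  qed
  have 2: "gmap ?C Phi2 = gLie \<xi> Phi2"
  proof -
    have "gmap (W \<xi>) E2 = gd (gi \<xi> Phi2) - (bracket br (gi \<xi> Phi1) Phi2 - bracket br Phi1 (gi \<xi> Phi2))"
      unfolding E2_def by (simp add: W_simps bW W_Phi1 W_Phi2 gop_simps bracket_simps algebra_simps)
    moreover have "gi \<xi> E2 = gi \<xi> (gd Phi2) + (bracket br (gi \<xi> Phi1) Phi2 - bracket br Phi1 (gi \<xi> Phi2))"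
      unfolding E2_def by (simp add: gop_simps is_der_gi[OF gpar_Phi1])
    moreover have "gmap ?C Phi2 = gi \<xi> E2 + gmap (W \<xi>) E2"
      by (simp add: gmap_anticommutator W_Phi2 S_simps S_Phi2)
    ultimately show ?thesis by (simp add: gLie_def)
  qed
  have L: "gmap (part p) (gLie \<xi> X) = gLie \<xi> (gmap (part p) X)" for p and X :: "('a, 'd) gform"
    using gpart_evol[OF evol_Lie, of p \<xi> X] by (simp only: gop_gmap)
  have "?C = W_trans n \<xi>"
  proof (rule model_eqI[OF evC evol_W_trans])
    fix p assume p: "p \<le> n + 2"
    show "gmap ?C (l1 p) = gmap (W_trans n \<xi>) (l1 p)" "gmap ?C (l2 p) = gmap (W_trans n \<xi>) (l2 p)"
      unfolding ladder_of_total[OF evC] 1 2 L gpart_Phi1 gpart_Phi2 W_trans_ladder[OF p] by (rule refl)+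
  next
    fix k j assume kj: "1 \<le> k" "k \<le> n" "j \<le> n - k"
    show "gmap ?C (Cb k (int j)) = gmap (W_trans n \<xi>) (Cb k (int j))"
      "gmap ?C (Pi k (int j)) = gmap (W_trans n \<xi>) (Pi k (int j))"
      by (simp_all add: gmap_anticommutator W_Cb[OF kj] W_Pi[OF kj] S_Cb S_Pi S_simps W_simps W_trans_Cb W_trans_Pi gop_simps)
  qed (simp_all add: not_field_jet ev0 gmap_anticommutator S_AGhost S_Mult W_AGhost W_Mult S_simps W_simps W_trans_F fields_def)
  then show ?thesis by (simp add: odd_commutator_def[abs_def])
qed

end

lemma W_W: "odd_commutator (W \<xi>) (W \<xi>') = (\<lambda>_. 0)"
proof -
  let ?C = "\<lambda>y. W \<xi> (W \<xi>' y) + W \<xi>' (W \<xi> y)"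
  note evC = evol_anticommutator[OF evol_W[of \<xi>] evol_W[of \<xi>']]
  have z: "gmap (\<lambda>_. 0) X = 0" for X :: "('a, 'd) gform" by (simp add: vec_eq_iff)
  \<comment> \<open>The second application may act one step beyond the end of the row; the formula
    persists there because all entries involved vanish.\<close>
  have W0: "gmap (W \<zeta>) (Cb k (int j + 1)) = (-1) ^ (n + (k + 1) div 2) *\<^sub>R gmetric g \<zeta> (Cb k (int j + 2))" 
    and W0': "gmap (W \<zeta>) (Pi k (int j + 1)) = (-1) ^ (n + (k + 1) div 2) *\<^sub>R gmetric g \<zeta> (Pi k (int j + 2)) + gLie \<zeta> (Cb k (int j + 1))"
    if "1 \<le> k" "k \<le> n" "odd k" for k j \<zeta>
  proof -
    have "gmap (W \<zeta>) (Cb k (int j + 1)) = (-1) ^ (n + (k + 1) div 2) *\<^sub>R gmetric g \<zeta> (Cb k (int j + 2)) \<and>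
      gmap (W \<zeta>) (Pi k (int j + 1)) = (-1) ^ (n + (k + 1) div 2) *\<^sub>R gmetric g \<zeta> (Pi k (int j + 2)) + gLie \<zeta> (Cb k (int j + 1))"
    proof (cases "Suc j \<le> n - k")
      case True
      then show ?thesis using W_Cb[OF that(1,2) True] W_Pi[OF that(1,2) True] that(3) by (simp add: algebra_simps)
    next
      case False
      then have "Cb k (int j + 1) = 0" "Cb k (int j + 2) = 0" "Pi k (int j + 1) = 0" "Pi k (int j + 2) = 0"
        using that(2) by (auto simp: antighost_def multiplier_def)
      then show ?thesis by (simp add: W_simps gop_simps)
    qed
    then show "gmap (W \<zeta>) (Cb k (int j + 1)) = (-1) ^ (n + (k + 1) div 2) *\<^sub>R gmetric g \<zeta> (Cb k (int j + 2))" 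
      "gmap (W \<zeta>) (Pi k (int j + 1)) = (-1) ^ (n + (k + 1) div 2) *\<^sub>R gmetric g \<zeta> (Pi k (int j + 2)) + gLie \<zeta> (Cb k (int j + 1))" by auto
  qed
  \<comment> \<open>Likewise at the beginning of an even row, where entry -1 and its neighbour -2
    are zero.\<close>
  have W1: "gmap (W \<zeta>) (Cb k (int j - 1)) = (-1) ^ (k div 2 + 1) *\<^sub>R gi \<zeta> (Cb k (int j - 2))" 
    and W1': "gmap (W \<zeta>) (Pi k (int j - 1)) = (-1) ^ (k div 2 + 1) *\<^sub>R gi \<zeta> (Pi k (int j - 2)) + gLie \<zeta> (Cb k (int j - 1))"
    if "1 \<le> k" "k \<le> n" "even k" "j \<le> n - k" for k j \<zeta>
  proof -
    have "gmap (W \<zeta>) (Cb k (int j - 1)) = (-1) ^ (k div 2 + 1) *\<^sub>R gi \<zeta> (Cb k (int j - 2)) \<and>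
      gmap (W \<zeta>) (Pi k (int j - 1)) = (-1) ^ (k div 2 + 1) *\<^sub>R gi \<zeta> (Pi k (int j - 2)) + gLie \<zeta> (Cb k (int j - 1))"
    proof (cases j)
      case (Suc i)
      then have i: "i \<le> n - k" using that(4) by simp
      show ?thesis using W_Cb[OF that(1,2) i] W_Pi[OF that(1,2) i] that(3) by (simp add: Suc algebra_simps)
    next
      case 0
      then have "Cb k (int j - 1) = 0" "Cb k (int j - 2) = 0" "Pi k (int j - 1) = 0" "Pi k (int j - 2) = 0"
        by (auto simp: antighost_def multiplier_def)
      then show ?thesis by (simp add: W_simps gop_simps)
    qed
    then show "gmap (W \<zeta>) (Cb k (int j - 1)) = (-1) ^ (k div 2 + 1) *\<^sub>R gi \<zeta> (Cb k (int j - 2))" 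
      "gmap (W \<zeta>) (Pi k (int j - 1)) = (-1) ^ (k div 2 + 1) *\<^sub>R gi \<zeta> (Pi k (int j - 2)) + gLie \<zeta> (Cb k (int j - 1))" by auto
  qed
  have comm: "gLie \<zeta> (gmetric g \<zeta>' X) = gmetric g \<zeta>' (gLie \<zeta> X)" "gLie \<zeta> (gi \<zeta>' X) = gi \<zeta>' (gLie \<zeta> X)" for \<zeta> \<zeta>' and X :: "('a, 'd) gform"
    by (simp_all add: gLie_gmetric gLie_gi)
  have "?C = (\<lambda>_. 0)"
  proof (rule model_eqI[OF evC evol_zero])
    fix p
    show "gmap ?C (l1 p) = gmap (\<lambda>_. 0) (l1 p)" "gmap ?C (l2 p) = gmap (\<lambda>_. 0) (l2 p)"
      by (simp_all add: gmap_anticommutator W_l1 W_l2 W_simps gop_simps z gi_anticommute[of \<xi> \<xi>'])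
  next
    fix k j assume kj: "1 \<le> k" "k \<le> n" "j \<le> n - k"
    show "gmap ?C (Cb k (int j)) = gmap (\<lambda>_. 0) (Cb k (int j))"
    proof (cases "odd k")
      case True
      then show ?thesis
        by (simp add: gmap_anticommutator W_Cb[OF kj] W_simps W0[OF kj(1,2) True] gop_simps z gi_anticommute[of \<xi> \<xi>'] gmetric_anticommute[of g \<xi> \<xi>'])
    next
      case False
      then show ?thesis
        by (simp add: gmap_anticommutator W_Cb[OF kj] W_simps W1[OF kj(1,2) _ kj(3)] gop_simps z gi_anticommute[of \<xi> \<xi>'] gmetric_anticommute[of g \<xi> \<xi>'])
    qed
    show "gmap ?C (Pi k (int j)) = gmap (\<lambda>_. 0) (Pi k (int j))"
    proof (cases "odd k")
      case True
      then show ?thesis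
        by (simp add: gmap_anticommutator W_Pi[OF kj] W_Cb[OF kj] W_simps W0'[OF kj(1,2) True] gop_simps z comm scaleR_right_distrib scaleR_diff_right gi_anticommute[of \<xi> \<xi>'] gmetric_anticommute[of g \<xi> \<xi>'])
    next
      case False
      then show ?thesis
        by (simp add: gmap_anticommutator W_Pi[OF kj] W_Cb[OF kj] W_simps W1'[OF kj(1,2) _ kj(3)] gop_simps z comm scaleR_right_distrib scaleR_diff_right gi_anticommute[of \<xi> \<xi>'] gmetric_anticommute[of g \<xi> \<xi>'])
    qed
  qed (simp_all add: gmap_anticommutator W_AGhost W_Mult W_simps z gop_simps not_field_jet(2) ev0(2))
  then show ?thesis by (simp add: odd_commutator_def[abs_def])
qed

end

section \<open>The Ward identity: telescoping sums and exactness of the remainders\<close>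

lemma sum_telescope:
  fixes R :: "int \<Rightarrow> 'v :: real_vector"
  shows "(\<Sum>j = 0..m. R (int j) - R (int j - 1)) = R (int m) - R (- 1)"
  by (induction m) (simp_all add: algebra_simps)

context bf_model
begin

lemma hsign_eq: "hsign TYPE('d) = sg (int n + 1)"
  by (auto simp: hsign_def dim sg_def minus_one_power_iff)

subsection \<open>Integration by parts and Hodge identities\<close>

lemma exact_gd:
  fixes X Y :: "('a, 'd) gform"
  assumes "gpar e X"
  shows "exact (Tr tr (gd X) Y + sg e *\<^sub>R Tr tr X (gd Y))"
proof -
  have "ext_d (Tr tr X Y) = Tr tr (gd X) Y + sg e *\<^sub>R Tr tr X (gd Y)"
    using is_der_Tr[OF is_der_ext_d assms] by (simp add: gop_gmap)
  then show ?thesis by (metis exact_ext_d)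
qed

text \<open>The product has top degree, so its exterior derivative vanishes and its Lie derivative
  reduces to \<open>d i_\<xi>\<close>.\<close>

lemma exact_gLie:
  fixes X Y :: "('a, 'd) gform"
  assumes "gpar e X" "gdeg p X" "gdeg q Y" "p + q = n + 2"
  shows "exact (Tr tr (gLie \<xi> X) Y + Tr tr X (gLie \<xi> Y))"
proof -
  let ?z = "Tr tr X Y"
  have "deg (n + 2 + 1) (ext_d ?z)"
    using deg_ext_d[OF deg_Tr[OF assms(2,3)]] assms(4) by simp
  then have "ext_d ?z = 0" by (rule deg_too_big) (simp add: dim)
  then have "inner_deriv \<xi> (ext_d ?z) + ext_d (inner_deriv \<xi> ?z) = ext_d (inner_deriv \<xi> ?z)" by (simp add: inner_simps)
  moreover have "inner_deriv \<xi> (ext_d ?z) + ext_d (inner_deriv \<xi> ?z) = Tr tr (gLie \<xi> X) Y + Tr tr X (gLie \<xi> Y)"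
    using is_der_Tr[OF evol_is_der[OF evol_Lie] assms(1), of \<xi> tr Y] by (simp add: gop_gmap)
  ultimately show ?thesis by (metis exact_ext_d)
qed

lemma exact_gLie_hodge:
  fixes X Y :: "('a, 'd) gform"
  assumes "gpar e X" "gdeg p X" "gdeg p Y" "p \<le> n + 2"
  shows "exact (Tr tr (gLie \<xi> X) (gstar g Y) + Tr tr X (gstar g (gLie \<xi> Y)))"
proof -
  have "gdeg (n + 2 - p) (gstar g Y)" using gdeg_gop(3)[OF assms(3)] by (simp add: dim)
  then show ?thesis
    using exact_gLie[OF assms(1,2), of "n + 2 - p" "gstar g Y" \<xi>] assms(4) by (simp add: gLie_gstar)
qed

lemma Tr_hodge_metric:
  fixes X Y :: "('a, 'd) gform"
  assumes "gpar e X" "gdeg (Suc p) X" "gdeg p Y"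
  shows "Tr tr X (gstar g (gmetric g \<xi> Y)) = - (sg e * hsign TYPE('d)) *\<^sub>R Tr tr (gi \<xi> X) (gstar g Y)"
proof -
  have "X $ a * hodge g (metric_form g \<xi> * Y $ b) = - (sg e * hsign TYPE('d)) *\<^sub>R (inner_deriv \<xi> (X $ a) * hodge g (Y $ b))" for a b
    using assms by (intro times_hodge_metric_form[OF inv sym]) (auto simp: gpar_def gdeg_def)
  then show ?thesis by (simp add: Tr_def scaleR_sum_right mult.commute)
qed

lemma Tr_hodge_inner:
  fixes X Y :: "('a, 'd) gform"
  assumes "gpar e X"
  shows "Tr tr X (gstar g (gi \<xi> Y)) = (sg e * hsign TYPE('d)) *\<^sub>R Tr tr (gmetric g \<xi> X) (gstar g Y)"
proof -
  have "X $ a * hodge g (inner_deriv \<xi> (Y $ b)) = (sg e * hsign TYPE('d)) *\<^sub>R (metric_form g \<xi> * X $ a * hodge g (Y $ b))" for a b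
    using assms by (intro times_hodge_inner[OF inv sym]) (auto simp: gpar_def)
  then show ?thesis by (simp add: Tr_def scaleR_sum_right mult.commute)
qed

text \<open>As \<open>**\<close> is a constant, the integrand is a multiple of \<open>Tr dX d(g(\<xi>) Y)\<close>.\<close>

lemma exact_gd_hodge_gi_hodge_gd:
  fixes X Y :: "('a, 'd) gform"
  assumes "gpar e X"
  shows "exact (Tr tr (gd X) (gstar g (gi \<xi> (gstar g (gd Y)))))"
proof -
  obtain \<kappa> where k: "\<And>x :: ('a, 'd) lform. hodge g (hodge g x) = \<kappa> *\<^sub>R x"
    using hodge_hodge[OF inv sym] by blast
  have "gstar g (gi \<xi> (gstar g (gd Y))) = hsign TYPE('d) *\<^sub>R gmetric g \<xi> (gstar g (gstar g (gd Y)))"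
    by (simp add: vec_eq_iff hodge_inner[OF inv sym])
  also have "gstar g (gstar g (gd Y)) = \<kappa> *\<^sub>R gd Y" by (simp add: vec_eq_iff k)
  also have "hsign TYPE('d) *\<^sub>R gmetric g \<xi> (\<kappa> *\<^sub>R gd Y) = gd (- (hsign TYPE('d) * \<kappa>) *\<^sub>R gmetric g \<xi> Y)"
    by (simp add: gop_simps gd_gmetric)
  finally show ?thesis
    using exact_gd[OF assms, of "gd (- (hsign TYPE('d) * \<kappa>) *\<^sub>R gmetric g \<xi> Y)"] by (simp add: Tr_simps)
qed

lemma gpar_gd_Pi: "gpar (int n) (gd (Pi k j))" and gpar_gd_Cb: "gpar (int n + 1) (gd (Cb k j))" and gpar_Cb: "gpar (int n) (Cb k j)"
  using gpar_gop(1)[OF gpar_antighost[of n k j]] gpar_cong[OF gpar_gop(1)[OF gpar_multiplier[of n k j]], of "int n"] gpar_antighost[of n k j]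
  by simp_all

lemma gdeg_rows:
  assumes "j \<le> n - k" "k \<le> n"
  shows "gdeg (n - k - j) (Cb k (int j))" "gdeg (n - k - j) (Pi k (int j))"
    "gdeg (Suc (n - k - j)) (gd (Cb k (int j)))" "gdeg (Suc (n - k - j)) (gd (Pi k (int j)))"
proof -
  have "nat (int n - int j - int k) = n - k - j" using assms by auto
  then show "gdeg (n - k - j) (Cb k (int j))" "gdeg (n - k - j) (Pi k (int j))"
    "gdeg (Suc (n - k - j)) (gd (Cb k (int j)))" "gdeg (Suc (n - k - j)) (gd (Pi k (int j)))"
    using gdeg_antighost[of n "int j" k] gdeg_multiplier[of n "int j" k]
      gdeg_gop(1)[OF gdeg_antighost[of n "int j" k]] gdeg_gop(1)[OF gdeg_multiplier[of n "int j" k]] by simp_all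
qed

lemma gdeg_rows_shift:
  assumes "j \<le> n - k" "1 \<le> k" "k \<le> n"
  shows "gdeg (n - k - j) (Cb (k - 1) (int j + 1))" "gdeg (n - k - j) (Pi (k - 1) (int j + 1))"
    "gdeg (Suc (n - k - j)) (Cb (k - 1) (int j))" "gdeg (Suc (n - k - j)) (Pi (k - 1) (int j))"
proof -
  have e1: "n - k - j = nat (int n - (int j + 1) - int (k - 1))" and e2: "Suc (n - k - j) = nat (int n - int j - int (k - 1))"
    using assms by (auto simp: of_nat_diff)
  show "gdeg (n - k - j) (Cb (k - 1) (int j + 1))" "gdeg (n - k - j) (Pi (k - 1) (int j + 1))"
    unfolding e1 by (rule gdeg_antighost, rule gdeg_multiplier)
  show "gdeg (Suc (n - k - j)) (Cb (k - 1) (int j))" "gdeg (Suc (n - k - j)) (Pi (k - 1) (int j))"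
    unfolding e2 by (rule gdeg_antighost, rule gdeg_multiplier)
qed

lemma W_der: "gpar e X \<Longrightarrow> W \<xi> (Tr tr X Y) = Tr tr (gmap (W \<xi>) X) Y + sg e *\<^sub>R Tr tr X (gmap (W \<xi>) Y)"
  using is_der_Tr[OF evol_is_der[OF evol_W]] by simp

lemmas W_lin = is_der_simps[OF evol_is_der[OF evol_W]]

subsection \<open>Variation of the action\<close>

text \<open>On both total forms the operator is minus a contraction, and as derivations the two
  agree up to sign on everything but \<open>d\<close>. Being evolutionary, the operator anticommutes
  with \<open>d\<close>, and the discrepancy is a Lie derivative.\<close>

lemma W_Lagr: "W \<xi> Lagr = - inner_deriv \<xi> Lagr - Tr tr Phi1 (gLie \<xi> Phi2)"
proof -
  have i: "inner_deriv \<xi> (Tr tr X Y) = Tr tr (gi \<xi> X) Y + sg e *\<^sub>R Tr tr X (gi \<xi> Y)" if "gpar e X" for e and X Y :: "('a, 'd) gform"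
    using is_der_Tr[OF is_der_inner that] by (simp add: gop_gmap)
  have B: "gpar 2 (bracket br Phi1 Phi1)" using gpar_bracket[OF gpar_Phi1 gpar_Phi1] by simp
  have "W \<xi> (Tr tr Phi1 (gd Phi2)) = - inner_deriv \<xi> (Tr tr Phi1 (gd Phi2)) - Tr tr Phi1 (gLie \<xi> Phi2)"
    by (simp add: W_der[OF gpar_Phi1] i[OF gpar_Phi1] W_Phi1 W_Phi2 W_simps Tr_simps gop_simps gLie_def)
  moreover have "W \<xi> (Tr tr (bracket br Phi1 Phi1) Phi2) = - inner_deriv \<xi> (Tr tr (bracket br Phi1 Phi1) Phi2)"
    by (simp add: W_der[OF B] i[OF B] W_Phi1 W_Phi2 is_der_bracket[OF evol_is_der[OF evol_W] gpar_Phi1] is_der_gi[OF gpar_Phi1] Tr_simps bracket_simps sg_def)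
  ultimately show ?thesis
    unfolding Lagr_def by (simp add: W_lin inner_simps)
qed

lemma W_Sigma_hat: "W \<xi> (Sigma_hat n g br tr) = - (\<Sum>p\<le>CARD('d). Tr tr (l1 p) (gLie \<xi> (l2 (n + 2 - p))))"
proof -
  have "part (n + 2 + 1) Lagr = 0"
    using deg_too_big[OF deg_part[of "n + 2 + 1" Lagr]] by (simp add: dim)
  then have "part (n + 2) (inner_deriv \<xi> Lagr) = 0"
    by (simp add: part_inner inner_simps)
  then have "W \<xi> (Sigma_hat n g br tr) = - part (n + 2) (Tr tr Phi1 (gLie \<xi> Phi2))"
    unfolding Sigma_hat_eq part_vert[OF evol_vert[OF evol_W], symmetric] W_Lagr by (simp add: part_simps)
  also have "part (n + 2) (Tr tr Phi1 (gLie \<xi> Phi2)) = (\<Sum>p\<le>CARD('d). part (n + 2) (Tr tr (l1 p) (gLie \<xi> Phi2)))"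
    by (simp add: Phi1_def Tr_simps part_simps)
  also have "\<dots> = (\<Sum>p\<le>CARD('d). Tr tr (l1 p) (gLie \<xi> (l2 (n + 2 - p))))"
  proof (intro sum.cong refl)
    fix p assume "p \<in> {..CARD('d)}"
    moreover have "gmap (part q) (gLie \<xi> Phi2) = gLie \<xi> (l2 q)" for q
      using gpart_evol[OF evol_Lie, of q \<xi> Phi2] by (simp add: gpart_Phi2 gop_gmap)
    ultimately show "part (n + 2) (Tr tr (l1 p) (gLie \<xi> Phi2)) = Tr tr (l1 p) (gLie \<xi> (l2 (n + 2 - p)))"
      by (simp add: part_Tr[OF gdeg_l1] dim)
  qed
  finally show ?thesis .
qed

text \<open>The part of the breaking that comes from the bare sources; the contributions of the
  shifts by \<open>c-bar\<close> and by the antighosts are split off as \<open>rest_A\<close> and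
  \<open>rest_B\<close>.\<close>

definition Delta_src :: "'d vector \<Rightarrow> ('a, 'd) lform" where
  "Delta_src \<xi> = - (\<Sum>j = 0..n. Tr tr (F (SrcB j)) (gLie \<xi> (F (BF j))))
     + (-1) ^ n *\<^sub>R Tr tr (F SrcGamma) (gLie \<xi> (F Conn))
     + (-1) ^ n *\<^sub>R Tr tr (F SrcTau) (gLie \<xi> (F Ghost))"

definition rest_A :: "'d vector \<Rightarrow> ('a, 'd) lform" where
  "rest_A \<xi> = Tr tr (F Conn) (gLie \<xi> (gstar g (gd (F AGhost))))"

definition rest_B :: "'d vector \<Rightarrow> ('a, 'd) lform" where
  "rest_B \<xi> = (\<Sum>j = 0..<n. (-1) ^ j *\<^sub>R Tr tr (gstar g (gd (Cb 1 (int j)))) (gLie \<xi> (F (BF j))))"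

text \<open>Apart from the splitting of the shifted sources, the only work is to move the Lie
  derivative from \<open>tau\<close> and \<open>gamma\<close> onto \<open>c\<close> and
  \<open>A\<close>, which costs an exact form and a sign.\<close>

lemma exact_W_Sigma_hat: "exact (W \<xi> (Sigma_hat n g br tr) - (Delta_src \<xi> + rest_A \<xi> + rest_B \<xi>))"
proof -
  let ?f = "\<lambda>p. Tr tr (l1 p) (gLie \<xi> (l2 (n + 2 - p)))"
  have "(\<Sum>p\<le>CARD('d). ?f p) = ?f 0 + (?f 1 + (\<Sum>j\<le>n. ?f (j + 2)))"
    by (simp add: dim sum.atMost_Suc_shift del: sum.atMost_Suc)
  also have "?f 0 = Tr tr (F Ghost) (gLie \<xi> (F SrcTau))" by (simp add: ladder1_def ladder2_def)
  also have "?f 1 = Tr tr (F Conn) (gLie \<xi> (F SrcGamma)) - rest_A \<xi>"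
    by (simp add: ladder1_def ladder2_def gamma_hat_def gop_simps Tr_simps rest_A_def)
  also have "(\<Sum>j\<le>n. ?f (j + 2)) = (\<Sum>j = 0..n. Tr tr (F (SrcB j)) (gLie \<xi> (F (BF j)))) - rest_B \<xi>"
  proof -
    have "?f (j + 2) = Tr tr (F (SrcB j)) (gLie \<xi> (F (BF j))) - (-1) ^ j *\<^sub>R Tr tr (gstar g (gd (Cb 1 (int j)))) (gLie \<xi> (F (BF j)))" if "j \<le> n" for j
      using that by (simp add: ladder1_eq ladder2_def lfield1_def Tr_simps)
    then have "(\<Sum>j\<le>n. ?f (j + 2)) = (\<Sum>j = 0..n. Tr tr (F (SrcB j)) (gLie \<xi> (F (BF j))))
       - (\<Sum>j = 0..n. (-1) ^ j *\<^sub>R Tr tr (gstar g (gd (Cb 1 (int j)))) (gLie \<xi> (F (BF j))))"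
      by (simp add: sum_subtractf atMost_atLeast0)
    also have "(\<Sum>j = 0..n. (-1) ^ j *\<^sub>R Tr tr (gstar g (gd (Cb 1 (int j)))) (gLie \<xi> (F (BF j)))) = rest_B \<xi>"
    proof -
      have "Cb 1 (int n) = 0" by (simp add: antighost_def)
      then have "Tr tr (gstar g (gd (Cb 1 (int n)))) (gLie \<xi> (F (BF n))) = 0" by (simp only: gop_simps Tr_simps)
      then show ?thesis unfolding rest_B_def atLeast0_atMost_Suc
        by (intro sum.mono_neutral_right) (auto simp: not_less)
    qed
    finally show ?thesis .
  qed
  finally have e: "W \<xi> (Sigma_hat n g br tr) - (Delta_src \<xi> + rest_A \<xi> + rest_B \<xi>) =
      - (Tr tr (F Ghost) (gLie \<xi> (F SrcTau)) + (-1) ^ n *\<^sub>R Tr tr (F SrcTau) (gLie \<xi> (F Ghost)))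
      - (Tr tr (F Conn) (gLie \<xi> (F SrcGamma)) + (-1) ^ n *\<^sub>R Tr tr (F SrcGamma) (gLie \<xi> (F Conn)))"
    unfolding W_Sigma_hat Delta_src_def by (simp add: algebra_simps)
  have p: "gpar 1 (F Ghost)" "gpar (int n) (F SrcTau)" "gpar 1 (F Conn)" "gpar (int n) (F SrcGamma)"
    using gpar_F[of Ghost] gpar_F[of SrcTau] gpar_F[of Conn] gpar_F[of SrcGamma] by (simp_all add: fpar_def)
  have d: "gdeg 0 (F Ghost)" "gdeg (n + 2) (F SrcTau)" "gdeg 1 (F Conn)" "gdeg (n + 1) (F SrcGamma)"
    using gdeg_F[of Ghost] gdeg_F[of SrcTau] gdeg_F[of Conn] gdeg_F[of SrcGamma] by simp_all
  have c: "(-1) ^ n *\<^sub>R Tr tr Y (gLie \<xi> X) = Tr tr (gLie \<xi> X) Y" if "gpar 1 X" "gpar (int n) Y" for X Y :: "('a, 'd) gform"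
    using Tr_commute[OF gpar_gop(5)[OF that(1)] that(2), of tr, OF tr_sym] by (simp add: sg_of_nat)
  show ?thesis
    unfolding e c[OF p(1,2)] c[OF p(3,4)]
    using exact_gLie[OF p(1) d(1,2), of \<xi>] exact_gLie[OF p(3) d(3,4), of \<xi>]
    by (intro exact_diff exact_uminus) (simp_all add: add.commute)
qed

text \<open>\<open>rest_A\<close> cancels against the variation of the multiplier. Varying the
  connection yields the breaking term after integration by parts, and the antighost inside the
  shifted source contributes only an exact form.\<close>

lemma exact_W_pi:
  "exact (rest_A \<xi> + W \<xi> (- Tr tr (gd (F Mult)) (gstar g (F Conn))) - Tr tr (gd (gstar g (gi \<xi> (F (SrcB 0))))) (F Mult))"
proof -
  have p: "gpar 0 (F Mult)" "gpar 1 (F Conn)" "gpar (- 1) (F AGhost)" "gpar 1 (F (SrcB 0))"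
    using gpar_F[of Mult] gpar_F[of Conn] gpar_F[of AGhost] gpar_F[of "SrcB 0"] by (simp_all add: fpar_def)
  have d: "gdeg 1 (F Conn)" "gdeg 1 (gLie \<xi> (gd (F AGhost)))"
    using gdeg_F[of Conn] gdeg_gop(5)[OF gdeg_gop(1)[OF gdeg_F[of AGhost]]] by simp_all
  have q: "gpar 0 (gLie \<xi> (gd (F AGhost)))" using gpar_gop(5)[OF gpar_gop(1)[OF p(3)]] by simp
  have A: "rest_A \<xi> = - Tr tr (gd (gLie \<xi> (F AGhost))) (gstar g (F Conn))"
    unfolding rest_A_def gLie_gstar using Tr_hodge_commute[OF p(2) q d] by (simp add: gLie_gd)
  have WA: "gmap (W \<xi>) (F Conn) = - gi \<xi> (F (SrcB 0)) + gi \<xi> (gstar g (gd (Cb 1 0)))"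
  proof -
    have "gmap (W \<xi>) (l1 1) = - gi \<xi> (l1 2)" using W_l1[of \<xi> 1] by (simp only: one_add_one)
    moreover have "l1 1 = F Conn" by (simp add: ladder1_def)
    moreover have "l1 2 = F (SrcB 0) - gstar g (gd (Cb 1 0))" using ladder1_eq[of 2 n g] by (simp add: lfield1_def)
    ultimately show ?thesis by (simp add: gop_simps)
  qed
  have "gpar 1 (gd (F Mult))" using gpar_gop(1)[OF p(1)] by simp
  then have W: "W \<xi> (- Tr tr (gd (F Mult)) (gstar g (F Conn))) = Tr tr (gd (gLie \<xi> (F AGhost))) (gstar g (F Conn))
      - Tr tr (gd (F Mult)) (gstar g (gi \<xi> (F (SrcB 0)))) + Tr tr (gd (F Mult)) (gstar g (gi \<xi> (gstar g (gd (Cb 1 0)))))"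
    by (simp add: W_lin W_der W_simps W_Mult WA gop_simps Tr_simps)
  have e: "rest_A \<xi> + W \<xi> (- Tr tr (gd (F Mult)) (gstar g (F Conn))) - Tr tr (gd (gstar g (gi \<xi> (F (SrcB 0))))) (F Mult)
    = - (Tr tr (gd (F Mult)) (gstar g (gi \<xi> (F (SrcB 0)))) + Tr tr (F Mult) (gd (gstar g (gi \<xi> (F (SrcB 0))))))
      + Tr tr (gd (F Mult)) (gstar g (gi \<xi> (gstar g (gd (Cb 1 0)))))"
    using Tr_commute[OF gpar_gop(1)[OF gpar_gop(3)[OF gpar_gop(2)[OF p(4)]]] p(1), of tr, OF tr_sym] by (simp add: A W)
  have "exact (Tr tr (gd (F Mult)) (gstar g (gi \<xi> (F (SrcB 0)))) + Tr tr (F Mult) (gd (gstar g (gi \<xi> (F (SrcB 0))))))"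
    using exact_gd[OF p(1), of "gstar g (gi \<xi> (F (SrcB 0)))"] by simp
  then show ?thesis
    unfolding e by (rule exact_add[OF exact_uminus exact_gd_hodge_gi_hodge_gd[OF p(1)]])
qed

text \<open>\<open>rest_B\<close> and the Lie derivative in the multiplier variation form an exact
  total, while \<open>g(\<xi>)\<close> on row 1 and \<open>i_\<xi>\<close> on the second ladder
  telescope. At the lower end \<open>B^0\<close> goes to the shifted \<open>gamma\<close>: its bare
  part is the breaking term and its shift is exact.\<close>

lemma exact_W_Pi_B:
  "exact (rest_B \<xi> + W \<xi> (- (\<Sum>j = 0..<n. Tr tr (gd (Pi 1 (int j))) (gstar g (F (BF j)))))
     - Tr tr (gd (gstar g (gi \<xi> (F SrcGamma)))) (Pi 1 0))"
proof -
  let ?c = "(-1) ^ (n + 1) :: real"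
  \<comment> \<open>The cutoff is needed because \<open>nat\<close> sends negative indices to 0; it
    makes the telescoping sum start at zero.\<close>
  define R where "R j = (if j < 0 then 0 else Tr tr (gmetric g \<xi> (gd (Pi 1 (j + 1)))) (gstar g (F (BF (nat j)))))" for j :: int
  let ?G = "Tr tr (gd (Pi 1 0)) (gstar g (gi \<xi> (F SrcGamma)))" and ?H = "Tr tr (gd (Pi 1 0)) (gstar g (gi \<xi> (gstar g (gd (F AGhost)))))"
  have hn: "sg (int n) * hsign TYPE('d) = -1" "sg (int n) * (hsign TYPE('d) * r) = - r" for r by (auto simp: hsign_eq sg_def)
  have step: "\<exists>\<theta>. exact \<theta> \<and> (-1) ^ j *\<^sub>R Tr tr (gstar g (gd (Cb 1 (int j)))) (gLie \<xi> (F (BF j)))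
      - W \<xi> (Tr tr (gd (Pi 1 (int j))) (gstar g (F (BF j))))
      = \<theta> + sg (int n) *\<^sub>R (R (int j) - R (int j - 1)) + (if j = 0 then sg (int n) *\<^sub>R (?G - ?H) else 0)"
    if j: "j < n" for j
  proof -
    have pB: "gpar (int n) (F (BF j))" and dB: "gdeg (n - j) (F (BF j))"
      using gpar_F[of "BF j"] gdeg_F[of "BF j"] j by (simp_all add: fpar_def of_nat_diff)
    have dC: "gdeg (n - j) (gd (Cb 1 (int j)))"
      using gdeg_rows(3)[of j 1] j by (simp add: Suc_diff_Suc)
    have pC: "gpar 1 (gstar g (gd (Cb 1 (int j))))"
      by (rule gpar_cong[OF gpar_gop(3)[OF gpar_gd_Cb]]) (simp add: dim)
    have f1: "(-1) ^ j *\<^sub>R Tr tr (gstar g (gd (Cb 1 (int j)))) (gLie \<xi> (F (BF j)))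
      = Tr tr (gd (Cb 1 (int j))) (gstar g (gLie \<xi> (F (BF j))))"
    proof -
      have "Tr tr (gstar g (gd (Cb 1 (int j)))) (gLie \<xi> (F (BF j))) = sg (1 * int n) *\<^sub>R Tr tr (gLie \<xi> (F (BF j))) (gstar g (gd (Cb 1 (int j))))"
        by (rule Tr_commute[OF pC gpar_gop(5)[OF pB], of tr, OF tr_sym])
      also have "Tr tr (gLie \<xi> (F (BF j))) (gstar g (gd (Cb 1 (int j)))) =
          sg (int n * (int n + 1) + int (n - j)) *\<^sub>R Tr tr (gd (Cb 1 (int j))) (gstar g (gLie \<xi> (F (BF j))))"
        by (rule Tr_hodge_commute[OF gpar_gop(5)[OF pB] gpar_gd_Cb gdeg_gop(5)[OF dB] dC])
      finally show ?thesis using j by (simp add: minus_one_power_iff sg_def of_nat_diff)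
    qed
    have f2: "W \<xi> (Tr tr (gd (Pi 1 (int j))) (gstar g (F (BF j)))) =
        - (?c *\<^sub>R Tr tr (gd (gmetric g \<xi> (Pi 1 (int j + 1)))) (gstar g (F (BF j)))) - Tr tr (gLie \<xi> (gd (Cb 1 (int j)))) (gstar g (F (BF j)))
        - sg (int n) *\<^sub>R Tr tr (gd (Pi 1 (int j))) (gstar g (gi \<xi> (l2 (n - j + 1))))"
    proof -
      have "gmap (W \<xi>) (F (BF j)) = - gi \<xi> (l2 (n - j + 1))"
        using W_l2[of \<xi> "n - j"] j by (simp add: ladder2_def[of _ _ "n - j"])
      then show ?thesis
        using W_Pi[of 1 j \<xi>] j by (simp add: W_der[OF gpar_gd_Pi] W_simps gop_simps Tr_simps gLie_gd)
    qed
    have f3: "?c *\<^sub>R Tr tr (gd (gmetric g \<xi> (Pi 1 (int j + 1)))) (gstar g (F (BF j))) = sg (int n) *\<^sub>R R (int j)"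
      by (simp add: R_def gd_gmetric Tr_simps sg_of_nat sg_add)
    have f4: "Tr tr (gd (Pi 1 (int j))) (gstar g (gi \<xi> (l2 (n - j + 1)))) = (if j = 0 then ?G - ?H else - R (int j - 1))"
    proof (cases j)
      case 0
      then show ?thesis by (simp add: ladder2_def gamma_hat_def gop_simps Tr_simps)
    next
      case (Suc i)
      then have "n - j + 1 = n - i" "i \<le> n" using j by auto
      then have "l2 (n - j + 1) = F (BF i)" by (simp add: ladder2_def)
      then show ?thesis using Suc
        by (simp add: Tr_hodge_inner[OF gpar_gd_Pi] hn R_def add.commute)
    qed
    have "R (- 1) = 0" by (simp add: R_def)
    then have "(-1) ^ j *\<^sub>R Tr tr (gstar g (gd (Cb 1 (int j)))) (gLie \<xi> (F (BF j)))
        - W \<xi> (Tr tr (gd (Pi 1 (int j))) (gstar g (F (BF j))))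
        = (Tr tr (gLie \<xi> (gd (Cb 1 (int j)))) (gstar g (F (BF j))) + Tr tr (gd (Cb 1 (int j))) (gstar g (gLie \<xi> (F (BF j)))))
          + sg (int n) *\<^sub>R (R (int j) - R (int j - 1)) + (if j = 0 then sg (int n) *\<^sub>R (?G - ?H) else 0)"
      unfolding f1 f2 f3 f4 by (cases "j = 0") (simp_all add: algebra_simps scaleR_diff_right)
    moreover have "exact (Tr tr (gLie \<xi> (gd (Cb 1 (int j)))) (gstar g (F (BF j))) + Tr tr (gd (Cb 1 (int j))) (gstar g (gLie \<xi> (F (BF j)))))"
      by (rule exact_gLie_hodge[OF gpar_gd_Cb dC dB]) simp
    ultimately show ?thesis by blast
  qed
  then obtain \<theta> where th: "\<And>j. j < n \<Longrightarrow> exact (\<theta> j)"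
    "\<And>j. j < n \<Longrightarrow> (-1) ^ j *\<^sub>R Tr tr (gstar g (gd (Cb 1 (int j)))) (gLie \<xi> (F (BF j)))
      - W \<xi> (Tr tr (gd (Pi 1 (int j))) (gstar g (F (BF j))))
      = \<theta> j + sg (int n) *\<^sub>R (R (int j) - R (int j - 1)) + (if j = 0 then sg (int n) *\<^sub>R (?G - ?H) else 0)"
    by metis
  have "rest_B \<xi> + W \<xi> (- (\<Sum>j = 0..<n. Tr tr (gd (Pi 1 (int j))) (gstar g (F (BF j)))))
     = (\<Sum>j = 0..<n. \<theta> j + sg (int n) *\<^sub>R (R (int j) - R (int j - 1)) + (if j = 0 then sg (int n) *\<^sub>R (?G - ?H) else 0))"
    unfolding rest_B_def W_lin diff_conv_add_uminus[symmetric] sum_subtractf[symmetric] by (intro sum.cong refl th(2)) simp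
  also have "\<dots> = (\<Sum>j = 0..<n. \<theta> j) + sg (int n) *\<^sub>R (\<Sum>j = 0..<n. R (int j) - R (int j - 1)) + sg (int n) *\<^sub>R (?G - ?H)"
    using n by (simp add: sum.distrib scaleR_sum_right)
  also have "(\<Sum>j = 0..<n. R (int j) - R (int j - 1)) = 0"
  proof -
    have "{0..<n} = {0..n - 1}" using n by auto
    moreover have "R (int (n - 1)) = 0"
    proof -
      \<comment> \<open>Row 1 ends at entry \<open>n - 1\<close>, so the upper end of the
        telescoping sum vanishes.\<close>
      have "Pi 1 (int (n - 1) + 1) = 0" using n by (simp add: multiplier_def of_nat_diff)
      then show ?thesis unfolding R_def by (simp only: gop_simps Tr_simps if_cancel)
    qed
    ultimately show ?thesis by (simp add: sum_telescope) (simp add: R_def)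
  qed
  finally have e: "rest_B \<xi> + W \<xi> (- (\<Sum>j = 0..<n. Tr tr (gd (Pi 1 (int j))) (gstar g (F (BF j)))))
    = (\<Sum>j = 0..<n. \<theta> j) + sg (int n) *\<^sub>R (?G - ?H)" by simp
  have pg: "gpar (int n) (F SrcGamma)" using gpar_F[of SrcGamma] by (simp add: fpar_def)
  have pG: "gpar 0 (gd (gstar g (gi \<xi> (F SrcGamma))))"
    by (rule gpar_cong[OF gpar_gop(1)[OF gpar_gop(3)[OF gpar_gop(2)[OF pg]]]]) (simp add: dim)
  have c: "Tr tr (gd (gstar g (gi \<xi> (F SrcGamma)))) (Pi 1 0) = Tr tr (Pi 1 0) (gd (gstar g (gi \<xi> (F SrcGamma))))"
    using Tr_commute[OF pG gpar_Pi, of tr, OF tr_sym] by simp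
  have "exact (sg (int n) *\<^sub>R (?G + sg (int n + 1) *\<^sub>R Tr tr (Pi 1 0) (gd (gstar g (gi \<xi> (F SrcGamma))))) - sg (int n) *\<^sub>R ?H + (\<Sum>j = 0..<n. \<theta> j))"
    using th(1) by (intro exact_add exact_diff exact_scaleR exact_sum exact_gd[OF gpar_Pi] exact_gd_hodge_gi_hodge_gd[OF gpar_Pi]) simp
  moreover have "sg (int n) *\<^sub>R (?G + sg (int n + 1) *\<^sub>R Tr tr (Pi 1 0) (gd (gstar g (gi \<xi> (F SrcGamma))))) - sg (int n) *\<^sub>R ?H + (\<Sum>j = 0..<n. \<theta> j)
    = (\<Sum>j = 0..<n. \<theta> j) + sg (int n) *\<^sub>R (?G - ?H) - Tr tr (Pi 1 0) (gd (gstar g (gi \<xi> (F SrcGamma))))"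
    by (simp add: sg_add algebra_simps scaleR_diff_right)
  ultimately show ?thesis unfolding e c by (simp only:)
qed

subsection \<open>Antighost rows\<close>

definition row :: "nat \<Rightarrow> nat \<Rightarrow> ('a, 'd) lform" where
  "row k j = - Tr tr (gd (Pi k (int j))) (gstar g (Cb (k - 1) (int j)))
     + (-1) ^ (n + 1) *\<^sub>R Tr tr (gd (Cb k (int j))) (gstar g (Pi (k - 1) (int j)))"

text \<open>The Lie derivatives from the two multipliers join to an exact form. What remains is
  sorted into pairings of a row \<open>k\<close> multiplier with an antighost and of a row
  \<open>k\<close> antighost with a multiplier.\<close>

lemma W_row:
  assumes k: "1 \<le> k" "k \<le> n" and j: "j \<le> n - k"
    and C: "gmap (W \<xi>) (Cb k (int j)) = c1" "gmap (W \<xi>) (Cb (k - 1) (int j)) = c2"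
    and P: "gmap (W \<xi>) (Pi k (int j)) = p1 + gLie \<xi> (Cb k (int j))" "gmap (W \<xi>) (Pi (k - 1) (int j)) = p2 + gLie \<xi> (Cb (k - 1) (int j))"
  shows "\<exists>E. exact E \<and> W \<xi> (row k j) = E
    + (Tr tr (gd p1) (gstar g (Cb (k - 1) (int j))) - sg (int n) *\<^sub>R Tr tr (gd (Pi k (int j))) (gstar g c2))
    + (sg (int n) *\<^sub>R Tr tr (gd c1) (gstar g (Pi (k - 1) (int j))) + Tr tr (gd (Cb k (int j))) (gstar g p2))"
proof -
  let ?E = "Tr tr (gLie \<xi> (gd (Cb k (int j)))) (gstar g (Cb (k - 1) (int j))) + Tr tr (gd (Cb k (int j))) (gstar g (gLie \<xi> (Cb (k - 1) (int j))))"
  have "Suc (n - k - j) \<le> n + 2" by simp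
  then have "exact ?E"
    by (rule exact_gLie_hodge[OF gpar_gd_Cb gdeg_rows(3)[OF j k(2)] gdeg_rows_shift(3)[OF j k]])
  moreover have "W \<xi> (row k j) = ?E
    + (Tr tr (gd p1) (gstar g (Cb (k - 1) (int j))) - sg (int n) *\<^sub>R Tr tr (gd (Pi k (int j))) (gstar g c2))
    + (sg (int n) *\<^sub>R Tr tr (gd c1) (gstar g (Pi (k - 1) (int j))) + Tr tr (gd (Cb k (int j))) (gstar g p2))"
    unfolding row_def
    by (simp add: W_lin W_der[OF gpar_gd_Pi] W_der[OF gpar_gd_Cb] W_simps C[unfolded One_nat_def] P[unfolded One_nat_def] gop_simps Tr_simps gLie_gd sg_of_nat sg_add
        scaleR_right_distrib scaleR_diff_right)
  ultimately show ?thesis by blast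
qed

text \<open>Row \<open>k\<close> moves to entry \<open>j + 1\<close> by \<open>g(\<xi>)\<close> and
  row \<open>k - 1\<close> to entry \<open>j - 1\<close> by \<open>i_\<xi>\<close>. Hodge duality
  turns the second into the first with the opposite sign, so each of the two families telescopes by
  itself.\<close>

lemma exact_W_row_odd:
  assumes k: "2 \<le> k" "k \<le> n" "odd k"
  shows "exact (W \<xi> (\<Sum>j = 0..n - k. row k j))"
proof -
  obtain m where m: "k = 2 * m + 1" using k(3) by (rule oddE)
  let ?c = "sg (int n + int m + 1)" and ?a = "sg (int m + 1)"
  define R where "R j = Tr tr (gmetric g \<xi> (gd (Pi k (j + 1)))) (gstar g (Cb (k - 1) j))" for j
  define R' where "R' j = Tr tr (gmetric g \<xi> (gd (Cb k (j + 1)))) (gstar g (Pi (k - 1) j))" for j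
  have "\<exists>E. exact E \<and> W \<xi> (row k j) = E - ?c *\<^sub>R (R (int j) - R (int j - 1)) - (sg (int n) * ?c) *\<^sub>R (R' (int j) - R' (int j - 1))"
    if j: "j \<le> n - k" for j
  proof -
    have k1: "1 \<le> k" "1 \<le> k - 1" "k - 1 \<le> n" "j \<le> n - (k - 1)" using k j by auto
    have ev: "even (k - 1)" using m by simp
    have "gmap (W \<xi>) (Cb k (int j)) = ?c *\<^sub>R gmetric g \<xi> (Cb k (int j + 1))"
      using W_Cb[OF k1(1) k(2) j] by (simp add: m sg_of_nat sg_add add_ac mult_ac)
    moreover have "gmap (W \<xi>) (Pi k (int j)) = ?c *\<^sub>R gmetric g \<xi> (Pi k (int j + 1)) + gLie \<xi> (Cb k (int j))"
      using W_Pi[OF k1(1) k(2) j] by (simp add: m sg_of_nat sg_add add_ac mult_ac)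
    moreover have "gmap (W \<xi>) (Cb (k - 1) (int j)) = ?a *\<^sub>R gi \<xi> (Cb (k - 1) (int j - 1))"
      using W_Cb[OF k1(2-4)] ev by (simp add: m sg_of_nat sg_add add_ac mult_ac)
    moreover have "gmap (W \<xi>) (Pi (k - 1) (int j)) = ?a *\<^sub>R gi \<xi> (Pi (k - 1) (int j - 1)) + gLie \<xi> (Cb (k - 1) (int j))"
      using W_Pi[OF k1(2-4)] ev by (simp add: m sg_of_nat sg_add add_ac mult_ac)
    ultimately obtain E where E: "exact E" and e: "W \<xi> (row k j) = E
      + (Tr tr (gd (?c *\<^sub>R gmetric g \<xi> (Pi k (int j + 1)))) (gstar g (Cb (k - 1) (int j)))
        - sg (int n) *\<^sub>R Tr tr (gd (Pi k (int j))) (gstar g (?a *\<^sub>R gi \<xi> (Cb (k - 1) (int j - 1)))))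
      + (sg (int n) *\<^sub>R Tr tr (gd (?c *\<^sub>R gmetric g \<xi> (Cb k (int j + 1)))) (gstar g (Pi (k - 1) (int j)))
        + Tr tr (gd (Cb k (int j))) (gstar g (?a *\<^sub>R gi \<xi> (Pi (k - 1) (int j - 1)))))"
      using W_row[OF k1(1) k(2) j] by metis
    have 1: "Tr tr (gd (?c *\<^sub>R gmetric g \<xi> (Pi k (int j + 1)))) (gstar g (Cb (k - 1) (int j))) = - (?c *\<^sub>R R (int j))"
      by (simp add: R_def gop_simps gd_gmetric Tr_simps)
    have "sg (int n) * ?a * (sg (int n) * hsign TYPE('d)) = - ?c" by (auto simp: hsign_eq sg_def)
    then have 2: "sg (int n) *\<^sub>R Tr tr (gd (Pi k (int j))) (gstar g (?a *\<^sub>R gi \<xi> (Cb (k - 1) (int j - 1)))) = - (?c *\<^sub>R R (int j - 1))"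
      by (simp add: R_def gop_simps Tr_simps Tr_hodge_inner[OF gpar_gd_Pi] mult.assoc)
    have 3: "sg (int n) *\<^sub>R Tr tr (gd (?c *\<^sub>R gmetric g \<xi> (Cb k (int j + 1)))) (gstar g (Pi (k - 1) (int j))) = - ((sg (int n) * ?c) *\<^sub>R R' (int j))"
      by (simp add: R'_def gop_simps gd_gmetric Tr_simps)
    have "?a * (sg (int n + 1) * hsign TYPE('d)) = sg (int n) * ?c" by (auto simp: hsign_eq sg_def)
    then have 4: "Tr tr (gd (Cb k (int j))) (gstar g (?a *\<^sub>R gi \<xi> (Pi (k - 1) (int j - 1)))) = (sg (int n) * ?c) *\<^sub>R R' (int j - 1)"
      by (simp add: R'_def gop_simps Tr_simps Tr_hodge_inner[OF gpar_gd_Cb])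
    show ?thesis
      using E e unfolding 1 2 3 4 by (intro exI[of _ E]) (simp add: scaleR_diff_right)
  qed
  then obtain E where E: "\<And>j. j \<le> n - k \<Longrightarrow> exact (E j)" and
    e: "\<And>j. j \<le> n - k \<Longrightarrow> W \<xi> (row k j) = E j - ?c *\<^sub>R (R (int j) - R (int j - 1)) - (sg (int n) * ?c) *\<^sub>R (R' (int j) - R' (int j - 1))"
    by metis
  have "W \<xi> (\<Sum>j = 0..n - k. row k j) = (\<Sum>j = 0..n - k. E j) - ?c *\<^sub>R (R (int (n - k)) - R (- 1)) - (sg (int n) * ?c) *\<^sub>R (R' (int (n - k)) - R' (- 1))"
    unfolding W_lin sum_telescope[symmetric] scaleR_sum_right sum_subtractf[symmetric] by (intro sum.cong refl e) simp
  \<comment> \<open>The upper ends contain an entry past the end of row \<open>k\<close>, the lower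
    ends the entry -1 of row \<open>k - 1\<close>.\<close>
  moreover have "R (int (n - k)) = 0" "R (- 1) = 0" "R' (int (n - k)) = 0" "R' (- 1) = 0"
    using k by (simp_all add: R_def R'_def antighost_def multiplier_def gop_simps Tr_simps of_nat_diff)
  ultimately show ?thesis using E by (auto intro!: exact_sum)
qed

text \<open>Here \<open>U\<close> and \<open>U'\<close> carry \<open>d i_\<xi>\<close>, but duality
  produces \<open>i_\<xi> d\<close>, so the rows alone do not telescope. The quadratic terms add
  \<open>?Q\<close>, which completes one family to an exact Lie derivative, and
  \<open>?V' + U'\<close>, which cancels the stray term of the other; their own remainder
  \<open>Y\<close> telescopes.\<close>

lemma exact_W_row_even:
  fixes x :: "nat \<Rightarrow> nat \<Rightarrow> nat \<Rightarrow> real"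
  assumes k: "2 \<le> k" "k \<le> n" "even k" and x: "\<And>k j. odd k \<Longrightarrow> x k j n = (-1) ^ (n + j + (k + 1) div 2)"
  shows "exact (W \<xi> ((\<Sum>j = 0..n - k. row k j)
    + (\<Sum>j = 0..n - k. x (k - 1) (j + 1) n *\<^sub>R Tr tr (Pi (k - 1) (int j + 1)) (gstar g (Pi k (int j))))))"
proof -
  obtain m where m: "k = 2 * m" using k(3) by (rule evenE)
  have m1: "1 \<le> m" using k(1) m by simp
  let ?c = "sg (int n + int m)" and ?a = "sg (int m + 1)"
  define U where "U j = Tr tr (gd (gi \<xi> (Pi k j))) (gstar g (Cb (k - 1) (j + 1)))" for j
  define U' where "U' j = Tr tr (gd (gi \<xi> (Cb k j))) (gstar g (Pi (k - 1) (j + 1)))" for j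
  define Y where "Y j = sg j *\<^sub>R Tr tr (gmetric g \<xi> (Pi (k - 1) (j + 2))) (gstar g (Pi k j))" for j
  let ?t = "\<lambda>j. x (k - 1) (j + 1) n *\<^sub>R Tr tr (Pi (k - 1) (int j + 1)) (gstar g (Pi k (int j)))"
  have "\<exists>E. exact E \<and> W \<xi> (row k j + ?t j) = E - ?a *\<^sub>R (U (int j) - U (int j - 1)) + ?c *\<^sub>R (U' (int j) - U' (int j - 1))
      + (- (Y (int j) - Y (int j - 1)))"
    if j: "j \<le> n - k" for j
  proof -
    have k1: "1 \<le> k" "1 \<le> k - 1" "k - 1 \<le> n" "j \<le> n - (k - 1)" "j + 1 \<le> n - (k - 1)" using k j by auto
    have od: "odd (k - 1)" "(k - 1 + 1) div 2 = m" using m m1 by auto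
    have "gmap (W \<xi>) (Cb k (int j)) = ?a *\<^sub>R gi \<xi> (Cb k (int j - 1))"
      using W_Cb[OF k1(1) k(2) j] by (simp add: m sg_of_nat sg_add add_ac mult_ac)
    moreover have W2: "gmap (W \<xi>) (Pi k (int j)) = ?a *\<^sub>R gi \<xi> (Pi k (int j - 1)) + gLie \<xi> (Cb k (int j))"
      using W_Pi[OF k1(1) k(2) j] by (simp add: m sg_of_nat sg_add add_ac mult_ac)
    moreover have "gmap (W \<xi>) (Cb (k - 1) (int j)) = ?c *\<^sub>R gmetric g \<xi> (Cb (k - 1) (int j + 1))"
      using W_Cb[OF k1(2-4)] k(1,3) unfolding od(2) by (simp add: sg_of_nat sg_add)
    moreover have "gmap (W \<xi>) (Pi (k - 1) (int j)) = ?c *\<^sub>R gmetric g \<xi> (Pi (k - 1) (int j + 1)) + gLie \<xi> (Cb (k - 1) (int j))"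
      using W_Pi[OF k1(2-4)] k(1,3) unfolding od(2) by (simp add: sg_of_nat sg_add)
    ultimately obtain E where E: "exact E" and e: "W \<xi> (row k j) = E
      + (Tr tr (gd (?a *\<^sub>R gi \<xi> (Pi k (int j - 1)))) (gstar g (Cb (k - 1) (int j)))
        - sg (int n) *\<^sub>R Tr tr (gd (Pi k (int j))) (gstar g (?c *\<^sub>R gmetric g \<xi> (Cb (k - 1) (int j + 1)))))
      + (sg (int n) *\<^sub>R Tr tr (gd (?a *\<^sub>R gi \<xi> (Cb k (int j - 1)))) (gstar g (Pi (k - 1) (int j)))
        + Tr tr (gd (Cb k (int j))) (gstar g (?c *\<^sub>R gmetric g \<xi> (Pi (k - 1) (int j + 1)))))"
      using W_row[OF k1(1) k(2) j] by metis
    let ?V = "Tr tr (gi \<xi> (gd (Pi k (int j)))) (gstar g (Cb (k - 1) (int j + 1)))"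
    let ?V' = "Tr tr (gi \<xi> (gd (Cb k (int j)))) (gstar g (Pi (k - 1) (int j + 1)))"
    let ?Q = "Tr tr (Pi k (int j)) (gstar g (gLie \<xi> (Cb (k - 1) (int j + 1))))"
    note d = gdeg_rows[OF j k(2)] and d' = gdeg_rows_shift[OF j k1(1) k(2)]
    have 1: "Tr tr (gd (?a *\<^sub>R gi \<xi> (Pi k (int j - 1)))) (gstar g (Cb (k - 1) (int j))) = ?a *\<^sub>R U (int j - 1)"
      by (simp add: U_def gop_simps Tr_simps)
    have "sg (int n) * ?c * (sg (int n) * hsign TYPE('d)) = ?a" by (auto simp: hsign_eq sg_def)
    then have 2: "sg (int n) *\<^sub>R Tr tr (gd (Pi k (int j))) (gstar g (?c *\<^sub>R gmetric g \<xi> (Cb (k - 1) (int j + 1)))) = - (?a *\<^sub>R ?V)"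
      by (simp add: gop_simps Tr_simps Tr_hodge_metric[OF gpar_gd_Pi d(4) d'(1)[unfolded One_nat_def]] mult.assoc)
    have "sg (int n) * ?a = - ?c" by (auto simp: sg_def)
    then have 3: "sg (int n) *\<^sub>R Tr tr (gd (?a *\<^sub>R gi \<xi> (Cb k (int j - 1)))) (gstar g (Pi (k - 1) (int j))) = - (?c *\<^sub>R U' (int j - 1))"
      by (simp add: U'_def gop_simps Tr_simps)
    have "?c * (sg (int n + 1) * hsign TYPE('d)) = ?c" by (auto simp: hsign_eq sg_def)
    then have 4: "Tr tr (gd (Cb k (int j))) (gstar g (?c *\<^sub>R gmetric g \<xi> (Pi (k - 1) (int j + 1)))) = - (?c *\<^sub>R ?V')"
      by (simp add: gop_simps Tr_simps Tr_hodge_metric[OF gpar_gd_Cb d(3) d'(2)[unfolded One_nat_def]])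
    have L: "Tr tr (gLie \<xi> X) Z = Tr tr (gi \<xi> (gd X)) Z + Tr tr (gd (gi \<xi> X)) Z" for X Z :: "('a, 'd) gform"
      by (simp add: gLie_def Tr_simps)
    \<comment> \<open>The gauge parameter is what gives \<open>?Q\<close> the coefficient
      \<open>?a\<close> and \<open>?V'\<close> the coefficient \<open>?c\<close>, so that both
      corrections match the terms left by the row.\<close>
    have xj: "x (k - 1) (j + 1) n = sg (int n + int j + 1 + int m)"
      using x[OF od(1), of "j + 1"] unfolding od(2) by (simp add: sg_of_nat sg_add mult_ac)
    have P1: "gmap (W \<xi>) (Pi (k - 1) (int j + 1)) = ?c *\<^sub>R gmetric g \<xi> (Pi (k - 1) (int j + 2)) + gLie \<xi> (Cb (k - 1) (int j + 1))"
      using W_Pi[OF k1(2,3,5), of \<xi>] k(1,3) unfolding od(2) by (simp add: sg_of_nat sg_add algebra_simps)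
    have q1: "Tr tr (gLie \<xi> (Cb (k - 1) (int j + 1))) (gstar g (Pi k (int j))) = sg (int n + int j) *\<^sub>R ?Q"
    proof -
      have "sg (int n * (int n + 1) + int (n - k - j)) = sg (int n + int j)" using j k(2,3) by (intro sg_cong) (simp add: of_nat_diff)
      then show ?thesis using Tr_hodge_commute[OF gpar_gop(5)[OF gpar_Cb] gpar_Pi gdeg_gop(5)[OF d'(1)] d(2), of \<xi>] by simp
    qed
    have q2: "Tr tr (Pi (k - 1) (int j + 1)) (gstar g (gLie \<xi> (Cb k (int j)))) = sg (int n + int j) *\<^sub>R (?V' + U' (int j))"
    proof -
      have "sg ((int n + 1) * int n + int (n - k - j)) = sg (int n + int j)" using j k(2,3) by (intro sg_cong) (simp add: of_nat_diff)
      then show ?thesis using Tr_hodge_commute[OF gpar_Pi gpar_gop(5)[OF gpar_Cb] d'(2) gdeg_gop(5)[OF d(1)], of \<xi>] by (simp add: L U'_def)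
    qed
    have "Tr tr (Pi (k - 1) (int j + 1)) (gstar g (?a *\<^sub>R gi \<xi> (Pi k (int j - 1))))
        = (?a * (sg (int n + 1) * hsign TYPE('d))) *\<^sub>R Tr tr (gmetric g \<xi> (Pi (k - 1) (int j + 1))) (gstar g (Pi k (int j - 1)))"
      unfolding gop_simps Tr_simps Tr_hodge_inner[OF gpar_Pi] scaleR_scaleR ..
    moreover have "W \<xi> (?t j) = sg (int n + int j + 1 + int m) *\<^sub>R (Tr tr (gmap (W \<xi>) (Pi (k - 1) (int j + 1))) (gstar g (Pi k (int j)))
        + sg (int n + 1) *\<^sub>R Tr tr (Pi (k - 1) (int j + 1)) (gstar g (gmap (W \<xi>) (Pi k (int j)))))"
      unfolding xj is_der_simps(5)[OF evol_is_der[OF evol_W]] W_der[OF gpar_Pi] evol_gop(3)[OF evol_W] ..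
    ultimately have "W \<xi> (?t j) = sg (int n + int j + 1 + int m) *\<^sub>R
       (?c *\<^sub>R Tr tr (gmetric g \<xi> (Pi (k - 1) (int j + 2))) (gstar g (Pi k (int j)))
        + (sg (int n + 1) * (?a * (sg (int n + 1) * hsign TYPE('d)))) *\<^sub>R Tr tr (gmetric g \<xi> (Pi (k - 1) (int j + 1))) (gstar g (Pi k (int j - 1)))
        + sg (int n + int j) *\<^sub>R ?Q + (sg (int n + 1) * sg (int n + int j)) *\<^sub>R (?V' + U' (int j)))"
      unfolding P1 W2 gstar_simps(2) Tr_simps(2,5,8) q1 q2 scaleR_right_distrib scaleR_scaleR by (simp only: add_ac scaleR_scaleR mult.assoc)
    also have "\<dots> = - (Y (int j) - Y (int j - 1)) + ?a *\<^sub>R ?Q + ?c *\<^sub>R (?V' + U' (int j))"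
    proof -
      have "sg (int n + int j + 1 + int m) * ?c = - sg (int j)"
        "sg (int n + int j + 1 + int m) * (sg (int n + 1) * (?a * (sg (int n + 1) * hsign TYPE('d)))) = sg (int j - 1)"
        "sg (int n + int j + 1 + int m) * sg (int n + int j) = ?a"
        "sg (int n + int j + 1 + int m) * (sg (int n + 1) * sg (int n + int j)) = ?c"
        by (auto simp: hsign_eq sg_def)
      then show ?thesis unfolding scaleR_right_distrib[of "sg (int n + int j + 1 + int m)"] scaleR_scaleR by (simp add: Y_def add_ac)
    qed
    finally have t: "W \<xi> (?t j) = - (Y (int j) - Y (int j - 1)) + ?a *\<^sub>R ?Q + ?c *\<^sub>R (?V' + U' (int j))" .
    have "exact (Tr tr (gLie \<xi> (Pi k (int j))) (gstar g (Cb (k - 1) (int j + 1))) + ?Q)"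
      by (rule exact_gLie_hodge[OF gpar_Pi d(2) d'(1)]) simp
    then have "exact (?V + U (int j) + ?Q)" unfolding L U_def .
    then have "exact (E + ?a *\<^sub>R (?V + U (int j) + ?Q))" by (rule exact_add[OF E exact_scaleR])
    moreover have "W \<xi> (row k j + ?t j) = (E + ?a *\<^sub>R (?V + U (int j) + ?Q)) - ?a *\<^sub>R (U (int j) - U (int j - 1)) + ?c *\<^sub>R (U' (int j) - U' (int j - 1))
      + (- (Y (int j) - Y (int j - 1)))"
      using e t unfolding W_lin 1 2 3 4 by (simp add: scaleR_diff_right scaleR_right_distrib)
    ultimately show ?thesis by blast
  qed
  then obtain E where E: "\<And>j. j \<le> n - k \<Longrightarrow> exact (E j)" and
    e: "\<And>j. j \<le> n - k \<Longrightarrow> W \<xi> (row k j + ?t j) = E j - ?a *\<^sub>R (U (int j) - U (int j - 1)) + ?c *\<^sub>R (U' (int j) - U' (int j - 1))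
      + (- (Y (int j) - Y (int j - 1)))"
    by metis
  have "W \<xi> ((\<Sum>j = 0..n - k. row k j) + (\<Sum>j = 0..n - k. ?t j)) = (\<Sum>j = 0..n - k. E j) - ?a *\<^sub>R (U (int (n - k)) - U (- 1))
      + ?c *\<^sub>R (U' (int (n - k)) - U' (- 1)) + (- (Y (int (n - k)) - Y (- 1)))"
    unfolding sum.distrib[symmetric] is_der_simps(6)[OF evol_is_der[OF evol_W]] sum_telescope[symmetric] scaleR_sum_right sum_subtractf[symmetric] sum_negf[symmetric]
    by (intro sum.cong refl e) simp
  \<comment> \<open>The neighbouring entry of row \<open>k - 1\<close> does exist here; the upper
    end vanishes because the last entry of row \<open>k\<close> is a zero-form.\<close>
  moreover have "gi \<xi> (Pi k (int (n - k))) = 0" "gi \<xi> (Cb k (int (n - k))) = 0"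
    using gdeg_rows(1,2)[of "n - k" k] k(2) by (simp_all add: vec_eq_iff gdeg_def inner_deg_0)
  then have "U (int (n - k)) = 0" "U' (int (n - k)) = 0" by (simp_all add: U_def U'_def gop_simps Tr_simps)
  moreover have "U (- 1) = 0" "U' (- 1) = 0" "Y (- 1) = 0"
    by (simp_all add: U_def U'_def Y_def antighost_def multiplier_def gop_simps Tr_simps)
  moreover have "Y (int (n - k)) = 0"
    using k by (simp add: Y_def multiplier_def gop_simps Tr_simps of_nat_diff)
  ultimately show ?thesis using E by (auto intro!: exact_sum)
qed

text \<open>Each quadratic term with odd first row is attributed to the even row following it, so
  that it is varied together with that row. A last odd row \<open>k = n\<close> has an empty sum
  over entries and nothing is lost.\<close>

lemma Sigma_Pi_eq: "Sigma_Pi n g tr x = - Tr tr (gd (F Mult)) (gstar g (F Conn))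
   + - (\<Sum>j = 0..<n. Tr tr (gd (Pi 1 (int j))) (gstar g (F (BF j))))
   + (\<Sum>k = 2..n. (\<Sum>j = 0..n - k. row k j)
      + (if even k then \<Sum>j = 0..n - k. x (k - 1) (j + 1) n *\<^sub>R Tr tr (Pi (k - 1) (int j + 1)) (gstar g (Pi k (int j))) else 0))"
proof -
  let ?t = "\<lambda>k j. x k j n *\<^sub>R Tr tr (Pi k (int j)) (gstar g (Pi (k + 1) (int j - 1)))"
  let ?u = "\<lambda>k. \<Sum>j = 0..n - k. x (k - 1) (j + 1) n *\<^sub>R Tr tr (Pi (k - 1) (int j + 1)) (gstar g (Pi k (int j)))"
  have "(\<Sum>k | 1 \<le> k \<and> k \<le> n \<and> odd k. \<Sum>j = 1..n - k. ?t k j) = (\<Sum>k | 1 \<le> k \<and> k < n \<and> odd k. \<Sum>j = 1..n - k. ?t k j)"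
    by (rule sum.mono_neutral_right) (auto simp: le_less)
  also have "\<dots> = (\<Sum>k | 2 \<le> k \<and> k \<le> n \<and> even k. ?u k)"
  proof (rule sum.reindex_bij_witness[of _ "\<lambda>k. k - 1" "\<lambda>k. k + 1"])
    fix k assume "k \<in> {k. 1 \<le> k \<and> k < n \<and> odd k}"
    then have "n - k = Suc (n - (k + 1))" by auto
    then have "(\<Sum>j = 1..n - k. ?t k j) = (\<Sum>j = 0..n - (k + 1). ?t k (Suc j))"
      using sum.shift_bounds_cl_Suc_ivl[of "?t k" 0 "n - (k + 1)"] by (simp only: One_nat_def)
    also have "\<dots> = ?u (k + 1)"
      by (intro sum.cong refl) (simp add: add.commute)
    finally show "?u (k + 1) = (\<Sum>j = 1..n - k. ?t k j)" by (rule HOL.sym)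
  qed auto
  also have "\<dots> = (\<Sum>k = 2..n. if even k then ?u k else 0)"
    by (subst sum.inter_filter[symmetric]) (auto intro!: sum.cong)
  finally have "(\<Sum>k | 1 \<le> k \<and> k \<le> n \<and> odd k. \<Sum>j = 1..n - k. ?t k j) = (\<Sum>k = 2..n. if even k then ?u k else 0)" .
  then show ?thesis
    unfolding Sigma_Pi_def row_def by (simp add: sum.distrib)
qed

lemma Delta_susy_eq: "Delta_susy n g tr \<xi> = Delta_src \<xi> + Tr tr (gd (gstar g (gi \<xi> (F (SrcB 0))))) (F Mult)
     + Tr tr (gd (gstar g (gi \<xi> (F SrcGamma)))) (Pi 1 0)"
  by (simp add: Delta_susy_def Delta_src_def)

theorem W_action:
  fixes x :: "nat \<Rightarrow> nat \<Rightarrow> nat \<Rightarrow> real"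
  assumes x: "\<And>k j. odd k \<Longrightarrow> x k j n = (-1) ^ (n + j + (k + 1) div 2)"
  shows "integral_of (W \<xi> (Sigma_action n g br tr x)) = integral_of (Delta_susy n g tr \<xi>)"
proof (rule integral_of_eqI)
  let ?r = "\<lambda>k. (\<Sum>j = 0..n - k. row k j)
      + (if even k then \<Sum>j = 0..n - k. x (k - 1) (j + 1) n *\<^sub>R Tr tr (Pi (k - 1) (int j + 1)) (gstar g (Pi k (int j))) else 0)"
  let ?A = "- Tr tr (gd (F Mult)) (gstar g (F Conn))" and ?B = "- (\<Sum>j = 0..<n. Tr tr (gd (Pi 1 (int j))) (gstar g (F (BF j))))"
  have "exact (W \<xi> (?r k))" if "k \<in> {2..n}" for k
    using that exact_W_row_odd[of k \<xi>] exact_W_row_even[where k = k and x = x and \<xi> = \<xi>, OF _ _ _ x] by (cases "even k") simp_all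
  then have r: "exact (\<Sum>k = 2..n. W \<xi> (?r k))" by (rule exact_sum)
  have a: "W \<xi> (Sigma_action n g br tr x) = W \<xi> (Sigma_hat n g br tr) + (W \<xi> ?A + W \<xi> ?B + (\<Sum>k = 2..n. W \<xi> (?r k)))"
    unfolding Sigma_action_def Sigma_Pi_eq
    unfolding is_der_simps(2)[OF evol_is_der[OF evol_W], of \<xi> "Sigma_hat n g br tr"]
      is_der_simps(2)[OF evol_is_der[OF evol_W], of \<xi> "?A + ?B"] is_der_simps(2)[OF evol_is_der[OF evol_W], of \<xi> ?A]
      is_der_simps(6)[OF evol_is_der[OF evol_W]] ..
  have "W \<xi> (Sigma_action n g br tr x) - Delta_susy n g tr \<xi>
    = (W \<xi> (Sigma_hat n g br tr) - (Delta_src \<xi> + rest_A \<xi> + rest_B \<xi>))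
    + (rest_A \<xi> + W \<xi> ?A - Tr tr (gd (gstar g (gi \<xi> (F (SrcB 0))))) (F Mult))
    + (rest_B \<xi> + W \<xi> ?B - Tr tr (gd (gstar g (gi \<xi> (F SrcGamma)))) (Pi 1 0))
    + (\<Sum>k = 2..n. W \<xi> (?r k))"
    unfolding a Delta_susy_eq by (simp only: algebra_simps)
  also have "exact \<dots>"
    by (intro exact_add exact_W_Sigma_hat exact_W_pi exact_W_Pi_B r)
  finally show "exact (W \<xi> (Sigma_action n g br tr x) - Delta_susy n g tr \<xi>)" .
qed

end

theorem mainTheorem1:
  fixes n :: nat
    and g :: "('d :: {finite, linorder}) matrix"
    and br :: "('a :: finite) vector \<Rightarrow> 'a vector \<Rightarrow> 'a vector"
    and tr :: "'a vector \<Rightarrow> 'a vector \<Rightarrow> real"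
    and x :: "nat \<Rightarrow> nat \<Rightarrow> nat \<Rightarrow> real"
    and \<Sigma> :: "('a, 'd) lform"
  assumes "n \<ge> 1" and "CARD('d) = n + 2"
    and "transpose g = g" and "invertible g"
    and "simple_lie_algebra br" and "invariant_form br tr"
    and "\<And>k j. odd k \<Longrightarrow> x k j n = (-1) ^ (n + j + (k + 1) div 2)"
    and "\<Sigma> = Sigma_action n g br tr x"
  shows "(\<forall>\<xi>. integral_of (W_susy n g \<xi> \<Sigma>) = integral_of (Delta_susy n g tr \<xi>)) \<and>
    (\<forall>\<xi>. odd_commutator (slavnov n tr \<Sigma>) (W_susy n g \<xi>) = W_trans n \<xi>) \<and>
    slavnov n tr \<Sigma> \<circ> slavnov n tr \<Sigma> = (\<lambda>_. 0) \<and>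
    (\<forall>\<xi> \<xi>'. odd_commutator (W_susy n g \<xi>) (W_susy n g \<xi>') = (\<lambda>_ :: ('a, 'd) lform. 0))"
proof -
  interpret bf_model n g br tr
    using assms by unfold_locales (auto simp: simple_lie_algebra_def)
  show ?thesis
    unfolding assms(8) using W_action[where x = x, OF assms(7)] S_W[where x = x] S_S[where x = x] W_W by (simp add: fun_eq_iff)
qed

end
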